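(* Let $n\ge 0$, let $\mathcal T_0,\dots,\mathcal T_n$ be small triangulated categories with universal determinant functors $\det\colon\mathcal T_i\to V(\mathcal T_i)$, and write $\det\colon \mathcal T_0\times\dots\times\mathcal T_n\to V(\mathcal T_0)\times\dots\times V(\mathcal T_n)$ for their product. For every multi-determinant functor $D\colon\mathcal T_0\times\dots\times\mathcal T_n\to\mathcal P$ to a Picard groupoid $\mathcal P$, there exists a pair $(d,a)$ consisting of a multiexact functor $d\colon V(\mathcal T_0)\times\dots\times V(\mathcal T_n)\to\mathcal P$ and a natural transformation $a\colon d\circ\det\Rightarrow D$ which is a morphism of multi-determinant functors. The pair is unique in the following sense: for any other pair $(g,\beta)$ consisting of a multiexact functor $g\colon V(\mathcal T_0)\times\dots\times V(\mathcal T_n)\to\mathcal P$ and a natural transformation $\beta\colon g\circ\det\Rightarrow D$ which is a morphism of multi-determinant functors, there exists a unique natural transformation $\gamma\colon d\Rightarrow g$ (monoidal in each variable) such that $a=\beta\circ(\gamma\ast\det)$.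
   Context: **Picard groupoids.** A Picard groupoid is a groupoid $\mathcal P$ with a symmetric monoidal structure $(+,0)$ (not assumed strict) such that $x+(-)\colon\mathcal P\to\mathcal P$ is an equivalence for every object $x$. Write $\mathrm{coas}\colon(a+b)+(c+d)\to(a+c)+(b+d)$ for the canonical isomorphism built from associativity and symmetry. Morphisms of Picard groupoids are symmetric monoidal functors; transformations between them are monoidal natural transformations. A functor $F\colon\mathcal P_1\times\dots\times\mathcal P_n\to\mathcal P$ between Picard groupoids is *multiexact* if it is a (symmetric) monoidal functor in each variable, naturally in the others, and for every pair of variables (the others fixed and suppressed) the composite $F(a+b,c+d)\to F(a,c+d)+F(b,c+d)\to(F(a,c)+F(a,d))+(F(b,c)+F(b,d))\xrightarrow{\mathrm{coas}}(F(a,c)+F(b,c))+(F(a,d)+F(b,d))$ equals $F(a+b,c+d)\to F(a+b,c)+F(a+b,d)\to(F(a,c)+F(b,c))+(F(a,d)+F(b,d))$. **Determinant functors.** $\Sigma$ is the translation of a triangulated category, and $\mathrm{isom}(\mathcal T)$ is the category of isomorphisms of $\mathcal T$. A *determinant functor* $[-]\colon\mathcal T\to\mathcal P$ is a functor $[-]\colon\mathrm{isom}(\mathcal T)\to\mathcal P$ with additivity data: for each distinguished triangle $\Delta\colon x\to y\to z\to\Sigma x$ a morphism $[\Delta]\colon[z]+[x]\to[y]$, natural for isomorphisms of distinguished triangles, such that: (Commutativity) for the split triangles $\Delta_1\colon x\to x\oplus y\to y\to\Sigma x$ and $\Delta_2\colon y\to x\oplus y\to x\to\Sigma y$, $[\Delta_2]$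 equals $[\Delta_1]$ precomposed with the symmetry $[x]+[y]\to[y]+[x]$; (Associativity) for every octahedron with triangles $\Delta_1\colon x\to y\to z'\to\Sigma x$, $\Delta_2\colon x\to z\to y'\to\Sigma x$, $\Delta_3\colon y\to z\to x'\to\Sigma y$, $\Delta_4\colon z'\to y'\to x'\to\Sigma z'$, one has $[\Delta_2]\circ([\Delta_4]+\mathrm{id})=[\Delta_3]\circ(\mathrm{id}+[\Delta_1])\circ\mathrm{assoc}$ as maps $([x']+[z'])+[x]\to[z]$. **Universal determinant functors.** A determinant functor $\det\colon\mathcal T\to V$ is *universal* if for every determinant functor $D\colon\mathcal T\to\mathcal P'$ there is a pair $(f,\alpha)$ of a morphism of Picard groupoids $f\colon V\to\mathcal P'$ and a natural transformation $\alpha\colon f\circ\det\Rightarrow D$ such that for each distinguished triangle $\Delta\colon x\to y\to z\to\Sigma x$, $\alpha_y$ composed with $f(\det z)+f(\det x)\to f(\det z+\det x)\xrightarrow{f(\det\Delta)}f(\det y)$ equals $D(\Delta)\circ(\alpha_z+\alpha_x)$; and for any other such pair $(f',\alpha')$ there is a unique natural transformation $\beta\colon f\Rightarrow f'$ with $\alpha'\circ(\beta\ast\det)=\alpha$. A universal determinant functor $\det\colon\mathcal T\to V(\mathcal T)$ is known to exist for every small triangulated category $\mathcal T$; one is fixed for each $\mathcal T$. **Multi-determinant functors.** A *multi-determinant functor* $D\colon\mathcal T_1\times\dots\times\mathcal T_m\to\mathcal P$ is an $m$-functor $\mathrm{isom}(\mathcal T_1)\times\dots\times\mathrm{isom}(\mathcal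 T_m)\to\mathcal P$ that is a determinant functor in each variable and satisfies, for distinct $i,j$ (other variables fixed and suppressed): (Two Triangles, written for $i<j$) for distinguished triangles $\Delta_k\colon x_k\to y_k\to z_k\to\Sigma x_k$ in $\mathcal T_k$, $k=i,j$, one has $D(y_i,\Delta_j)\circ(D(\Delta_i,z_j)+D(\Delta_i,x_j))=D(\Delta_i,y_j)\circ(D(z_i,\Delta_j)+D(x_i,\Delta_j))\circ\mathrm{coas}$ as maps $(D(z_i,z_j)+D(x_i,z_j))+(D(z_i,x_j)+D(x_i,x_j))\to D(y_i,y_j)$; (Triangle-Function) for $f_i\colon a_i\to b_i$ in $\mathrm{isom}(\mathcal T_i)$ and a distinguished triangle $\Delta_j\colon x_j\to y_j\to z_j\to\Sigma x_j$ in $\mathcal T_j$, $D(f_i,y_j)\circ D(a_i,\Delta_j)=D(b_i,\Delta_j)\circ(D(f_i,z_j)+D(f_i,x_j))$. A *morphism* $\theta\colon d_1\Rightarrow d_2$ of multi-determinant functors is a natural transformation with $\theta_{y_i}\circ d_1(\Delta_i)=d_2(\Delta_i)\circ(\theta_{z_i}+\theta_{x_i})$ for every variable $i$ and distinguished triangle $\Delta_i$. For a multiexact $g$, $g\circ\det$ is a multi-determinant functor with additivity data $g(\det z)+g(\det x)\cong g(\det z+\det x)\to g(\det y)$ in each variable. *)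

theory Defs
  imports "HOL-Algebra.Group"
begin

text \<open>
  No category theory is imported: categories are records of a set of objects and a set of arrows
  inside arbitrary types, so every category here is small.  Composition is written in function
  order.  Nothing is assumed about the operations outside the carrier sets.
\<close>

section \<open>Categories, functors, natural transformations\<close>

record ('o, 'm) cat =
  Obj :: "'o set"
  Arr :: "'m set"
  Dom :: "'m \<Rightarrow> 'o"
  Cod :: "'m \<Rightarrow> 'o"
  Ide :: "'o \<Rightarrow> 'm"
  Cmp :: "'m \<Rightarrow> 'm \<Rightarrow> 'm" (infixl "\<cdot>\<index>" 70)

definition Hom :: "('o, 'm, 'x) cat_scheme \<Rightarrow> 'o \<Rightarrow> 'o \<Rightarrow> 'm set" where
  "Hom C a b = {f \<in> Arr C. Dom C f = a \<and> Cod C f = b}"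

locale category =
  fixes C :: "('o, 'm, 'x) cat_scheme" (structure)
  assumes Dom_in: "f \<in> Arr C \<Longrightarrow> Dom C f \<in> Obj C"
    and Cod_in: "f \<in> Arr C \<Longrightarrow> Cod C f \<in> Obj C"
    and Ide_in: "a \<in> Obj C \<Longrightarrow> Ide C a \<in> Hom C a a"
    and Cmp_in: "\<lbrakk>f \<in> Hom C a b; g \<in> Hom C b c\<rbrakk> \<Longrightarrow> g \<cdot> f \<in> Hom C a c"
    and Ide_left: "f \<in> Hom C a b \<Longrightarrow> Ide C b \<cdot> f = f"
    and Ide_right: "f \<in> Hom C a b \<Longrightarrow> f \<cdot> Ide C a = f"
    and Cmp_assoc: "\<lbrakk>f \<in> Hom C a b; g \<in> Hom C b c; h \<in> Hom C c d\<rbrakk>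
          \<Longrightarrow> (h \<cdot> g) \<cdot> f = h \<cdot> (g \<cdot> f)"

definition inverse_arrows :: "('o, 'm, 'x) cat_scheme \<Rightarrow> 'm \<Rightarrow> 'm \<Rightarrow> bool" where
  "inverse_arrows C f g \<longleftrightarrow> f \<in> Arr C \<and> g \<in> Hom C (Cod C f) (Dom C f)
     \<and> g \<cdot>\<^bsub>C\<^esub> f = Ide C (Dom C f) \<and> f \<cdot>\<^bsub>C\<^esub> g = Ide C (Cod C f)"

definition iso_arr :: "('o, 'm, 'x) cat_scheme \<Rightarrow> 'm \<Rightarrow> bool" where
  "iso_arr C f \<longleftrightarrow> (\<exists>g. inverse_arrows C f g)"

definition inv_arr :: "('o, 'm, 'x) cat_scheme \<Rightarrow> 'm \<Rightarrow> 'm" where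
  "inv_arr C f = (THE g. inverse_arrows C f g)"

definition isom :: "('o, 'm, 'x) cat_scheme \<Rightarrow> ('o, 'm) cat" where
  "isom C = \<lparr>Obj = Obj C, Arr = {f. iso_arr C f}, Dom = Dom C, Cod = Cod C,
             Ide = Ide C, Cmp = Cmp C\<rparr>"

text \<open>Product of a family of categories.  Tuples are extensional functions on the index set; the
  members of the family share their types but have independent carriers.\<close>

definition prod_cat :: "'i set \<Rightarrow> ('i \<Rightarrow> ('o, 'm, 'x) cat_scheme) \<Rightarrow> ('i \<Rightarrow> 'o, 'i \<Rightarrow> 'm) cat" where
  "prod_cat I C = \<lparr>Obj = (\<Pi>\<^sub>E i\<in>I. Obj (C i)), Arr = (\<Pi>\<^sub>E i\<in>I. Arr (C i)),
     Dom = (\<lambda>f. \<lambda>i\<in>I. Dom (C i) (f i)), Cod = (\<lambda>f. \<lambda>i\<in>I. Cod (C i) (f i)),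
     Ide = (\<lambda>x. \<lambda>i\<in>I. Ide (C i) (x i)), Cmp = (\<lambda>g f. \<lambda>i\<in>I. g i \<cdot>\<^bsub>C i\<^esub> f i)\<rparr>"

record ('o, 'm, 'p, 'q) funct =
  onObj :: "'o \<Rightarrow> 'p"
  onArr :: "'m \<Rightarrow> 'q"

definition is_functor ::
  "('o, 'm, 'x) cat_scheme \<Rightarrow> ('p, 'q, 'y) cat_scheme \<Rightarrow> ('o, 'm, 'p, 'q, 'z) funct_scheme \<Rightarrow> bool"
where
  "is_functor C D F \<longleftrightarrow>
     (\<forall>a\<in>Obj C. onObj F a \<in> Obj D) \<and>
     (\<forall>a b. \<forall>f\<in>Hom C a b. onArr F f \<in> Hom D (onObj F a) (onObj F b)) \<and>
     (\<forall>a\<in>Obj C. onArr F (Ide C a) = Ide D (onObj F a)) \<and>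
     (\<forall>a b c. \<forall>f\<in>Hom C a b. \<forall>g\<in>Hom C b c.
        onArr F (g \<cdot>\<^bsub>C\<^esub> f) = onArr F g \<cdot>\<^bsub>D\<^esub> onArr F f)"

definition id_functor :: "('o, 'm, 'o, 'm) funct" where
  "id_functor = \<lparr>onObj = (\<lambda>a. a), onArr = (\<lambda>f. f)\<rparr>"

definition comp_functor ::
  "('p, 'q, 'r, 's, 'y) funct_scheme \<Rightarrow> ('o, 'm, 'p, 'q, 'x) funct_scheme \<Rightarrow> ('o, 'm, 'r, 's) funct"
where
  "comp_functor G F = \<lparr>onObj = (\<lambda>a. onObj G (onObj F a)), onArr = (\<lambda>f. onArr G (onArr F f))\<rparr>"

text \<open>Components are extensional functions on the set of objects, so that equality of natural
  transformations is equality in HOL and \<open>\<exists>!\<close> expresses uniqueness of a natural transformation.\<close>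

definition nat_trans ::
  "('o, 'm, 'x) cat_scheme \<Rightarrow> ('p, 'q, 'y) cat_scheme \<Rightarrow> ('o, 'm, 'p, 'q, 'u) funct_scheme
    \<Rightarrow> ('o, 'm, 'p, 'q, 'v) funct_scheme \<Rightarrow> ('o \<Rightarrow> 'q) \<Rightarrow> bool"
where
  "nat_trans C D F G \<tau> \<longleftrightarrow>
     \<tau> \<in> extensional (Obj C) \<and>
     (\<forall>a\<in>Obj C. \<tau> a \<in> Hom D (onObj F a) (onObj G a)) \<and>
     (\<forall>a b. \<forall>f\<in>Hom C a b. \<tau> b \<cdot>\<^bsub>D\<^esub> onArr F f = onArr G f \<cdot>\<^bsub>D\<^esub> \<tau> a)"

definition nat_iso ::
  "('o, 'm, 'x) cat_scheme \<Rightarrow> ('p, 'q, 'y) cat_scheme \<Rightarrow> ('o, 'm, 'p, 'q, 'u) funct_scheme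
    \<Rightarrow> ('o, 'm, 'p, 'q, 'v) funct_scheme \<Rightarrow> ('o \<Rightarrow> 'q) \<Rightarrow> bool"
where
  "nat_iso C D F G \<tau> \<longleftrightarrow> nat_trans C D F G \<tau> \<and> (\<forall>a\<in>Obj C. iso_arr D (\<tau> a))"

definition equivalence_functor ::
  "('o, 'm, 'x) cat_scheme \<Rightarrow> ('p, 'q, 'y) cat_scheme \<Rightarrow> ('o, 'm, 'p, 'q, 'z) funct_scheme \<Rightarrow> bool"
where
  "equivalence_functor C D F \<longleftrightarrow> is_functor C D F \<and>
     (\<exists>(G :: ('p, 'q, 'o, 'm) funct) \<eta> \<epsilon>. is_functor D C G \<and>
        nat_iso C C id_functor (comp_functor G F) \<eta> \<and>
        nat_iso D D (comp_functor F G) id_functor \<epsilon>)"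


section \<open>Picard groupoids\<close>

record ('o, 'm) mon_cat = "('o, 'm) cat" +
  tensO :: "'o \<Rightarrow> 'o \<Rightarrow> 'o" (infixl "\<oplus>\<index>" 65)
  tensA :: "'m \<Rightarrow> 'm \<Rightarrow> 'm" (infixl "\<boxplus>\<index>" 72)
  unitO :: "'o"
  assoc :: "'o \<Rightarrow> 'o \<Rightarrow> 'o \<Rightarrow> 'm"
  lunit :: "'o \<Rightarrow> 'm"
  runit :: "'o \<Rightarrow> 'm"
  symm :: "'o \<Rightarrow> 'o \<Rightarrow> 'm"

locale symmetric_monoidal_category = category C
  for C :: "('o, 'm, 'x) mon_cat_scheme" (structure) +
  assumes tensO_in: "\<lbrakk>a \<in> Obj C; b \<in> Obj C\<rbrakk> \<Longrightarrow> a \<oplus> b \<in> Obj C"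
    and tensA_in: "\<lbrakk>f \<in> Hom C a a'; g \<in> Hom C b b'\<rbrakk> \<Longrightarrow> f \<boxplus> g \<in> Hom C (a \<oplus> b) (a' \<oplus> b')"
    and tensA_Ide: "\<lbrakk>a \<in> Obj C; b \<in> Obj C\<rbrakk> \<Longrightarrow> Ide C a \<boxplus> Ide C b = Ide C (a \<oplus> b)"
    and tensA_Cmp: "\<lbrakk>f \<in> Hom C a a'; f' \<in> Hom C a' a''; g \<in> Hom C b b'; g' \<in> Hom C b' b''\<rbrakk>
          \<Longrightarrow> (f' \<cdot> f) \<boxplus> (g' \<cdot> g) = (f' \<boxplus> g') \<cdot> (f \<boxplus> g)"
    and unitO_in: "unitO C \<in> Obj C"
    and assoc_in: "\<lbrakk>a \<in> Obj C; b \<in> Obj C; c \<in> Obj C\<rbrakk>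
          \<Longrightarrow> assoc C a b c \<in> Hom C ((a \<oplus> b) \<oplus> c) (a \<oplus> (b \<oplus> c)) \<and> iso_arr C (assoc C a b c)"
    and lunit_in: "a \<in> Obj C \<Longrightarrow> lunit C a \<in> Hom C (unitO C \<oplus> a) a \<and> iso_arr C (lunit C a)"
    and runit_in: "a \<in> Obj C \<Longrightarrow> runit C a \<in> Hom C (a \<oplus> unitO C) a \<and> iso_arr C (runit C a)"
    and symm_in: "\<lbrakk>a \<in> Obj C; b \<in> Obj C\<rbrakk> \<Longrightarrow> symm C a b \<in> Hom C (a \<oplus> b) (b \<oplus> a)"
    and assoc_nat: "\<lbrakk>f \<in> Hom C a a'; g \<in> Hom C b b'; h \<in> Hom C c c'\<rbrakk>
          \<Longrightarrow> assoc C a' b' c' \<cdot> ((f \<boxplus> g) \<boxplus> h) = (f \<boxplus> (g \<boxplus> h)) \<cdot> assoc C a b c"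
    and lunit_nat: "f \<in> Hom C a a' \<Longrightarrow> lunit C a' \<cdot> (Ide C (unitO C) \<boxplus> f) = f \<cdot> lunit C a"
    and runit_nat: "f \<in> Hom C a a' \<Longrightarrow> runit C a' \<cdot> (f \<boxplus> Ide C (unitO C)) = f \<cdot> runit C a"
    and symm_nat: "\<lbrakk>f \<in> Hom C a a'; g \<in> Hom C b b'\<rbrakk>
          \<Longrightarrow> symm C a' b' \<cdot> (f \<boxplus> g) = (g \<boxplus> f) \<cdot> symm C a b"
    and pentagon: "\<lbrakk>a \<in> Obj C; b \<in> Obj C; c \<in> Obj C; d \<in> Obj C\<rbrakk>
          \<Longrightarrow> (Ide C a \<boxplus> assoc C b c d) \<cdot> (assoc C a (b \<oplus> c) d \<cdot> (assoc C a b c \<boxplus> Ide C d))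
            = assoc C a b (c \<oplus> d) \<cdot> assoc C (a \<oplus> b) c d"
    and triangle_unit: "\<lbrakk>a \<in> Obj C; b \<in> Obj C\<rbrakk>
          \<Longrightarrow> (Ide C a \<boxplus> lunit C b) \<cdot> assoc C a (unitO C) b = runit C a \<boxplus> Ide C b"
    and symm_symm: "\<lbrakk>a \<in> Obj C; b \<in> Obj C\<rbrakk> \<Longrightarrow> symm C b a \<cdot> symm C a b = Ide C (a \<oplus> b)"
    and hexagon: "\<lbrakk>a \<in> Obj C; b \<in> Obj C; c \<in> Obj C\<rbrakk>
          \<Longrightarrow> assoc C b c a \<cdot> (symm C a (b \<oplus> c) \<cdot> assoc C a b c)
            = (Ide C b \<boxplus> symm C a c) \<cdot> (assoc C b a c \<cdot> (symm C a b \<boxplus> Ide C c))"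

definition translation_functor :: "('o, 'm, 'x) mon_cat_scheme \<Rightarrow> 'o \<Rightarrow> ('o, 'm, 'o, 'm) funct" where
  "translation_functor P x = \<lparr>onObj = (\<lambda>a. x \<oplus>\<^bsub>P\<^esub> a), onArr = (\<lambda>f. Ide P x \<boxplus>\<^bsub>P\<^esub> f)\<rparr>"

locale picard_groupoid = symmetric_monoidal_category P
  for P :: "('o, 'm, 'x) mon_cat_scheme" (structure) +
  assumes groupoid: "f \<in> Arr P \<Longrightarrow> iso_arr P f"
    and translation_equivalence: "x \<in> Obj P \<Longrightarrow> equivalence_functor P P (translation_functor P x)"

text \<open>The canonical isomorphism \<open>(a + b) + (c + d) \<rightarrow> (a + c) + (b + d)\<close>.\<close>

definition coas :: "('o, 'm, 'x) mon_cat_scheme \<Rightarrow> 'o \<Rightarrow> 'o \<Rightarrow> 'o \<Rightarrow> 'o \<Rightarrow> 'm" where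
  "coas P a b c d =
     inv_arr P (assoc P a c (b \<oplus>\<^bsub>P\<^esub> d)) \<cdot>\<^bsub>P\<^esub>
     ((Ide P a \<boxplus>\<^bsub>P\<^esub> assoc P c b d) \<cdot>\<^bsub>P\<^esub>
     ((Ide P a \<boxplus>\<^bsub>P\<^esub> (symm P b c \<boxplus>\<^bsub>P\<^esub> Ide P d)) \<cdot>\<^bsub>P\<^esub>
     ((Ide P a \<boxplus>\<^bsub>P\<^esub> inv_arr P (assoc P b c d)) \<cdot>\<^bsub>P\<^esub>
      assoc P a b (c \<oplus>\<^bsub>P\<^esub> d))))"

text \<open>Symmetric monoidal functors carry \<open>F a + F b \<rightarrow> F (a + b)\<close> and \<open>0 \<rightarrow> F 0\<close>, both invertible.\<close>

record ('o, 'm, 'p, 'q) mon_funct = "('o, 'm, 'p, 'q) funct" +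
  tensC :: "'o \<Rightarrow> 'o \<Rightarrow> 'q"
  unitC :: "'q"

definition symmetric_monoidal_functor ::
  "('o, 'm, 'x) mon_cat_scheme \<Rightarrow> ('p, 'q, 'y) mon_cat_scheme
    \<Rightarrow> ('o, 'm, 'p, 'q, 'z) mon_funct_scheme \<Rightarrow> bool"
where
  "symmetric_monoidal_functor V P F \<longleftrightarrow>
     is_functor V P F \<and>
     (\<forall>a\<in>Obj V. \<forall>b\<in>Obj V.
        tensC F a b \<in> Hom P (onObj F a \<oplus>\<^bsub>P\<^esub> onObj F b) (onObj F (a \<oplus>\<^bsub>V\<^esub> b)) \<and>
        iso_arr P (tensC F a b)) \<and>
     unitC F \<in> Hom P (unitO P) (onObj F (unitO V)) \<and> iso_arr P (unitC F) \<and>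
     (\<forall>a a' b b'. \<forall>f\<in>Hom V a a'. \<forall>g\<in>Hom V b b'.
        tensC F a' b' \<cdot>\<^bsub>P\<^esub> (onArr F f \<boxplus>\<^bsub>P\<^esub> onArr F g)
        = onArr F (f \<boxplus>\<^bsub>V\<^esub> g) \<cdot>\<^bsub>P\<^esub> tensC F a b) \<and>
     (\<forall>a\<in>Obj V. \<forall>b\<in>Obj V. \<forall>c\<in>Obj V.
        onArr F (assoc V a b c) \<cdot>\<^bsub>P\<^esub>
          (tensC F (a \<oplus>\<^bsub>V\<^esub> b) c \<cdot>\<^bsub>P\<^esub> (tensC F a b \<boxplus>\<^bsub>P\<^esub> Ide P (onObj F c)))
        = tensC F a (b \<oplus>\<^bsub>V\<^esub> c) \<cdot>\<^bsub>P\<^esub>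
          ((Ide P (onObj F a) \<boxplus>\<^bsub>P\<^esub> tensC F b c) \<cdot>\<^bsub>P\<^esub>
            assoc P (onObj F a) (onObj F b) (onObj F c))) \<and>
     (\<forall>a\<in>Obj V.
        onArr F (lunit V a) \<cdot>\<^bsub>P\<^esub>
          (tensC F (unitO V) a \<cdot>\<^bsub>P\<^esub> (unitC F \<boxplus>\<^bsub>P\<^esub> Ide P (onObj F a)))
        = lunit P (onObj F a)) \<and>
     (\<forall>a\<in>Obj V.
        onArr F (runit V a) \<cdot>\<^bsub>P\<^esub>
          (tensC F a (unitO V) \<cdot>\<^bsub>P\<^esub> (Ide P (onObj F a) \<boxplus>\<^bsub>P\<^esub> unitC F))
        = runit P (onObj F a)) \<and>
     (\<forall>a\<in>Obj V. \<forall>b\<in>Obj V.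
        onArr F (symm V a b) \<cdot>\<^bsub>P\<^esub> tensC F a b
        = tensC F b a \<cdot>\<^bsub>P\<^esub> symm P (onObj F a) (onObj F b))"

definition monoidal_nat_trans ::
  "('o, 'm, 'x) mon_cat_scheme \<Rightarrow> ('p, 'q, 'y) mon_cat_scheme
    \<Rightarrow> ('o, 'm, 'p, 'q, 'u) mon_funct_scheme \<Rightarrow> ('o, 'm, 'p, 'q, 'v) mon_funct_scheme
    \<Rightarrow> ('o \<Rightarrow> 'q) \<Rightarrow> bool"
where
  "monoidal_nat_trans V P F G \<tau> \<longleftrightarrow>
     nat_trans V P F G \<tau> \<and>
     (\<forall>a\<in>Obj V. \<forall>b\<in>Obj V.
        \<tau> (a \<oplus>\<^bsub>V\<^esub> b) \<cdot>\<^bsub>P\<^esub> tensC F a b = tensC G a b \<cdot>\<^bsub>P\<^esub> (\<tau> a \<boxplus>\<^bsub>P\<^esub> \<tau> b)) \<and>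
     \<tau> (unitO V) \<cdot>\<^bsub>P\<^esub> unitC F = unitC G"


section \<open>Triangulated categories\<close>

datatype 'm triangle = Tri (tU: 'm) (tV: 'm) (tW: 'm)

record ('o, 'm) tri_cat = "('o, 'm) cat" +
  addA :: "'m \<Rightarrow> 'm \<Rightarrow> 'm"
  zeroA :: "'o \<Rightarrow> 'o \<Rightarrow> 'm"
  shiftO :: "'o \<Rightarrow> 'o"
  shiftA :: "'m \<Rightarrow> 'm"
  Dist :: "'m triangle set"

definition shift :: "('o, 'm, 'x) tri_cat_scheme \<Rightarrow> ('o, 'm, 'o, 'm) funct" where
  "shift T = \<lparr>onObj = shiftO T, onArr = shiftA T\<rparr>"

definition Hom_group :: "('o, 'm, 'x) tri_cat_scheme \<Rightarrow> 'o \<Rightarrow> 'o \<Rightarrow> 'm monoid" where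
  "Hom_group T a b = \<lparr>carrier = Hom T a b, monoid.mult = addA T, one = zeroA T a b\<rparr>"

definition negA :: "('o, 'm, 'x) tri_cat_scheme \<Rightarrow> 'm \<Rightarrow> 'm" where
  "negA T f = inv\<^bsub>Hom_group T (Dom T f) (Cod T f)\<^esub> f"

definition zero_object :: "('o, 'm, 'x) cat_scheme \<Rightarrow> 'o \<Rightarrow> bool" where
  "zero_object C z \<longleftrightarrow>
     z \<in> Obj C \<and> (\<forall>a\<in>Obj C. (\<exists>!f. f \<in> Hom C a z) \<and> (\<exists>!f. f \<in> Hom C z a))"

text \<open>\<open>s\<close>, with injections \<open>i\<^sub>1, i\<^sub>2\<close> and projections \<open>p\<^sub>1, p\<^sub>2\<close>, is a direct sum of \<open>x\<close> and \<open>y\<close>.\<close>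

definition biproduct ::
  "('o, 'm, 'x) tri_cat_scheme \<Rightarrow> 'o \<Rightarrow> 'o \<Rightarrow> 'o \<Rightarrow> 'm \<Rightarrow> 'm \<Rightarrow> 'm \<Rightarrow> 'm \<Rightarrow> bool"
where
  "biproduct T x y s i\<^sub>1 i\<^sub>2 p\<^sub>1 p\<^sub>2 \<longleftrightarrow>
     x \<in> Obj T \<and> y \<in> Obj T \<and> s \<in> Obj T \<and>
     i\<^sub>1 \<in> Hom T x s \<and> i\<^sub>2 \<in> Hom T y s \<and> p\<^sub>1 \<in> Hom T s x \<and> p\<^sub>2 \<in> Hom T s y \<and>
     p\<^sub>1 \<cdot>\<^bsub>T\<^esub> i\<^sub>1 = Ide T x \<and> p\<^sub>2 \<cdot>\<^bsub>T\<^esub> i\<^sub>2 = Ide T y \<and>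
     p\<^sub>2 \<cdot>\<^bsub>T\<^esub> i\<^sub>1 = zeroA T x y \<and> p\<^sub>1 \<cdot>\<^bsub>T\<^esub> i\<^sub>2 = zeroA T y x \<and>
     addA T (i\<^sub>1 \<cdot>\<^bsub>T\<^esub> p\<^sub>1) (i\<^sub>2 \<cdot>\<^bsub>T\<^esub> p\<^sub>2) = Ide T s"

locale additive_category = category T
  for T :: "('o, 'm, 'x) tri_cat_scheme" (structure) +
  assumes Hom_comm_group: "\<lbrakk>a \<in> Obj T; b \<in> Obj T\<rbrakk> \<Longrightarrow> comm_group (Hom_group T a b)"
    and Cmp_add_right: "\<lbrakk>f \<in> Hom T a b; f' \<in> Hom T a b; g \<in> Hom T b c\<rbrakk>
          \<Longrightarrow> g \<cdot> addA T f f' = addA T (g \<cdot> f) (g \<cdot> f')"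
    and Cmp_add_left: "\<lbrakk>f \<in> Hom T a b; g \<in> Hom T b c; g' \<in> Hom T b c\<rbrakk>
          \<Longrightarrow> addA T g g' \<cdot> f = addA T (g \<cdot> f) (g' \<cdot> f)"
    and has_zero_object: "\<exists>z. zero_object T z"
    and has_biproducts: "\<lbrakk>x \<in> Obj T; y \<in> Obj T\<rbrakk> \<Longrightarrow> \<exists>s i\<^sub>1 i\<^sub>2 p\<^sub>1 p\<^sub>2. biproduct T x y s i\<^sub>1 i\<^sub>2 p\<^sub>1 p\<^sub>2"

text \<open>The vertices of a triangle \<open>x \<rightarrow> y \<rightarrow> z \<rightarrow> \<Sigma>x\<close>.\<close>

definition tX :: "('o, 'm, 'x) cat_scheme \<Rightarrow> 'm triangle \<Rightarrow> 'o" where "tX T \<Delta> = Dom T (tU \<Delta>)"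
definition tY :: "('o, 'm, 'x) cat_scheme \<Rightarrow> 'm triangle \<Rightarrow> 'o" where "tY T \<Delta> = Cod T (tU \<Delta>)"
definition tZ :: "('o, 'm, 'x) cat_scheme \<Rightarrow> 'm triangle \<Rightarrow> 'o" where "tZ T \<Delta> = Cod T (tV \<Delta>)"

definition is_triangle :: "('o, 'm, 'x) tri_cat_scheme \<Rightarrow> 'm triangle \<Rightarrow> bool" where
  "is_triangle T \<Delta> \<longleftrightarrow> tU \<Delta> \<in> Arr T \<and> tV \<Delta> \<in> Hom T (tY T \<Delta>) (tZ T \<Delta>)
     \<and> tW \<Delta> \<in> Hom T (tZ T \<Delta>) (shiftO T (tX T \<Delta>))"

definition triangle_morphism ::
  "('o, 'm, 'x) tri_cat_scheme \<Rightarrow> 'm triangle \<Rightarrow> 'm triangle \<Rightarrow> 'm \<Rightarrow> 'm \<Rightarrow> 'm \<Rightarrow> bool"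
where
  "triangle_morphism T \<Delta> \<Delta>' f g h \<longleftrightarrow>
     f \<in> Hom T (tX T \<Delta>) (tX T \<Delta>') \<and> g \<in> Hom T (tY T \<Delta>) (tY T \<Delta>') \<and>
     h \<in> Hom T (tZ T \<Delta>) (tZ T \<Delta>') \<and>
     g \<cdot>\<^bsub>T\<^esub> tU \<Delta> = tU \<Delta>' \<cdot>\<^bsub>T\<^esub> f \<and> h \<cdot>\<^bsub>T\<^esub> tV \<Delta> = tV \<Delta>' \<cdot>\<^bsub>T\<^esub> g \<and>
     shiftA T f \<cdot>\<^bsub>T\<^esub> tW \<Delta> = tW \<Delta>' \<cdot>\<^bsub>T\<^esub> h"

definition triangle_iso ::
  "('o, 'm, 'x) tri_cat_scheme \<Rightarrow> 'm triangle \<Rightarrow> 'm triangle \<Rightarrow> 'm \<Rightarrow> 'm \<Rightarrow> 'm \<Rightarrow> bool"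
where
  "triangle_iso T \<Delta> \<Delta>' f g h \<longleftrightarrow>
     triangle_morphism T \<Delta> \<Delta>' f g h \<and> iso_arr T f \<and> iso_arr T g \<and> iso_arr T h"

text \<open>
  \<open>\<Delta>\<^sub>1: x \<rightarrow> y \<rightarrow> z' \<rightarrow> \<Sigma>x\<close>, \<open>\<Delta>\<^sub>2: x \<rightarrow> z \<rightarrow> y' \<rightarrow> \<Sigma>x\<close>, \<open>\<Delta>\<^sub>3: y \<rightarrow> z \<rightarrow> x' \<rightarrow> \<Sigma>y\<close> start with
  \<open>u\<close>, \<open>v \<cdot> u\<close>, \<open>v\<close>, and \<open>\<Delta>\<^sub>4: z' \<rightarrow> y' \<rightarrow> x' \<rightarrow> \<Sigma>z'\<close> ends with \<open>x' \<rightarrow> \<Sigma>y \<rightarrow> \<Sigma>z'\<close>.  The last four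
  equations are the remaining commutativities of the octahedron.
\<close>

definition octahedron ::
  "('o, 'm, 'x) tri_cat_scheme \<Rightarrow> 'm triangle \<Rightarrow> 'm triangle \<Rightarrow> 'm triangle \<Rightarrow> 'm triangle \<Rightarrow> bool"
where
  "octahedron T \<Delta>\<^sub>1 \<Delta>\<^sub>2 \<Delta>\<^sub>3 \<Delta>\<^sub>4 \<longleftrightarrow>
     {\<Delta>\<^sub>1, \<Delta>\<^sub>2, \<Delta>\<^sub>3, \<Delta>\<^sub>4} \<subseteq> Dist T \<and>
     tY T \<Delta>\<^sub>1 = tX T \<Delta>\<^sub>3 \<and> tU \<Delta>\<^sub>2 = tU \<Delta>\<^sub>3 \<cdot>\<^bsub>T\<^esub> tU \<Delta>\<^sub>1 \<and>
     tX T \<Delta>\<^sub>4 = tZ T \<Delta>\<^sub>1 \<and> tY T \<Delta>\<^sub>4 = tZ T \<Delta>\<^sub>2 \<and> tZ T \<Delta>\<^sub>4 = tZ T \<Delta>\<^sub>3 \<and>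
     tW \<Delta>\<^sub>4 = shiftA T (tV \<Delta>\<^sub>1) \<cdot>\<^bsub>T\<^esub> tW \<Delta>\<^sub>3 \<and>
     tU \<Delta>\<^sub>4 \<cdot>\<^bsub>T\<^esub> tV \<Delta>\<^sub>1 = tV \<Delta>\<^sub>2 \<cdot>\<^bsub>T\<^esub> tU \<Delta>\<^sub>3 \<and>
     tV \<Delta>\<^sub>4 \<cdot>\<^bsub>T\<^esub> tV \<Delta>\<^sub>2 = tV \<Delta>\<^sub>3 \<and>
     tW \<Delta>\<^sub>2 \<cdot>\<^bsub>T\<^esub> tU \<Delta>\<^sub>4 = tW \<Delta>\<^sub>1 \<and>
     tW \<Delta>\<^sub>3 \<cdot>\<^bsub>T\<^esub> tV \<Delta>\<^sub>4 = shiftA T (tU \<Delta>\<^sub>1) \<cdot>\<^bsub>T\<^esub> tW \<Delta>\<^sub>2"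

locale triangulated_category = additive_category T
  for T :: "('o, 'm, 'x) tri_cat_scheme" (structure) +
  assumes shift_equivalence: "equivalence_functor T T (shift T)"
    and shift_additive: "\<lbrakk>f \<in> Hom T a b; f' \<in> Hom T a b\<rbrakk>
          \<Longrightarrow> shiftA T (addA T f f') = addA T (shiftA T f) (shiftA T f')"
    and Dist_triangle: "\<Delta> \<in> Dist T \<Longrightarrow> is_triangle T \<Delta>"
    and Dist_identity: "\<lbrakk>x \<in> Obj T; zero_object T z\<rbrakk>
          \<Longrightarrow> Tri (Ide T x) (zeroA T x z) (zeroA T z (shiftO T x)) \<in> Dist T"
    and Dist_iso: "\<lbrakk>\<Delta> \<in> Dist T; is_triangle T \<Delta>'; triangle_iso T \<Delta> \<Delta>' f g h\<rbrakk> \<Longrightarrow> \<Delta>' \<in> Dist T"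
    and Dist_complete: "u \<in> Arr T \<Longrightarrow> \<exists>v w. Tri u v w \<in> Dist T"
    and Dist_rotate: "is_triangle T (Tri u v w)
          \<Longrightarrow> Tri u v w \<in> Dist T \<longleftrightarrow> Tri v w (negA T (shiftA T u)) \<in> Dist T"
    and Dist_morphism: "\<lbrakk>\<Delta> \<in> Dist T; \<Delta>' \<in> Dist T; f \<in> Hom T (tX T \<Delta>) (tX T \<Delta>');
          g \<in> Hom T (tY T \<Delta>) (tY T \<Delta>'); g \<cdot> tU \<Delta> = tU \<Delta>' \<cdot> f\<rbrakk>
          \<Longrightarrow> \<exists>h. triangle_morphism T \<Delta> \<Delta>' f g h"
    and Dist_octahedron: "\<lbrakk>\<Delta>\<^sub>1 \<in> Dist T; \<Delta>\<^sub>2 \<in> Dist T; \<Delta>\<^sub>3 \<in> Dist T; tY T \<Delta>\<^sub>1 = tX T \<Delta>\<^sub>3;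
          tU \<Delta>\<^sub>2 = tU \<Delta>\<^sub>3 \<cdot> tU \<Delta>\<^sub>1\<rbrakk> \<Longrightarrow> \<exists>\<Delta>\<^sub>4. octahedron T \<Delta>\<^sub>1 \<Delta>\<^sub>2 \<Delta>\<^sub>3 \<Delta>\<^sub>4"


section \<open>Determinant functors\<close>

record ('o, 'm, 'p, 'q) det_funct = "('o, 'm, 'p, 'q) funct" +
  addD :: "'m triangle \<Rightarrow> 'q"

text \<open>In the commutativity axiom the split triangles are taken for every choice of a direct sum
  \<open>s\<close> of \<open>x\<close> and \<open>y\<close>; by naturality this does not depend on the choice.\<close>

definition determinant_functor ::
  "('o, 'm, 'x) tri_cat_scheme \<Rightarrow> ('p, 'q, 'y) mon_cat_scheme
    \<Rightarrow> ('o, 'm, 'p, 'q, 'z) det_funct_scheme \<Rightarrow> bool"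
where
  "determinant_functor T P D \<longleftrightarrow>
     is_functor (isom T) P D \<and>
     (\<forall>\<Delta>\<in>Dist T. addD D \<Delta> \<in>
        Hom P (onObj D (tZ T \<Delta>) \<oplus>\<^bsub>P\<^esub> onObj D (tX T \<Delta>)) (onObj D (tY T \<Delta>))) \<and>
     (\<forall>\<Delta>\<in>Dist T. \<forall>\<Delta>'\<in>Dist T. \<forall>f g h. triangle_iso T \<Delta> \<Delta>' f g h \<longrightarrow>
        addD D \<Delta>' \<cdot>\<^bsub>P\<^esub> (onArr D h \<boxplus>\<^bsub>P\<^esub> onArr D f) = onArr D g \<cdot>\<^bsub>P\<^esub> addD D \<Delta>) \<and>
     (\<forall>x y s i\<^sub>1 i\<^sub>2 p\<^sub>1 p\<^sub>2. biproduct T x y s i\<^sub>1 i\<^sub>2 p\<^sub>1 p\<^sub>2 \<longrightarrow>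
        addD D (Tri i\<^sub>2 p\<^sub>1 (zeroA T x (shiftO T y)))
        = addD D (Tri i\<^sub>1 p\<^sub>2 (zeroA T y (shiftO T x))) \<cdot>\<^bsub>P\<^esub> symm P (onObj D x) (onObj D y)) \<and>
     (\<forall>\<Delta>\<^sub>1 \<Delta>\<^sub>2 \<Delta>\<^sub>3 \<Delta>\<^sub>4. octahedron T \<Delta>\<^sub>1 \<Delta>\<^sub>2 \<Delta>\<^sub>3 \<Delta>\<^sub>4 \<longrightarrow>
        addD D \<Delta>\<^sub>2 \<cdot>\<^bsub>P\<^esub> (addD D \<Delta>\<^sub>4 \<boxplus>\<^bsub>P\<^esub> Ide P (onObj D (tX T \<Delta>\<^sub>1)))
        = addD D \<Delta>\<^sub>3 \<cdot>\<^bsub>P\<^esub>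
          ((Ide P (onObj D (tZ T \<Delta>\<^sub>3)) \<boxplus>\<^bsub>P\<^esub> addD D \<Delta>\<^sub>1) \<cdot>\<^bsub>P\<^esub>
            assoc P (onObj D (tZ T \<Delta>\<^sub>3)) (onObj D (tZ T \<Delta>\<^sub>1)) (onObj D (tX T \<Delta>\<^sub>1))))"

text \<open>\<open>(f, \<alpha>)\<close> factors the determinant functor \<open>D\<close> on \<open>T\<close> through \<open>det\<close>.\<close>

definition det_factorization ::
  "('o, 'm, 'x) tri_cat_scheme \<Rightarrow> ('v, 'w, 'y) mon_cat_scheme \<Rightarrow> ('p, 'q, 'z) mon_cat_scheme
    \<Rightarrow> ('o, 'm, 'v, 'w, 'a) det_funct_scheme \<Rightarrow> ('o, 'm, 'p, 'q, 'b) det_funct_scheme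
    \<Rightarrow> ('v, 'w, 'p, 'q, 'c) mon_funct_scheme \<Rightarrow> ('o \<Rightarrow> 'q) \<Rightarrow> bool"
where
  "det_factorization T V P det D f \<alpha> \<longleftrightarrow>
     symmetric_monoidal_functor V P f \<and>
     nat_trans (isom T) P (comp_functor f det) D \<alpha> \<and>
     (\<forall>\<Delta>\<in>Dist T.
        \<alpha> (tY T \<Delta>) \<cdot>\<^bsub>P\<^esub>
          (onArr f (addD det \<Delta>) \<cdot>\<^bsub>P\<^esub> tensC f (onObj det (tZ T \<Delta>)) (onObj det (tX T \<Delta>)))
        = addD D \<Delta> \<cdot>\<^bsub>P\<^esub> (\<alpha> (tZ T \<Delta>) \<boxplus>\<^bsub>P\<^esub> \<alpha> (tX T \<Delta>)))"

text \<open>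
  HOL cannot quantify over types inside a formula, so the types \<open>'p, 'q\<close> hosting the Picard groupoids
  against which \<open>det\<close> is universal are a parameter, passed as the first argument.
\<close>

definition universal_determinant_functor ::
  "('p, 'q) mon_cat itself \<Rightarrow> ('o, 'm, 'x) tri_cat_scheme \<Rightarrow> ('v, 'w, 'y) mon_cat_scheme
    \<Rightarrow> ('o, 'm, 'v, 'w, 'a) det_funct_scheme \<Rightarrow> bool"
where
  "universal_determinant_functor (_ :: ('p, 'q) mon_cat itself) T V det \<longleftrightarrow>
     picard_groupoid V \<and> determinant_functor T V det \<and>
     (\<forall>(P' :: ('p, 'q) mon_cat) (D :: ('o, 'm, 'p, 'q) det_funct).
        picard_groupoid P' \<and> determinant_functor T P' D \<longrightarrow>
        (\<exists>(f :: ('v, 'w, 'p, 'q) mon_funct) \<alpha>. det_factorization T V P' det D f \<alpha> \<and>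
           (\<forall>(f' :: ('v, 'w, 'p, 'q) mon_funct) \<alpha>'. det_factorization T V P' det D f' \<alpha>' \<longrightarrow>
              (\<exists>!\<beta>. monoidal_nat_trans V P' f f' \<beta> \<and>
                 (\<forall>x\<in>Obj T. \<alpha>' x \<cdot>\<^bsub>P'\<^esub> \<beta> (onObj det x) = \<alpha> x)))))"


section \<open>Functors of several variables\<close>

text \<open>
  The variables are numbered \<open>0, \<dots>, n\<close>.  A structure map in variable \<open>i\<close> takes the values of the
  other variables as an extensional tuple \<open>x\<close> on \<open>{..n} - {i}\<close>, completed by \<open>a\<close> to \<open>x(i := a)\<close>.
\<close>

definition arr_at :: "nat \<Rightarrow> (nat \<Rightarrow> ('o, 'm, 'x) cat_scheme) \<Rightarrow> nat \<Rightarrow> (nat \<Rightarrow> 'o) \<Rightarrow> 'm \<Rightarrow> nat \<Rightarrow> 'm" where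
  "arr_at n C i x f = (Ide (prod_cat ({..n} - {i}) C) x)(i := f)"

subsection \<open>Multiexact functors\<close>

record ('o, 'm, 'p, 'q) mexact_funct = "(nat \<Rightarrow> 'o, nat \<Rightarrow> 'm, 'p, 'q) funct" +
  mtensC :: "nat \<Rightarrow> (nat \<Rightarrow> 'o) \<Rightarrow> 'o \<Rightarrow> 'o \<Rightarrow> 'q"
  munitC :: "nat \<Rightarrow> (nat \<Rightarrow> 'o) \<Rightarrow> 'q"

definition mexact_slice ::
  "nat \<Rightarrow> (nat \<Rightarrow> ('o, 'm, 'x) mon_cat_scheme) \<Rightarrow> ('o, 'm, 'p, 'q, 'z) mexact_funct_scheme
    \<Rightarrow> nat \<Rightarrow> (nat \<Rightarrow> 'o) \<Rightarrow> ('o, 'm, 'p, 'q) mon_funct"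
where
  "mexact_slice n V F i x =
     \<lparr>onObj = (\<lambda>a. onObj F (x(i := a))), onArr = (\<lambda>f. onArr F (arr_at n V i x f)),
      tensC = mtensC F i x, unitC = munitC F i x\<rparr>"

definition multiexact ::
  "nat \<Rightarrow> (nat \<Rightarrow> ('o, 'm, 'x) mon_cat_scheme) \<Rightarrow> ('p, 'q, 'y) mon_cat_scheme
    \<Rightarrow> ('o, 'm, 'p, 'q, 'z) mexact_funct_scheme \<Rightarrow> bool"
where
  "multiexact n V P F \<longleftrightarrow>
     is_functor (prod_cat {..n} V) P F \<and>
     (\<forall>i\<le>n. \<forall>x\<in>Obj (prod_cat ({..n} - {i}) V).
        symmetric_monoidal_functor (V i) P (mexact_slice n V F i x)) \<and>
     (\<forall>i\<le>n. \<forall>x x'. \<forall>h\<in>Hom (prod_cat ({..n} - {i}) V) x x'. \<forall>a\<in>Obj (V i). \<forall>b\<in>Obj (V i).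
        mtensC F i x' a b \<cdot>\<^bsub>P\<^esub>
          (onArr F (h(i := Ide (V i) a)) \<boxplus>\<^bsub>P\<^esub> onArr F (h(i := Ide (V i) b)))
        = onArr F (h(i := Ide (V i) (a \<oplus>\<^bsub>V i\<^esub> b))) \<cdot>\<^bsub>P\<^esub> mtensC F i x a b) \<and>
     (\<forall>i\<le>n. \<forall>x x'. \<forall>h\<in>Hom (prod_cat ({..n} - {i}) V) x x'.
        munitC F i x' = onArr F (h(i := Ide (V i) (unitO (V i)))) \<cdot>\<^bsub>P\<^esub> munitC F i x) \<and>
     (\<forall>i j. i < j \<and> j \<le> n \<longrightarrow>
        (\<forall>x\<in>Obj (prod_cat ({..n} - {i, j}) V).
         \<forall>a\<in>Obj (V i). \<forall>b\<in>Obj (V i). \<forall>c\<in>Obj (V j). \<forall>d\<in>Obj (V j).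
           (let Fo = (\<lambda>s t. onObj F (x(i := s, j := t)));
                split_i = (\<lambda>t. inv_arr P (mtensC F i (x(j := t)) a b));
                split_j = (\<lambda>s. inv_arr P (mtensC F j (x(i := s)) c d))
            in coas P (Fo a c) (Fo a d) (Fo b c) (Fo b d) \<cdot>\<^bsub>P\<^esub>
                 ((split_j a \<boxplus>\<^bsub>P\<^esub> split_j b) \<cdot>\<^bsub>P\<^esub> split_i (c \<oplus>\<^bsub>V j\<^esub> d))
               = (split_i c \<boxplus>\<^bsub>P\<^esub> split_i d) \<cdot>\<^bsub>P\<^esub> split_j (a \<oplus>\<^bsub>V i\<^esub> b))))"

text \<open>Natural transformations of multiexact functors that are monoidal in each variable.\<close>

definition multiexact_nat_trans ::
  "nat \<Rightarrow> (nat \<Rightarrow> ('o, 'm, 'x) mon_cat_scheme) \<Rightarrow> ('p, 'q, 'y) mon_cat_scheme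
    \<Rightarrow> ('o, 'm, 'p, 'q, 'u) mexact_funct_scheme \<Rightarrow> ('o, 'm, 'p, 'q, 'v) mexact_funct_scheme
    \<Rightarrow> ((nat \<Rightarrow> 'o) \<Rightarrow> 'q) \<Rightarrow> bool"
where
  "multiexact_nat_trans n V P F G \<gamma> \<longleftrightarrow>
     nat_trans (prod_cat {..n} V) P F G \<gamma> \<and>
     (\<forall>i\<le>n. \<forall>x\<in>Obj (prod_cat ({..n} - {i}) V).
        monoidal_nat_trans (V i) P (mexact_slice n V F i x) (mexact_slice n V G i x)
          (\<lambda>a\<in>Obj (V i). \<gamma> (x(i := a))))"

subsection \<open>Multi-determinant functors\<close>

record ('o, 'm, 'p, 'q) mdet_funct = "(nat \<Rightarrow> 'o, nat \<Rightarrow> 'm, 'p, 'q) funct" +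
  maddD :: "nat \<Rightarrow> (nat \<Rightarrow> 'o) \<Rightarrow> 'm triangle \<Rightarrow> 'q"

definition mdet_slice ::
  "nat \<Rightarrow> (nat \<Rightarrow> ('o, 'm, 'x) tri_cat_scheme) \<Rightarrow> ('o, 'm, 'p, 'q, 'z) mdet_funct_scheme
    \<Rightarrow> nat \<Rightarrow> (nat \<Rightarrow> 'o) \<Rightarrow> ('o, 'm, 'p, 'q) det_funct"
where
  "mdet_slice n T D i x =
     \<lparr>onObj = (\<lambda>a. onObj D (x(i := a))), onArr = (\<lambda>f. onArr D (arr_at n T i x f)),
      addD = maddD D i x\<rparr>"

definition multi_determinant_functor ::
  "nat \<Rightarrow> (nat \<Rightarrow> ('o, 'm, 'x) tri_cat_scheme) \<Rightarrow> ('p, 'q, 'y) mon_cat_scheme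
    \<Rightarrow> ('o, 'm, 'p, 'q, 'z) mdet_funct_scheme \<Rightarrow> bool"
where
  "multi_determinant_functor n T P D \<longleftrightarrow>
     is_functor (prod_cat {..n} (\<lambda>i. isom (T i))) P D \<and>
     (\<forall>i\<le>n. \<forall>x\<in>Obj (prod_cat ({..n} - {i}) T).
        determinant_functor (T i) P (mdet_slice n T D i x)) \<and>
     \<comment> \<open>Two Triangles\<close>
     (\<forall>i j. i < j \<and> j \<le> n \<longrightarrow>
        (\<forall>x\<in>Obj (prod_cat ({..n} - {i, j}) T). \<forall>\<Delta>\<^sub>i\<in>Dist (T i). \<forall>\<Delta>\<^sub>j\<in>Dist (T j).
           (let x\<^sub>i = tX (T i) \<Delta>\<^sub>i; y\<^sub>i = tY (T i) \<Delta>\<^sub>i; z\<^sub>i = tZ (T i) \<Delta>\<^sub>i;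
                x\<^sub>j = tX (T j) \<Delta>\<^sub>j; y\<^sub>j = tY (T j) \<Delta>\<^sub>j; z\<^sub>j = tZ (T j) \<Delta>\<^sub>j;
                Do = (\<lambda>s t. onObj D (x(i := s, j := t)));
                D\<^sub>i = (\<lambda>t. maddD D i (x(j := t)) \<Delta>\<^sub>i);
                D\<^sub>j = (\<lambda>s. maddD D j (x(i := s)) \<Delta>\<^sub>j)
            in D\<^sub>j y\<^sub>i \<cdot>\<^bsub>P\<^esub> (D\<^sub>i z\<^sub>j \<boxplus>\<^bsub>P\<^esub> D\<^sub>i x\<^sub>j)
               = D\<^sub>i y\<^sub>j \<cdot>\<^bsub>P\<^esub> ((D\<^sub>j z\<^sub>i \<boxplus>\<^bsub>P\<^esub> D\<^sub>j x\<^sub>i) \<cdot>\<^bsub>P\<^esub>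
                   coas P (Do z\<^sub>i z\<^sub>j) (Do x\<^sub>i z\<^sub>j) (Do z\<^sub>i x\<^sub>j) (Do x\<^sub>i x\<^sub>j))))) \<and>
     \<comment> \<open>Triangle-Function\<close>
     (\<forall>i j. i \<noteq> j \<and> i \<le> n \<and> j \<le> n \<longrightarrow>
        (\<forall>x\<in>Obj (prod_cat ({..n} - {i, j}) T). \<forall>a b. \<forall>f\<in>Hom (isom (T i)) a b. \<forall>\<Delta>\<in>Dist (T j).
           (let Df = (\<lambda>t. onArr D (arr_at n T i (x(j := t)) f))
            in Df (tY (T j) \<Delta>) \<cdot>\<^bsub>P\<^esub> maddD D j (x(i := a)) \<Delta>
               = maddD D j (x(i := b)) \<Delta> \<cdot>\<^bsub>P\<^esub> (Df (tZ (T j) \<Delta>) \<boxplus>\<^bsub>P\<^esub> Df (tX (T j) \<Delta>)))))"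

definition mdet_morphism ::
  "nat \<Rightarrow> (nat \<Rightarrow> ('o, 'm, 'x) tri_cat_scheme) \<Rightarrow> ('p, 'q, 'y) mon_cat_scheme
    \<Rightarrow> ('o, 'm, 'p, 'q, 'u) mdet_funct_scheme \<Rightarrow> ('o, 'm, 'p, 'q, 'v) mdet_funct_scheme
    \<Rightarrow> ((nat \<Rightarrow> 'o) \<Rightarrow> 'q) \<Rightarrow> bool"
where
  "mdet_morphism n T P D\<^sub>1 D\<^sub>2 \<theta> \<longleftrightarrow>
     nat_trans (prod_cat {..n} (\<lambda>i. isom (T i))) P D\<^sub>1 D\<^sub>2 \<theta> \<and>
     (\<forall>i\<le>n. \<forall>x\<in>Obj (prod_cat ({..n} - {i}) T). \<forall>\<Delta>\<in>Dist (T i).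
        \<theta> (x(i := tY (T i) \<Delta>)) \<cdot>\<^bsub>P\<^esub> maddD D\<^sub>1 i x \<Delta>
        = maddD D\<^sub>2 i x \<Delta> \<cdot>\<^bsub>P\<^esub> (\<theta> (x(i := tZ (T i) \<Delta>)) \<boxplus>\<^bsub>P\<^esub> \<theta> (x(i := tX (T i) \<Delta>))))"

definition prod_functor ::
  "'i set \<Rightarrow> ('i \<Rightarrow> ('o, 'm, 'p, 'q, 'z) funct_scheme) \<Rightarrow> ('i \<Rightarrow> 'o, 'i \<Rightarrow> 'm, 'i \<Rightarrow> 'p, 'i \<Rightarrow> 'q) funct"
where
  "prod_functor I F = \<lparr>onObj = (\<lambda>x. \<lambda>i\<in>I. onObj (F i) (x i)), onArr = (\<lambda>f. \<lambda>i\<in>I. onArr (F i) (f i))\<rparr>"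

text \<open>\<open>g \<circ> det\<close> for \<open>g\<close> multiexact, with its additivity data
  \<open>g (det z) + g (det x) \<cong> g (det z + det x) \<rightarrow> g (det y)\<close> in each variable.\<close>

definition mexact_comp_det ::
  "nat \<Rightarrow> (nat \<Rightarrow> ('o, 'm, 'x) tri_cat_scheme) \<Rightarrow> (nat \<Rightarrow> ('v, 'w, 'y) mon_cat_scheme)
    \<Rightarrow> ('p, 'q, 'z) mon_cat_scheme \<Rightarrow> ('v, 'w, 'p, 'q, 'a) mexact_funct_scheme
    \<Rightarrow> (nat \<Rightarrow> ('o, 'm, 'v, 'w, 'b) det_funct_scheme) \<Rightarrow> ('o, 'm, 'p, 'q) mdet_funct"
where
  "mexact_comp_det n T V P g det =
     \<lparr>onObj = onObj (comp_functor g (prod_functor {..n} det)),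
      onArr = onArr (comp_functor g (prod_functor {..n} det)),
      maddD = (\<lambda>i x \<Delta>.
        let v = onObj (prod_functor ({..n} - {i}) det) x
        in onArr g (arr_at n V i v (addD (det i) \<Delta>)) \<cdot>\<^bsub>P\<^esub>
           mtensC g i v (onObj (det i) (tZ (T i) \<Delta>)) (onObj (det i) (tX (T i) \<Delta>)))\<rparr>"

text \<open>\<open>(d, a)\<close> factors the multi-determinant functor \<open>D\<close> through the product of the \<open>det i\<close>.\<close>

definition mdet_factorization ::
  "nat \<Rightarrow> (nat \<Rightarrow> ('o, 'm, 'x) tri_cat_scheme) \<Rightarrow> (nat \<Rightarrow> ('v, 'w, 'y) mon_cat_scheme)
    \<Rightarrow> ('p, 'q, 'z) mon_cat_scheme \<Rightarrow> (nat \<Rightarrow> ('o, 'm, 'v, 'w, 'b) det_funct_scheme)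
    \<Rightarrow> ('o, 'm, 'p, 'q, 'c) mdet_funct_scheme \<Rightarrow> ('v, 'w, 'p, 'q, 'a) mexact_funct_scheme
    \<Rightarrow> ((nat \<Rightarrow> 'o) \<Rightarrow> 'q) \<Rightarrow> bool"
where
  "mdet_factorization n T V P det D d a \<longleftrightarrow>
     multiexact n V P d \<and> mdet_morphism n T P (mexact_comp_det n T V P d det) D a"

end

theory Submission
  imports Defs
begin

text \<open>
  Determinant functors, symmetric monoidal functors and their versions in several variables are all
  models, in the Picard groupoid \<open>P\<close>, of abstract data: a category with triangles, on which
  additivity maps subject to prescribed relations are required.  Unit constraints need not be
  counted among the data, because the full faithfulness of translations determines them uniquely.
  A determinant functor \<open>T \<rightarrow> V\<close> is a map between such data, and its universality says that pulling
  back along it is an equivalence from models on \<open>V\<close> to models on \<open>T\<close>.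

  Models on \<open>S\<close> can be added pointwise.  A model in two variables on \<open>R\<close> and \<open>S\<close> is therefore a
  family of models on \<open>S\<close> indexed by the objects of \<open>R\<close>, with a morphism of models from the sum of
  two of them to the third for every triangle of \<open>R\<close>: this is what the two-triangle axiom expresses.
  Models and morphisms of models on \<open>S\<close> extend along an equivalence uniquely, so an equivalence in
  one variable, with the other one kept, is again an equivalence.  Replacing the variables one at a
  time gives the theorem by induction on their number.
\<close>

section \<open>Arrows of Picard groupoids\<close>

text \<open>Currying would suggest applying universality to the Picard groupoid of exact functors
  from the remaining \<open>V i\<close> to \<open>P\<close>. Its objects are functors, so it does
  not live over the types for which \<open>det\<close> is assumed universal. Hence universality is
  only ever applied with target \<open>P\<close> itself, to one row of a model at a time, and the
  rows are glued afterwards. Gluing works because every relation in one variable is an equation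
  between two morphisms of models in the other, and by faithfulness such an equation may be tested
  on the image of \<open>det\<close>. For this each side has to be a morphism of models: pointwise
  sums must be models, and the symmetry, the associator and \<open>coas\<close> must be morphisms
  between such sums. That is the purpose of the coherence computations with
  \<open>coas\<close>.\<close>

declare Hom_def [simp]

context category
begin

lemma Ide_simps [simp]:
  assumes "a \<in> Obj C"
  shows "Ide C a \<in> Arr C" "Dom C (Ide C a) = a" "Cod C (Ide C a) = a"
  using Ide_in[OF assms] by auto

lemma Obj_simps [simp]:
  assumes "f \<in> Arr C"
  shows "Dom C f \<in> Obj C" "Cod C f \<in> Obj C"
  using assms by (simp_all add: Dom_in Cod_in)

lemma Cmp_simps [simp]:
  assumes "f \<in> Arr C" "g \<in> Arr C" "Dom C g = Cod C f"
  shows "g \<cdot> f \<in> Arr C" "Dom C (g \<cdot> f) = Dom C f" "Cod C (g \<cdot> f) = Cod C g"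
  using Cmp_in[of f "Dom C f" "Cod C f" g "Cod C g"] assms by auto

lemma Ide_Cmp [simp]: "\<lbrakk>f \<in> Arr C; Cod C f = b\<rbrakk> \<Longrightarrow> Ide C b \<cdot> f = f"
  using Ide_left by auto

lemma Cmp_Ide [simp]: "\<lbrakk>f \<in> Arr C; Dom C f = a\<rbrakk> \<Longrightarrow> f \<cdot> Ide C a = f"
  using Ide_right by auto

lemma Cmp_assoc' [simp]:
  assumes "f \<in> Arr C" "g \<in> Arr C" "h \<in> Arr C" "Dom C g = Cod C f" "Dom C h = Cod C g"
  shows "(h \<cdot> g) \<cdot> f = h \<cdot> (g \<cdot> f)"
  using Cmp_assoc[of f _ _ g _ h] assms by auto

lemma inverse_arrows_unique:
  assumes "inverse_arrows C f g" "inverse_arrows C f g'"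
  shows "g = g'"
proof -
  have "(g \<cdot> f) \<cdot> g' = g \<cdot> (f \<cdot> g')"
    using assms by (intro Cmp_assoc') (auto simp: inverse_arrows_def)
  then show ?thesis
    using assms by (simp add: inverse_arrows_def)
qed

lemma inverse_arrows_inv_arr: "iso_arr C f \<Longrightarrow> inverse_arrows C f (inv_arr C f)"
  unfolding iso_arr_def inv_arr_def
  by (erule exE, rule theI) (auto intro: inverse_arrows_unique)

lemma iso_arrI:
  assumes "f \<in> Arr C" "g \<in> Arr C" "Dom C g = Cod C f" "Cod C g = Dom C f"
    "g \<cdot> f = Ide C (Dom C f)" "f \<cdot> g = Ide C (Cod C f)"
  shows "iso_arr C f"
  using assms unfolding iso_arr_def inverse_arrows_def by auto

end

context picard_groupoid
begin

lemma iso [simp]: "f \<in> Arr P \<Longrightarrow> iso_arr P f"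
  by (rule groupoid)

lemma inv_simps [simp]:
  assumes "f \<in> Arr P"
  shows "inv_arr P f \<in> Arr P" "Dom P (inv_arr P f) = Cod P f" "Cod P (inv_arr P f) = Dom P f"
  using inverse_arrows_inv_arr[OF groupoid[OF assms]] by (auto simp: inverse_arrows_def)

lemma inv_Cmp [simp]: "\<lbrakk>f \<in> Arr P; Dom P f = a\<rbrakk> \<Longrightarrow> inv_arr P f \<cdot> f = Ide P a"
  using inverse_arrows_inv_arr[OF groupoid, of f] by (auto simp: inverse_arrows_def)

lemma Cmp_inv [simp]: "\<lbrakk>f \<in> Arr P; Cod P f = a\<rbrakk> \<Longrightarrow> f \<cdot> inv_arr P f = Ide P a"
  using inverse_arrows_inv_arr[OF groupoid, of f] by (auto simp: inverse_arrows_def)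

text \<open>\<open>Cmp_assoc'\<close> brackets all composites to the right, so a law for
  \<open>f \<cdot> g\<close> no longer matches inside a longer composite. Here and below the variant
  with a trailing arrow restores it.\<close>

lemma inv_Cmp_left [simp]:
  assumes "f \<in> Arr P" "g \<in> Arr P" "Dom P f = Cod P g"
  shows "inv_arr P f \<cdot> (f \<cdot> g) = g"
  using assms Cmp_assoc'[of g f "inv_arr P f", symmetric] by simp

lemma Cmp_inv_left [simp]:
  assumes "f \<in> Arr P" "g \<in> Arr P" "Cod P f = Cod P g"
  shows "f \<cdot> (inv_arr P f \<cdot> g) = g"
  using assms Cmp_assoc'[of g "inv_arr P f" f, symmetric] by simp

lemma Cmp_cancel_left:
  assumes "f \<cdot> g = f \<cdot> h" "f \<in> Arr P" "g \<in> Arr P" "h \<in> Arr P" "Dom P f = Cod P g" "Dom P f = Cod P h"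
  shows "g = h"
  using inv_Cmp_left[of f g] inv_Cmp_left[of f h] assms by simp

lemma Cmp_cancel_right:
  assumes "g \<cdot> f = h \<cdot> f" "f \<in> Arr P" "g \<in> Arr P" "h \<in> Arr P" "Dom P g = Cod P f" "Dom P h = Cod P f"
  shows "g = h"
proof -
  have "g = (g \<cdot> f) \<cdot> inv_arr P f" using assms(2-) by simp
  also have "\<dots> = (h \<cdot> f) \<cdot> inv_arr P f" by (simp only: assms(1))
  also have "\<dots> = h" using assms(2-) by simp
  finally show ?thesis .
qed

lemma inv_unique:
  assumes "f \<cdot> g = Ide P (Dom P g)" "f \<in> Arr P" "g \<in> Arr P" "Dom P f = Cod P g" "Cod P f = Dom P g"
  shows "inv_arr P f = g"
  by (rule Cmp_cancel_left[of f]) (use assms in auto)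

lemma inv_Ide [simp]: "a \<in> Obj P \<Longrightarrow> inv_arr P (Ide P a) = Ide P a"
  by (rule inv_unique) auto

lemma inv_inv [simp]: "f \<in> Arr P \<Longrightarrow> inv_arr P (inv_arr P f) = f"
  by (rule inv_unique) auto

lemma tensO_Obj [simp]: "\<lbrakk>a \<in> Obj P; b \<in> Obj P\<rbrakk> \<Longrightarrow> a \<oplus> b \<in> Obj P"
  by (rule tensO_in)

lemma unitO_Obj [simp]: "unitO P \<in> Obj P"
  by (rule unitO_in)

lemma tensA_simps [simp]:
  assumes "f \<in> Arr P" "g \<in> Arr P"
  shows "f \<boxplus> g \<in> Arr P" "Dom P (f \<boxplus> g) = Dom P f \<oplus> Dom P g" "Cod P (f \<boxplus> g) = Cod P f \<oplus> Cod P g"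
  using tensA_in[of f "Dom P f" "Cod P f" g "Dom P g" "Cod P g"] assms by auto

lemma tensA_Ide' [simp]: "\<lbrakk>a \<in> Obj P; b \<in> Obj P\<rbrakk> \<Longrightarrow> Ide P a \<boxplus> Ide P b = Ide P (a \<oplus> b)"
  by (rule tensA_Ide)

lemma interchange:
  assumes "f \<in> Arr P" "f' \<in> Arr P" "g \<in> Arr P" "g' \<in> Arr P" "Dom P f' = Cod P f" "Dom P g' = Cod P g"
  shows "(f' \<boxplus> g') \<cdot> (f \<boxplus> g) = (f' \<cdot> f) \<boxplus> (g' \<cdot> g)"
  using tensA_Cmp[of f _ _ f' _ g _ _ g'] assms by auto

lemma interchange':
  assumes "f \<in> Arr P" "f' \<in> Arr P" "g \<in> Arr P" "g' \<in> Arr P" "Dom P f' = Cod P f" "Dom P g' = Cod P g"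
    "k \<in> Arr P" "Cod P k = Dom P f \<oplus> Dom P g"
  shows "(f' \<boxplus> g') \<cdot> ((f \<boxplus> g) \<cdot> k) = ((f' \<cdot> f) \<boxplus> (g' \<cdot> g)) \<cdot> k"
  using assms by (simp add: interchange[symmetric])

lemma inv_tensA [simp]:
  assumes "f \<in> Arr P" "g \<in> Arr P"
  shows "inv_arr P (f \<boxplus> g) = inv_arr P f \<boxplus> inv_arr P g"
  by (rule inv_unique) (use assms in \<open>auto simp: interchange\<close>)

lemma assoc_simps [simp]:
  assumes "a \<in> Obj P" "b \<in> Obj P" "c \<in> Obj P"
  shows "assoc P a b c \<in> Arr P" "Dom P (assoc P a b c) = (a \<oplus> b) \<oplus> c" "Cod P (assoc P a b c) = a \<oplus> (b \<oplus> c)"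
  using assoc_in[OF assms] by auto

lemma symm_simps [simp]:
  assumes "a \<in> Obj P" "b \<in> Obj P"
  shows "symm P a b \<in> Arr P" "Dom P (symm P a b) = a \<oplus> b" "Cod P (symm P a b) = b \<oplus> a"
  using symm_in[OF assms] by auto

lemma lunit_simps [simp]:
  assumes "a \<in> Obj P"
  shows "lunit P a \<in> Arr P" "Dom P (lunit P a) = unitO P \<oplus> a" "Cod P (lunit P a) = a"
  using lunit_in[OF assms] by auto

lemma runit_simps [simp]:
  assumes "a \<in> Obj P"
  shows "runit P a \<in> Arr P" "Dom P (runit P a) = a \<oplus> unitO P" "Cod P (runit P a) = a"
  using runit_in[OF assms] by auto

lemma assoc_natural:
  assumes "f \<in> Arr P" "g \<in> Arr P" "h \<in> Arr P"
    "Cod P f = a" "Cod P g = b" "Cod P h = c" "Dom P f = a'" "Dom P g = b'" "Dom P h = c'"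
  shows "assoc P a b c \<cdot> ((f \<boxplus> g) \<boxplus> h) = (f \<boxplus> (g \<boxplus> h)) \<cdot> assoc P a' b' c'"
  using assoc_nat[of f _ _ g _ _ h] assms by auto

lemma assoc_natural':
  assumes "f \<in> Arr P" "g \<in> Arr P" "h \<in> Arr P"
    "Cod P f = a" "Cod P g = b" "Cod P h = c" "Dom P f = a'" "Dom P g = b'" "Dom P h = c'"
    "k \<in> Arr P" "Cod P k = (a' \<oplus> b') \<oplus> c'"
  shows "assoc P a b c \<cdot> (((f \<boxplus> g) \<boxplus> h) \<cdot> k) = (f \<boxplus> (g \<boxplus> h)) \<cdot> (assoc P a' b' c' \<cdot> k)"
proof -
  have "assoc P a b c \<cdot> (((f \<boxplus> g) \<boxplus> h) \<cdot> k) = (assoc P a b c \<cdot> ((f \<boxplus> g) \<boxplus> h)) \<cdot> k"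
    using assms by auto
  also have "\<dots> = ((f \<boxplus> (g \<boxplus> h)) \<cdot> assoc P a' b' c') \<cdot> k"
    using assms by (simp only: assoc_natural)
  also have "\<dots> = (f \<boxplus> (g \<boxplus> h)) \<cdot> (assoc P a' b' c' \<cdot> k)"
    using assms by auto
  finally show ?thesis .
qed

lemma symm_natural:
  assumes "f \<in> Arr P" "g \<in> Arr P" "Cod P f = a" "Cod P g = b" "Dom P f = a'" "Dom P g = b'"
  shows "symm P a b \<cdot> (f \<boxplus> g) = (g \<boxplus> f) \<cdot> symm P a' b'"
  using symm_nat[of f _ _ g] assms by auto

text \<open>Full faithfulness of the translations is all that is used of the Picard condition.\<close>

lemma tensA_Ide_left_faithful:
  assumes "Ide P x \<boxplus> f = Ide P x \<boxplus> g" "x \<in> Obj P" "f \<in> Arr P" "g \<in> Arr P"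
    "Dom P f = Dom P g" "Cod P f = Cod P g"
  shows "f = g"
proof -
  obtain G :: "('o, 'm, 'o, 'm) funct" and \<eta> where
    \<eta>: "nat_iso P P id_functor (comp_functor G (translation_functor P x)) \<eta>"
    using translation_equivalence[OF assms(2)] unfolding equivalence_functor_def by blast
  have *: "\<eta> (Cod P h) \<cdot> h = onArr G (Ide P x \<boxplus> h) \<cdot> \<eta> (Dom P h)" if "h \<in> Arr P" for h
    using \<eta> that by (auto simp: nat_iso_def nat_trans_def id_functor_def comp_functor_def translation_functor_def)
  have "\<eta> (Cod P f) \<in> Arr P" "Dom P (\<eta> (Cod P f)) = Cod P f"
    using \<eta> assms by (auto simp: nat_iso_def nat_trans_def id_functor_def comp_functor_def translation_functor_def)
  note \<eta>f = this
  have "\<eta> (Cod P f) \<cdot> f = \<eta> (Cod P f) \<cdot> g"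
    using *[OF assms(3)] *[OF assms(4)] assms(1,5,6) by simp
  then show ?thesis
    by (rule Cmp_cancel_left) (use assms(2-) \<eta>f in simp_all)
qed

lemma tensA_Ide_left_full:
  assumes "x \<in> Obj P" "a \<in> Obj P" "b \<in> Obj P" "h \<in> Hom P (x \<oplus> a) (x \<oplus> b)"
  shows "\<exists>f\<in>Hom P a b. Ide P x \<boxplus> f = h"
proof -
  let ?F = "translation_functor P x"
  obtain G :: "('o, 'm, 'o, 'm) funct" and \<eta> \<epsilon> where G: "is_functor P P G" and
    \<eta>: "nat_iso P P id_functor (comp_functor G ?F) \<eta>" and
    \<epsilon>: "nat_iso P P (comp_functor ?F G) id_functor \<epsilon>"
    using translation_equivalence[OF assms(1)] unfolding equivalence_functor_def by blast
  have GA: "onArr G k \<in> Arr P" "Dom P (onArr G k) = onObj G (Dom P k)" "Cod P (onArr G k) = onObj G (Cod P k)"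
    if "k \<in> Arr P" for k
    using G that by (auto simp: is_functor_def)
  have \<eta>A: "\<eta> c \<in> Arr P" "Dom P (\<eta> c) = c" "Cod P (\<eta> c) = onObj G (x \<oplus> c)" if "c \<in> Obj P" for c
    using \<eta> that by (auto simp: nat_iso_def nat_trans_def id_functor_def comp_functor_def translation_functor_def)
  have \<epsilon>A: "\<epsilon> c \<in> Arr P" "Cod P (\<epsilon> c) = c" "Dom P (\<epsilon> c) = x \<oplus> onObj G c" if "c \<in> Obj P" for c
    using \<epsilon> that by (auto simp: nat_iso_def nat_trans_def id_functor_def comp_functor_def translation_functor_def)
  have \<eta>N: "\<eta> (Cod P k) \<cdot> k = onArr G (Ide P x \<boxplus> k) \<cdot> \<eta> (Dom P k)" if "k \<in> Arr P" for k
    using \<eta> that by (auto simp: nat_iso_def nat_trans_def id_functor_def comp_functor_def translation_functor_def)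
  have \<epsilon>N: "\<epsilon> (Cod P k) \<cdot> (Ide P x \<boxplus> onArr G k) = k \<cdot> \<epsilon> (Dom P k)" if "k \<in> Arr P" for k
    using \<epsilon> that by (auto simp: nat_iso_def nat_trans_def id_functor_def comp_functor_def translation_functor_def)
  \<comment> \<open>Naturality of \<open>\<eta>\<close> at the arrow sought, with
    \<open>onArr G h\<close> in place of the image of its translate under \<open>G\<close>, leaves
    only this choice.\<close>
  define f where "f = inv_arr P (\<eta> b) \<cdot> (onArr G h \<cdot> \<eta> a)"
  have f: "f \<in> Arr P" "Dom P f = a" "Cod P f = b"
    using assms by (auto simp: f_def GA \<eta>A)
  have "onArr G (Ide P x \<boxplus> f) \<cdot> \<eta> a = \<eta> b \<cdot> f"
    using \<eta>N[OF f(1)] f by simp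
  also have "\<dots> = onArr G h \<cdot> \<eta> a"
    using assms by (simp add: f_def GA \<eta>A)
  finally have "onArr G (Ide P x \<boxplus> f) = onArr G h"
    by (rule Cmp_cancel_right) (use assms f in \<open>auto simp: GA \<eta>A\<close>)
  \<comment> \<open>Naturality of \<open>\<epsilon>\<close> removes \<open>G\<close>: two parallel
    arrows with the same image under \<open>G\<close> agree after composition with the invertible
    \<open>\<epsilon> (x \<oplus> a)\<close>.\<close>
  then have "(Ide P x \<boxplus> f) \<cdot> \<epsilon> (x \<oplus> a) = h \<cdot> \<epsilon> (x \<oplus> a)"
    using \<epsilon>N[of "Ide P x \<boxplus> f"] \<epsilon>N[of h] f assms by simp
  then have "Ide P x \<boxplus> f = h"
    by (rule Cmp_cancel_right) (use assms f in \<open>auto simp: \<epsilon>A\<close>)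
  then show ?thesis
    using f by auto
qed

text \<open>The symmetry conjugates translation on the right into translation on the left.\<close>

lemma tensA_Ide_right_faithful:
  assumes "f \<boxplus> Ide P x = g \<boxplus> Ide P x" "x \<in> Obj P" "f \<in> Arr P" "g \<in> Arr P"
    "Dom P f = Dom P g" "Cod P f = Cod P g"
  shows "f = g"
proof -
  have "(Ide P x \<boxplus> f) \<cdot> symm P (Dom P f) x = symm P (Cod P f) x \<cdot> (f \<boxplus> Ide P x)"
    using assms(2,3) by (intro symm_natural[symmetric]) simp_all
  also have "\<dots> = symm P (Cod P f) x \<cdot> (g \<boxplus> Ide P x)"
    by (simp only: assms(1))
  also have "\<dots> = (Ide P x \<boxplus> g) \<cdot> symm P (Dom P f) x"
    using assms(2-) by (intro symm_natural) simp_all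
  finally have "Ide P x \<boxplus> f = Ide P x \<boxplus> g"
    by (rule Cmp_cancel_right) (use assms(2-) in simp_all)
  then show ?thesis
    by (rule tensA_Ide_left_faithful) (use assms(2-) in simp_all)
qed

lemma tensA_Ide_right_full:
  assumes "x \<in> Obj P" "a \<in> Obj P" "b \<in> Obj P" "h \<in> Hom P (a \<oplus> x) (b \<oplus> x)"
  shows "\<exists>f\<in>Hom P a b. f \<boxplus> Ide P x = h"
proof -
  have "symm P b x \<cdot> (h \<cdot> symm P x a) \<in> Hom P (x \<oplus> a) (x \<oplus> b)"
    using assms by simp
  from tensA_Ide_left_full[OF assms(1-3) this]
  obtain f where f: "f \<in> Hom P a b" "Ide P x \<boxplus> f = symm P b x \<cdot> (h \<cdot> symm P x a)"
    by blast
  have "symm P b x \<cdot> (f \<boxplus> Ide P x) = (symm P b x \<cdot> (h \<cdot> symm P x a)) \<cdot> symm P a x"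
    unfolding f(2)[symmetric] using f(1) assms by (intro symm_natural) simp_all
  also have "\<dots> = symm P b x \<cdot> h"
    using assms by (simp add: symm_symm)
  finally have "f \<boxplus> Ide P x = h"
    by (rule Cmp_cancel_left) (use assms f in auto)
  then show ?thesis using f by auto
qed

end

section \<open>Coherence\<close>

text \<open>Formal bracketed sums without a unit, since no unit constraint occurs in the
  isomorphisms to be compared.\<close>

datatype 'p sexp = At 'p | Pl "'p sexp" "'p sexp"

section \<open>Right-bracketed normal forms of sums followed by a tail\<close>

context picard_groupoid
begin

primrec ev :: "'o sexp \<Rightarrow> 'o" where
  "ev (At a) = a"
| "ev (Pl E G) = ev E \<oplus> ev G"

text \<open>The fully right-bracketed sum
  \<open>a1 \<oplus> (a2 \<oplus> (\<dots> (an \<oplus> Z)))\<close> of the atoms of the expression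
  and the tail.\<close>

primrec tailO :: "'o sexp \<Rightarrow> 'o \<Rightarrow> 'o" where
  "tailO (At a) Z = a \<oplus> Z"
| "tailO (Pl E G) Z = tailO E (tailO G Z)"

primrec tailA :: "'o sexp \<Rightarrow> 'm \<Rightarrow> 'm" where
  "tailA (At a) f = Ide P a \<boxplus> f"
| "tailA (Pl E G) f = tailA E (tailA G f)"

primrec wfe :: "'o sexp \<Rightarrow> bool" where
  "wfe (At a) \<longleftrightarrow> a \<in> Obj P"
| "wfe (Pl E G) \<longleftrightarrow> wfe E \<and> wfe G"

text \<open>The rebracketing isomorphism from \<open>ev E \<oplus> Z\<close> to
  \<open>tailO E Z\<close>, made of associators only.\<close>

primrec nf :: "'o sexp \<Rightarrow> 'o \<Rightarrow> 'm" where
  "nf (At a) Z = Ide P (a \<oplus> Z)"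
| "nf (Pl E G) Z = nf E (tailO G Z) \<cdot> ((Ide P (ev E) \<boxplus> nf G Z) \<cdot> assoc P (ev E) (ev G) Z)"

lemma ev_Obj [simp]: "wfe E \<Longrightarrow> ev E \<in> Obj P"
  by (induction E) auto

lemma tailO_Obj [simp]: "\<lbrakk>wfe E; Z \<in> Obj P\<rbrakk> \<Longrightarrow> tailO E Z \<in> Obj P"
  by (induction E arbitrary: Z) auto

lemma tailA_simps [simp]:
  assumes "wfe E" "f \<in> Arr P"
  shows "tailA E f \<in> Arr P" "Dom P (tailA E f) = tailO E (Dom P f)" "Cod P (tailA E f) = tailO E (Cod P f)"
  using assms by (induction E arbitrary: f) auto

lemma tailA_Ide [simp]: "\<lbrakk>wfe E; Z \<in> Obj P\<rbrakk> \<Longrightarrow> tailA E (Ide P Z) = Ide P (tailO E Z)"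
  by (induction E arbitrary: Z) auto

lemma nf_simps [simp]:
  assumes "wfe E" "Z \<in> Obj P"
  shows "nf E Z \<in> Arr P" "Dom P (nf E Z) = ev E \<oplus> Z" "Cod P (nf E Z) = tailO E Z"
  using assms by (induction E arbitrary: Z) auto

text \<open>The tail varies in the induction: when the atoms of \<open>E\<close> are reached, the
  arrow acting on the tail is already \<open>tailA G f\<close>.\<close>

lemma nf_natural:
  assumes "wfe E" "f \<in> Arr P" "Dom P f = Y" "Cod P f = Z"
  shows "nf E Z \<cdot> (Ide P (ev E) \<boxplus> f) = tailA E f \<cdot> nf E Y"
  using assms
proof (induction E arbitrary: f Y Z)
  case (Pl E G)
  let ?a = "ev E" and ?b = "ev G"
  have "nf (Pl E G) Z \<cdot> (Ide P (ev (Pl E G)) \<boxplus> f)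
      = nf E (tailO G Z) \<cdot> ((Ide P ?a \<boxplus> nf G Z) \<cdot> (assoc P ?a ?b Z \<cdot> ((Ide P ?a \<boxplus> Ide P ?b) \<boxplus> f)))"
    using Pl.prems by auto
  also have "\<dots> = nf E (tailO G Z) \<cdot> ((Ide P ?a \<boxplus> nf G Z) \<cdot> ((Ide P ?a \<boxplus> (Ide P ?b \<boxplus> f)) \<cdot> assoc P ?a ?b Y))"
    using Pl.prems by (subst assoc_natural[of _ _ _ _ _ _ ?a ?b Y]) auto
  also have "\<dots> = nf E (tailO G Z) \<cdot> ((Ide P ?a \<boxplus> (tailA G f \<cdot> nf G Y)) \<cdot> assoc P ?a ?b Y)"
    using Pl.prems Pl.IH(2)[of f Y Z] by (auto simp: interchange')
  also have "\<dots> = (nf E (tailO G Z) \<cdot> (Ide P ?a \<boxplus> tailA G f)) \<cdot> ((Ide P ?a \<boxplus> nf G Y) \<cdot> assoc P ?a ?b Y)"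
    using Pl.prems by (auto simp: interchange')
  also have "nf E (tailO G Z) \<cdot> (Ide P ?a \<boxplus> tailA G f) = tailA E (tailA G f) \<cdot> nf E (tailO G Y)"
    using Pl.prems by (intro Pl.IH(1)) auto
  finally show ?case
    using Pl.prems by auto
qed auto

text \<open>
  To compare two canonical isomorphisms, add an arbitrary tail \<open>Z\<close> on the right and rebracket
  to the right: associators then become identities, and only swaps of neighbours remain.
\<close>

definition rep :: "'o sexp \<Rightarrow> 'o sexp \<Rightarrow> 'm \<Rightarrow> ('o \<Rightarrow> 'm) \<Rightarrow> bool" where
  "rep E G f \<phi> \<longleftrightarrow> wfe E \<and> wfe G \<and> f \<in> Hom P (ev E) (ev G) \<and>
     (\<forall>Z\<in>Obj P. \<phi> Z \<in> Hom P (tailO E Z) (tailO G Z) \<and> nf G Z \<cdot> (f \<boxplus> Ide P Z) = \<phi> Z \<cdot> nf E Z)"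

lemma repD:
  assumes "rep E G f \<phi>"
  shows "wfe E" "wfe G" "f \<in> Arr P" "Dom P f = ev E" "Cod P f = ev G"
    "\<And>Z. Z \<in> Obj P \<Longrightarrow> \<phi> Z \<in> Arr P" "\<And>Z. Z \<in> Obj P \<Longrightarrow> Dom P (\<phi> Z) = tailO E Z"
    "\<And>Z. Z \<in> Obj P \<Longrightarrow> Cod P (\<phi> Z) = tailO G Z"
    "\<And>Z. Z \<in> Obj P \<Longrightarrow> nf G Z \<cdot> (f \<boxplus> Ide P Z) = \<phi> Z \<cdot> nf E Z"
  using assms by (auto simp: rep_def)

lemma rep_eqI:
  assumes "rep E G f \<phi>" "rep E G g \<psi>" "\<And>Z. Z \<in> Obj P \<Longrightarrow> \<phi> Z = \<psi> Z"
  shows "f = g"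
proof -
  note f = repD[OF assms(1)] and g = repD[OF assms(2)]
  let ?Z = "unitO P"
  have "nf G ?Z \<cdot> (f \<boxplus> Ide P ?Z) = nf G ?Z \<cdot> (g \<boxplus> Ide P ?Z)"
    using f(9)[of ?Z] g(9)[of ?Z] assms(3)[of ?Z] by simp
  then have "f \<boxplus> Ide P ?Z = g \<boxplus> Ide P ?Z"
    by (rule Cmp_cancel_left) (use f(1-5) g(1-5) in simp_all)
  then show ?thesis
    by (rule tensA_Ide_right_faithful) (use f(1-5) g(1-5) in simp_all)
qed

lemma rep_Ide: "wfe E \<Longrightarrow> rep E E (Ide P (ev E)) (\<lambda>Z. Ide P (tailO E Z))"
  by (auto simp: rep_def)

lemma rep_Cmp:
  assumes "rep E G f \<phi>" "rep G H g \<psi>"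
  shows "rep E H (g \<cdot> f) (\<lambda>Z. \<psi> Z \<cdot> \<phi> Z)"
proof -
  note f = repD[OF assms(1)] and g = repD[OF assms(2)]
  have "nf H Z \<cdot> ((g \<cdot> f) \<boxplus> Ide P Z) = (\<psi> Z \<cdot> \<phi> Z) \<cdot> nf E Z" if Z: "Z \<in> Obj P" for Z
  proof -
    have "nf H Z \<cdot> ((g \<cdot> f) \<boxplus> Ide P Z) = (nf H Z \<cdot> (g \<boxplus> Ide P Z)) \<cdot> (f \<boxplus> Ide P Z)"
      using f(1-5) g(1-5) Z by (simp add: interchange)
    also have "\<dots> = \<psi> Z \<cdot> (nf G Z \<cdot> (f \<boxplus> Ide P Z))"
      using f(1-8) g Z by simp
    also have "\<dots> = (\<psi> Z \<cdot> \<phi> Z) \<cdot> nf E Z"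
      using f g(1-8) Z by simp
    finally show ?thesis .
  qed
  then show ?thesis
    using f(1-8) g(1-8) by (simp add: rep_def)
qed

text \<open>For the first summand the second one belongs to the tail. So \<open>\<psi>\<close> acts
  first, below the atoms of \<open>E\<close>, and \<open>\<phi>\<close> then acts in front of a tail
  that already has the shape \<open>G'\<close>.\<close>

lemma rep_tensA:
  assumes "rep E E' f \<phi>" "rep G G' g \<psi>"
  shows "rep (Pl E G) (Pl E' G') (f \<boxplus> g) (\<lambda>Z. \<phi> (tailO G' Z) \<cdot> tailA E (\<psi> Z))"
proof -
  note f = repD[OF assms(1)] and g = repD[OF assms(2)]
  let ?a = "ev E" and ?b = "ev G" and ?a' = "ev E'" and ?b' = "ev G'"
  have "nf (Pl E' G') Z \<cdot> ((f \<boxplus> g) \<boxplus> Ide P Z) = (\<phi> (tailO G' Z) \<cdot> tailA E (\<psi> Z)) \<cdot> nf (Pl E G) Z"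
    if Z: "Z \<in> Obj P" for Z
  proof -
    have "nf (Pl E' G') Z \<cdot> ((f \<boxplus> g) \<boxplus> Ide P Z)
        = nf E' (tailO G' Z) \<cdot> ((Ide P ?a' \<boxplus> nf G' Z) \<cdot> (assoc P ?a' ?b' Z \<cdot> ((f \<boxplus> g) \<boxplus> Ide P Z)))"
      using f(1-5) g(1-5) Z by simp
    also have "\<dots> = nf E' (tailO G' Z) \<cdot> ((Ide P ?a' \<boxplus> nf G' Z) \<cdot> ((f \<boxplus> (g \<boxplus> Ide P Z)) \<cdot> assoc P ?a ?b Z))"
      using f(1-5) g(1-5) Z by (subst assoc_natural[of _ _ _ _ _ _ ?a ?b Z]) simp_all
    also have "\<dots> = nf E' (tailO G' Z) \<cdot> ((f \<boxplus> (\<psi> Z \<cdot> nf G Z)) \<cdot> assoc P ?a ?b Z)"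
      using f(1-5) g Z by (simp add: interchange')
    also have "\<dots> = (nf E' (tailO G' Z) \<cdot> (f \<boxplus> Ide P (tailO G' Z)))
          \<cdot> ((Ide P ?a \<boxplus> \<psi> Z) \<cdot> ((Ide P ?a \<boxplus> nf G Z) \<cdot> assoc P ?a ?b Z))"
      using f(1-5) g(1-8) Z by (simp add: interchange')
    also have "\<dots> = \<phi> (tailO G' Z) \<cdot> ((nf E (tailO G' Z) \<cdot> (Ide P ?a \<boxplus> \<psi> Z)) \<cdot> ((Ide P ?a \<boxplus> nf G Z) \<cdot> assoc P ?a ?b Z))"
      using f g(1-8) Z by simp
    also have "nf E (tailO G' Z) \<cdot> (Ide P ?a \<boxplus> \<psi> Z) = tailA E (\<psi> Z) \<cdot> nf E (tailO G Z)"
      using f(1-5) g(1-8) Z by (intro nf_natural) simp_all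
    finally show ?thesis
      using f(1-8) g(1-8) Z by simp
  qed
  then show ?thesis
    using f(1-8) g(1-8) by (simp add: rep_def)
qed

lemma rep_inv:
  assumes "rep E G f \<phi>"
  shows "rep G E (inv_arr P f) (\<lambda>Z. inv_arr P (\<phi> Z))"
proof -
  note f = repD[OF assms]
  have "nf E Z \<cdot> (inv_arr P f \<boxplus> Ide P Z) = inv_arr P (\<phi> Z) \<cdot> nf G Z" if Z: "Z \<in> Obj P" for Z
  proof -
    have "inv_arr P (\<phi> Z) \<cdot> nf G Z = inv_arr P (\<phi> Z) \<cdot> ((nf G Z \<cdot> (f \<boxplus> Ide P Z)) \<cdot> (inv_arr P f \<boxplus> Ide P Z))"
      using f(1-8) Z by (simp add: interchange)
    also have "\<dots> = nf E Z \<cdot> (inv_arr P f \<boxplus> Ide P Z)"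
      unfolding f(9)[OF Z] using f(1-8) Z by simp
    finally show ?thesis ..
  qed
  then show ?thesis
    using f(1-8) by (simp add: rep_def)
qed

lemma pentagon':
  assumes "a \<in> Obj P" "b \<in> Obj P" "c \<in> Obj P" "d \<in> Obj P"
  shows "(Ide P a \<boxplus> assoc P b c d) \<cdot> (assoc P a (b \<oplus> c) d \<cdot> (assoc P a b c \<boxplus> Ide P d))
    = assoc P a b (c \<oplus> d) \<cdot> assoc P (a \<oplus> b) c d"
  by (rule pentagon[OF assms])

text \<open>The pentagon with the tail \<open>Z\<close> as its fourth object: rebracketing to the
  right absorbs the associator, which is therefore represented by identities.\<close>

lemma rep_assoc:
  assumes "wfe E" "wfe G" "wfe H" "ev E = a" "ev G = b" "ev H = c"
  shows "rep (Pl (Pl E G) H) (Pl E (Pl G H)) (assoc P a b c) (\<lambda>Z. Ide P (tailO E (tailO G (tailO H Z))))"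
proof -
  let ?w = "\<lambda>Z. tailO G (tailO H Z)"
  have "nf (Pl E (Pl G H)) Z \<cdot> (assoc P a b c \<boxplus> Ide P Z) = nf (Pl (Pl E G) H) Z" if Z: "Z \<in> Obj P" for Z
  proof -
    let ?k = "nf H Z"
    have ob: "a \<in> Obj P" "b \<in> Obj P" "c \<in> Obj P"
      using assms by auto
    have "nf (Pl E (Pl G H)) Z \<cdot> (assoc P a b c \<boxplus> Ide P Z)
      = nf E (?w Z) \<cdot> ((Ide P a \<boxplus> nf G (tailO H Z)) \<cdot> ((Ide P a \<boxplus> (Ide P b \<boxplus> ?k))
          \<cdot> ((Ide P a \<boxplus> assoc P b c Z) \<cdot> (assoc P a (b \<oplus> c) Z \<cdot> (assoc P a b c \<boxplus> Ide P Z)))))"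
      using assms ob Z by (simp add: interchange')
    also have "\<dots> = nf E (?w Z) \<cdot> ((Ide P a \<boxplus> nf G (tailO H Z)) \<cdot> (((Ide P a \<boxplus> (Ide P b \<boxplus> ?k))
          \<cdot> assoc P a b (c \<oplus> Z)) \<cdot> assoc P (a \<oplus> b) c Z))"
      using assms ob Z by (simp add: pentagon')
    also have "(Ide P a \<boxplus> (Ide P b \<boxplus> ?k)) \<cdot> assoc P a b (c \<oplus> Z)
        = assoc P a b (tailO H Z) \<cdot> ((Ide P a \<boxplus> Ide P b) \<boxplus> ?k)"
      using assms ob Z by (intro assoc_natural[symmetric]) simp_all
    finally show ?thesis
      using assms ob Z by simp
  qed
  then show ?thesis
    using assms by (auto simp: rep_def)
qed

text \<open>The exchange of two neighbours in front of a tail. After rebracketing, the isomorphisms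
  compared below become composites of such exchanges with summands added on the left.\<close>

definition swp :: "'o \<Rightarrow> 'o \<Rightarrow> 'o \<Rightarrow> 'm" where
  "swp a b Z = assoc P b a Z \<cdot> ((symm P a b \<boxplus> Ide P Z) \<cdot> inv_arr P (assoc P a b Z))"

lemma swp_simps [simp]:
  assumes "a \<in> Obj P" "b \<in> Obj P" "Z \<in> Obj P"
  shows "swp a b Z \<in> Arr P" "Dom P (swp a b Z) = a \<oplus> (b \<oplus> Z)" "Cod P (swp a b Z) = b \<oplus> (a \<oplus> Z)"
  using assms by (auto simp: swp_def)

lemma rep_symm: "\<lbrakk>a \<in> Obj P; b \<in> Obj P\<rbrakk> \<Longrightarrow> rep (Pl (At a) (At b)) (Pl (At b) (At a)) (symm P a b) (swp a b)"
  by (auto simp: rep_def swp_def)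

lemma swp_swp [simp]:
  assumes "a \<in> Obj P" "b \<in> Obj P" "Z \<in> Obj P"
  shows "swp b a Z \<cdot> swp a b Z = Ide P (a \<oplus> (b \<oplus> Z))"
proof -
  have "swp b a Z \<cdot> swp a b Z = assoc P a b Z \<cdot> (((symm P b a \<cdot> symm P a b) \<boxplus> Ide P Z) \<cdot> inv_arr P (assoc P a b Z))"
    using assms by (simp add: swp_def interchange')
  then show ?thesis
    using assms by (simp add: symm_symm)
qed

lemma swp_swp_left [simp]:
  assumes "a \<in> Obj P" "b \<in> Obj P" "Z \<in> Obj P" "k \<in> Arr P" "Cod P k = a \<oplus> (b \<oplus> Z)"
  shows "swp b a Z \<cdot> (swp a b Z \<cdot> k) = k"
  using assms Cmp_assoc'[of k "swp a b Z" "swp b a Z", symmetric] by simp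

lemma inv_symm [simp]: "\<lbrakk>a \<in> Obj P; b \<in> Obj P\<rbrakk> \<Longrightarrow> inv_arr P (symm P a b) = symm P b a"
  by (rule inv_unique) (simp_all add: symm_symm)

lemma inv_swp [simp]: "\<lbrakk>a \<in> Obj P; b \<in> Obj P; Z \<in> Obj P\<rbrakk> \<Longrightarrow> inv_arr P (swp a b Z) = swp b a Z"
  by (rule inv_unique) simp_all

lemma swp_natural:
  assumes "f \<in> Arr P" "g \<in> Arr P" "h \<in> Arr P" "Dom P f = a'" "Dom P g = b'" "Dom P h = c'"
    "Cod P f = a" "Cod P g = b" "Cod P h = c"
  shows "swp a b c \<cdot> (f \<boxplus> (g \<boxplus> h)) = (g \<boxplus> (f \<boxplus> h)) \<cdot> swp a' b' c'"
proof -
  have ob: "a \<in> Obj P" "b \<in> Obj P" "c \<in> Obj P" "a' \<in> Obj P" "b' \<in> Obj P" "c' \<in> Obj P"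
    using assms by auto
  have "(swp a b c \<cdot> (f \<boxplus> (g \<boxplus> h))) \<cdot> assoc P a' b' c' = swp a b c \<cdot> (assoc P a b c \<cdot> ((f \<boxplus> g) \<boxplus> h))"
    using assms ob by (simp add: assoc_natural)
  also have "\<dots> = assoc P b a c \<cdot> (((symm P a b \<cdot> (f \<boxplus> g)) \<boxplus> h))"
    using assms ob by (simp add: swp_def interchange)
  also have "\<dots> = assoc P b a c \<cdot> (((g \<boxplus> f) \<boxplus> h) \<cdot> (symm P a' b' \<boxplus> Ide P c'))"
    using assms ob by (simp add: symm_natural interchange)
  also have "\<dots> = ((g \<boxplus> (f \<boxplus> h)) \<cdot> swp a' b' c') \<cdot> assoc P a' b' c'"
    using assms ob by (simp add: swp_def assoc_natural')
  finally show ?thesis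
    by (rule Cmp_cancel_right) (use assms ob in auto)
qed

text \<open>The hexagon, solved for the symmetry with a sum.\<close>

lemma symm_plus_right:
  assumes "a \<in> Obj P" "b \<in> Obj P" "c \<in> Obj P"
  shows "symm P a (b \<oplus> c) = inv_arr P (assoc P b c a) \<cdot> ((Ide P b \<boxplus> symm P a c)
     \<cdot> (assoc P b a c \<cdot> ((symm P a b \<boxplus> Ide P c) \<cdot> inv_arr P (assoc P a b c))))"
proof -
  have "inv_arr P (assoc P b c a) \<cdot> ((assoc P b c a \<cdot> (symm P a (b \<oplus> c) \<cdot> assoc P a b c)) \<cdot> inv_arr P (assoc P a b c))
     = symm P a (b \<oplus> c)"
    using assms by simp
  then show ?thesis
    unfolding hexagon[OF assms] using assms by simp
qed

lemma rep_cong: "\<lbrakk>rep E G f \<phi>; f = g; \<And>Z. Z \<in> Obj P \<Longrightarrow> \<phi> Z = \<psi> Z\<rbrakk> \<Longrightarrow> rep E G g \<psi>"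
  by (simp add: rep_def)

text \<open>By the hexagon \<open>E\<close> passes the sum of \<open>G\<close> and \<open>H\<close>
  in two moves: past \<open>G\<close> with \<open>H\<close> in the tail, then past \<open>H\<close>
  below the atoms of \<open>G\<close>.\<close>

lemma rep_symm_right:
  assumes "wfe E" "wfe G" "wfe H" "rep (Pl E G) (Pl G E) (symm P (ev E) (ev G)) \<phi>"
    "rep (Pl E H) (Pl H E) (symm P (ev E) (ev H)) \<psi>"
  shows "rep (Pl E (Pl G H)) (Pl (Pl G H) E) (symm P (ev E) (ev (Pl G H))) (\<lambda>Z. tailA G (\<psi> Z) \<cdot> \<phi> (tailO H Z))"
proof -
  note reps = rep_Cmp[OF rep_Cmp[OF rep_Cmp[OF rep_Cmp[OF
     rep_inv[OF rep_assoc[OF assms(1-3) refl refl refl]] rep_tensA[OF assms(4) rep_Ide[OF assms(3)]]]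
       rep_assoc[OF assms(2,1,3) refl refl refl]] rep_tensA[OF rep_Ide[OF assms(2)] assms(5)]]
       rep_inv[OF rep_assoc[OF assms(2,3,1) refl refl refl]]]
  show ?thesis
    by (rule rep_cong[OF reps])
      (use assms(1-3) repD(1-8)[OF assms(4)] repD(1-8)[OF assms(5)] in \<open>simp_all add: symm_plus_right\<close>)
qed

end

context picard_groupoid
begin

text \<open>The inverse of a symmetry is the symmetry with exchanged arguments, so this is the
  inverse of the move in the opposite direction.\<close>

lemma rep_symm_left:
  assumes "wfe E" "wfe G" "wfe H" "rep (Pl E G) (Pl G E) (symm P (ev E) (ev G)) \<phi>"
    "rep (Pl E H) (Pl H E) (symm P (ev E) (ev H)) \<psi>"
  shows "rep (Pl (Pl G H) E) (Pl E (Pl G H)) (symm P (ev (Pl G H)) (ev E))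
    (\<lambda>Z. inv_arr P (\<phi> (tailO H Z)) \<cdot> tailA G (inv_arr P (\<psi> Z)))"
proof -
  have tail_inv: "inv_arr P (tailA E f) = tailA E (inv_arr P f)" if "wfe E" "f \<in> Arr P" for E f
    using that by (induction E arbitrary: f) auto
  have inv_comp: "inv_arr P (g \<cdot> f) = inv_arr P f \<cdot> inv_arr P g"
    if "f \<in> Arr P" "g \<in> Arr P" "Dom P g = Cod P f" for f g
    by (rule inv_unique) (use that in auto)
  show ?thesis
    by (rule rep_cong[OF rep_inv[OF rep_symm_right[OF assms]]])
      (use assms(1-3) repD(1-8)[OF assms(4)] repD(1-8)[OF assms(5)] in \<open>simp_all add: tail_inv inv_comp\<close>)
qed

section \<open>The exchange of the two middle summands among four\<close>

lemma coas_simps [simp]: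
  assumes "a \<in> Obj P" "b \<in> Obj P" "c \<in> Obj P" "d \<in> Obj P"
  shows "coas P a b c d \<in> Arr P" "Dom P (coas P a b c d) = (a \<oplus> b) \<oplus> (c \<oplus> d)"
    "Cod P (coas P a b c d) = (a \<oplus> c) \<oplus> (b \<oplus> d)"
  using assms by (auto simp: coas_def)

text \<open>All associators disappear in the right-bracketed form; what is left is the exchange of
  \<open>B\<close> and \<open>C\<close>, with \<open>D\<close> in the tail.\<close>

lemma rep_coas:
  assumes "wfe A" "wfe B" "wfe C" "wfe D" "rep (Pl B C) (Pl C B) (symm P (ev B) (ev C)) \<phi>"
    "ev A = a" "ev B = b" "ev C = c" "ev D = d"
  shows "rep (Pl (Pl A B) (Pl C D)) (Pl (Pl A C) (Pl B D)) (coas P a b c d) (\<lambda>Z. tailA A (\<phi> (tailO D Z)))"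
proof -
  let ?as = "\<lambda>E G H. rep (Pl (Pl E G) H) (Pl E (Pl G H)) (assoc P (ev E) (ev G) (ev H))
    (\<lambda>Z. Ide P (tailO E (tailO G (tailO H Z))))"
  have as: "?as A B (Pl C D)" "?as B C D" "?as C B D" "?as A C (Pl B D)"
    using assms(1-4) rep_assoc[OF assms(1) assms(2), of "Pl C D"] rep_assoc[OF assms(2-4)]
    rep_assoc[OF assms(3,2,4)] rep_assoc[OF assms(1) assms(3), of "Pl B D"] by simp_all
  note A = rep_Ide[OF assms(1)] and D = rep_Ide[OF assms(4)]
  note reps = rep_Cmp[OF rep_Cmp[OF rep_Cmp[OF rep_Cmp[OF as(1) rep_tensA[OF A rep_inv[OF as(2)]]]
    rep_tensA[OF A rep_tensA[OF assms(5) D]]] rep_tensA[OF A as(3)]] rep_inv[OF as(4)]]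
  show ?thesis
    by (rule rep_cong[OF reps])
      (use assms(1-4) repD(1-8)[OF assms(5)] in \<open>simp_all add: coas_def assms(6-9)[symmetric]\<close>)
qed

text \<open>Two opposite exchanges of the middle summands cancel.\<close>

lemma coas_coas [simp]:
  assumes "a \<in> Obj P" "b \<in> Obj P" "c \<in> Obj P" "d \<in> Obj P"
  shows "coas P a c b d \<cdot> coas P a b c d = Ide P ((a \<oplus> b) \<oplus> (c \<oplus> d))"
  by (rule rep_eqI[OF rep_Cmp[OF rep_coas rep_coas] rep_Ide[of "Pl (Pl (At a) (At b)) (Pl (At c) (At d))"], simplified])
    (use assms in \<open>auto intro: rep_symm simp: interchange\<close>)

lemma symm_coas:
  assumes "a \<in> Obj P" "b \<in> Obj P" "c \<in> Obj P" "d \<in> Obj P"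
  shows "coas P c d a b \<cdot> symm P (a \<oplus> b) (c \<oplus> d) = (symm P a c \<boxplus> symm P b d) \<cdot> coas P a b c d"
proof -
  let ?a = "At a" and ?b = "At b" and ?c = "At c" and ?d = "At d"
  have w: "wfe ?a" "wfe ?b" "wfe ?c" "wfe ?d"
    using assms by auto
  have s: "rep (Pl (At x) (At y)) (Pl (At y) (At x)) (symm P (ev (At x)) (ev (At y))) (swp x y)"
    if "x \<in> Obj P" "y \<in> Obj P" for x y
    using rep_symm[OF that] by simp
  note sl = rep_symm_left[OF w(3,1,2) s s] rep_symm_left[OF w(4,1,2) s s]
  have ws: "wfe (Pl ?a ?b)" using w by simp
  have "rep (Pl (Pl ?a ?b) (Pl ?c ?d)) (Pl (Pl ?c ?d) (Pl ?a ?b)) (symm P (ev (Pl ?a ?b)) (ev (Pl ?c ?d)))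
     (\<lambda>Z. tailA ?c (inv_arr P (swp d a (b \<oplus> Z)) \<cdot> (Ide P a \<boxplus> inv_arr P (swp d b Z))) \<cdot>
       (inv_arr P (swp c a (b \<oplus> (d \<oplus> Z))) \<cdot> (Ide P a \<boxplus> inv_arr P (swp c b (d \<oplus> Z)))))"
    using rep_symm_right[OF ws w(3,4) sl] assms by simp
  note l' = rep_Cmp[OF this rep_coas[OF w(3,4,1,2) s refl refl refl refl]]
  \<comment> \<open>\<open>coas P c d a b\<close> undoes the exchange of \<open>a\<close> and
    \<open>d\<close> made by the symmetry of the two blocks. Three exchanges remain, as on the other
    side, and the two lists differ by sliding disjoint exchanges past each other, which is
    \<open>swp_natural\<close>.\<close>
  have l: "rep (Pl (Pl ?a ?b) (Pl ?c ?d)) (Pl (Pl ?c ?a) (Pl ?d ?b)) (coas P c d a b \<cdot> symm P (a \<oplus> b) (c \<oplus> d))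
     (\<lambda>Z. (Ide P c \<boxplus> (Ide P a \<boxplus> swp b d Z)) \<cdot> (swp a c (b \<oplus> (d \<oplus> Z)) \<cdot> (Ide P a \<boxplus> swp b c (d \<oplus> Z))))"
    by (rule rep_cong[OF l']) (use assms in \<open>simp_all add: interchange interchange'\<close>)
  note r' = rep_Cmp[OF rep_coas[OF w s refl refl refl refl] rep_tensA[OF rep_symm rep_symm]]
  have r: "rep (Pl (Pl ?a ?b) (Pl ?c ?d)) (Pl (Pl ?c ?a) (Pl ?d ?b)) ((symm P a c \<boxplus> symm P b d) \<cdot> coas P a b c d)
     (\<lambda>Z. (swp a c (d \<oplus> (b \<oplus> Z)) \<cdot> (Ide P a \<boxplus> (Ide P c \<boxplus> swp b d Z))) \<cdot> (Ide P a \<boxplus> swp b c (d \<oplus> Z)))"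
    by (rule rep_cong[OF r']) (use assms in simp_all)
  show ?thesis
    by (rule rep_eqI[OF l r]) (use assms in \<open>simp add: swp_natural\<close>)
qed

text \<open>Equivalent to \<open>symm_coas\<close> for \<open>a, c, b, d\<close>, because
  \<open>coas\<close> is inverted by exchanging its middle arguments.\<close>

lemma coas_symm:
  assumes "a \<in> Obj P" "b \<in> Obj P" "c \<in> Obj P" "d \<in> Obj P"
  shows "symm P (a \<oplus> c) (b \<oplus> d) \<cdot> coas P a b c d = coas P b a d c \<cdot> (symm P a b \<boxplus> symm P c d)"
proof -
  have "coas P b a d c \<cdot> (symm P a b \<boxplus> symm P c d)
     = coas P b a d c \<cdot> (((symm P a b \<boxplus> symm P c d) \<cdot> coas P a c b d) \<cdot> coas P a b c d)"
    using assms by simp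
  also have "\<dots> = (coas P b a d c \<cdot> coas P b d a c) \<cdot> (symm P (a \<oplus> c) (b \<oplus> d) \<cdot> coas P a b c d)"
    using assms by (simp add: symm_coas[symmetric] del: coas_coas)
  also have "\<dots> = symm P (a \<oplus> c) (b \<oplus> d) \<cdot> coas P a b c d"
    using assms by (simp del: Cmp_assoc')
  finally show ?thesis ..
qed

text \<open>The six summands undergo the same permutation on both sides. This identity is what makes
  the pointwise sum of two models satisfy the associativity relation.\<close>

lemma assoc_coas:
  assumes "a \<in> Obj P" "b \<in> Obj P" "c \<in> Obj P" "a' \<in> Obj P" "b' \<in> Obj P" "c' \<in> Obj P"
  shows "(assoc P a b c \<boxplus> assoc P a' b' c') \<cdot> (coas P (a \<oplus> b) (a' \<oplus> b') c c' \<cdot> (coas P a a' b b' \<boxplus> Ide P (c \<oplus> c')))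
    = coas P a a' (b \<oplus> c) (b' \<oplus> c') \<cdot> ((Ide P (a \<oplus> a') \<boxplus> coas P b b' c c') \<cdot> assoc P (a \<oplus> a') (b \<oplus> b') (c \<oplus> c'))"
proof -
  let ?a = "At a" and ?b = "At b" and ?c = "At c" and ?a' = "At a'" and ?b' = "At b'" and ?c' = "At c'"
  have w: "wfe ?a" "wfe ?b" "wfe ?c" "wfe ?a'" "wfe ?b'" "wfe ?c'"
    using assms by auto
  have w2: "wfe (Pl ?a ?b)" "wfe (Pl ?a' ?b')" "wfe (Pl ?b ?c)" "wfe (Pl ?b' ?c')" "wfe (Pl ?c ?c')" "wfe (Pl ?a ?a')" "wfe (Pl ?b ?b')"
    using assms by auto
  have s: "rep (Pl (At x) (At y)) (Pl (At y) (At x)) (symm P (ev (At x)) (ev (At y))) (swp x y)"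
    if "x \<in> Obj P" "y \<in> Obj P" for x y
    using rep_symm[OF that] by simp
  note c1 = rep_coas[OF w(1,4,2,5) s refl refl refl refl]
  note c2 = rep_coas[OF w2(1,2) w(3,6) rep_symm_left[OF w(3,4,5) s s] refl refl refl refl]
  note c3 = rep_coas[OF w(2,5,3,6) s refl refl refl refl]
  note c4 = rep_coas[OF w(1,4) w2(3,4) rep_symm_right[OF w(4,2,3) s s] refl refl refl refl]
  note as = rep_assoc[OF w(1,2,3) refl refl refl] rep_assoc[OF w(4,5,6) refl refl refl]
    rep_assoc[OF w2(6,7,5) refl refl refl]
  note l = rep_Cmp[OF rep_Cmp[OF rep_tensA[OF c1 rep_Ide[OF w2(5)]] c2] rep_tensA[OF as(1,2)]]
  note r = rep_Cmp[OF rep_Cmp[OF as(3) rep_tensA[OF rep_Ide[OF w2(6)] c3]] c4]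
  show ?thesis
    by (rule rep_eqI[OF l r, simplified])
      (use assms in \<open>simp_all add: interchange interchange' swp_natural\<close>)
qed

lemma coas_swp:
  assumes "a \<in> Obj P" "b \<in> Obj P" "c \<in> Obj P" "d \<in> Obj P"
  shows "coas P a b c d = inv_arr P (assoc P a c (b \<oplus> d)) \<cdot> ((Ide P a \<boxplus> swp b c d) \<cdot> assoc P a b (c \<oplus> d))"
  using assms by (simp add: coas_def swp_def interchange')

text \<open>Through \<open>coas_swp\<close> this reduces to naturality of the associator and of the
  exchange of neighbours.\<close>

lemma coas_natural:
  assumes "f \<in> Arr P" "g \<in> Arr P" "h \<in> Arr P" "k \<in> Arr P"
    "Dom P f = a" "Dom P g = b" "Dom P h = c" "Dom P k = d"
    "Cod P f = a'" "Cod P g = b'" "Cod P h = c'" "Cod P k = d'"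
  shows "coas P a' b' c' d' \<cdot> ((f \<boxplus> g) \<boxplus> (h \<boxplus> k)) = ((f \<boxplus> h) \<boxplus> (g \<boxplus> k)) \<cdot> coas P a b c d"
proof -
  have ob: "a \<in> Obj P" "b \<in> Obj P" "c \<in> Obj P" "d \<in> Obj P" "a' \<in> Obj P" "b' \<in> Obj P" "c' \<in> Obj P" "d' \<in> Obj P"
    using assms by auto
  have "((Ide P a' \<boxplus> swp b' c' d') \<cdot> assoc P a' b' (c' \<oplus> d')) \<cdot> ((f \<boxplus> g) \<boxplus> (h \<boxplus> k))
    = (Ide P a' \<boxplus> swp b' c' d') \<cdot> ((f \<boxplus> (g \<boxplus> (h \<boxplus> k))) \<cdot> assoc P a b (c \<oplus> d))"
    using assms ob by (simp add: assoc_natural)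
  also have "\<dots> = ((f \<boxplus> (h \<boxplus> (g \<boxplus> k))) \<cdot> (Ide P a \<boxplus> swp b c d)) \<cdot> assoc P a b (c \<oplus> d)"
    using assms ob by (simp add: interchange interchange' swp_natural)
  also have "\<dots> = assoc P a' c' (b' \<oplus> d') \<cdot> ((((f \<boxplus> h) \<boxplus> (g \<boxplus> k)) \<cdot> coas P a b c d))"
    using assms ob by (simp add: coas_swp assoc_natural')
  finally show ?thesis
    using assms ob inv_Cmp_left[of "assoc P a' c' (b' \<oplus> d')" "((f \<boxplus> h) \<boxplus> (g \<boxplus> k)) \<cdot> coas P a b c d"]
    by (simp add: coas_swp[of a'])
qed

lemma coas_natural':
  assumes "f \<in> Arr P" "g \<in> Arr P" "h \<in> Arr P" "k \<in> Arr P"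
    "Dom P f = a" "Dom P g = b" "Dom P h = c" "Dom P k = d"
    "Cod P f = a'" "Cod P g = b'" "Cod P h = c'" "Cod P k = d'"
    "l \<in> Arr P" "Cod P l = (a \<oplus> b) \<oplus> (c \<oplus> d)"
  shows "coas P a' b' c' d' \<cdot> (((f \<boxplus> g) \<boxplus> (h \<boxplus> k)) \<cdot> l) = ((f \<boxplus> h) \<boxplus> (g \<boxplus> k)) \<cdot> (coas P a b c d \<cdot> l)"
proof -
  have ob: "a \<in> Obj P" "b \<in> Obj P" "c \<in> Obj P" "d \<in> Obj P" "a' \<in> Obj P" "b' \<in> Obj P" "c' \<in> Obj P" "d' \<in> Obj P"
    using assms by auto
  have "coas P a' b' c' d' \<cdot> (((f \<boxplus> g) \<boxplus> (h \<boxplus> k)) \<cdot> l) = (coas P a' b' c' d' \<cdot> ((f \<boxplus> g) \<boxplus> (h \<boxplus> k))) \<cdot> l"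
    using assms ob by simp
  also have "\<dots> = (((f \<boxplus> h) \<boxplus> (g \<boxplus> k)) \<cdot> coas P a b c d) \<cdot> l"
    using assms(1-12) by (simp only: coas_natural)
  also have "\<dots> = ((f \<boxplus> h) \<boxplus> (g \<boxplus> k)) \<cdot> (coas P a b c d \<cdot> l)"
    using assms ob by simp
  finally show ?thesis .
qed

text \<open>\<open>assoc_coas\<close> with all four occurrences of \<open>coas\<close> moved to the
  other side: each is invertible, with inverse the \<open>coas\<close> whose middle arguments are
  exchanged.\<close>

lemma assoc_coas_coas:
  assumes "a \<in> Obj P" "b \<in> Obj P" "c \<in> Obj P" "a' \<in> Obj P" "b' \<in> Obj P" "c' \<in> Obj P"
  shows "assoc P (a \<oplus> a') (b \<oplus> b') (c \<oplus> c') \<cdot> ((coas P a b a' b' \<boxplus> Ide P (c \<oplus> c')) \<cdot> coas P (a \<oplus> b) c (a' \<oplus> b') c')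
    = (Ide P (a \<oplus> a') \<boxplus> coas P b c b' c') \<cdot> (coas P a (b \<oplus> c) a' (b' \<oplus> c') \<cdot> (assoc P a b c \<boxplus> assoc P a' b' c'))"
  (is "?A \<cdot> (?B \<cdot> ?C) = ?D \<cdot> (?E \<cdot> ?F)")
proof -
  let ?E' = "coas P a a' (b \<oplus> c) (b' \<oplus> c')" and ?D' = "Ide P (a \<oplus> a') \<boxplus> coas P b b' c c'"
    and ?C' = "coas P (a \<oplus> b) (a' \<oplus> b') c c'" and ?B' = "coas P a a' b b' \<boxplus> Ide P (c \<oplus> c')"
  have E: "?E \<cdot> ?E' = Ide P (Dom P ?E')" and D: "?D \<cdot> ?D' = Ide P (Dom P ?D')"
    and C: "?C' \<cdot> ?C = Ide P (Dom P ?C)" and B: "?B' \<cdot> ?B = Ide P (Dom P ?B)"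
    using assms by (simp_all add: interchange)
  have "?A \<cdot> (?B \<cdot> ?C) = (?D \<cdot> ((?E \<cdot> ?E') \<cdot> ?D')) \<cdot> (?A \<cdot> (?B \<cdot> ?C))"
    unfolding E using assms by (simp add: D del: Cmp_assoc')
  also have "\<dots> = ?D \<cdot> (?E \<cdot> ((?E' \<cdot> (?D' \<cdot> ?A)) \<cdot> (?B \<cdot> ?C)))"
    using assms by (simp del: coas_coas)
  also have "\<dots> = ?D \<cdot> (?E \<cdot> ((?F \<cdot> (?C' \<cdot> ?B')) \<cdot> (?B \<cdot> ?C)))"
    using assms by (simp only: assoc_coas)
  also have "\<dots> = ?D \<cdot> (?E \<cdot> (?F \<cdot> (?C' \<cdot> ((?B' \<cdot> ?B) \<cdot> ?C))))"
    using assms by simp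
  also have "\<dots> = ?D \<cdot> (?E \<cdot> (?F \<cdot> (?C' \<cdot> ?C)))"
    unfolding B using assms by (simp del: coas_coas)
  also have "\<dots> = ?D \<cdot> (?E \<cdot> ?F)"
    unfolding C using assms by simp
  finally show ?thesis .
qed

text \<open>\<open>tri_mor\<close> says that \<open>(p, q, r)\<close> is a morphism from \<open>u: z + x \<rightarrow> y\<close> to \<open>v: z' + x' \<rightarrow> y'\<close>.\<close>

definition tri_mor :: "'o \<Rightarrow> 'o \<Rightarrow> 'm \<Rightarrow> 'o \<Rightarrow> 'o \<Rightarrow> 'm \<Rightarrow> 'm \<Rightarrow> 'm \<Rightarrow> 'm \<Rightarrow> bool" where
  "tri_mor z x u z' x' v p q r \<longleftrightarrow> z \<in> Obj P \<and> x \<in> Obj P \<and> z' \<in> Obj P \<and> x' \<in> Obj P \<and>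
     u \<in> Arr P \<and> Dom P u = z \<oplus> x \<and> v \<in> Arr P \<and> Dom P v = z' \<oplus> x' \<and>
     p \<in> Hom P z z' \<and> q \<in> Hom P x x' \<and> r \<in> Hom P (Cod P u) (Cod P v) \<and> r \<cdot> u = v \<cdot> (p \<boxplus> q)"

text \<open>The sum of two triangles must be a map out of
  \<open>(z \<oplus> z') \<oplus> (x \<oplus> x')\<close>, so the middle summands change places
  first.\<close>

definition tri_sum :: "'o \<Rightarrow> 'o \<Rightarrow> 'm \<Rightarrow> 'o \<Rightarrow> 'o \<Rightarrow> 'm \<Rightarrow> 'm" where
  "tri_sum z x u z' x' u' = (u \<boxplus> u') \<cdot> coas P z z' x x'"

lemma tri_sum_simps [simp]:
  assumes "z \<in> Obj P" "x \<in> Obj P" "z' \<in> Obj P" "x' \<in> Obj P"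
    "u \<in> Arr P" "u' \<in> Arr P" "Dom P u = z \<oplus> x" "Dom P u' = z' \<oplus> x'"
  shows "tri_sum z x u z' x' u' \<in> Arr P" "Dom P (tri_sum z x u z' x' u') = (z \<oplus> z') \<oplus> (x \<oplus> x')"
    "Cod P (tri_sum z x u z' x' u') = Cod P u \<oplus> Cod P u'"
  using assms by (simp_all add: tri_sum_def)

lemma tri_mor_Ide:
  assumes "z \<in> Obj P" "x \<in> Obj P" "u \<in> Arr P" "Dom P u = z \<oplus> x" "Cod P u = y"
  shows "tri_mor z x u z x u (Ide P z) (Ide P x) (Ide P y)"
  using assms by (auto simp: tri_mor_def)

lemma tri_mor_Cmp:
  assumes "tri_mor z x u z' x' v p q r" "tri_mor z' x' v z'' x'' w p' q' r'"
  shows "tri_mor z x u z'' x'' w (p' \<cdot> p) (q' \<cdot> q) (r' \<cdot> r)"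
proof -
  have "(r' \<cdot> r) \<cdot> u = r' \<cdot> (v \<cdot> (p \<boxplus> q))"
    using assms by (simp add: tri_mor_def)
  also have "\<dots> = (r' \<cdot> v) \<cdot> (p \<boxplus> q)"
    using assms by (intro Cmp_assoc'[symmetric]) (simp_all add: tri_mor_def)
  also have "r' \<cdot> v = w \<cdot> (p' \<boxplus> q')"
    using assms by (simp add: tri_mor_def)
  also have "(w \<cdot> (p' \<boxplus> q')) \<cdot> (p \<boxplus> q) = w \<cdot> ((p' \<cdot> p) \<boxplus> (q' \<cdot> q))"
    using assms by (simp add: tri_mor_def interchange)
  finally show ?thesis
    using assms by (simp add: tri_mor_def)
qed

lemma tri_mor_inv:
  assumes "tri_mor z x u z' x' v p q r"
  shows "tri_mor z' x' v z x u (inv_arr P p) (inv_arr P q) (inv_arr P r)"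
proof -
  have t: "u \<in> Arr P" "r \<in> Arr P" "p \<in> Arr P" "q \<in> Arr P" "Dom P r = Cod P u" "Dom P u = Dom P p \<oplus> Dom P q"
    and eq: "v \<cdot> (p \<boxplus> q) = r \<cdot> u"
    using assms by (simp_all add: tri_mor_def)
  have "inv_arr P r \<cdot> v = inv_arr P r \<cdot> ((v \<cdot> (p \<boxplus> q)) \<cdot> (inv_arr P p \<boxplus> inv_arr P q))"
    using assms by (simp add: tri_mor_def interchange)
  also have "\<dots> = u \<cdot> (inv_arr P p \<boxplus> inv_arr P q)"
    unfolding eq using t by simp
  finally show ?thesis
    using assms by (simp add: tri_mor_def)
qed

lemma tri_mor_sum:
  assumes "tri_mor z x u z' x' v p q r" "tri_mor z\<^sub>2 x\<^sub>2 u\<^sub>2 z\<^sub>2' x\<^sub>2' v\<^sub>2 p\<^sub>2 q\<^sub>2 r\<^sub>2"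
  shows "tri_mor (z \<oplus> z\<^sub>2) (x \<oplus> x\<^sub>2) (tri_sum z x u z\<^sub>2 x\<^sub>2 u\<^sub>2) (z' \<oplus> z\<^sub>2') (x' \<oplus> x\<^sub>2') (tri_sum z' x' v z\<^sub>2' x\<^sub>2' v\<^sub>2)
    (p \<boxplus> p\<^sub>2) (q \<boxplus> q\<^sub>2) (r \<boxplus> r\<^sub>2)"
proof -
  have "(r \<boxplus> r\<^sub>2) \<cdot> ((u \<boxplus> u\<^sub>2) \<cdot> coas P z z\<^sub>2 x x\<^sub>2) = (v \<boxplus> v\<^sub>2) \<cdot> (coas P z' z\<^sub>2' x' x\<^sub>2' \<cdot> ((p \<boxplus> p\<^sub>2) \<boxplus> (q \<boxplus> q\<^sub>2)))"
    using assms by (simp add: tri_mor_def interchange interchange' coas_natural)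
  then show ?thesis
    using assms by (simp add: tri_mor_def tri_sum_def)
qed

lemma tri_mor_symm:
  assumes "z \<in> Obj P" "x \<in> Obj P" "u \<in> Arr P" "Dom P u = z \<oplus> x" "Cod P u = y"
    "z' \<in> Obj P" "x' \<in> Obj P" "u' \<in> Arr P" "Dom P u' = z' \<oplus> x'" "Cod P u' = y'"
  shows "tri_mor (z \<oplus> z') (x \<oplus> x') (tri_sum z x u z' x' u') (z' \<oplus> z) (x' \<oplus> x) (tri_sum z' x' u' z x u)
    (symm P z z') (symm P x x') (symm P y y')"
proof -
  have ob: "y \<in> Obj P" "y' \<in> Obj P" using assms by auto
  have "symm P y y' \<cdot> ((u \<boxplus> u') \<cdot> coas P z z' x x') = (symm P y y' \<cdot> (u \<boxplus> u')) \<cdot> coas P z z' x x'"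
    using assms ob by simp
  also have "\<dots> = (u' \<boxplus> u) \<cdot> (symm P (z \<oplus> x) (z' \<oplus> x') \<cdot> coas P z z' x x')"
    using assms ob by (simp add: symm_natural)
  also have "\<dots> = ((u' \<boxplus> u) \<cdot> coas P z' z x' x) \<cdot> (symm P z z' \<boxplus> symm P x x')"
    using assms ob by (simp add: coas_symm)
  finally show ?thesis
    using assms ob by (simp add: tri_mor_def tri_sum_def)
qed

lemma tri_mor_assoc:
  assumes "z \<in> Obj P" "x \<in> Obj P" "u \<in> Arr P" "Dom P u = z \<oplus> x" "Cod P u = y"
    "z' \<in> Obj P" "x' \<in> Obj P" "u' \<in> Arr P" "Dom P u' = z' \<oplus> x'" "Cod P u' = y'"
    "z'' \<in> Obj P" "x'' \<in> Obj P" "u'' \<in> Arr P" "Dom P u'' = z'' \<oplus> x''" "Cod P u'' = y''"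
  shows "tri_mor ((z \<oplus> z') \<oplus> z'') ((x \<oplus> x') \<oplus> x'') (tri_sum (z \<oplus> z') (x \<oplus> x') (tri_sum z x u z' x' u') z'' x'' u'')
     (z \<oplus> (z' \<oplus> z'')) (x \<oplus> (x' \<oplus> x'')) (tri_sum z x u (z' \<oplus> z'') (x' \<oplus> x'') (tri_sum z' x' u' z'' x'' u''))
    (assoc P z z' z'') (assoc P x x' x'') (assoc P y y' y'')"
proof -
  have ob: "y \<in> Obj P" "y' \<in> Obj P" "y'' \<in> Obj P" using assms by auto
  let ?l = "(coas P z z' x x' \<boxplus> Ide P (z'' \<oplus> x'')) \<cdot> coas P (z \<oplus> z') z'' (x \<oplus> x') x''"
  let ?r = "coas P z (z' \<oplus> z'') x (x' \<oplus> x'') \<cdot> (assoc P z z' z'' \<boxplus> assoc P x x' x'')"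
  have "assoc P y y' y'' \<cdot> ((((u \<boxplus> u') \<cdot> coas P z z' x x') \<boxplus> u'') \<cdot> coas P (z \<oplus> z') z'' (x \<oplus> x') x'')
     = assoc P y y' y'' \<cdot> (((u \<boxplus> u') \<boxplus> u'') \<cdot> ?l)"
    using assms ob by (simp add: interchange')
  also have "\<dots> = (u \<boxplus> (u' \<boxplus> u'')) \<cdot> (assoc P (z \<oplus> x) (z' \<oplus> x') (z'' \<oplus> x'') \<cdot> ?l)"
    using assms ob by (intro assoc_natural') simp_all
  also have "\<dots> = (u \<boxplus> (u' \<boxplus> u'')) \<cdot> ((Ide P (z \<oplus> x) \<boxplus> coas P z' z'' x' x'') \<cdot> ?r)"
    using assms ob by (simp only: assoc_coas_coas)
  also have "\<dots> = ((u \<boxplus> ((u' \<boxplus> u'') \<cdot> coas P z' z'' x' x'')) \<cdot> coas P z (z' \<oplus> z'') x (x' \<oplus> x''))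
       \<cdot> (assoc P z z' z'' \<boxplus> assoc P x x' x'')"
    using assms ob by (simp add: interchange')
  finally show ?thesis
    using assms ob by (simp add: tri_mor_def tri_sum_def)
qed

text \<open>\<open>coas\<close> is composed of associators, their inverses, symmetries and
  identities, and each of these is a morphism between the corresponding sums of triangles.\<close>

lemma tri_mor_coas:
  assumes "z1 \<in> Obj P" "x1 \<in> Obj P" "u1 \<in> Arr P" "Dom P u1 = z1 \<oplus> x1" "Cod P u1 = y1"
    "z2 \<in> Obj P" "x2 \<in> Obj P" "u2 \<in> Arr P" "Dom P u2 = z2 \<oplus> x2" "Cod P u2 = y2"
    "z3 \<in> Obj P" "x3 \<in> Obj P" "u3 \<in> Arr P" "Dom P u3 = z3 \<oplus> x3" "Cod P u3 = y3"
    "z4 \<in> Obj P" "x4 \<in> Obj P" "u4 \<in> Arr P" "Dom P u4 = z4 \<oplus> x4" "Cod P u4 = y4"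
  shows "tri_mor ((z1 \<oplus> z2) \<oplus> (z3 \<oplus> z4)) ((x1 \<oplus> x2) \<oplus> (x3 \<oplus> x4))
      (tri_sum (z1 \<oplus> z2) (x1 \<oplus> x2) (tri_sum z1 x1 u1 z2 x2 u2) (z3 \<oplus> z4) (x3 \<oplus> x4) (tri_sum z3 x3 u3 z4 x4 u4))
      ((z1 \<oplus> z3) \<oplus> (z2 \<oplus> z4)) ((x1 \<oplus> x3) \<oplus> (x2 \<oplus> x4))
      (tri_sum (z1 \<oplus> z3) (x1 \<oplus> x3) (tri_sum z1 x1 u1 z3 x3 u3) (z2 \<oplus> z4) (x2 \<oplus> x4) (tri_sum z2 x2 u2 z4 x4 u4))
      (coas P z1 z2 z3 z4) (coas P x1 x2 x3 x4) (coas P y1 y2 y3 y4)"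
  unfolding coas_def
  by (intro tri_mor_Cmp[OF tri_mor_Cmp[OF tri_mor_Cmp[OF tri_mor_Cmp[OF
        tri_mor_assoc tri_mor_sum[OF tri_mor_Ide tri_mor_inv[OF tri_mor_assoc]]]
        tri_mor_sum[OF tri_mor_Ide tri_mor_sum[OF tri_mor_symm tri_mor_Ide]]]
        tri_mor_sum[OF tri_mor_Ide tri_mor_assoc]] tri_mor_inv[OF tri_mor_assoc]])
    (use assms in simp_all)

text \<open>The previous lemma with identities
  \<open>z \<oplus> x \<rightarrow> z \<oplus> x\<close> as triangles: its commuting square is this
  equation for eight objects, obtained without listing exchanges.\<close>

lemma coas_coas_coas:
  assumes "z1 \<in> Obj P" "x1 \<in> Obj P" "z2 \<in> Obj P" "x2 \<in> Obj P"
    "z3 \<in> Obj P" "x3 \<in> Obj P" "z4 \<in> Obj P" "x4 \<in> Obj P"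
  shows "coas P (z1 \<oplus> x1) (z2 \<oplus> x2) (z3 \<oplus> x3) (z4 \<oplus> x4)
      \<cdot> ((coas P z1 z2 x1 x2 \<boxplus> coas P z3 z4 x3 x4) \<cdot> coas P (z1 \<oplus> z2) (z3 \<oplus> z4) (x1 \<oplus> x2) (x3 \<oplus> x4))
    = (coas P z1 z3 x1 x3 \<boxplus> coas P z2 z4 x2 x4)
      \<cdot> (coas P (z1 \<oplus> z3) (z2 \<oplus> z4) (x1 \<oplus> x3) (x2 \<oplus> x4) \<cdot> (coas P z1 z2 z3 z4 \<boxplus> coas P x1 x2 x3 x4))"
proof -
  have "Ide P (z \<oplus> x) \<in> Arr P" "Dom P (Ide P (z \<oplus> x)) = z \<oplus> x" "Cod P (Ide P (z \<oplus> x)) = z \<oplus> x"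
    if "z \<in> Obj P" "x \<in> Obj P" for z x
    using that by simp_all
  note I = this
  show ?thesis
    using tri_mor_coas[OF assms(1,2) I[OF assms(1,2)] assms(3,4) I[OF assms(3,4)]
       assms(5,6) I[OF assms(5,6)] assms(7,8) I[OF assms(7,8)]] assms
    by (simp add: tri_mor_def tri_sum_def)
qed

end

section \<open>Sketches and their models\<close>

text \<open>
  A sketch is a category with abstract triangles and the relations to be imposed on additivity
  data.  Triangulated categories, Picard groupoids and their families are all sketches: determinant
  functors, symmetric monoidal functors without unit constraint, multi-determinant functors and
  multiexact functors are their models.
\<close>

record ('o, 'm, 't) sketch = "('o, 'm) cat" +
  Tr :: "'t set"
  pX :: "'t \<Rightarrow> 'o"
  pY :: "'t \<Rightarrow> 'o"
  pZ :: "'t \<Rightarrow> 'o"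
  NatR :: "'t \<Rightarrow> 't \<Rightarrow> 'm \<Rightarrow> 'm \<Rightarrow> 'm \<Rightarrow> bool"
  ComR :: "'t \<Rightarrow> 't \<Rightarrow> 'm \<Rightarrow> bool"
  AssR :: "'t \<Rightarrow> 't \<Rightarrow> 't \<Rightarrow> 't \<Rightarrow> 'm \<Rightarrow> bool"
  TwoR :: "'t \<Rightarrow> 't \<Rightarrow> 't \<Rightarrow> 't \<Rightarrow> 't \<Rightarrow> 't \<Rightarrow> bool"

text \<open>The last argument of \<open>ComR\<close> and \<open>AssR\<close> compares middle
  vertices that need not be equal: it is a symmetry or an associator in a Picard groupoid and an
  identity in a triangulated category. \<open>NatR_Ide\<close> is what later makes an arrow of one
  variable compatible with a triangle of the other.\<close>

locale sketch = category S
  for S :: "('o, 'm, 't) sketch" (structure) +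
  assumes Tr_Obj [simp]: "d \<in> Tr S \<Longrightarrow> pX S d \<in> Obj S" "d \<in> Tr S \<Longrightarrow> pY S d \<in> Obj S" "d \<in> Tr S \<Longrightarrow> pZ S d \<in> Obj S"
    and NatR_in: "NatR S d d' f g h \<Longrightarrow> d \<in> Tr S \<and> d' \<in> Tr S \<and> f \<in> Hom S (pX S d) (pX S d')
      \<and> g \<in> Hom S (pY S d) (pY S d') \<and> h \<in> Hom S (pZ S d) (pZ S d')"
    and NatR_Ide: "d \<in> Tr S \<Longrightarrow> NatR S d d (Ide S (pX S d)) (Ide S (pY S d)) (Ide S (pZ S d))"
    and ComR_in: "ComR S d d' g \<Longrightarrow> d \<in> Tr S \<and> d' \<in> Tr S \<and> pZ S d' = pX S d \<and> pX S d' = pZ S d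
      \<and> g \<in> Hom S (pY S d') (pY S d)"
    and AssR_in: "AssR S d1 d2 d3 d4 g \<Longrightarrow> {d1, d2, d3, d4} \<subseteq> Tr S \<and> pX S d2 = pX S d1 \<and> pX S d3 = pY S d1
      \<and> pX S d4 = pZ S d1 \<and> pY S d4 = pZ S d2 \<and> pZ S d4 = pZ S d3 \<and> g \<in> Hom S (pY S d2) (pY S d3)"
    and TwoR_in: "TwoR S az ax ay bz bx by \<Longrightarrow> {az, ax, ay, bz, bx, by} \<subseteq> Tr S
      \<and> pY S az = pZ S by \<and> pY S ax = pX S by \<and> pY S bz = pZ S ay \<and> pY S bx = pX S ay
      \<and> pZ S bz = pZ S az \<and> pX S bz = pZ S ax \<and> pZ S bx = pX S az \<and> pX S bx = pX S ax
      \<and> pY S ay = pY S by"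

record ('o, 'm, 't, 'p, 'q) model = "('o, 'm, 'p, 'q) funct" +
  fadd :: "'t \<Rightarrow> 'q"

context picard_groupoid
begin

definition is_model :: "('a, 'b, 't) sketch \<Rightarrow> ('a, 'b, 't, 'o, 'm) model \<Rightarrow> bool" where
  "is_model S F \<longleftrightarrow> is_functor S P F \<and>
     (\<forall>d\<in>Tr S. fadd F d \<in> Hom P (onObj F (pZ S d) \<oplus> onObj F (pX S d)) (onObj F (pY S d))) \<and>
     (\<forall>d d' f g h. NatR S d d' f g h \<longrightarrow> fadd F d' \<cdot> (onArr F h \<boxplus> onArr F f) = onArr F g \<cdot> fadd F d) \<and>
     (\<forall>d d' g. ComR S d d' g \<longrightarrow>
        onArr F g \<cdot> fadd F d' = fadd F d \<cdot> symm P (onObj F (pZ S d')) (onObj F (pX S d'))) \<and>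
     (\<forall>d1 d2 d3 d4 g. AssR S d1 d2 d3 d4 g \<longrightarrow>
        onArr F g \<cdot> (fadd F d2 \<cdot> (fadd F d4 \<boxplus> Ide P (onObj F (pX S d1))))
        = fadd F d3 \<cdot> ((Ide P (onObj F (pZ S d3)) \<boxplus> fadd F d1)
           \<cdot> assoc P (onObj F (pZ S d3)) (onObj F (pZ S d1)) (onObj F (pX S d1)))) \<and>
     (\<forall>az ax ay bz bx by. TwoR S az ax ay bz bx by \<longrightarrow>
        fadd F by \<cdot> (fadd F az \<boxplus> fadd F ax)
        = fadd F ay \<cdot> ((fadd F bz \<boxplus> fadd F bx)
           \<cdot> coas P (onObj F (pZ S az)) (onObj F (pX S az)) (onObj F (pZ S ax)) (onObj F (pX S ax))))"

text \<open>Typing without relations, so that a candidate can be compared with a model before it is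
  known to be one.\<close>

definition is_data :: "('a, 'b, 't) sketch \<Rightarrow> ('a, 'b, 't, 'o, 'm) model \<Rightarrow> bool" where
  "is_data S F \<longleftrightarrow> (\<forall>a\<in>Obj S. onObj F a \<in> Obj P) \<and>
     (\<forall>f\<in>Arr S. onArr F f \<in> Hom P (onObj F (Dom S f)) (onObj F (Cod S f))) \<and>
     (\<forall>d\<in>Tr S. fadd F d \<in> Hom P (onObj F (pZ S d) \<oplus> onObj F (pX S d)) (onObj F (pY S d)))"

lemma model_data: "is_model S F \<Longrightarrow> is_data S F"
  by (auto simp: is_model_def is_data_def is_functor_def)

lemma data_simps:
  assumes "is_data S F"
  shows "a \<in> Obj S \<Longrightarrow> onObj F a \<in> Obj P"
    "f \<in> Arr S \<Longrightarrow> onArr F f \<in> Arr P"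
    "f \<in> Arr S \<Longrightarrow> Dom P (onArr F f) = onObj F (Dom S f)"
    "f \<in> Arr S \<Longrightarrow> Cod P (onArr F f) = onObj F (Cod S f)"
    "d \<in> Tr S \<Longrightarrow> fadd F d \<in> Arr P"
    "d \<in> Tr S \<Longrightarrow> Dom P (fadd F d) = onObj F (pZ S d) \<oplus> onObj F (pX S d)"
    "d \<in> Tr S \<Longrightarrow> Cod P (fadd F d) = onObj F (pY S d)"
  using assms by (auto simp: is_data_def)

lemmas model_simps = data_simps[OF model_data]

lemma model_Ide: "\<lbrakk>is_model S F; a \<in> Obj S\<rbrakk> \<Longrightarrow> onArr F (Ide S a) = Ide P (onObj F a)"
  by (auto simp: is_model_def is_functor_def)

lemma model_Cmp:
  "\<lbrakk>is_model S F; f \<in> Arr S; g \<in> Arr S; Dom S g = Cod S f\<rbrakk> \<Longrightarrow> onArr F (g \<cdot>\<^bsub>S\<^esub> f) = onArr F g \<cdot> onArr F f"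
  by (auto simp: is_model_def is_functor_def)

lemma model_nat: "\<lbrakk>is_model S F; NatR S d d' f g h\<rbrakk> \<Longrightarrow> fadd F d' \<cdot> (onArr F h \<boxplus> onArr F f) = onArr F g \<cdot> fadd F d"
  by (simp add: is_model_def)

lemma model_com: "\<lbrakk>is_model S F; ComR S d d' g\<rbrakk> \<Longrightarrow>
    onArr F g \<cdot> fadd F d' = fadd F d \<cdot> symm P (onObj F (pZ S d')) (onObj F (pX S d'))"
  by (simp add: is_model_def)

lemma model_ass: "\<lbrakk>is_model S F; AssR S d1 d2 d3 d4 g\<rbrakk> \<Longrightarrow>
    onArr F g \<cdot> (fadd F d2 \<cdot> (fadd F d4 \<boxplus> Ide P (onObj F (pX S d1))))
    = fadd F d3 \<cdot> ((Ide P (onObj F (pZ S d3)) \<boxplus> fadd F d1)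
       \<cdot> assoc P (onObj F (pZ S d3)) (onObj F (pZ S d1)) (onObj F (pX S d1)))"
  by (simp add: is_model_def)

lemma model_two: "\<lbrakk>is_model S F; TwoR S az ax ay bz bx by\<rbrakk> \<Longrightarrow>
    fadd F by \<cdot> (fadd F az \<boxplus> fadd F ax)
    = fadd F ay \<cdot> ((fadd F bz \<boxplus> fadd F bx)
       \<cdot> coas P (onObj F (pZ S az)) (onObj F (pX S az)) (onObj F (pZ S ax)) (onObj F (pX S ax)))"
  by (simp add: is_model_def)

lemma is_modelI:
  assumes "is_data S F" "category S"
    and "\<And>a. a \<in> Obj S \<Longrightarrow> onArr F (Ide S a) = Ide P (onObj F a)"
    and "\<And>f g. \<lbrakk>f \<in> Arr S; g \<in> Arr S; Dom S g = Cod S f\<rbrakk> \<Longrightarrow> onArr F (g \<cdot>\<^bsub>S\<^esub> f) = onArr F g \<cdot> onArr F f"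
    and "\<And>d d' f g h. NatR S d d' f g h \<Longrightarrow> fadd F d' \<cdot> (onArr F h \<boxplus> onArr F f) = onArr F g \<cdot> fadd F d"
    and "\<And>d d' g. ComR S d d' g \<Longrightarrow>
      onArr F g \<cdot> fadd F d' = fadd F d \<cdot> symm P (onObj F (pZ S d')) (onObj F (pX S d'))"
    and "\<And>d1 d2 d3 d4 g. AssR S d1 d2 d3 d4 g \<Longrightarrow>
      onArr F g \<cdot> (fadd F d2 \<cdot> (fadd F d4 \<boxplus> Ide P (onObj F (pX S d1))))
      = fadd F d3 \<cdot> ((Ide P (onObj F (pZ S d3)) \<boxplus> fadd F d1)
         \<cdot> assoc P (onObj F (pZ S d3)) (onObj F (pZ S d1)) (onObj F (pX S d1)))"
    and "\<And>az ax ay bz bx by. TwoR S az ax ay bz bx by \<Longrightarrow>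
      fadd F by \<cdot> (fadd F az \<boxplus> fadd F ax)
      = fadd F ay \<cdot> ((fadd F bz \<boxplus> fadd F bx)
         \<cdot> coas P (onObj F (pZ S az)) (onObj F (pX S az)) (onObj F (pZ S ax)) (onObj F (pX S ax)))"
  shows "is_model S F"
  using assms unfolding is_model_def is_functor_def is_data_def by auto

subsection \<open>Commutative squares\<close>

text \<open>\<open>f\<close> and \<open>g\<close> are the two rows; \<open>p\<close> connects their
  sources and \<open>q\<close> their targets.\<close>

definition sq :: "'m \<Rightarrow> 'm \<Rightarrow> 'm \<Rightarrow> 'm \<Rightarrow> bool" where
  "sq p f g q \<longleftrightarrow> p \<in> Arr P \<and> f \<in> Hom P (Dom P p) (Dom P q) \<and> g \<in> Hom P (Cod P p) (Cod P q) \<and> q \<in> Arr P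
     \<and> q \<cdot> f = g \<cdot> p"

lemma sq_Cmp:
  assumes "sq p f g q" "sq q f' g' r"
  shows "sq p (f' \<cdot> f) (g' \<cdot> g) r"
proof -
  have "r \<cdot> (f' \<cdot> f) = (r \<cdot> f') \<cdot> f"
    using assms by (intro Cmp_assoc'[symmetric]) (auto simp: sq_def)
  also have "\<dots> = (g' \<cdot> q) \<cdot> f"
    using assms by (simp add: sq_def)
  also have "\<dots> = g' \<cdot> (q \<cdot> f)"
    using assms by (intro Cmp_assoc') (auto simp: sq_def)
  also have "\<dots> = g' \<cdot> (g \<cdot> p)"
    using assms by (simp add: sq_def)
  finally show ?thesis
    using assms by (auto simp: sq_def)
qed

lemma sq_tensA:
  assumes "sq p f g q" "sq p' f' g' q'"
  shows "sq (p \<boxplus> p') (f \<boxplus> f') (g \<boxplus> g') (q \<boxplus> q')"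
  using assms by (auto simp: sq_def interchange)

lemma sq_Ide: "\<lbrakk>p \<in> Arr P; Dom P p = a; Cod P p = b\<rbrakk> \<Longrightarrow> sq p (Ide P a) (Ide P b) p"
  by (auto simp: sq_def)

lemma sq_assoc:
  assumes "p \<in> Arr P" "q \<in> Arr P" "r \<in> Arr P" "Dom P p = a" "Dom P q = b" "Dom P r = c"
    "Cod P p = a'" "Cod P q = b'" "Cod P r = c'"
  shows "sq ((p \<boxplus> q) \<boxplus> r) (assoc P a b c) (assoc P a' b' c') (p \<boxplus> (q \<boxplus> r))"
  using assms assoc_natural[OF assms(1-3) assms(7-9) assms(4-6)] by (auto simp: sq_def)

lemma sq_symm:
  assumes "p \<in> Arr P" "q \<in> Arr P" "Dom P p = a" "Dom P q = b" "Cod P p = a'" "Cod P q = b'"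
  shows "sq (p \<boxplus> q) (symm P a b) (symm P a' b') (q \<boxplus> p)"
  using assms symm_natural[OF assms(1,2,5,6,3,4)] by (auto simp: sq_def)

lemma sq_coas:
  assumes "p \<in> Arr P" "q \<in> Arr P" "r \<in> Arr P" "s \<in> Arr P" "Dom P p = a" "Dom P q = b" "Dom P r = c" "Dom P s = d"
    "Cod P p = a'" "Cod P q = b'" "Cod P r = c'" "Cod P s = d'"
  shows "sq ((p \<boxplus> q) \<boxplus> (r \<boxplus> s)) (coas P a b c d) (coas P a' b' c' d') ((p \<boxplus> r) \<boxplus> (q \<boxplus> s))"
proof -
  have "a \<in> Obj P" "b \<in> Obj P" "c \<in> Obj P" "d \<in> Obj P" "a' \<in> Obj P" "b' \<in> Obj P" "c' \<in> Obj P" "d' \<in> Obj P"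
    using assms by auto
  then show ?thesis
    using assms coas_natural[OF assms] by (simp add: sq_def)
qed

text \<open>The legs are invertible, so one row determines the other. Hence an equation between
  composites passes from a model to data connected with it.\<close>

lemma sq_left_unique:
  assumes "sq p f g q" "sq p f' g q"
  shows "f = f'"
proof -
  have "q \<cdot> f = q \<cdot> f'" using assms by (simp add: sq_def)
  then show ?thesis by (rule Cmp_cancel_left) (use assms in \<open>auto simp: sq_def\<close>)
qed

subsection \<open>Morphisms of models\<close>

text \<open>Values outside \<open>Obj S\<close> are left free, unlike in \<open>nat_trans\<close>;
  uniqueness of a morphism of models is accordingly always stated on the objects.\<close>

definition mmor :: "('a, 'b, 't) sketch \<Rightarrow> ('a, 'b, 't, 'o, 'm) model \<Rightarrow> ('a, 'b, 't, 'o, 'm) model \<Rightarrow> ('a \<Rightarrow> 'm) \<Rightarrow> bool" where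
  "mmor S F G \<theta> \<longleftrightarrow> (\<forall>a\<in>Obj S. \<theta> a \<in> Hom P (onObj F a) (onObj G a)) \<and>
     (\<forall>f\<in>Arr S. sq (\<theta> (Dom S f)) (onArr F f) (onArr G f) (\<theta> (Cod S f))) \<and>
     (\<forall>d\<in>Tr S. sq (\<theta> (pZ S d) \<boxplus> \<theta> (pX S d)) (fadd F d) (fadd G d) (\<theta> (pY S d)))"

lemma mmorD:
  assumes "mmor S F G \<theta>"
  shows "a \<in> Obj S \<Longrightarrow> \<theta> a \<in> Arr P" "a \<in> Obj S \<Longrightarrow> Dom P (\<theta> a) = onObj F a"
    "a \<in> Obj S \<Longrightarrow> Cod P (\<theta> a) = onObj G a"
    "f \<in> Arr S \<Longrightarrow> sq (\<theta> (Dom S f)) (onArr F f) (onArr G f) (\<theta> (Cod S f))"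
    "d \<in> Tr S \<Longrightarrow> sq (\<theta> (pZ S d) \<boxplus> \<theta> (pX S d)) (fadd F d) (fadd G d) (\<theta> (pY S d))"
  using assms by (auto simp: mmor_def)

lemma mmor_cong:
  assumes "mmor S F G \<theta>" "\<And>a. a \<in> Obj S \<Longrightarrow> \<theta>' a = \<theta> a" "sketch S"
  shows "mmor S F G \<theta>'"
proof -
  interpret S: sketch S by fact
  show ?thesis using assms(1,2) by (simp add: mmor_def)
qed

text \<open>Since all arrows of \<open>P\<close> are invertible, data connected to a model form a model.\<close>

lemma model_transport:
  assumes "is_model S F" "is_data S G" "mmor S G F \<theta>" "sketch S"
  shows "is_model S G"
proof -
  interpret S: sketch S by fact
  note D = mmorD[OF assms(3)] and G = data_simps[OF assms(2)] and F = model_simps[OF assms(1)]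
  have sqA: "sq (\<theta> a) (onArr G f) (onArr F f) (\<theta> b)" if "f \<in> Hom S a b" for f a b
    using D(4)[of f] that by simp
  have sqT: "sq (\<theta> z \<boxplus> \<theta> x) (fadd G d) (fadd F d) (\<theta> y)" if "d \<in> Tr S" "pZ S d = z" "pX S d = x" "pY S d = y" for d x y z
    using D(5)[of d] that by simp
  have sqI: "sq (\<theta> a) (Ide P (onObj G a)) (Ide P (onObj F a)) (\<theta> a)" if "a \<in> Obj S" for a
    using D(1-3)[OF that] by (intro sq_Ide)
  show ?thesis
  proof (rule is_modelI[OF assms(2) S.category_axioms])
    fix a assume a: "a \<in> Obj S"
    show "onArr G (Ide S a) = Ide P (onObj G a)"
      by (rule sq_left_unique[OF sqA sqI[OF a, folded model_Ide[OF assms(1) a]]]) (use a in auto)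
  next
    fix f g assume fg: "f \<in> Arr S" "g \<in> Arr S" "Dom S g = Cod S f"
    have 1: "sq (\<theta> (Dom S f)) (onArr G (g \<cdot>\<^bsub>S\<^esub> f)) (onArr F (g \<cdot>\<^bsub>S\<^esub> f)) (\<theta> (Cod S g))"
      using fg by (intro sqA) auto
    have 2: "sq (\<theta> (Dom S f)) (onArr G g \<cdot> onArr G f) (onArr F g \<cdot> onArr F f) (\<theta> (Cod S g))"
      using fg by (intro sq_Cmp[OF sqA sqA]) auto
    show "onArr G (g \<cdot>\<^bsub>S\<^esub> f) = onArr G g \<cdot> onArr G f"
      using sq_left_unique[OF 1 2[folded model_Cmp[OF assms(1) fg]]] .
  next
    fix d d' f g h assume n: "NatR S d d' f g h"
    note t = S.NatR_in[OF n]
    have 1: "sq (\<theta> (pZ S d) \<boxplus> \<theta> (pX S d)) (fadd G d' \<cdot> (onArr G h \<boxplus> onArr G f)) (fadd F d' \<cdot> (onArr F h \<boxplus> onArr F f)) (\<theta> (pY S d'))"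
      using t by (intro sq_Cmp[OF sq_tensA sqT] sqA) auto
    have 2: "sq (\<theta> (pZ S d) \<boxplus> \<theta> (pX S d)) (onArr G g \<cdot> fadd G d) (onArr F g \<cdot> fadd F d) (\<theta> (pY S d'))"
      using t by (intro sq_Cmp[OF sqT sqA]) auto
    show "fadd G d' \<cdot> (onArr G h \<boxplus> onArr G f) = onArr G g \<cdot> fadd G d"
      using sq_left_unique[OF 1 2[folded model_nat[OF assms(1) n]]] .
  next
    fix d d' g assume c: "ComR S d d' g"
    note t = S.ComR_in[OF c]
    have 1: "sq (\<theta> (pZ S d') \<boxplus> \<theta> (pX S d')) (onArr G g \<cdot> fadd G d') (onArr F g \<cdot> fadd F d') (\<theta> (pY S d))"
      using t by (intro sq_Cmp[OF sqT sqA]) auto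
    have 2: "sq (\<theta> (pZ S d') \<boxplus> \<theta> (pX S d')) (fadd G d \<cdot> symm P (onObj G (pZ S d')) (onObj G (pX S d')))
        (fadd F d \<cdot> symm P (onObj F (pZ S d')) (onObj F (pX S d'))) (\<theta> (pY S d))"
      using t by (intro sq_Cmp[OF sq_symm sqT]) (auto simp: D(1-3))
    show "onArr G g \<cdot> fadd G d' = fadd G d \<cdot> symm P (onObj G (pZ S d')) (onObj G (pX S d'))"
      using sq_left_unique[OF 1 2[folded model_com[OF assms(1) c]]] .
  next
    fix d1 d2 d3 d4 g assume c: "AssR S d1 d2 d3 d4 g"
    note t = S.AssR_in[OF c]
    have 1: "sq ((\<theta> (pZ S d3) \<boxplus> \<theta> (pZ S d1)) \<boxplus> \<theta> (pX S d1))
       (onArr G g \<cdot> (fadd G d2 \<cdot> (fadd G d4 \<boxplus> Ide P (onObj G (pX S d1)))))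
       (onArr F g \<cdot> (fadd F d2 \<cdot> (fadd F d4 \<boxplus> Ide P (onObj F (pX S d1))))) (\<theta> (pY S d3))"
      using t by (intro sq_Cmp[OF sq_Cmp[OF sq_tensA[OF sqT sqI] sqT] sqA]) auto
    have 2: "sq ((\<theta> (pZ S d3) \<boxplus> \<theta> (pZ S d1)) \<boxplus> \<theta> (pX S d1))
       (fadd G d3 \<cdot> ((Ide P (onObj G (pZ S d3)) \<boxplus> fadd G d1) \<cdot> assoc P (onObj G (pZ S d3)) (onObj G (pZ S d1)) (onObj G (pX S d1))))
       (fadd F d3 \<cdot> ((Ide P (onObj F (pZ S d3)) \<boxplus> fadd F d1) \<cdot> assoc P (onObj F (pZ S d3)) (onObj F (pZ S d1)) (onObj F (pX S d1)))) (\<theta> (pY S d3))"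
      using t by (intro sq_Cmp[OF sq_Cmp[OF sq_assoc sq_tensA[OF sqI sqT]] sqT]) (auto simp: D(1-3))
    show "onArr G g \<cdot> (fadd G d2 \<cdot> (fadd G d4 \<boxplus> Ide P (onObj G (pX S d1))))
        = fadd G d3 \<cdot> ((Ide P (onObj G (pZ S d3)) \<boxplus> fadd G d1) \<cdot> assoc P (onObj G (pZ S d3)) (onObj G (pZ S d1)) (onObj G (pX S d1)))"
      using sq_left_unique[OF 1 2[folded model_ass[OF assms(1) c]]] .
  next
    fix az ax ay bz bx "by" assume c: "TwoR S az ax ay bz bx by"
    note t = S.TwoR_in[OF c]
    let ?p = "(\<theta> (pZ S az) \<boxplus> \<theta> (pX S az)) \<boxplus> (\<theta> (pZ S ax) \<boxplus> \<theta> (pX S ax))"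
    have 1: "sq ?p (fadd G by \<cdot> (fadd G az \<boxplus> fadd G ax)) (fadd F by \<cdot> (fadd F az \<boxplus> fadd F ax)) (\<theta> (pY S by))"
      using t by (intro sq_Cmp[OF sq_tensA[OF sqT sqT] sqT]) auto
    have 2: "sq ?p (fadd G ay \<cdot> ((fadd G bz \<boxplus> fadd G bx) \<cdot> coas P (onObj G (pZ S az)) (onObj G (pX S az)) (onObj G (pZ S ax)) (onObj G (pX S ax))))
      (fadd F ay \<cdot> ((fadd F bz \<boxplus> fadd F bx) \<cdot> coas P (onObj F (pZ S az)) (onObj F (pX S az)) (onObj F (pZ S ax)) (onObj F (pX S ax)))) (\<theta> (pY S by))"
      using t by (intro sq_Cmp[OF sq_Cmp[OF sq_coas sq_tensA[OF sqT sqT]] sqT]) (auto simp: D(1-3))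
    show "fadd G by \<cdot> (fadd G az \<boxplus> fadd G ax)
      = fadd G ay \<cdot> ((fadd G bz \<boxplus> fadd G bx) \<cdot> coas P (onObj G (pZ S az)) (onObj G (pX S az)) (onObj G (pZ S ax)) (onObj G (pX S ax)))"
      using sq_left_unique[OF 1 2[folded model_two[OF assms(1) c]]] .
  qed
qed

end

section \<open>The groupoid of models of a sketch\<close>

context picard_groupoid
begin

lemma sq_vert:
  assumes "sq p f g q" "sq p' g h q'"
  shows "sq (p' \<cdot> p) f h (q' \<cdot> q)"
proof -
  have "(q' \<cdot> q) \<cdot> f = q' \<cdot> (g \<cdot> p)"
    using assms by (simp add: sq_def)
  also have "\<dots> = (q' \<cdot> g) \<cdot> p"
    using assms by (intro Cmp_assoc'[symmetric]) (auto simp: sq_def)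
  also have "\<dots> = (h \<cdot> p') \<cdot> p"
    using assms by (simp add: sq_def)
  also have "\<dots> = h \<cdot> (p' \<cdot> p)"
    using assms by (intro Cmp_assoc') (auto simp: sq_def)
  finally show ?thesis
    using assms by (auto simp: sq_def)
qed

lemma sq_inv:
  assumes "sq p f g q"
  shows "sq (inv_arr P p) g f (inv_arr P q)"
proof -
  have t: "p \<in> Arr P" "q \<in> Arr P" "f \<in> Arr P" "Dom P f = Dom P p" "Cod P f = Dom P q" and eq: "g \<cdot> p = q \<cdot> f"
    using assms by (auto simp: sq_def)
  have "inv_arr P q \<cdot> g = inv_arr P q \<cdot> ((g \<cdot> p) \<cdot> inv_arr P p)"
    using assms by (simp add: sq_def)
  also have "\<dots> = f \<cdot> inv_arr P p"
    unfolding eq using t by simp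
  finally show ?thesis
    using assms by (simp add: sq_def)
qed

lemma mmor_Ide:
  assumes "is_data S F" "sketch S"
  shows "mmor S F F (\<lambda>a. Ide P (onObj F a))"
proof -
  interpret S: sketch S by fact
  show ?thesis
    using data_simps[OF assms(1)] by (auto simp: mmor_def sq_def)
qed

lemma mmor_Cmp:
  assumes "mmor S F G \<theta>" "mmor S G H \<eta>" "sketch S"
  shows "mmor S F H (\<lambda>a. \<eta> a \<cdot> \<theta> a)"
proof -
  interpret S: sketch S by fact
  note \<theta> = mmorD[OF assms(1)] and \<eta> = mmorD[OF assms(2)]
  show ?thesis
    unfolding mmor_def
  proof (intro conjI ballI)
    show "\<eta> a \<cdot> \<theta> a \<in> Hom P (onObj F a) (onObj H a)" if "a \<in> Obj S" for a
      using that \<theta>(1-3) \<eta>(1-3) by simp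
    show "sq (\<eta> (Dom S f) \<cdot> \<theta> (Dom S f)) (onArr F f) (onArr H f) (\<eta> (Cod S f) \<cdot> \<theta> (Cod S f))" if "f \<in> Arr S" for f
      using sq_vert[OF \<theta>(4) \<eta>(4)] that by simp
    show "sq ((\<eta> (pZ S d) \<cdot> \<theta> (pZ S d)) \<boxplus> (\<eta> (pX S d) \<cdot> \<theta> (pX S d))) (fadd F d) (fadd H d) (\<eta> (pY S d) \<cdot> \<theta> (pY S d))"
      if "d \<in> Tr S" for d
      using sq_vert[OF \<theta>(5) \<eta>(5), of d] that \<theta>(1-3) \<eta>(1-3) by (simp add: interchange)
  qed
qed

lemma mmor_inv:
  assumes "mmor S F G \<theta>" "sketch S"
  shows "mmor S G F (\<lambda>a. inv_arr P (\<theta> a))"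
proof -
  interpret S: sketch S by fact
  note \<theta> = mmorD[OF assms(1)]
  show ?thesis
    unfolding mmor_def
  proof (intro conjI ballI)
    show "inv_arr P (\<theta> a) \<in> Hom P (onObj G a) (onObj F a)" if "a \<in> Obj S" for a
      using that \<theta>(1-3) by simp
    show "sq (inv_arr P (\<theta> (Dom S f))) (onArr G f) (onArr F f) (inv_arr P (\<theta> (Cod S f)))" if "f \<in> Arr S" for f
      using sq_inv[OF \<theta>(4)] that by simp
    show "sq (inv_arr P (\<theta> (pZ S d)) \<boxplus> inv_arr P (\<theta> (pX S d))) (fadd G d) (fadd F d) (inv_arr P (\<theta> (pY S d)))"
      if "d \<in> Tr S" for d
      using sq_inv[OF \<theta>(5), of d] that \<theta>(1-3) by simp
  qed
qed

text \<open>Equality of records would also compare values outside the carriers.\<close>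

definition agree :: "('a, 'b, 't) sketch \<Rightarrow> ('a, 'b, 't, 'o, 'm) model \<Rightarrow> ('a, 'b, 't, 'o, 'm) model \<Rightarrow> bool" where
  "agree S F G \<longleftrightarrow> (\<forall>a\<in>Obj S. onObj F a = onObj G a) \<and> (\<forall>f\<in>Arr S. onArr F f = onArr G f)
     \<and> (\<forall>d\<in>Tr S. fadd F d = fadd G d)"

lemma agree_refl [simp]: "agree S F F"
  by (simp add: agree_def)

lemma mmor_agree:
  assumes "mmor S F G \<theta>" "agree S F F'" "agree S G G'"
  shows "mmor S F' G' \<theta>"
  using assms by (auto simp: agree_def mmor_def)

lemma model_agree:
  assumes "is_model S F" "agree S F G" "sketch S"
  shows "is_model S G"
proof -
  interpret S: sketch S by fact
  have d: "is_data S G"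
    using model_data[OF assms(1)] assms(2) by (simp add: agree_def is_data_def)
  show ?thesis
    by (rule model_transport[OF assms(1) d mmor_agree[OF mmor_Ide[OF d assms(3)]] assms(3)])
      (use assms(2) in \<open>auto simp: agree_def\<close>)
qed

subsection \<open>The pointwise sum of two models\<close>

definition msum :: "('a, 'b, 't) sketch \<Rightarrow> ('a, 'b, 't, 'o, 'm) model \<Rightarrow> ('a, 'b, 't, 'o, 'm) model \<Rightarrow> ('a, 'b, 't, 'o, 'm) model" where
  "msum S F G = \<lparr>onObj = (\<lambda>a. onObj F a \<oplus> onObj G a), onArr = (\<lambda>f. onArr F f \<boxplus> onArr G f),
     fadd = (\<lambda>d. tri_sum (onObj F (pZ S d)) (onObj F (pX S d)) (fadd F d)
       (onObj G (pZ S d)) (onObj G (pX S d)) (fadd G d))\<rparr>"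

lemma msum_sel [simp]:
  "onObj (msum S F G) a = onObj F a \<oplus> onObj G a" "onArr (msum S F G) f = onArr F f \<boxplus> onArr G f"
  "fadd (msum S F G) d = tri_sum (onObj F (pZ S d)) (onObj F (pX S d)) (fadd F d)
       (onObj G (pZ S d)) (onObj G (pX S d)) (fadd G d)"
  by (simp_all add: msum_def)

lemma data_msum:
  assumes "is_data S F" "is_data S G" "sketch S"
  shows "is_data S (msum S F G)"
proof -
  interpret S: sketch S by fact
  show ?thesis
    using data_simps[OF assms(1)] data_simps[OF assms(2)] by (auto simp: is_data_def)
qed

text \<open>Each relation splits into the relations for \<open>F\<close> and for \<open>G\<close>
  once \<open>coas\<close> is moved across. This uses \<open>coas_natural\<close> for naturality and
  \<open>symm_coas\<close>, \<open>assoc_coas\<close> and \<open>coas_coas_coas\<close> for the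
  other three.\<close>

lemma model_msum:
  assumes "is_model S F" "is_model S G" "sketch S"
  shows "is_model S (msum S F G)"
proof -
  interpret S: sketch S by fact
  note F = model_simps[OF assms(1)] and G = model_simps[OF assms(2)]
  show ?thesis
  proof (rule is_modelI[OF data_msum[OF model_data[OF assms(1)] model_data[OF assms(2)] assms(3)] S.category_axioms])
    show "onArr (msum S F G) (Ide S a) = Ide P (onObj (msum S F G) a)" if "a \<in> Obj S" for a
      using that F G by (simp add: model_Ide[OF assms(1)] model_Ide[OF assms(2)])
    show "onArr (msum S F G) (g \<cdot>\<^bsub>S\<^esub> f) = onArr (msum S F G) g \<cdot> onArr (msum S F G) f"
      if "f \<in> Arr S" "g \<in> Arr S" "Dom S g = Cod S f" for f g
      using that F G by (simp add: model_Cmp[OF assms(1)] model_Cmp[OF assms(2)] interchange)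
  next
    fix d d' f g h assume n: "NatR S d d' f g h"
    show "fadd (msum S F G) d' \<cdot> (onArr (msum S F G) h \<boxplus> onArr (msum S F G) f) = onArr (msum S F G) g \<cdot> fadd (msum S F G) d"
      using S.NatR_in[OF n] F G
      by (simp add: tri_sum_def coas_natural interchange' model_nat[OF assms(1) n] model_nat[OF assms(2) n])
  next
    fix d d' g assume c: "ComR S d d' g"
    note t = S.ComR_in[OF c]
    let ?s = "\<lambda>F. symm P (onObj F (pZ S d')) (onObj F (pX S d'))"
    have "onArr (msum S F G) g \<cdot> fadd (msum S F G) d' = ((onArr F g \<cdot> fadd F d') \<boxplus> (onArr G g \<cdot> fadd G d'))
       \<cdot> coas P (onObj F (pZ S d')) (onObj G (pZ S d')) (onObj F (pX S d')) (onObj G (pX S d'))"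
      using t F G by (simp add: tri_sum_def interchange')
    also have "\<dots> = (fadd F d \<boxplus> fadd G d) \<cdot> ((?s F \<boxplus> ?s G)
       \<cdot> coas P (onObj F (pZ S d')) (onObj G (pZ S d')) (onObj F (pX S d')) (onObj G (pX S d')))"
      unfolding model_com[OF assms(1) c] model_com[OF assms(2) c] using t F G by (simp add: interchange')
    also have "\<dots> = fadd (msum S F G) d \<cdot> symm P (onObj (msum S F G) (pZ S d')) (onObj (msum S F G) (pX S d'))"
      using t F G by (simp add: tri_sum_def symm_coas[symmetric])
    finally show "onArr (msum S F G) g \<cdot> fadd (msum S F G) d' = \<dots>" .
  next
    fix d1 d2 d3 d4 g assume c: "AssR S d1 d2 d3 d4 g"
    note t = S.AssR_in[OF c]
    define a b x where "a = pZ S d3" and "b = pZ S d1" and "x = pX S d1"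
    have ob: "a \<in> Obj S" "b \<in> Obj S" "x \<in> Obj S"
      using t by (auto simp: a_def b_def x_def)
    let ?as = "\<lambda>F. assoc P (onObj F a) (onObj F b) (onObj F x)"
    let ?l = "coas P (onObj F a \<oplus> onObj F b) (onObj G a \<oplus> onObj G b) (onObj F x) (onObj G x)
       \<cdot> (coas P (onObj F a) (onObj G a) (onObj F b) (onObj G b) \<boxplus> Ide P (onObj F x \<oplus> onObj G x))"
    let ?r = "(Ide P (onObj F a \<oplus> onObj G a) \<boxplus> coas P (onObj F b) (onObj G b) (onObj F x) (onObj G x))
       \<cdot> assoc P (onObj F a \<oplus> onObj G a) (onObj F b \<oplus> onObj G b) (onObj F x \<oplus> onObj G x)"
    \<comment> \<open>The composite is rearranged into the sum of the composites for
      \<open>F\<close> and for \<open>G\<close>, preceded by a permutation \<open>?l\<close> of the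
      six summands.\<close>
    have "onArr (msum S F G) g \<cdot> (fadd (msum S F G) d2 \<cdot> (fadd (msum S F G) d4 \<boxplus> Ide P (onObj (msum S F G) (pX S d1))))
      = ((onArr F g \<cdot> (fadd F d2 \<cdot> (fadd F d4 \<boxplus> Ide P (onObj F x)))) \<boxplus> (onArr G g \<cdot> (fadd G d2 \<cdot> (fadd G d4 \<boxplus> Ide P (onObj G x))))) \<cdot> ?l"
    proof -
      have "fadd (msum S F G) d4 \<boxplus> Ide P (onObj (msum S F G) (pX S d1))
        = ((fadd F d4 \<boxplus> fadd G d4) \<boxplus> (Ide P (onObj F x) \<boxplus> Ide P (onObj G x)))
          \<cdot> (coas P (onObj F a) (onObj G a) (onObj F b) (onObj G b) \<boxplus> Ide P (onObj F x \<oplus> onObj G x))"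
        using t F G ob by (simp add: tri_sum_def interchange a_def b_def x_def)
      note e = this
      show ?thesis
        unfolding e using t F G ob
        by (simp add: tri_sum_def coas_natural' a_def b_def x_def del: tensA_Ide') (simp add: interchange')
    qed
    also have "\<dots> = ((fadd F d3 \<cdot> (Ide P (onObj F a) \<boxplus> fadd F d1)) \<boxplus> (fadd G d3 \<cdot> (Ide P (onObj G a) \<boxplus> fadd G d1)))
        \<cdot> ((?as F \<boxplus> ?as G) \<cdot> ?l)"
      unfolding x_def model_ass[OF assms(1) c] model_ass[OF assms(2) c]
      using t F G ob by (simp add: interchange' a_def b_def)
    also have "\<dots> = ((fadd F d3 \<cdot> (Ide P (onObj F a) \<boxplus> fadd F d1)) \<boxplus> (fadd G d3 \<cdot> (Ide P (onObj G a) \<boxplus> fadd G d1)))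
        \<cdot> (coas P (onObj F a) (onObj G a) (onObj F b \<oplus> onObj F x) (onObj G b \<oplus> onObj G x) \<cdot> ?r)"
      using F G ob by (simp only: assoc_coas)
    also have "\<dots> = fadd (msum S F G) d3 \<cdot> ((Ide P (onObj (msum S F G) a) \<boxplus> fadd (msum S F G) d1)
         \<cdot> assoc P (onObj (msum S F G) a) (onObj (msum S F G) b) (onObj (msum S F G) x))"
    proof -
      have "Ide P (onObj (msum S F G) a) \<boxplus> fadd (msum S F G) d1 = ((Ide P (onObj F a) \<boxplus> Ide P (onObj G a)) \<boxplus> (fadd F d1 \<boxplus> fadd G d1))
          \<cdot> (Ide P (onObj F a \<oplus> onObj G a) \<boxplus> coas P (onObj F b) (onObj G b) (onObj F x) (onObj G x))"
        using t F G ob by (simp add: tri_sum_def interchange a_def b_def x_def)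
      note e = this
      show ?thesis
        unfolding e using t F G ob
        by (simp add: tri_sum_def coas_natural' a_def b_def x_def del: tensA_Ide') (simp add: interchange')
    qed
    finally show "onArr (msum S F G) g \<cdot> (fadd (msum S F G) d2 \<cdot> (fadd (msum S F G) d4 \<boxplus> Ide P (onObj (msum S F G) (pX S d1))))
      = fadd (msum S F G) d3 \<cdot> ((Ide P (onObj (msum S F G) (pZ S d3)) \<boxplus> fadd (msum S F G) d1)
         \<cdot> assoc P (onObj (msum S F G) (pZ S d3)) (onObj (msum S F G) (pZ S d1)) (onObj (msum S F G) (pX S d1)))"
      by (simp only: a_def b_def x_def)
  next
    fix az ax ay bz bx "by" assume c: "TwoR S az ax ay bz bx by"
    note t = S.TwoR_in[OF c]
    define z1 z3 x1 x3 where "z1 = pZ S az" and "z3 = pX S az" and "x1 = pZ S ax" and "x3 = pX S ax"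
    have ob: "z1 \<in> Obj S" "z3 \<in> Obj S" "x1 \<in> Obj S" "x3 \<in> Obj S"
      using t by (auto simp: z1_def z3_def x1_def x3_def)
    let ?c = "\<lambda>F. coas P (onObj F z1) (onObj F z3) (onObj F x1) (onObj F x3)"
    let ?d = "\<lambda>a b. coas P (onObj F a) (onObj G a) (onObj F b) (onObj G b)"
    let ?K = "coas P (onObj F z1 \<oplus> onObj F z3) (onObj G z1 \<oplus> onObj G z3) (onObj F x1 \<oplus> onObj F x3) (onObj G x1 \<oplus> onObj G x3)"
    let ?L = "coas P (onObj F z1 \<oplus> onObj F x1) (onObj G z1 \<oplus> onObj G x1) (onObj F z3 \<oplus> onObj F x3) (onObj G z3 \<oplus> onObj G x3)"
    let ?M = "coas P (onObj F z1 \<oplus> onObj G z1) (onObj F z3 \<oplus> onObj G z3) (onObj F x1 \<oplus> onObj G x1) (onObj F x3 \<oplus> onObj G x3)"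
    \<comment> \<open>Both sides are the same permutation of eight summands, four values of
      \<open>F\<close> and four of \<open>G\<close>: on the left the two models are separated before
      the vertices are exchanged, on the right afterwards.\<close>
    have D5: "(?c F \<boxplus> ?c G) \<cdot> (?K \<cdot> (?d z1 z3 \<boxplus> ?d x1 x3)) = ?L \<cdot> ((?d z1 x1 \<boxplus> ?d z3 x3) \<cdot> ?M)"
      by (rule coas_coas_coas[symmetric]) (use F G ob in simp_all)
    have "fadd (msum S F G) by \<cdot> (fadd (msum S F G) az \<boxplus> fadd (msum S F G) ax)
      = (fadd F by \<boxplus> fadd G by) \<cdot> (coas P (onObj F (pY S az)) (onObj G (pY S az)) (onObj F (pY S ax)) (onObj G (pY S ax))
         \<cdot> (((fadd F az \<boxplus> fadd G az) \<boxplus> (fadd F ax \<boxplus> fadd G ax)) \<cdot> (?d z1 z3 \<boxplus> ?d x1 x3)))"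
      using t F G ob by (simp add: tri_sum_def interchange z1_def z3_def x1_def x3_def)
    also have "\<dots> = ((fadd F by \<cdot> (fadd F az \<boxplus> fadd F ax)) \<boxplus> (fadd G by \<cdot> (fadd G az \<boxplus> fadd G ax)))
         \<cdot> (?K \<cdot> (?d z1 z3 \<boxplus> ?d x1 x3))"
      using t F G ob by (simp add: coas_natural' z1_def z3_def x1_def x3_def) (simp add: interchange')
    also have "\<dots> = ((fadd F ay \<cdot> (fadd F bz \<boxplus> fadd F bx)) \<boxplus> (fadd G ay \<cdot> (fadd G bz \<boxplus> fadd G bx)))
         \<cdot> ((?c F \<boxplus> ?c G) \<cdot> (?K \<cdot> (?d z1 z3 \<boxplus> ?d x1 x3)))"
      unfolding model_two[OF assms(1) c] model_two[OF assms(2) c]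
      using t F G ob by (simp add: interchange' z1_def z3_def x1_def x3_def)
    also have "\<dots> = ((fadd F ay \<cdot> (fadd F bz \<boxplus> fadd F bx)) \<boxplus> (fadd G ay \<cdot> (fadd G bz \<boxplus> fadd G bx)))
         \<cdot> (?L \<cdot> ((?d z1 x1 \<boxplus> ?d z3 x3) \<cdot> ?M))"
      by (simp only: D5)
    also have "\<dots> = (fadd F ay \<boxplus> fadd G ay) \<cdot> (coas P (onObj F (pY S bz)) (onObj G (pY S bz)) (onObj F (pY S bx)) (onObj G (pY S bx))
         \<cdot> (((fadd F bz \<boxplus> fadd G bz) \<boxplus> (fadd F bx \<boxplus> fadd G bx)) \<cdot> ((?d z1 x1 \<boxplus> ?d z3 x3) \<cdot> ?M)))"
      using t F G ob by (simp add: coas_natural' z1_def z3_def x1_def x3_def) (simp add: interchange')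
    also have "\<dots> = fadd (msum S F G) ay \<cdot> ((fadd (msum S F G) bz \<boxplus> fadd (msum S F G) bx) \<cdot> ?M)"
      using t F G ob by (simp add: tri_sum_def interchange' z1_def z3_def x1_def x3_def)
    finally show "fadd (msum S F G) by \<cdot> (fadd (msum S F G) az \<boxplus> fadd (msum S F G) ax)
      = fadd (msum S F G) ay \<cdot> ((fadd (msum S F G) bz \<boxplus> fadd (msum S F G) bx)
         \<cdot> coas P (onObj (msum S F G) (pZ S az)) (onObj (msum S F G) (pX S az))
            (onObj (msum S F G) (pZ S ax)) (onObj (msum S F G) (pX S ax)))"
      by (simp add: z1_def z3_def x1_def x3_def)
  qed
qed

lemma mmorI:
  assumes "is_data S F" "is_data S G" "sketch S"
    and "\<And>a. a \<in> Obj S \<Longrightarrow> \<theta> a \<in> Hom P (onObj F a) (onObj G a)"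
    and "\<And>f. f \<in> Arr S \<Longrightarrow> \<theta> (Cod S f) \<cdot> onArr F f = onArr G f \<cdot> \<theta> (Dom S f)"
    and "\<And>d. d \<in> Tr S \<Longrightarrow> tri_mor (onObj F (pZ S d)) (onObj F (pX S d)) (fadd F d)
       (onObj G (pZ S d)) (onObj G (pX S d)) (fadd G d) (\<theta> (pZ S d)) (\<theta> (pX S d)) (\<theta> (pY S d))"
  shows "mmor S F G \<theta>"
proof -
  interpret S: sketch S by fact
  show ?thesis
    using assms(4-6) data_simps[OF assms(1)] data_simps[OF assms(2)]
    unfolding mmor_def by (simp add: sq_def tri_mor_def)
qed

lemma mmor_tri_mor:
  assumes "is_data S F" "is_data S G" "sketch S" "mmor S F G \<theta>" "d \<in> Tr S"
  shows "tri_mor (onObj F (pZ S d)) (onObj F (pX S d)) (fadd F d)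
       (onObj G (pZ S d)) (onObj G (pX S d)) (fadd G d) (\<theta> (pZ S d)) (\<theta> (pX S d)) (\<theta> (pY S d))"
proof -
  interpret S: sketch S by fact
  show ?thesis
    using mmorD[OF assms(4)] assms(5) data_simps[OF assms(1)] data_simps[OF assms(2)]
    by (simp add: sq_def tri_mor_def)
qed

lemma mmor_msum:
  assumes "is_data S F" "is_data S G" "is_data S F'" "is_data S G'" "sketch S" "mmor S F F' \<theta>" "mmor S G G' \<eta>"
  shows "mmor S (msum S F G) (msum S F' G') (\<lambda>a. \<theta> a \<boxplus> \<eta> a)"
proof -
  interpret S: sketch S by fact
  note t = mmorD[OF assms(6)] mmorD[OF assms(7)]
  show ?thesis
  proof (rule mmorI[OF data_msum[OF assms(1,2,5)] data_msum[OF assms(3,4,5)] assms(5)])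
    show "\<theta> a \<boxplus> \<eta> a \<in> Hom P (onObj (msum S F G) a) (onObj (msum S F' G') a)" if "a \<in> Obj S" for a
      using t that by simp
    show "(\<theta> (Cod S f) \<boxplus> \<eta> (Cod S f)) \<cdot> onArr (msum S F G) f = onArr (msum S F' G') f \<cdot> (\<theta> (Dom S f) \<boxplus> \<eta> (Dom S f))"
      if "f \<in> Arr S" for f
      using sq_tensA[OF t(4)[OF that] t(9)[OF that]] by (simp add: sq_def)
    show "tri_mor (onObj (msum S F G) (pZ S d)) (onObj (msum S F G) (pX S d)) (fadd (msum S F G) d)
       (onObj (msum S F' G') (pZ S d)) (onObj (msum S F' G') (pX S d)) (fadd (msum S F' G') d)
       (\<theta> (pZ S d) \<boxplus> \<eta> (pZ S d)) (\<theta> (pX S d) \<boxplus> \<eta> (pX S d)) (\<theta> (pY S d) \<boxplus> \<eta> (pY S d))" if "d \<in> Tr S" for d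
      using tri_mor_sum[OF mmor_tri_mor[OF assms(1,3,5,6) that] mmor_tri_mor[OF assms(2,4,5,7) that]] by simp
  qed
qed

text \<open>Together with the next two lemmas: the isomorphisms occurring in the commutativity,
  associativity and two-triangle relations of one variable are morphisms of models in the
  other.\<close>

lemma mmor_symm:
  assumes "is_data S F" "is_data S G" "sketch S"
  shows "mmor S (msum S F G) (msum S G F) (\<lambda>a. symm P (onObj F a) (onObj G a))"
proof -
  interpret S: sketch S by fact
  note t = data_simps[OF assms(1)] data_simps[OF assms(2)]
  show ?thesis
    by (rule mmorI[OF data_msum[OF assms] data_msum[OF assms(2,1,3)] assms(3)])
      (use t in \<open>auto simp: symm_natural intro!: tri_mor_symm\<close>)
qed

lemma mmor_assoc:
  assumes "is_data S F" "is_data S G" "is_data S H" "sketch S"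
  shows "mmor S (msum S (msum S F G) H) (msum S F (msum S G H)) (\<lambda>a. assoc P (onObj F a) (onObj G a) (onObj H a))"
proof -
  interpret S: sketch S by fact
  note t = data_simps[OF assms(1)] data_simps[OF assms(2)] data_simps[OF assms(3)]
  show ?thesis
    by (rule mmorI[OF data_msum[OF data_msum[OF assms(1,2,4)] assms(3,4)] data_msum[OF assms(1) data_msum[OF assms(2,3,4)] assms(4)] assms(4)])
      (use t in \<open>auto simp: assoc_natural intro!: tri_mor_assoc\<close>)
qed

lemma mmor_coas:
  assumes "is_data S F" "is_data S G" "is_data S H" "is_data S K" "sketch S"
  shows "mmor S (msum S (msum S F G) (msum S H K)) (msum S (msum S F H) (msum S G K))
    (\<lambda>a. coas P (onObj F a) (onObj G a) (onObj H a) (onObj K a))"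
proof -
  interpret S: sketch S by fact
  note t = data_simps[OF assms(1)] data_simps[OF assms(2)] data_simps[OF assms(3)] data_simps[OF assms(4)]
  show ?thesis
    by (rule mmorI[OF data_msum[OF data_msum[OF assms(1,2,5)] data_msum[OF assms(3,4,5)] assms(5)]
       data_msum[OF data_msum[OF assms(1,3,5)] data_msum[OF assms(2,4,5)] assms(5)] assms(5)])
      (use t in \<open>auto simp: coas_natural intro!: tri_mor_coas\<close>)
qed

end

text \<open>
  A map of sketches sends a triangle \<open>d\<close> to a triangle \<open>jT d\<close> whose middle vertex need not be the
  image of that of \<open>d\<close>: the two are related by the arrow \<open>jA d\<close>.
\<close>

record ('a, 'b, 'c, 'd, 't, 'u) smap = "('a, 'b, 'c, 'd) funct" +
  jT :: "'t \<Rightarrow> 'u"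
  jA :: "'t \<Rightarrow> 'd"

text \<open>Preservation of relations is not included. \<open>det\<close> sends an octahedron to
  pairs whose sums match only up to the arrows \<open>jA\<close>, so it preserves relations in no
  literal sense; that models pull back to models is a separate clause of
  \<open>requiv\<close>.\<close>

definition is_smap :: "('a, 'b, 't) sketch \<Rightarrow> ('c, 'd, 'u) sketch \<Rightarrow> ('a, 'b, 'c, 'd, 't, 'u) smap \<Rightarrow> bool" where
  "is_smap A B J \<longleftrightarrow> is_functor A B J \<and> (\<forall>d\<in>Tr A. jT J d \<in> Tr B \<and> pX B (jT J d) = onObj J (pX A d)
     \<and> pZ B (jT J d) = onObj J (pZ A d) \<and> jA J d \<in> Hom B (pY B (jT J d)) (onObj J (pY A d)))"

lemma smap_simps:
  assumes "is_smap A B J"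
  shows "a \<in> Obj A \<Longrightarrow> onObj J a \<in> Obj B" "f \<in> Arr A \<Longrightarrow> onArr J f \<in> Arr B"
    "f \<in> Arr A \<Longrightarrow> Dom B (onArr J f) = onObj J (Dom A f)" "f \<in> Arr A \<Longrightarrow> Cod B (onArr J f) = onObj J (Cod A f)"
    "a \<in> Obj A \<Longrightarrow> onArr J (Ide A a) = Ide B (onObj J a)"
    "\<lbrakk>f \<in> Arr A; g \<in> Arr A; Dom A g = Cod A f\<rbrakk> \<Longrightarrow> onArr J (g \<cdot>\<^bsub>A\<^esub> f) = onArr J g \<cdot>\<^bsub>B\<^esub> onArr J f"
    "d \<in> Tr A \<Longrightarrow> jT J d \<in> Tr B" "d \<in> Tr A \<Longrightarrow> pX B (jT J d) = onObj J (pX A d)"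
    "d \<in> Tr A \<Longrightarrow> pZ B (jT J d) = onObj J (pZ A d)" "d \<in> Tr A \<Longrightarrow> jA J d \<in> Arr B"
    "d \<in> Tr A \<Longrightarrow> Dom B (jA J d) = pY B (jT J d)" "d \<in> Tr A \<Longrightarrow> Cod B (jA J d) = onObj J (pY A d)"
  using assms by (auto simp: is_smap_def is_functor_def)

definition strict_smap :: "('a, 'b, 't) sketch \<Rightarrow> ('c, 'd, 'u) sketch \<Rightarrow> ('a, 'b, 'c, 'd, 't, 'u) smap \<Rightarrow> bool" where
  "strict_smap A B J \<longleftrightarrow> is_smap A B J \<and>
     (\<forall>d\<in>Tr A. pY B (jT J d) = onObj J (pY A d) \<and> jA J d = Ide B (onObj J (pY A d))) \<and>
     (\<forall>d d' f g h. NatR A d d' f g h \<longrightarrow> NatR B (jT J d) (jT J d') (onArr J f) (onArr J g) (onArr J h)) \<and>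
     (\<forall>d d' g. ComR A d d' g \<longrightarrow> ComR B (jT J d) (jT J d') (onArr J g)) \<and>
     (\<forall>d1 d2 d3 d4 g. AssR A d1 d2 d3 d4 g \<longrightarrow> AssR B (jT J d1) (jT J d2) (jT J d3) (jT J d4) (onArr J g)) \<and>
     (\<forall>az ax ay bz bx by. TwoR A az ax ay bz bx by \<longrightarrow>
        TwoR B (jT J az) (jT J ax) (jT J ay) (jT J bz) (jT J bx) (jT J by))"

definition comp_smap :: "('c, 'd, 'v) sketch \<Rightarrow> ('e, 'f, 'c, 'd, 'u, 'v) smap \<Rightarrow> ('a, 'b, 'e, 'f, 't, 'u) smap
    \<Rightarrow> ('a, 'b, 'c, 'd, 't, 'v) smap" where
  "comp_smap C K J = \<lparr>onObj = (\<lambda>a. onObj K (onObj J a)), onArr = (\<lambda>f. onArr K (onArr J f)),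
     jT = (\<lambda>d. jT K (jT J d)), jA = (\<lambda>d. onArr K (jA J d) \<cdot>\<^bsub>C\<^esub> jA K (jT J d))\<rparr>"

lemma is_smap_comp:
  assumes "is_smap A B J" "is_smap B C K" "sketch A" "sketch B" "sketch C"
  shows "is_smap A C (comp_smap C K J)"
proof -
  interpret A: sketch A by fact
  interpret B: sketch B by fact
  interpret C: sketch C by fact
  note J = smap_simps[OF assms(1)] and K = smap_simps[OF assms(2)]
  show ?thesis
    by (auto simp: is_smap_def comp_smap_def is_functor_def J K)
qed

definition smap_agree :: "('a, 'b, 't) sketch \<Rightarrow> ('a, 'b, 'c, 'd, 't, 'u) smap \<Rightarrow> ('a, 'b, 'c, 'd, 't, 'u) smap \<Rightarrow> bool" where
  "smap_agree A J J' \<longleftrightarrow> (\<forall>a\<in>Obj A. onObj J a = onObj J' a) \<and> (\<forall>f\<in>Arr A. onArr J f = onArr J' f)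
     \<and> (\<forall>d\<in>Tr A. jT J d = jT J' d \<and> jA J d = jA J' d)"

context picard_groupoid
begin

text \<open>The factor \<open>onArr F (jA J d)\<close> corrects the middle vertex. For
  \<open>det\<close> it is the passage from \<open>g (det z + det x)\<close> to
  \<open>g (det y)\<close> in the additivity data of a composite.\<close>

definition pull :: "('c, 'd, 'u, 'o, 'm) model \<Rightarrow> ('a, 'b, 'c, 'd, 't, 'u) smap \<Rightarrow> ('a, 'b, 't, 'o, 'm) model" where
  "pull F J = \<lparr>onObj = (\<lambda>a. onObj F (onObj J a)), onArr = (\<lambda>f. onArr F (onArr J f)),
     fadd = (\<lambda>d. onArr F (jA J d) \<cdot> fadd F (jT J d))\<rparr>"

lemma pull_sel [simp]:
  "onObj (pull F J) a = onObj F (onObj J a)" "onArr (pull F J) f = onArr F (onArr J f)"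
  "fadd (pull F J) d = onArr F (jA J d) \<cdot> fadd F (jT J d)"
  by (simp_all add: pull_def)

lemma data_pull:
  assumes "is_data B F" "is_smap A B J" "sketch A" "sketch B"
  shows "is_data A (pull F J)"
proof -
  interpret A: sketch A by fact
  interpret B: sketch B by fact
  show ?thesis
    using data_simps[OF assms(1)] smap_simps[OF assms(2)] by (simp add: is_data_def)
qed

lemma mmor_pull:
  assumes "mmor B F G \<theta>" "is_data B F" "is_data B G" "is_smap A B J" "sketch A" "sketch B"
  shows "mmor A (pull F J) (pull G J) (\<lambda>a. \<theta> (onObj J a))"
proof -
  interpret A: sketch A by fact
  interpret B: sketch B by fact
  note t = mmorD[OF assms(1)] and J = smap_simps[OF assms(4)]
  show ?thesis
    unfolding mmor_def pull_sel
  proof (intro conjI ballI)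
    show "\<theta> (onObj J a) \<in> Hom P (onObj F (onObj J a)) (onObj G (onObj J a))" if "a \<in> Obj A" for a
      using that t(1-3) J by simp
    show "sq (\<theta> (onObj J (Dom A f))) (onArr F (onArr J f)) (onArr G (onArr J f)) (\<theta> (onObj J (Cod A f)))" if "f \<in> Arr A" for f
      using t(4)[of "onArr J f"] that J by simp
    show "sq (\<theta> (onObj J (pZ A d)) \<boxplus> \<theta> (onObj J (pX A d))) (onArr F (jA J d) \<cdot> fadd F (jT J d))
       (onArr G (jA J d) \<cdot> fadd G (jT J d)) (\<theta> (onObj J (pY A d)))" if "d \<in> Tr A" for d
      using sq_Cmp[OF t(5)[of "jT J d"] t(4)[of "jA J d", unfolded J(11)[OF that]]] that J by simp
  qed
qed

lemma agree_pull:
  assumes "agree B F G" "is_smap A B J"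
  shows "agree A (pull F J) (pull G J)"
  using assms smap_simps[OF assms(2)] by (simp add: agree_def)

text \<open>The correction by \<open>jA\<close> is applied after the additivity map, one summand at
  a time, so only interchange is involved.\<close>

lemma pull_msum:
  assumes "is_data B F" "is_data B G" "is_smap A B J" "sketch A" "sketch B"
  shows "agree A (pull (msum B F G) J) (msum A (pull F J) (pull G J))"
proof -
  interpret A: sketch A by fact
  interpret B: sketch B by fact
  show ?thesis
    using data_simps[OF assms(1)] data_simps[OF assms(2)] smap_simps[OF assms(3)]
    by (simp add: agree_def tri_sum_def interchange')
qed

lemma model_strict_pull:
  assumes "is_model B F" "strict_smap A B J" "sketch A" "sketch B"
  shows "is_model A (pull F J)"
proof -
  interpret A: sketch A by fact
  interpret B: sketch B by fact
  have sm: "is_smap A B J"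
    using assms(2) by (simp add: strict_smap_def)
  note J = smap_simps[OF sm] and F = model_simps[OF assms(1)]
  have Y: "pY B (jT J d) = onObj J (pY A d)" "jA J d = Ide B (onObj J (pY A d))" if "d \<in> Tr A" for d
    using that assms(2) by (auto simp: strict_smap_def)
  have ad: "fadd (pull F J) d = fadd F (jT J d)" if "d \<in> Tr A" for d
    using that J Y F by (simp add: model_Ide[OF assms(1)])
  show ?thesis
  proof (rule is_modelI[OF data_pull[OF model_data[OF assms(1)] sm assms(3,4)] A.category_axioms])
    show "onArr (pull F J) (Ide A a) = Ide P (onObj (pull F J) a)" if "a \<in> Obj A" for a
      using that J by (simp add: model_Ide[OF assms(1)])
    show "onArr (pull F J) (g \<cdot>\<^bsub>A\<^esub> f) = onArr (pull F J) g \<cdot> onArr (pull F J) f"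
      if "f \<in> Arr A" "g \<in> Arr A" "Dom A g = Cod A f" for f g
      using that J by (simp add: model_Cmp[OF assms(1)])
    show "fadd (pull F J) d' \<cdot> (onArr (pull F J) h \<boxplus> onArr (pull F J) f) = onArr (pull F J) g \<cdot> fadd (pull F J) d"
      if n: "NatR A d d' f g h" for d d' f g h
    proof -
      have "NatR B (jT J d) (jT J d') (onArr J f) (onArr J g) (onArr J h)"
        using n assms(2) by (simp add: strict_smap_def)
      from model_nat[OF assms(1) this] show ?thesis
        using A.NatR_in[OF n] ad by simp
    qed
    show "onArr (pull F J) g \<cdot> fadd (pull F J) d' = fadd (pull F J) d \<cdot> symm P (onObj (pull F J) (pZ A d')) (onObj (pull F J) (pX A d'))"
      if n: "ComR A d d' g" for d d' g
    proof -
      have "ComR B (jT J d) (jT J d') (onArr J g)"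
        using n assms(2) by (simp add: strict_smap_def)
      from model_com[OF assms(1) this] show ?thesis
        using A.ComR_in[OF n] ad J by simp
    qed
    show "onArr (pull F J) g \<cdot> (fadd (pull F J) d2 \<cdot> (fadd (pull F J) d4 \<boxplus> Ide P (onObj (pull F J) (pX A d1))))
      = fadd (pull F J) d3 \<cdot> ((Ide P (onObj (pull F J) (pZ A d3)) \<boxplus> fadd (pull F J) d1)
         \<cdot> assoc P (onObj (pull F J) (pZ A d3)) (onObj (pull F J) (pZ A d1)) (onObj (pull F J) (pX A d1)))"
      if n: "AssR A d1 d2 d3 d4 g" for d1 d2 d3 d4 g
    proof -
      have "AssR B (jT J d1) (jT J d2) (jT J d3) (jT J d4) (onArr J g)"
        using n assms(2) by (simp add: strict_smap_def)
      from model_ass[OF assms(1) this] show ?thesis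
        using A.AssR_in[OF n] ad J by simp
    qed
    show "fadd (pull F J) by \<cdot> (fadd (pull F J) az \<boxplus> fadd (pull F J) ax)
      = fadd (pull F J) ay \<cdot> ((fadd (pull F J) bz \<boxplus> fadd (pull F J) bx)
         \<cdot> coas P (onObj (pull F J) (pZ A az)) (onObj (pull F J) (pX A az)) (onObj (pull F J) (pZ A ax)) (onObj (pull F J) (pX A ax)))"
      if n: "TwoR A az ax ay bz bx by" for az ax ay bz bx "by"
    proof -
      have "TwoR B (jT J az) (jT J ax) (jT J ay) (jT J bz) (jT J bx) (jT J by)"
        using n assms(2) by (simp add: strict_smap_def)
      from model_two[OF assms(1) this] show ?thesis
        using A.TwoR_in[OF n] ad J by simp
    qed
  qed
qed

subsection \<open>Maps of sketches that induce equivalences on models\<close>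

text \<open>After the typing, the clauses read: pulling back is defined on models, essentially
  surjective, full and faithful. The target \<open>P\<close> is fixed throughout, and morphisms of
  models are invertible, so the direction of \<open>\<alpha>\<close> is immaterial.\<close>

definition requiv :: "('a, 'b, 't) sketch \<Rightarrow> ('c, 'd, 'u) sketch \<Rightarrow> ('a, 'b, 'c, 'd, 't, 'u) smap \<Rightarrow> bool" where
  "requiv A B J \<longleftrightarrow> sketch A \<and> sketch B \<and> is_smap A B J \<and>
     (\<forall>G. is_model B G \<longrightarrow> is_model A (pull G J)) \<and>
     (\<forall>F. is_model A F \<longrightarrow> (\<exists>G \<alpha>. is_model B G \<and> mmor A (pull G J) F \<alpha>)) \<and>
     (\<forall>G H \<theta>. is_model B G \<longrightarrow> is_model B H \<longrightarrow> mmor A (pull G J) (pull H J) \<theta> \<longrightarrow>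
        (\<exists>\<eta>. mmor B G H \<eta> \<and> (\<forall>a\<in>Obj A. \<eta> (onObj J a) = \<theta> a))) \<and>
     (\<forall>G H \<eta> \<eta>'. is_model B G \<longrightarrow> is_model B H \<longrightarrow> mmor B G H \<eta> \<longrightarrow> mmor B G H \<eta>' \<longrightarrow>
        (\<forall>a\<in>Obj A. \<eta> (onObj J a) = \<eta>' (onObj J a)) \<longrightarrow> (\<forall>b\<in>Obj B. \<eta> b = \<eta>' b))"

lemma requivD:
  assumes "requiv A B J"
  shows "sketch A" "sketch B" "is_smap A B J"
    "is_model B G \<Longrightarrow> is_model A (pull G J)"
    "is_model A F \<Longrightarrow> \<exists>G \<alpha>. is_model B G \<and> mmor A (pull G J) F \<alpha>"
    "\<lbrakk>is_model B G; is_model B H; mmor A (pull G J) (pull H J) \<theta>\<rbrakk>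
      \<Longrightarrow> \<exists>\<eta>. mmor B G H \<eta> \<and> (\<forall>a\<in>Obj A. \<eta> (onObj J a) = \<theta> a)"
    "\<lbrakk>is_model B G; is_model B H; mmor B G H \<eta>; mmor B G H \<eta>'; \<And>a. a \<in> Obj A \<Longrightarrow> \<eta> (onObj J a) = \<eta>' (onObj J a);
      b \<in> Obj B\<rbrakk> \<Longrightarrow> \<eta> b = \<eta>' b"
proof -
  note r = assms[unfolded requiv_def]
  show "sketch A" "sketch B" "is_smap A B J"
    using r by auto
  show "is_model B G \<Longrightarrow> is_model A (pull G J)"
    using r by auto
  show "is_model A F \<Longrightarrow> \<exists>G \<alpha>. is_model B G \<and> mmor A (pull G J) F \<alpha>"
    using r by auto
  show "\<lbrakk>is_model B G; is_model B H; mmor A (pull G J) (pull H J) \<theta>\<rbrakk>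
      \<Longrightarrow> \<exists>\<eta>. mmor B G H \<eta> \<and> (\<forall>a\<in>Obj A. \<eta> (onObj J a) = \<theta> a)"
    using r by blast
  show "\<lbrakk>is_model B G; is_model B H; mmor B G H \<eta>; mmor B G H \<eta>'; \<And>a. a \<in> Obj A \<Longrightarrow> \<eta> (onObj J a) = \<eta>' (onObj J a);
      b \<in> Obj B\<rbrakk> \<Longrightarrow> \<eta> b = \<eta>' b"
    using r by blast
qed

lemma requivI:
  fixes A :: "('a, 'b, 't) sketch" and B :: "('c, 'd, 'u) sketch" and J :: "('a, 'b, 'c, 'd, 't, 'u) smap"
  assumes "sketch A" "sketch B" "is_smap A B J"
    "\<And>G. is_model B G \<Longrightarrow> is_model A (pull G J)"
    "\<And>F. is_model A F \<Longrightarrow> \<exists>G \<alpha>. is_model B G \<and> mmor A (pull G J) F \<alpha>"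
    "\<And>G H \<theta>. \<lbrakk>is_model B G; is_model B H; mmor A (pull G J) (pull H J) \<theta>\<rbrakk>
      \<Longrightarrow> \<exists>\<eta>. mmor B G H \<eta> \<and> (\<forall>a\<in>Obj A. \<eta> (onObj J a) = \<theta> a)"
    "\<And>G H \<eta> \<eta>' b. \<lbrakk>is_model B G; is_model B H; mmor B G H \<eta>; mmor B G H \<eta>';
       \<And>a. a \<in> Obj A \<Longrightarrow> \<eta> (onObj J a) = \<eta>' (onObj J a); b \<in> Obj B\<rbrakk> \<Longrightarrow> \<eta> b = \<eta>' b"
  shows "requiv A B J"
  unfolding requiv_def
proof (intro conjI allI impI ballI)
  show "sketch A" "sketch B" "is_smap A B J"
    by fact+
next
  fix G :: "('c, 'd, 'u, 'o, 'm) model"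
  assume "is_model B G"
  then show "is_model A (pull G J)" by (rule assms(4))
next
  fix F :: "('a, 'b, 't, 'o, 'm) model"
  assume "is_model A F"
  then show "\<exists>G \<alpha>. is_model B G \<and> mmor A (pull G J) F \<alpha>" by (rule assms(5))
next
  fix G H :: "('c, 'd, 'u, 'o, 'm) model" and \<theta>
  assume "is_model B G" "is_model B H" "mmor A (pull G J) (pull H J) \<theta>"
  then show "\<exists>\<eta>. mmor B G H \<eta> \<and> (\<forall>a\<in>Obj A. \<eta> (onObj J a) = \<theta> a)" by (rule assms(6))
next
  fix G H :: "('c, 'd, 'u, 'o, 'm) model" and \<eta> \<eta>' b
  assume "is_model B G" "is_model B H" "mmor B G H \<eta>" "mmor B G H \<eta>'"
    "\<forall>a\<in>Obj A. \<eta> (onObj J a) = \<eta>' (onObj J a)" "b \<in> Obj B"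
  then show "\<eta> b = \<eta>' b" using assms(7) by blast
qed

lemma requiv_trans:
  assumes "requiv A B J" "requiv B C K"
  shows "requiv A C (comp_smap C K J)"
proof -
  note J = requivD[OF assms(1)] and K = requivD[OF assms(2)]
  interpret A: sketch A by (rule J(1))
  interpret B: sketch B by (rule J(2))
  interpret C: sketch C by (rule K(2))
  have ag: "agree A (pull (pull G K) J) (pull G (comp_smap C K J))" if "is_model C G" for G
    using smap_simps[OF J(3)] smap_simps[OF K(3)] model_simps[OF that]
    by (simp add: agree_def comp_smap_def model_Cmp[OF that])
  have ag': "agree A (pull G (comp_smap C K J)) (pull (pull G K) J)" if "is_model C G" for G
    using ag[OF that] by (simp add: agree_def)
  show ?thesis
  proof (rule requivI[OF J(1) K(2) is_smap_comp[OF J(3) K(3) J(1,2) K(2)]])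
    fix G assume G: "is_model C G"
    show "is_model A (pull G (comp_smap C K J))"
      by (rule model_agree[OF J(4)[OF K(4)[OF G]] ag[OF G] J(1)])
  next
    fix F assume F: "is_model A F"
    obtain G \<alpha> where G: "is_model B G" "mmor A (pull G J) F \<alpha>"
      using J(5)[OF F] by blast
    obtain H \<beta> where H: "is_model C H" "mmor B (pull H K) G \<beta>"
      using K(5)[OF G(1)] by blast
    have "mmor A (pull (pull H K) J) F (\<lambda>a. \<alpha> a \<cdot> \<beta> (onObj J a))"
      by (rule mmor_Cmp[OF mmor_pull[OF H(2) model_data[OF K(4)[OF H(1)]] model_data[OF G(1)] J(3,1,2)] G(2) J(1)])
    from mmor_agree[OF this ag[OF H(1)] agree_refl]
    show "\<exists>G \<alpha>. is_model C G \<and> mmor A (pull G (comp_smap C K J)) F \<alpha>"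
      using H(1) by blast
  next
    fix G H \<theta> assume GH: "is_model C G" "is_model C H" and \<theta>: "mmor A (pull G (comp_smap C K J)) (pull H (comp_smap C K J)) \<theta>"
    obtain \<eta> where \<eta>: "mmor B (pull G K) (pull H K) \<eta>" "\<forall>a\<in>Obj A. \<eta> (onObj J a) = \<theta> a"
      using J(6)[OF K(4)[OF GH(1)] K(4)[OF GH(2)] mmor_agree[OF \<theta> ag'[OF GH(1)] ag'[OF GH(2)]]] by blast
    obtain \<zeta> where \<zeta>: "mmor C G H \<zeta>" "\<forall>b\<in>Obj B. \<zeta> (onObj K b) = \<eta> b"
      using K(6)[OF GH \<eta>(1)] by blast
    show "\<exists>\<eta>. mmor C G H \<eta> \<and> (\<forall>a\<in>Obj A. \<eta> (onObj (comp_smap C K J) a) = \<theta> a)"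
      using \<zeta> \<eta>(2) smap_simps(1)[OF J(3)] by (auto simp: comp_smap_def)
  next
    fix G H \<eta> \<eta>' c assume GH: "is_model C G" "is_model C H" and \<eta>: "mmor C G H \<eta>" "mmor C G H \<eta>'"
      and eq: "\<And>a. a \<in> Obj A \<Longrightarrow> \<eta> (onObj (comp_smap C K J) a) = \<eta>' (onObj (comp_smap C K J) a)" and c: "c \<in> Obj C"
    note d = model_data[OF GH(1)] model_data[OF GH(2)]
    have "\<eta> (onObj K b) = \<eta>' (onObj K b)" if "b \<in> Obj B" for b
      by (rule J(7)[OF K(4)[OF GH(1)] K(4)[OF GH(2)] mmor_pull[OF \<eta>(1) d K(3,1,2)] mmor_pull[OF \<eta>(2) d K(3,1,2)] _ that])
        (use eq in \<open>simp add: comp_smap_def\<close>)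
    then show "\<eta> c = \<eta>' c"
      by (rule K(7)[OF GH \<eta> _ c])
  qed
qed

text \<open>Needed because a composite of maps of sketches coincides with the intended map on the
  carriers only.\<close>

lemma requiv_cong:
  assumes "requiv A B J" "smap_agree A J J'"
  shows "requiv A B J'"
proof -
  note J = requivD[OF assms(1)]
  interpret A: sketch A by (rule J(1))
  have ag: "agree A (pull G J) (pull G J')" and ag': "agree A (pull G J') (pull G J)" for G
    using assms(2) by (simp_all add: agree_def smap_agree_def)
  have sm: "is_smap A B J'"
    using J(3) assms(2) by (simp add: is_smap_def is_functor_def smap_agree_def)
  have ob: "onObj J' a = onObj J a" if "a \<in> Obj A" for a
    using assms(2) that by (simp add: smap_agree_def)
  show ?thesis
  proof (rule requivI[OF J(1,2) sm])
    show "is_model A (pull G J')" if "is_model B G" for G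
      by (rule model_agree[OF J(4)[OF that] ag J(1)])
    show "\<exists>G \<alpha>. is_model B G \<and> mmor A (pull G J') F \<alpha>" if "is_model A F" for F
      using J(5)[OF that] mmor_agree[OF _ ag agree_refl] by blast
    show "\<exists>\<eta>. mmor B G H \<eta> \<and> (\<forall>a\<in>Obj A. \<eta> (onObj J' a) = \<theta> a)"
      if "is_model B G" "is_model B H" "mmor A (pull G J') (pull H J') \<theta>" for G H \<theta>
      using J(6)[OF that(1,2) mmor_agree[OF that(3) ag' ag']] ob by simp
    show "\<eta> b = \<eta>' b" if "is_model B G" "is_model B H" "mmor B G H \<eta>" "mmor B G H \<eta>'"
      "\<And>a. a \<in> Obj A \<Longrightarrow> \<eta> (onObj J' a) = \<eta>' (onObj J' a)" "b \<in> Obj B" for G H \<eta> \<eta>' b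
      by (rule J(7)[OF that(1-4) _ that(6)]) (use that(5) ob in simp)
  qed
qed

text \<open>For strict maps the comparison arrows are identities, so pulling back along both of two
  mutually inverse ones returns a model that agrees with the given one.\<close>

lemma requiv_iso:
  fixes A :: "('a, 'b, 't) sketch" and B :: "('c, 'd, 'u) sketch" and J :: "('a, 'b, 'c, 'd, 't, 'u) smap"
  assumes "sketch A" "sketch B" "strict_smap A B J" "strict_smap B A K"
    "\<And>a. a \<in> Obj A \<Longrightarrow> onObj K (onObj J a) = a" "\<And>f. f \<in> Arr A \<Longrightarrow> onArr K (onArr J f) = f"
    "\<And>d. d \<in> Tr A \<Longrightarrow> jT K (jT J d) = d"
    "\<And>b. b \<in> Obj B \<Longrightarrow> onObj J (onObj K b) = b" "\<And>f. f \<in> Arr B \<Longrightarrow> onArr J (onArr K f) = f"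
    "\<And>d. d \<in> Tr B \<Longrightarrow> jT J (jT K d) = d"
  shows "requiv A B J"
proof -
  interpret A: sketch A by fact
  interpret B: sketch B by fact
  have J: "is_smap A B J" and K: "is_smap B A K"
    using assms(3,4) by (auto simp: strict_smap_def)
  note Js = smap_simps[OF J] and Ks = smap_simps[OF K]
  have JY: "pY B (jT J d) = onObj J (pY A d)" "jA J d = Ide B (onObj J (pY A d))" if "d \<in> Tr A" for d
    using that assms(3) by (auto simp: strict_smap_def)
  have KY: "pY A (jT K d) = onObj K (pY B d)" "jA K d = Ide A (onObj K (pY B d))" if "d \<in> Tr B" for d
    using that assms(4) by (auto simp: strict_smap_def)
  have agJ: "agree B (pull (pull G J) K) G" if "is_model B G" for G
    using model_simps[OF that] assms(8-10) Ks KY Js JY by (simp add: agree_def model_Ide[OF that])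
  have agK: "agree A (pull (pull F K) J) F" if "is_model A F" for F
    using model_simps[OF that] assms(5-7) Ks KY Js JY by (simp add: agree_def model_Ide[OF that])
  have mJ: "is_model A (pull G J)" if "is_model B G" for G
    by (rule model_strict_pull[OF that assms(3,1,2)])
  show ?thesis
  proof (rule requivI[OF assms(1,2) J])
    show "is_model A (pull G J)" if "is_model B G" for G
      by (rule mJ[OF that])
    show "\<exists>G \<alpha>. is_model B G \<and> mmor A (pull G J) F \<alpha>" if F: "is_model A F" for F
    proof -
      have m: "is_model B (pull F K)"
        by (rule model_strict_pull[OF F assms(4,2,1)])
      have "mmor A (pull (pull F K) J) F (\<lambda>a. Ide P (onObj (pull (pull F K) J) a))"
        by (rule mmor_agree[OF mmor_Ide[OF model_data[OF mJ[OF m]] assms(1)] agree_refl agK[OF F]])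
      with m show ?thesis by blast
    qed
    show "\<exists>\<eta>. mmor B G H \<eta> \<and> (\<forall>a\<in>Obj A. \<eta> (onObj J a) = \<theta> a)"
      if G: "is_model B G" and H: "is_model B H" and \<theta>: "mmor A (pull G J) (pull H J) \<theta>" for G H \<theta>
    proof -
      have "mmor B G H (\<lambda>b. \<theta> (onObj K b))"
        by (rule mmor_agree[OF mmor_pull[OF \<theta> model_data[OF mJ[OF G]] model_data[OF mJ[OF H]] K assms(2,1)] agJ[OF G] agJ[OF H]])
      then show ?thesis
        using assms(5) by auto
    qed
    show "\<eta> b = \<eta>' b" if "\<And>a. a \<in> Obj A \<Longrightarrow> \<eta> (onObj J a) = \<eta>' (onObj J a)" "b \<in> Obj B" for \<eta> \<eta>' :: "'c \<Rightarrow> 'm" and b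
      using that(1)[of "onObj K b"] that(2) assms(8) Ks(1) by simp
  qed
qed

end

section \<open>The tensor product of two sketches\<close>

text \<open>The arrow \<open>k\<close> of the other variable is part of the relation: an identity
  \<open>k\<close> gives naturality in one variable, and the identity of a triangle gives its
  compatibility with arrows of the other variable.\<close>

inductive tnat for R :: "('a, 'b, 't) sketch" and S :: "('c, 'd, 'u) sketch" where
  tnatL: "\<lbrakk>NatR R e e' f g h; k \<in> Hom S s s'; s \<in> Obj S; s' \<in> Obj S\<rbrakk>
    \<Longrightarrow> tnat R S (Inl (e, s)) (Inl (e', s')) (f, k) (g, k) (h, k)"
| tnatR: "\<lbrakk>NatR S e e' f g h; k \<in> Hom R r r'; r \<in> Obj R; r' \<in> Obj R\<rbrakk>
    \<Longrightarrow> tnat R S (Inr (r, e)) (Inr (r', e')) (k, f) (k, g) (k, h)"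

inductive tcom for R :: "('a, 'b, 't) sketch" and S :: "('c, 'd, 'u) sketch" where
  tcomL: "\<lbrakk>ComR R e e' g; s \<in> Obj S\<rbrakk> \<Longrightarrow> tcom R S (Inl (e, s)) (Inl (e', s)) (g, Ide S s)"
| tcomR: "\<lbrakk>ComR S e e' g; r \<in> Obj R\<rbrakk> \<Longrightarrow> tcom R S (Inr (r, e)) (Inr (r, e')) (Ide R r, g)"

inductive tass for R :: "('a, 'b, 't) sketch" and S :: "('c, 'd, 'u) sketch" where
  tassL: "\<lbrakk>AssR R e1 e2 e3 e4 g; s \<in> Obj S\<rbrakk>
    \<Longrightarrow> tass R S (Inl (e1, s)) (Inl (e2, s)) (Inl (e3, s)) (Inl (e4, s)) (g, Ide S s)"
| tassR: "\<lbrakk>AssR S e1 e2 e3 e4 g; r \<in> Obj R\<rbrakk>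
    \<Longrightarrow> tass R S (Inr (r, e1)) (Inr (r, e2)) (Inr (r, e3)) (Inr (r, e4)) (Ide R r, g)"

text \<open>The mixed relation is listed in both orders, so that the exchange of the two factors is
  a strict map. The orders correspond because \<open>coas\<close> is inverted by exchanging its
  middle arguments.\<close>

inductive ttwo for R :: "('a, 'b, 't) sketch" and S :: "('c, 'd, 'u) sketch" where
  ttwoL: "\<lbrakk>TwoR R az ax ay bz bx by; s \<in> Obj S\<rbrakk>
    \<Longrightarrow> ttwo R S (Inl (az, s)) (Inl (ax, s)) (Inl (ay, s)) (Inl (bz, s)) (Inl (bx, s)) (Inl (by, s))"
| ttwoR: "\<lbrakk>TwoR S az ax ay bz bx by; r \<in> Obj R\<rbrakk>
    \<Longrightarrow> ttwo R S (Inr (r, az)) (Inr (r, ax)) (Inr (r, ay)) (Inr (r, bz)) (Inr (r, bx)) (Inr (r, by))"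
| ttwoLR: "\<lbrakk>d \<in> Tr R; e \<in> Tr S\<rbrakk> \<Longrightarrow> ttwo R S (Inl (d, pZ S e)) (Inl (d, pX S e)) (Inl (d, pY S e))
     (Inr (pZ R d, e)) (Inr (pX R d, e)) (Inr (pY R d, e))"
| ttwoRL: "\<lbrakk>d \<in> Tr R; e \<in> Tr S\<rbrakk> \<Longrightarrow> ttwo R S (Inr (pZ R d, e)) (Inr (pX R d, e)) (Inr (pY R d, e))
     (Inl (d, pZ S e)) (Inl (d, pX S e)) (Inl (d, pY S e))"

definition tsk :: "('a, 'b, 't) sketch \<Rightarrow> ('c, 'd, 'u) sketch \<Rightarrow> ('a \<times> 'c, 'b \<times> 'd, 't \<times> 'c + 'a \<times> 'u) sketch" where
  "tsk R S = \<lparr>Obj = Obj R \<times> Obj S, Arr = Arr R \<times> Arr S, Dom = map_prod (Dom R) (Dom S), Cod = map_prod (Cod R) (Cod S),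
     Ide = map_prod (Ide R) (Ide S), Cmp = (\<lambda>g f. (fst g \<cdot>\<^bsub>R\<^esub> fst f, snd g \<cdot>\<^bsub>S\<^esub> snd f)),
     Tr = Inl ` (Tr R \<times> Obj S) \<union> Inr ` (Obj R \<times> Tr S),
     pX = case_sum (map_prod (pX R) id) (map_prod id (pX S)),
     pY = case_sum (map_prod (pY R) id) (map_prod id (pY S)),
     pZ = case_sum (map_prod (pZ R) id) (map_prod id (pZ S)),
     NatR = tnat R S, ComR = tcom R S, AssR = tass R S, TwoR = ttwo R S\<rparr>"

lemma tsk_sel [simp]:
  "(r, s) \<in> Obj (tsk R S) \<longleftrightarrow> r \<in> Obj R \<and> s \<in> Obj S" "(f, g) \<in> Arr (tsk R S) \<longleftrightarrow> f \<in> Arr R \<and> g \<in> Arr S"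
  "Dom (tsk R S) (f, g) = (Dom R f, Dom S g)" "Cod (tsk R S) (f, g) = (Cod R f, Cod S g)"
  "Ide (tsk R S) (r, s) = (Ide R r, Ide S s)" "(f', g') \<cdot>\<^bsub>tsk R S\<^esub> (f, g) = (f' \<cdot>\<^bsub>R\<^esub> f, g' \<cdot>\<^bsub>S\<^esub> g)"
  "Inl (d, s) \<in> Tr (tsk R S) \<longleftrightarrow> d \<in> Tr R \<and> s \<in> Obj S" "Inr (r, e) \<in> Tr (tsk R S) \<longleftrightarrow> r \<in> Obj R \<and> e \<in> Tr S"
  "pX (tsk R S) (Inl (d, s)) = (pX R d, s)" "pX (tsk R S) (Inr (r, e)) = (r, pX S e)"
  "pY (tsk R S) (Inl (d, s)) = (pY R d, s)" "pY (tsk R S) (Inr (r, e)) = (r, pY S e)"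
  "pZ (tsk R S) (Inl (d, s)) = (pZ R d, s)" "pZ (tsk R S) (Inr (r, e)) = (r, pZ S e)"
  "NatR (tsk R S) = tnat R S" "ComR (tsk R S) = tcom R S" "AssR (tsk R S) = tass R S" "TwoR (tsk R S) = ttwo R S"
  by (auto simp: tsk_def)

lemma tsk_TrE:
  assumes "d \<in> Tr (tsk R S)"
  obtains e s where "d = Inl (e, s)" "e \<in> Tr R" "s \<in> Obj S" | r e where "d = Inr (r, e)" "r \<in> Obj R" "e \<in> Tr S"
  using assms by (auto simp: tsk_def)

lemma category_tsk:
  assumes "sketch R" "sketch S"
  shows "category (tsk R S)"
proof -
  interpret R: sketch R by fact
  interpret S: sketch S by fact
  show ?thesis
    by unfold_locales (auto simp: tsk_def)
qed

lemma sketch_tsk: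
  assumes "sketch R" "sketch S"
  shows "sketch (tsk R S)"
proof -
  interpret R: sketch R by fact
  interpret S: sketch S by fact
  interpret T: category "tsk R S" by (rule category_tsk[OF assms])
  show ?thesis
  proof unfold_locales
    show "pX (tsk R S) d \<in> Obj (tsk R S)" "pY (tsk R S) d \<in> Obj (tsk R S)" "pZ (tsk R S) d \<in> Obj (tsk R S)"
      if "d \<in> Tr (tsk R S)" for d
      using that by (auto elim!: tsk_TrE)
    show "d \<in> Tr (tsk R S) \<and> d' \<in> Tr (tsk R S) \<and> f \<in> Hom (tsk R S) (pX (tsk R S) d) (pX (tsk R S) d')
      \<and> g \<in> Hom (tsk R S) (pY (tsk R S) d) (pY (tsk R S) d') \<and> h \<in> Hom (tsk R S) (pZ (tsk R S) d) (pZ (tsk R S) d')"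
      if "NatR (tsk R S) d d' f g h" for d d' f g h
      using that by (auto elim!: tnat.cases dest: R.NatR_in S.NatR_in)
    show "NatR (tsk R S) d d (Ide (tsk R S) (pX (tsk R S) d)) (Ide (tsk R S) (pY (tsk R S) d)) (Ide (tsk R S) (pZ (tsk R S) d))"
      if "d \<in> Tr (tsk R S)" for d
      using that by (auto elim!: tsk_TrE intro!: tnat.intros R.NatR_Ide S.NatR_Ide)
    show "d \<in> Tr (tsk R S) \<and> d' \<in> Tr (tsk R S) \<and> pZ (tsk R S) d' = pX (tsk R S) d \<and> pX (tsk R S) d' = pZ (tsk R S) d
      \<and> g \<in> Hom (tsk R S) (pY (tsk R S) d') (pY (tsk R S) d)" if "ComR (tsk R S) d d' g" for d d' g
      using that by (auto elim!: tcom.cases dest: R.ComR_in S.ComR_in)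
    show "{d1, d2, d3, d4} \<subseteq> Tr (tsk R S) \<and> pX (tsk R S) d2 = pX (tsk R S) d1 \<and> pX (tsk R S) d3 = pY (tsk R S) d1
      \<and> pX (tsk R S) d4 = pZ (tsk R S) d1 \<and> pY (tsk R S) d4 = pZ (tsk R S) d2 \<and> pZ (tsk R S) d4 = pZ (tsk R S) d3
      \<and> g \<in> Hom (tsk R S) (pY (tsk R S) d2) (pY (tsk R S) d3)" if "AssR (tsk R S) d1 d2 d3 d4 g" for d1 d2 d3 d4 g
      using that by (auto elim!: tass.cases dest: R.AssR_in S.AssR_in)
    show "{az, ax, ay, bz, bx, by} \<subseteq> Tr (tsk R S)
      \<and> pY (tsk R S) az = pZ (tsk R S) by \<and> pY (tsk R S) ax = pX (tsk R S) by \<and> pY (tsk R S) bz = pZ (tsk R S) ay \<and> pY (tsk R S) bx = pX (tsk R S) ay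
      \<and> pZ (tsk R S) bz = pZ (tsk R S) az \<and> pX (tsk R S) bz = pZ (tsk R S) ax \<and> pZ (tsk R S) bx = pX (tsk R S) az \<and> pX (tsk R S) bx = pX (tsk R S) ax
      \<and> pY (tsk R S) ay = pY (tsk R S) by" if "TwoR (tsk R S) az ax ay bz bx by" for az ax ay bz bx "by"
      using that by (auto elim!: ttwo.cases dest: R.TwoR_in S.TwoR_in)
  qed
qed

definition row_map :: "('a, 'b, 't) sketch \<Rightarrow> ('c, 'd, 'u) sketch \<Rightarrow> 'a \<Rightarrow> ('c, 'd, 'a \<times> 'c, 'b \<times> 'd, 'u, 't \<times> 'c + 'a \<times> 'u) smap" where
  "row_map R S r = \<lparr>onObj = (\<lambda>s. (r, s)), onArr = (\<lambda>g. (Ide R r, g)), jT = (\<lambda>d. Inr (r, d)), jA = (\<lambda>d. (Ide R r, Ide S (pY S d)))\<rparr>"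

definition col_map :: "('a, 'b, 't) sketch \<Rightarrow> ('c, 'd, 'u) sketch \<Rightarrow> 'c \<Rightarrow> ('a, 'b, 'a \<times> 'c, 'b \<times> 'd, 't, 't \<times> 'c + 'a \<times> 'u) smap" where
  "col_map R S s = \<lparr>onObj = (\<lambda>r. (r, s)), onArr = (\<lambda>f. (f, Ide S s)), jT = (\<lambda>d. Inl (d, s)), jA = (\<lambda>d. (Ide R (pY R d), Ide S s))\<rparr>"

lemma strict_row_map:
  assumes "sketch R" "sketch S" "r \<in> Obj R"
  shows "strict_smap S (tsk R S) (row_map R S r)"
proof -
  interpret R: sketch R by fact
  interpret S: sketch S by fact
  show ?thesis
    using assms(3) by (auto simp: strict_smap_def is_smap_def is_functor_def row_map_def
        intro!: tnat.intros tcom.intros tass.intros ttwo.intros)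
qed

lemma strict_col_map:
  assumes "sketch R" "sketch S" "s \<in> Obj S"
  shows "strict_smap R (tsk R S) (col_map R S s)"
proof -
  interpret R: sketch R by fact
  interpret S: sketch S by fact
  show ?thesis
    using assms(3) by (auto simp: strict_smap_def is_smap_def is_functor_def col_map_def
        intro!: tnat.intros tcom.intros tass.intros ttwo.intros)
qed

section \<open>Rows and columns of a model in two variables\<close>

context picard_groupoid
begin

definition row :: "('a, 'b, 't) sketch \<Rightarrow> ('a \<times> 'c, 'b \<times> 'd, 't \<times> 'c + 'a \<times> 'u, 'o, 'm) model \<Rightarrow> 'a \<Rightarrow> ('c, 'd, 'u, 'o, 'm) model" where
  "row R F r = \<lparr>onObj = (\<lambda>s. onObj F (r, s)), onArr = (\<lambda>g. onArr F (Ide R r, g)), fadd = (\<lambda>d. fadd F (Inr (r, d)))\<rparr>"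

definition col :: "('c, 'd, 'u) sketch \<Rightarrow> ('a \<times> 'c, 'b \<times> 'd, 't \<times> 'c + 'a \<times> 'u, 'o, 'm) model \<Rightarrow> 'c \<Rightarrow> ('a, 'b, 't, 'o, 'm) model" where
  "col S F s = \<lparr>onObj = (\<lambda>r. onObj F (r, s)), onArr = (\<lambda>f. onArr F (f, Ide S s)), fadd = (\<lambda>d. fadd F (Inl (d, s)))\<rparr>"

lemma row_col_sel [simp]:
  "onObj (row R F r) s = onObj F (r, s)" "onArr (row R F r) g = onArr F (Ide R r, g)" "fadd (row R F r) e = fadd F (Inr (r, e))"
  "onObj (col S F s) r = onObj F (r, s)" "onArr (col S F s) f = onArr F (f, Ide S s)" "fadd (col S F s) d = fadd F (Inl (d, s))"
  by (simp_all add: row_def col_def)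

lemma row_model:
  assumes "sketch R" "sketch S" "is_model (tsk R S) F" "r \<in> Obj R"
  shows "is_model S (row R F r)"
proof -
  interpret R: sketch R by fact
  interpret S: sketch S by fact
  have I: "onArr F (Ide R r, Ide S s) = Ide P (onObj F (r, s))" if "s \<in> Obj S" for s
    using model_Ide[OF assms(3), of "(r, s)"] that assms(4) by simp
  show ?thesis
    by (rule model_agree[OF model_strict_pull[OF assms(3) strict_row_map[OF assms(1,2,4)] assms(2) sketch_tsk[OF assms(1,2)]] _ assms(2)])
      (use model_simps[OF assms(3)] assms(4) I in \<open>simp add: agree_def row_map_def\<close>)
qed

lemma col_model:
  assumes "sketch R" "sketch S" "is_model (tsk R S) F" "s \<in> Obj S"
  shows "is_model R (col S F s)"
proof -
  interpret R: sketch R by fact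
  interpret S: sketch S by fact
  have I: "onArr F (Ide R r, Ide S s) = Ide P (onObj F (r, s))" if "r \<in> Obj R" for r
    using model_Ide[OF assms(3), of "(r, s)"] that assms(4) by simp
  show ?thesis
    by (rule model_agree[OF model_strict_pull[OF assms(3) strict_col_map[OF assms(1,2,4)] assms(1) sketch_tsk[OF assms(1,2)]] _ assms(1)])
      (use model_simps[OF assms(3)] assms(4) I in \<open>simp add: agree_def col_map_def\<close>)
qed

lemma tsk_onArr_split:
  assumes "sketch R" "sketch S" "is_model (tsk R S) F" "f \<in> Arr R" "g \<in> Arr S"
  shows "onArr F (f, g) = onArr F (f, Ide S (Cod S g)) \<cdot> onArr F (Ide R (Dom R f), g)"
    "onArr F (f, g) = onArr F (Ide R (Cod R f), g) \<cdot> onArr F (f, Ide S (Dom S g))"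
proof -
  interpret R: sketch R by fact
  interpret S: sketch S by fact
  show "onArr F (f, g) = onArr F (f, Ide S (Cod S g)) \<cdot> onArr F (Ide R (Dom R f), g)"
    using assms(4,5) by (subst model_Cmp[OF assms(3), symmetric]) auto
  show "onArr F (f, g) = onArr F (Ide R (Cod R f), g) \<cdot> onArr F (f, Ide S (Dom S g))"
    using assms(4,5) by (subst model_Cmp[OF assms(3), symmetric]) auto
qed

text \<open>The square for a triangle of \<open>S\<close> is naturality along \<open>h\<close>
  combined with the identity of that triangle, which is where \<open>NatR_Ide\<close>
  enters.\<close>

lemma mmor_row_arr:
  assumes "sketch R" "sketch S" "is_model (tsk R S) F" "h \<in> Arr R"
  shows "mmor S (row R F (Dom R h)) (row R F (Cod R h)) (\<lambda>s. onArr F (h, Ide S s))"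
proof -
  interpret R: sketch R by fact
  interpret S: sketch S by fact
  note F = model_simps[OF assms(3)]
  show ?thesis
    unfolding mmor_def
  proof (intro conjI ballI)
    show "onArr F (h, Ide S s) \<in> Hom P (onObj (row R F (Dom R h)) s) (onObj (row R F (Cod R h)) s)" if "s \<in> Obj S" for s
      using that assms(4) F by simp
    show "sq (onArr F (h, Ide S (Dom S f))) (onArr (row R F (Dom R h)) f) (onArr (row R F (Cod R h)) f) (onArr F (h, Ide S (Cod S f)))"
      if "f \<in> Arr S" for f
      using that assms(4) F tsk_onArr_split[OF assms(1,2,3,4) that] by (simp add: sq_def)
    show "sq (onArr F (h, Ide S (pZ S d)) \<boxplus> onArr F (h, Ide S (pX S d))) (fadd (row R F (Dom R h)) d) (fadd (row R F (Cod R h)) d)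
       (onArr F (h, Ide S (pY S d)))" if "d \<in> Tr S" for d
    proof -
      have "NatR (tsk R S) (Inr (Dom R h, d)) (Inr (Cod R h, d)) (h, Ide S (pX S d)) (h, Ide S (pY S d)) (h, Ide S (pZ S d))"
        using that assms(4) by (auto intro!: tnatR S.NatR_Ide)
      from model_nat[OF assms(3) this] show ?thesis
        using that assms(4) F by (simp add: sq_def)
    qed
  qed
qed

text \<open>Compatibility with arrows of \<open>S\<close> is naturality along the identity of
  \<open>d\<close>; compatibility with a triangle of \<open>S\<close> is \<open>ttwoLR\<close>,
  whose \<open>coas\<close> is the one contained in the sum of the two rows.\<close>

lemma mmor_row_tri:
  assumes "sketch R" "sketch S" "is_model (tsk R S) F" "d \<in> Tr R"
  shows "mmor S (msum S (row R F (pZ R d)) (row R F (pX R d))) (row R F (pY R d)) (\<lambda>s. fadd F (Inl (d, s)))"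
proof -
  interpret R: sketch R by fact
  interpret S: sketch S by fact
  note F = model_simps[OF assms(3)]
  show ?thesis
    unfolding mmor_def
  proof (intro conjI ballI)
    show "fadd F (Inl (d, s)) \<in> Hom P (onObj (msum S (row R F (pZ R d)) (row R F (pX R d))) s) (onObj (row R F (pY R d)) s)"
      if "s \<in> Obj S" for s
      using that assms(4) F by simp
    show "sq (fadd F (Inl (d, Dom S f))) (onArr (msum S (row R F (pZ R d)) (row R F (pX R d))) f) (onArr (row R F (pY R d)) f)
        (fadd F (Inl (d, Cod S f)))" if "f \<in> Arr S" for f
    proof -
      have "NatR (tsk R S) (Inl (d, Dom S f)) (Inl (d, Cod S f)) (Ide R (pX R d), f) (Ide R (pY R d), f) (Ide R (pZ R d), f)"
        using that assms(4) by (auto intro!: tnatL R.NatR_Ide)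
      from model_nat[OF assms(3) this] show ?thesis
        using that assms(4) F by (simp add: sq_def)
    qed
    show "sq (fadd F (Inl (d, pZ S e)) \<boxplus> fadd F (Inl (d, pX S e))) (fadd (msum S (row R F (pZ R d)) (row R F (pX R d))) e)
       (fadd (row R F (pY R d)) e) (fadd F (Inl (d, pY S e)))" if "e \<in> Tr S" for e
    proof -
      have "TwoR (tsk R S) (Inl (d, pZ S e)) (Inl (d, pX S e)) (Inl (d, pY S e)) (Inr (pZ R d, e)) (Inr (pX R d, e)) (Inr (pY R d, e))"
        using that assms(4) by (auto intro: ttwoLR)
      from model_two[OF assms(3) this] show ?thesis
        using that assms(4) F by (simp add: sq_def tri_sum_def)
    qed
  qed
qed

text \<open>The converse: rows, columns, and morphisms of rows for the arrows and triangles of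
  \<open>R\<close> suffice. All mixed relations are obtained from the squares of these
  morphisms.\<close>

lemma tsk_modelI:
  assumes "sketch R" "sketch S"
    and F: "is_data (tsk R S) F"
    and split: "\<And>f g. \<lbrakk>f \<in> Arr R; g \<in> Arr S\<rbrakk> \<Longrightarrow> onArr F (f, g) = onArr F (f, Ide S (Cod S g)) \<cdot> onArr F (Ide R (Dom R f), g)"
    and rowm: "\<And>r. r \<in> Obj R \<Longrightarrow> is_model S (row R F r)"
    and colm: "\<And>s. s \<in> Obj S \<Longrightarrow> is_model R (col S F s)"
    and arr: "\<And>h. h \<in> Arr R \<Longrightarrow> mmor S (row R F (Dom R h)) (row R F (Cod R h)) (\<lambda>s. onArr F (h, Ide S s))"
    and tri: "\<And>d. d \<in> Tr R \<Longrightarrow> mmor S (msum S (row R F (pZ R d)) (row R F (pX R d))) (row R F (pY R d)) (\<lambda>s. fadd F (Inl (d, s)))"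
  shows "is_model (tsk R S) F"
proof -
  interpret R: sketch R by fact
  interpret S: sketch S by fact
  interpret T: sketch "tsk R S" by (rule sketch_tsk[OF assms(1,2)])
  note t = data_simps[OF F]
  \<comment> \<open>Functoriality on pairs needs the two orders of moving the variables to agree,
    and that is naturality of the morphism of rows given by \<open>f\<close>.\<close>
  have comm: "onArr F (f, Ide S (Cod S g)) \<cdot> onArr F (Ide R (Dom R f), g) = onArr F (Ide R (Cod R f), g) \<cdot> onArr F (f, Ide S (Dom S g))"
    if "f \<in> Arr R" "g \<in> Arr S" for f g
    using mmorD(4)[OF arr[OF that(1)] that(2)] by (simp add: sq_def)
  show ?thesis
  proof (rule is_modelI[OF F T.category_axioms])
    fix a assume "a \<in> Obj (tsk R S)"
    then show "onArr F (Ide (tsk R S) a) = Ide P (onObj F a)"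
      using model_Ide[OF rowm] by (cases a) auto
  next
    fix u v assume uv: "u \<in> Arr (tsk R S)" "v \<in> Arr (tsk R S)" "Dom (tsk R S) v = Cod (tsk R S) u"
    obtain f g f' g' where u: "u = (f, g)" and v: "v = (f', g')"
      by (cases u, cases v)
    have a: "f \<in> Arr R" "g \<in> Arr S" "f' \<in> Arr R" "g' \<in> Arr S" "Dom R f' = Cod R f" "Dom S g' = Cod S g"
      using uv by (auto simp: u v)
    have "onArr F (f' \<cdot>\<^bsub>R\<^esub> f, g' \<cdot>\<^bsub>S\<^esub> g) = onArr F (f' \<cdot>\<^bsub>R\<^esub> f, Ide S (Cod S g')) \<cdot> onArr F (Ide R (Dom R f), g' \<cdot>\<^bsub>S\<^esub> g)"
      using a by (subst split) auto
    also have "onArr F (f' \<cdot>\<^bsub>R\<^esub> f, Ide S (Cod S g')) = onArr F (f', Ide S (Cod S g')) \<cdot> onArr F (f, Ide S (Cod S g'))"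
      using a model_Cmp[OF colm, of "Cod S g'" f f'] by simp
    also have "onArr F (Ide R (Dom R f), g' \<cdot>\<^bsub>S\<^esub> g) = onArr F (Ide R (Dom R f), g') \<cdot> onArr F (Ide R (Dom R f), g)"
      using a model_Cmp[OF rowm, of "Dom R f" g g'] by simp
    also have "(onArr F (f', Ide S (Cod S g')) \<cdot> onArr F (f, Ide S (Cod S g'))) \<cdot> (onArr F (Ide R (Dom R f), g') \<cdot> onArr F (Ide R (Dom R f), g))
      = onArr F (f', Ide S (Cod S g')) \<cdot> ((onArr F (f, Ide S (Cod S g')) \<cdot> onArr F (Ide R (Dom R f), g')) \<cdot> onArr F (Ide R (Dom R f), g))"
      using a t by simp
    also have "\<dots> = onArr F (f', Ide S (Cod S g')) \<cdot> ((onArr F (Ide R (Cod R f), g') \<cdot> onArr F (f, Ide S (Dom S g'))) \<cdot> onArr F (Ide R (Dom R f), g))"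
      using a comm by simp
    also have "\<dots> = onArr F (f', g') \<cdot> onArr F (f, g)"
      using a t split[of f g] split[of f' g'] by simp
    finally show "onArr F (v \<cdot>\<^bsub>tsk R S\<^esub> u) = onArr F v \<cdot> onArr F u"
      by (simp add: u v)
  next
    fix d d' f g h assume "NatR (tsk R S) d d' f g h"
    then have "tnat R S d d' f g h" by simp
    then show "fadd F d' \<cdot> (onArr F h \<boxplus> onArr F f) = onArr F g \<cdot> fadd F d"
    proof cases
      case (tnatL e e' f' g' h' k s s')
      note n = R.NatR_in[OF tnatL(6)]
      have k: "k \<in> Arr S" "Dom S k = s" "Cod S k = s'"
        using tnatL by auto
      \<comment> \<open>A relation that changes the triangle and moves the other variable by
        \<open>k\<close> is pasted from the relation in a column and the morphism of rows belonging
        to the triangle.\<close>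
      have 1: "fadd F (Inl (e', s')) \<cdot> (onArr F (h', Ide S s') \<boxplus> onArr F (f', Ide S s')) = onArr F (g', Ide S s') \<cdot> fadd F (Inl (e, s'))"
        using model_nat[OF colm tnatL(6), of s'] k by auto
      have 2: "fadd F (Inl (e, s')) \<cdot> (onArr F (Ide R (pZ R e), k) \<boxplus> onArr F (Ide R (pX R e), k)) = onArr F (Ide R (pY R e), k) \<cdot> fadd F (Inl (e, s))"
        using mmorD(4)[OF tri[of e] k(1)] n k by (simp add: sq_def)
      have "fadd F (Inl (e', s')) \<cdot> (onArr F (h', k) \<boxplus> onArr F (f', k))
         = (fadd F (Inl (e', s')) \<cdot> (onArr F (h', Ide S s') \<boxplus> onArr F (f', Ide S s')))
            \<cdot> (onArr F (Ide R (pZ R e), k) \<boxplus> onArr F (Ide R (pX R e), k))"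
        using n k tnatL t by (simp add: split[of h' k] split[of f' k] interchange)
      also have "\<dots> = onArr F (g', Ide S s') \<cdot> (fadd F (Inl (e, s')) \<cdot> (onArr F (Ide R (pZ R e), k) \<boxplus> onArr F (Ide R (pX R e), k)))"
        unfolding 1 using n k tnatL(8,9) t by simp
      also have "\<dots> = onArr F (g', k) \<cdot> fadd F (Inl (e, s))"
        unfolding 2 using n k tnatL(8,9) t by (simp add: split[of g' k])
      finally show ?thesis using tnatL by simp
    next
      case (tnatR e e' f' g' h' k r r')
      note n = S.NatR_in[OF tnatR(6)]
      have k: "k \<in> Arr R" "Dom R k = r" "Cod R k = r'"
        using tnatR by auto
      have 1: "fadd F (Inr (r, e')) \<cdot> (onArr F (Ide R r, h') \<boxplus> onArr F (Ide R r, f')) = onArr F (Ide R r, g') \<cdot> fadd F (Inr (r, e))"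
        using model_nat[OF rowm tnatR(6), of r] k by auto
      have 2: "fadd F (Inr (r', e')) \<cdot> (onArr F (k, Ide S (pZ S e')) \<boxplus> onArr F (k, Ide S (pX S e'))) = onArr F (k, Ide S (pY S e')) \<cdot> fadd F (Inr (r, e'))"
        using mmorD(5)[OF arr[of k], of e'] n k by (simp add: sq_def)
      have "fadd F (Inr (r', e')) \<cdot> (onArr F (k, h') \<boxplus> onArr F (k, f'))
         = (fadd F (Inr (r', e')) \<cdot> (onArr F (k, Ide S (pZ S e')) \<boxplus> onArr F (k, Ide S (pX S e'))))
            \<cdot> (onArr F (Ide R r, h') \<boxplus> onArr F (Ide R r, f'))"
        using n k tnatR t by (simp add: split[of k h'] split[of k f'] interchange)
      also have "\<dots> = onArr F (k, Ide S (pY S e')) \<cdot> (fadd F (Inr (r, e')) \<cdot> (onArr F (Ide R r, h') \<boxplus> onArr F (Ide R r, f')))"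
        unfolding 2 using n k tnatR(8,9) t by simp
      also have "\<dots> = onArr F (k, g') \<cdot> fadd F (Inr (r, e))"
        unfolding 1 using n k tnatR(8,9) t by (simp add: split[of k g'])
      finally show ?thesis using tnatR by simp
    qed
  next
    fix d d' g assume "ComR (tsk R S) d d' g"
    then have "tcom R S d d' g" by simp
    then show "onArr F g \<cdot> fadd F d' = fadd F d \<cdot> symm P (onObj F (pZ (tsk R S) d')) (onObj F (pX (tsk R S) d'))"
    proof cases
      case (tcomL e e' g' s)
      then show ?thesis using model_com[OF colm[OF tcomL(5)] tcomL(4)] by simp
    next
      case (tcomR e e' g' r)
      then show ?thesis using model_com[OF rowm[OF tcomR(5)] tcomR(4)] by simp
    qed
  next
    fix d1 d2 d3 d4 g assume "AssR (tsk R S) d1 d2 d3 d4 g"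
    then have "tass R S d1 d2 d3 d4 g" by simp
    then show "onArr F g \<cdot> (fadd F d2 \<cdot> (fadd F d4 \<boxplus> Ide P (onObj F (pX (tsk R S) d1))))
      = fadd F d3 \<cdot> ((Ide P (onObj F (pZ (tsk R S) d3)) \<boxplus> fadd F d1)
         \<cdot> assoc P (onObj F (pZ (tsk R S) d3)) (onObj F (pZ (tsk R S) d1)) (onObj F (pX (tsk R S) d1)))"
    proof cases
      case (tassL e1 e2 e3 e4 g' s)
      then show ?thesis using model_ass[OF colm[OF tassL(7)] tassL(6)] by simp
    next
      case (tassR e1 e2 e3 e4 g' r)
      then show ?thesis using model_ass[OF rowm[OF tassR(7)] tassR(6)] by simp
    qed
  next
    fix az ax ay bz bx "by" assume "TwoR (tsk R S) az ax ay bz bx by"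
    then have "ttwo R S az ax ay bz bx by" by simp
    then show "fadd F by \<cdot> (fadd F az \<boxplus> fadd F ax)
      = fadd F ay \<cdot> ((fadd F bz \<boxplus> fadd F bx)
         \<cdot> coas P (onObj F (pZ (tsk R S) az)) (onObj F (pX (tsk R S) az)) (onObj F (pZ (tsk R S) ax)) (onObj F (pX (tsk R S) ax)))"
    proof cases
      case (ttwoL az' ax' ay' bz' bx' by' s)
      then show ?thesis using model_two[OF colm[OF ttwoL(8)] ttwoL(7)] by simp
    next
      case (ttwoR az' ax' ay' bz' bx' by' r)
      then show ?thesis using model_two[OF rowm[OF ttwoR(8)] ttwoR(7)] by simp
    next
      case (ttwoLR d e)
      then show ?thesis using mmorD(5)[OF tri[OF ttwoLR(7)] ttwoLR(8)] t by (simp add: sq_def tri_sum_def)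
    next
      case (ttwoRL d e)
      \<comment> \<open>The reversed relation is the square for \<open>d\<close> and
        \<open>e\<close> composed with the inverse \<open>coas\<close>.\<close>
      let ?c = "coas P (onObj F (pZ R d, pZ S e)) (onObj F (pX R d, pZ S e)) (onObj F (pZ R d, pX S e)) (onObj F (pX R d, pX S e))"
      have "fadd F (Inl (d, pY S e)) \<cdot> ((fadd F (Inr (pZ R d, e)) \<boxplus> fadd F (Inr (pX R d, e))) \<cdot> ?c)
        = fadd F (Inr (pY R d, e)) \<cdot> (fadd F (Inl (d, pZ S e)) \<boxplus> fadd F (Inl (d, pX S e)))"
        using mmorD(5)[OF tri[OF ttwoRL(7)] ttwoRL(8)] t ttwoRL(7,8) by (simp add: sq_def tri_sum_def)
      then have "fadd F (Inr (pY R d, e)) \<cdot> ((fadd F (Inl (d, pZ S e)) \<boxplus> fadd F (Inl (d, pX S e)))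
          \<cdot> coas P (onObj F (pZ R d, pZ S e)) (onObj F (pZ R d, pX S e)) (onObj F (pX R d, pZ S e)) (onObj F (pX R d, pX S e)))
        = (fadd F (Inl (d, pY S e)) \<cdot> ((fadd F (Inr (pZ R d, e)) \<boxplus> fadd F (Inr (pX R d, e))) \<cdot> ?c))
          \<cdot> coas P (onObj F (pZ R d, pZ S e)) (onObj F (pZ R d, pX S e)) (onObj F (pX R d, pZ S e)) (onObj F (pX R d, pX S e))"
        using t ttwoRL(7,8) by simp
      also have "\<dots> = fadd F (Inl (d, pY S e)) \<cdot> (fadd F (Inr (pZ R d, e)) \<boxplus> fadd F (Inr (pX R d, e)))"
        using t ttwoRL(7,8) by simp
      finally show ?thesis using ttwoRL by simp
    qed
  qed
qed

lemma mmor_row: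
  assumes "sketch R" "sketch S" "is_model (tsk R S) G" "is_model (tsk R S) H" "mmor (tsk R S) G H \<theta>" "r \<in> Obj R"
  shows "mmor S (row R G r) (row R H r) (\<lambda>s. \<theta> (r, s))"
proof -
  interpret R: sketch R by fact
  interpret S: sketch S by fact
  note t = mmorD[OF assms(5)]
  show ?thesis
    unfolding mmor_def using t(1-3) t(4)[of "(Ide R r, _)"] t(5)[of "Inr (r, _)"] assms(6) by simp
qed

text \<open>Every arrow is an arrow of a row followed by one of a column, so naturality need only be
  tested on these two kinds.\<close>

lemma tsk_mmorI:
  assumes "sketch R" "sketch S" "is_model (tsk R S) G" "is_model (tsk R S) H"
    and row: "\<And>r. r \<in> Obj R \<Longrightarrow> mmor S (row R G r) (row R H r) (\<lambda>s. \<theta> (r, s))"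
    and arr: "\<And>h s. \<lbrakk>h \<in> Arr R; s \<in> Obj S\<rbrakk> \<Longrightarrow>
      \<theta> (Cod R h, s) \<cdot> onArr G (h, Ide S s) = onArr H (h, Ide S s) \<cdot> \<theta> (Dom R h, s)"
    and tri: "\<And>d s. \<lbrakk>d \<in> Tr R; s \<in> Obj S\<rbrakk> \<Longrightarrow>
      \<theta> (pY R d, s) \<cdot> fadd G (Inl (d, s)) = fadd H (Inl (d, s)) \<cdot> (\<theta> (pZ R d, s) \<boxplus> \<theta> (pX R d, s))"
  shows "mmor (tsk R S) G H \<theta>"
proof -
  interpret R: sketch R by fact
  interpret S: sketch S by fact
  note G = model_simps[OF assms(3)] and H = model_simps[OF assms(4)]
  have \<theta>: "\<theta> (r, s) \<in> Arr P" "Dom P (\<theta> (r, s)) = onObj G (r, s)" "Cod P (\<theta> (r, s)) = onObj H (r, s)"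
    if "r \<in> Obj R" "s \<in> Obj S" for r s
    using mmorD(1-3)[OF row[OF that(1)] that(2)] by auto
  show ?thesis
    unfolding mmor_def
  proof (intro conjI ballI)
    show "\<theta> a \<in> Hom P (onObj G a) (onObj H a)" if "a \<in> Obj (tsk R S)" for a
      using that \<theta> by (cases a) auto
    show "sq (\<theta> (Dom (tsk R S) u)) (onArr G u) (onArr H u) (\<theta> (Cod (tsk R S) u))" if "u \<in> Arr (tsk R S)" for u
    proof -
      obtain f g where u: "u = (f, g)" by (cases u)
      have fg: "f \<in> Arr R" "g \<in> Arr S" using that u by auto
      have 1: "sq (\<theta> (Dom R f, Dom S g)) (onArr G (Ide R (Dom R f), g)) (onArr H (Ide R (Dom R f), g)) (\<theta> (Dom R f, Cod S g))"
        using mmorD(4)[OF row fg(2), of "Dom R f"] fg by simp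
      have 2: "sq (\<theta> (Dom R f, Cod S g)) (onArr G (f, Ide S (Cod S g))) (onArr H (f, Ide S (Cod S g))) (\<theta> (Cod R f, Cod S g))"
        using arr[OF fg(1), of "Cod S g"] fg \<theta> G H by (simp add: sq_def)
      show ?thesis
        using sq_Cmp[OF 1 2] fg tsk_onArr_split(1)[OF assms(1,2,3) fg] tsk_onArr_split(1)[OF assms(1,2,4) fg]
        by (simp add: u)
    qed
    show "sq (\<theta> (pZ (tsk R S) d) \<boxplus> \<theta> (pX (tsk R S) d)) (fadd G d) (fadd H d) (\<theta> (pY (tsk R S) d))" if "d \<in> Tr (tsk R S)" for d
      using that
    proof (cases rule: tsk_TrE)
      case (1 e s)
      then show ?thesis using tri[of e s] \<theta> G H by (simp add: sq_def)
    next
      case (2 r e)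
      then show ?thesis using mmorD(5)[OF row[OF 2(2)] 2(3)] by simp
    qed
  qed
qed

end

definition right_map :: "('a, 'b, 't) sketch \<Rightarrow> ('e, 'f, 'v) sketch \<Rightarrow> ('c, 'd, 'e, 'f, 'u, 'v) smap
    \<Rightarrow> ('a \<times> 'c, 'b \<times> 'd, 'a \<times> 'e, 'b \<times> 'f, 't \<times> 'c + 'a \<times> 'u, 't \<times> 'e + 'a \<times> 'v) smap" where
  "right_map R B J = \<lparr>onObj = map_prod id (onObj J), onArr = map_prod id (onArr J),
     jT = map_sum (map_prod id (onObj J)) (map_prod id (jT J)),
     jA = case_sum (\<lambda>(d, s). (Ide R (pY R d), Ide B (onObj J s))) (\<lambda>(r, e). (Ide R r, jA J e))\<rparr>"

lemma right_map_sel [simp]: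
  "onObj (right_map R B J) (r, s) = (r, onObj J s)" "onArr (right_map R B J) (f, g) = (f, onArr J g)"
  "jT (right_map R B J) (Inl (d, s)) = Inl (d, onObj J s)" "jT (right_map R B J) (Inr (r, e)) = Inr (r, jT J e)"
  "jA (right_map R B J) (Inl (d, s)) = (Ide R (pY R d), Ide B (onObj J s))" "jA (right_map R B J) (Inr (r, e)) = (Ide R r, jA J e)"
  by (simp_all add: right_map_def)

lemma is_smap_right:
  assumes "sketch R" "sketch A" "sketch B" "is_smap A B J"
  shows "is_smap (tsk R A) (tsk R B) (right_map R B J)"
proof -
  interpret R: sketch R by fact
  interpret A: sketch A by fact
  interpret B: sketch B by fact
  note J = smap_simps[OF assms(4)]
  show ?thesis
    unfolding is_smap_def is_functor_def
    by (auto simp: J elim!: tsk_TrE)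
qed

section \<open>An equivalence in the second variable, the first one being kept\<close>

context picard_groupoid
begin

lemma agree_msum:
  assumes "agree S F F'" "agree S G G'" "sketch S"
  shows "agree S (msum S F G) (msum S F' G')"
proof -
  interpret S: sketch S by fact
  show ?thesis using assms(1,2) by (simp add: agree_def)
qed

lemma agree_sym: "agree S F G \<Longrightarrow> agree S G F"
  by (simp add: agree_def)

lemma row_pull_right [simp]: "row R (pull G (right_map R B J)) r = pull (row R G r) J"
  by (simp add: row_def pull_def)

lemma model_Ide_tsk:
  assumes "is_model (tsk R S) F" "r \<in> Obj R" "s \<in> Obj S"
  shows "onArr F (Ide R r, Ide S s) = Ide P (onObj F (r, s))"
  using model_Ide[OF assms(1), of "(r, s)"] assms(2,3) by simp

lemma col_pull_right:
  assumes "sketch R" "sketch A" "sketch B" "is_smap A B J" "is_model (tsk R B) G" "s \<in> Obj A"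
  shows "agree R (col B G (onObj J s)) (col A (pull G (right_map R B J)) s)"
proof -
  interpret R: sketch R by fact
  interpret A: sketch A by fact
  interpret B: sketch B by fact
  show ?thesis
    using smap_simps[OF assms(4)] model_simps[OF assms(5)] assms(6)
    by (auto simp: agree_def model_Ide_tsk[OF assms(5)])
qed

text \<open>Rows pull back by the hypothesis on \<open>J\<close>, and the columns of the pulled back
  model agree with columns of \<open>G\<close>. The morphisms of rows pull back too, since pulling
  back commutes with pointwise sums.\<close>

lemma right_pull_model:
  assumes "requiv A B J" "sketch R" "is_model (tsk R B) G"
  shows "is_model (tsk R A) (pull G (right_map R B J))"
proof -
  note E = requivD[OF assms(1)]
  interpret R: sketch R by fact
  interpret A: sketch A by (rule E(1))
  interpret B: sketch B by (rule E(2))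
  note J = smap_simps[OF E(3)] and G = model_simps[OF assms(3)]
  let ?G = "pull G (right_map R B J)"
  show ?thesis
  proof (rule tsk_modelI[OF assms(2) E(1)])
    show "is_data (tsk R A) ?G"
      by (rule data_pull[OF model_data[OF assms(3)] is_smap_right[OF assms(2) E(1-3)]
            sketch_tsk[OF assms(2) E(1)] sketch_tsk[OF assms(2) E(2)]])
    show "onArr ?G (f, g) = onArr ?G (f, Ide A (Cod A g)) \<cdot> onArr ?G (Ide R (Dom R f), g)"
      if "f \<in> Arr R" "g \<in> Arr A" for f g
      using tsk_onArr_split(1)[OF assms(2) E(2) assms(3), of f "onArr J g"] that J by simp
    show "is_model A (row R ?G r)" if "r \<in> Obj R" for r
      using E(4)[OF row_model[OF assms(2) E(2) assms(3) that]] by simp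
    show "is_model R (col A ?G s)" if "s \<in> Obj A" for s
      by (rule model_agree[OF col_model[OF assms(2) E(2) assms(3)] col_pull_right[OF assms(2) E(1-3) assms(3) that] assms(2)])
        (use that J in simp)
    show "mmor A (row R ?G (Dom R h)) (row R ?G (Cod R h)) (\<lambda>s. onArr ?G (h, Ide A s))" if "h \<in> Arr R" for h
    proof -
      have "mmor A (pull (row R G (Dom R h)) J) (pull (row R G (Cod R h)) J) (\<lambda>s. onArr G (h, Ide B (onObj J s)))"
        using that by (intro mmor_pull[OF mmor_row_arr[OF assms(2) E(2) assms(3)]] model_data row_model[OF assms(2) E(2) assms(3)] E) auto
      then show ?thesis
        unfolding row_pull_right by (rule mmor_cong) (use J E in simp_all)
    qed
    show "mmor A (msum A (row R ?G (pZ R d)) (row R ?G (pX R d))) (row R ?G (pY R d)) (\<lambda>s. fadd ?G (Inl (d, s)))" if "d \<in> Tr R" for d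
    proof -
      have o: "pX R d \<in> Obj R" "pY R d \<in> Obj R" "pZ R d \<in> Obj R"
        using that by auto
      note rm = row_model[OF assms(2) E(2) assms(3)]
      have "mmor A (pull (msum B (row R G (pZ R d)) (row R G (pX R d))) J) (pull (row R G (pY R d)) J) (\<lambda>s. fadd G (Inl (d, onObj J s)))"
        using that by (intro mmor_pull[OF mmor_row_tri[OF assms(2) E(2) assms(3)]] data_msum model_data rm E) auto
      from mmor_agree[OF this pull_msum[OF model_data[OF rm[OF o(3)]] model_data[OF rm[OF o(1)]] E(3,1,2)] agree_refl]
      show ?thesis
        unfolding row_pull_right
        by (rule mmor_cong) (use J E G that in \<open>simp_all add: model_Ide_tsk[OF assms(3)]\<close>)
    qed
  qed
qed

lemma right_unique:
  assumes "requiv A B J" "sketch R" "is_model (tsk R B) G" "is_model (tsk R B) H"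
    "mmor (tsk R B) G H \<eta>" "mmor (tsk R B) G H \<eta>'"
    "\<And>a. a \<in> Obj (tsk R A) \<Longrightarrow> \<eta> (onObj (right_map R B J) a) = \<eta>' (onObj (right_map R B J) a)" "b \<in> Obj (tsk R B)"
  shows "\<eta> b = \<eta>' b"
proof -
  note E = requivD[OF assms(1)]
  obtain r v where b: "b = (r, v)" "r \<in> Obj R" "v \<in> Obj B"
    using assms(8) by (cases b) auto
  show ?thesis
    unfolding b(1)
    by (rule E(7)[OF row_model[OF assms(2) E(2) assms(3) b(2)] row_model[OF assms(2) E(2) assms(4) b(2)]
        mmor_row[OF assms(2) E(2) assms(3,4,5) b(2)] mmor_row[OF assms(2) E(2) assms(3,4,6) b(2)] _ b(3)])
      (use assms(7)[of "(r, _)"] b(2) in simp)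
qed

text \<open>Row by row \<open>\<theta>\<close> extends along \<open>J\<close>. Compatibility of the
  extensions with an arrow or a triangle of \<open>R\<close> equates two morphisms of models on
  \<open>B\<close>, and these agree on the image of \<open>J\<close> because \<open>\<theta>\<close>
  is a morphism.\<close>

lemma right_full:
  assumes "requiv A B J" "sketch R" "is_model (tsk R B) G" "is_model (tsk R B) H"
    "mmor (tsk R A) (pull G (right_map R B J)) (pull H (right_map R B J)) \<theta>"
  shows "\<exists>\<eta>. mmor (tsk R B) G H \<eta> \<and> (\<forall>a\<in>Obj (tsk R A). \<eta> (onObj (right_map R B J) a) = \<theta> a)"
proof -
  note E = requivD[OF assms(1)]
  interpret R: sketch R by fact
  interpret A: sketch A by (rule E(1))
  interpret B: sketch B by (rule E(2))
  note J = smap_simps[OF E(3)] and G = model_simps[OF assms(3)] and H = model_simps[OF assms(4)]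
  note rG = row_model[OF assms(2) E(2) assms(3)] and rH = row_model[OF assms(2) E(2) assms(4)]
  note pG = right_pull_model[OF assms(1,2,3)] and pH = right_pull_model[OF assms(1,2,4)]
  note \<theta> = mmorD[OF assms(5)]
  have "\<exists>\<eta>. mmor B (row R G r) (row R H r) \<eta> \<and> (\<forall>s\<in>Obj A. \<eta> (onObj J s) = \<theta> (r, s))" if "r \<in> Obj R" for r
    using E(6)[OF rG[OF that] rH[OF that] mmor_row[OF assms(2) E(1) pG pH assms(5) that, unfolded row_pull_right]] .
  then obtain \<eta> where \<eta>: "\<And>r. r \<in> Obj R \<Longrightarrow> mmor B (row R G r) (row R H r) (\<eta> r)"
    and \<eta>J: "\<And>r s. \<lbrakk>r \<in> Obj R; s \<in> Obj A\<rbrakk> \<Longrightarrow> \<eta> r (onObj J s) = \<theta> (r, s)"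
    by metis
  have "mmor (tsk R B) G H (\<lambda>(r, v). \<eta> r v)"
  proof (rule tsk_mmorI[OF assms(2) E(2) assms(3,4)])
    show "mmor B (row R G r) (row R H r) (\<lambda>s. (\<lambda>(r, v). \<eta> r v) (r, s))" if "r \<in> Obj R" for r
      using \<eta>[OF that] by simp
  next
    fix h v assume h: "h \<in> Arr R" and v: "v \<in> Obj B"
    have "\<eta> (Cod R h) v \<cdot> onArr G (h, Ide B v) = onArr H (h, Ide B v) \<cdot> \<eta> (Dom R h) v"
    proof (rule E(7)[OF rG rH mmor_Cmp[OF mmor_row_arr[OF assms(2) E(2) assms(3) h] \<eta> E(2)]
          mmor_Cmp[OF \<eta> mmor_row_arr[OF assms(2) E(2) assms(4) h] E(2)] _ v])
      fix s assume "s \<in> Obj A"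
      then show "\<eta> (Cod R h) (onObj J s) \<cdot> onArr G (h, Ide B (onObj J s)) = onArr H (h, Ide B (onObj J s)) \<cdot> \<eta> (Dom R h) (onObj J s)"
        using \<theta>(4)[of "(h, Ide A s)"] h J by (simp add: \<eta>J sq_def)
    qed (use h in auto)
    then show "(\<lambda>(r, v). \<eta> r v) (Cod R h, v) \<cdot> onArr G (h, Ide B v) = onArr H (h, Ide B v) \<cdot> (\<lambda>(r, v). \<eta> r v) (Dom R h, v)"
      by simp
  next
    fix d v assume d: "d \<in> Tr R" and v: "v \<in> Obj B"
    have o: "pX R d \<in> Obj R" "pY R d \<in> Obj R" "pZ R d \<in> Obj R"
      using d by auto
    have 1: "mmor B (msum B (row R G (pZ R d)) (row R G (pX R d))) (row R H (pY R d)) (\<lambda>v. \<eta> (pY R d) v \<cdot> fadd G (Inl (d, v)))"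
      by (rule mmor_Cmp[OF mmor_row_tri[OF assms(2) E(2) assms(3) d] \<eta> E(2)]) (use o in auto)
    have 2: "mmor B (msum B (row R G (pZ R d)) (row R G (pX R d))) (row R H (pY R d))
        (\<lambda>v. fadd H (Inl (d, v)) \<cdot> (\<eta> (pZ R d) v \<boxplus> \<eta> (pX R d) v))"
      by (rule mmor_Cmp[OF mmor_msum[OF model_data[OF rG] model_data[OF rG] model_data[OF rH] model_data[OF rH] E(2) \<eta> \<eta>]
            mmor_row_tri[OF assms(2) E(2) assms(4) d] E(2)]) (use o in auto)
    \<comment> \<open>Faithfulness is applied to morphisms out of a sum of rows, which is why sums
      of models must be models.\<close>
    have "\<eta> (pY R d) v \<cdot> fadd G (Inl (d, v)) = fadd H (Inl (d, v)) \<cdot> (\<eta> (pZ R d) v \<boxplus> \<eta> (pX R d) v)"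
    proof (rule E(7)[OF model_msum[OF rG rG E(2)] rH 1 2 _ v])
      fix s assume "s \<in> Obj A"
      then show "\<eta> (pY R d) (onObj J s) \<cdot> fadd G (Inl (d, onObj J s)) = fadd H (Inl (d, onObj J s)) \<cdot> (\<eta> (pZ R d) (onObj J s) \<boxplus> \<eta> (pX R d) (onObj J s))"
        using \<theta>(5)[of "Inl (d, s)"] d o J G H by (simp add: \<eta>J sq_def model_Ide_tsk[OF assms(3)] model_Ide_tsk[OF assms(4)])
    qed (use o in auto)
    then show "(\<lambda>(r, v). \<eta> r v) (pY R d, v) \<cdot> fadd G (Inl (d, v))
      = fadd H (Inl (d, v)) \<cdot> ((\<lambda>(r, v). \<eta> r v) (pZ R d, v) \<boxplus> (\<lambda>(r, v). \<eta> r v) (pX R d, v))"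
      by simp
  qed
  then show ?thesis
    using \<eta>J by (intro exI[of _ "\<lambda>(r, v). \<eta> r v"]) auto
qed

text \<open>Choose for every row a model on \<open>B\<close> whose pullback is isomorphic to it, and
  extend the arrows and triangles of \<open>R\<close>, conjugated by the chosen isomorphisms, by
  fullness. The relations of \<open>R\<close> are not built into these choices; each is an equality
  of morphisms of models on \<open>B\<close> and follows from faithfulness.\<close>

lemma right_ess_surj:
  assumes "requiv A B J" "sketch R" "is_model (tsk R A) F"
  shows "\<exists>G \<alpha>. is_model (tsk R B) G \<and> mmor (tsk R A) (pull G (right_map R B J)) F \<alpha>"
proof -
  note E = requivD[OF assms(1)]
  interpret R: sketch R by fact
  interpret A: sketch A by (rule E(1))
  interpret B: sketch B by (rule E(2))
  note J = smap_simps[OF E(3)] and F = model_simps[OF assms(3)]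
  note rF = row_model[OF assms(2) E(1) assms(3)]
  have "\<exists>d \<alpha>. is_model B d \<and> mmor A (pull d J) (row R F r) \<alpha>" if "r \<in> Obj R" for r
    by (rule E(5)[OF rF[OF that]])
  then obtain d \<alpha> where d: "\<And>r. r \<in> Obj R \<Longrightarrow> is_model B (d r)"
    and \<alpha>: "\<And>r. r \<in> Obj R \<Longrightarrow> mmor A (pull (d r) J) (row R F r) (\<alpha> r)"
    by metis
  note D = model_simps[OF d] and dd = model_data[OF d] and pd = E(4)[OF d]
  have aS: "\<alpha> r s \<in> Arr P" "Dom P (\<alpha> r s) = onObj (d r) (onObj J s)" "Cod P (\<alpha> r s) = onObj F (r, s)"
    if "r \<in> Obj R" "s \<in> Obj A" for r s
    using mmorD(1-3)[OF \<alpha>[OF that(1)] that(2)] by auto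
  \<comment> \<open>The action of \<open>h\<close> on the rows of \<open>F\<close>, carried over to
    the chosen models by \<open>\<alpha>\<close>.\<close>
  let ?\<theta>h = "\<lambda>h s. inv_arr P (\<alpha> (Cod R h) s) \<cdot> (onArr F (h, Ide A s) \<cdot> \<alpha> (Dom R h) s)"
  have "mmor A (pull (d (Dom R h)) J) (pull (d (Cod R h)) J) (?\<theta>h h)" if "h \<in> Arr R" for h
    by (rule mmor_Cmp[OF mmor_Cmp[OF \<alpha> mmor_row_arr[OF assms(2) E(1) assms(3) that] E(1)] mmor_inv[OF \<alpha> E(1)] E(1)])
      (use that in auto)
  from E(6)[OF d d this] have "\<exists>\<eta>. mmor B (d (Dom R h)) (d (Cod R h)) \<eta> \<and> (\<forall>s\<in>Obj A. \<eta> (onObj J s) = ?\<theta>h h s)"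
    if "h \<in> Arr R" for h
    using that by auto
  then obtain \<eta> where \<eta>0: "\<And>h. h \<in> Arr R \<Longrightarrow> mmor B (d (Dom R h)) (d (Cod R h)) (\<eta> h)"
    and \<eta>J: "\<And>h s. \<lbrakk>h \<in> Arr R; s \<in> Obj A\<rbrakk> \<Longrightarrow> \<eta> h (onObj J s) = ?\<theta>h h s"
    by metis
  have \<eta>: "mmor B (d a) (d b) (\<eta> h)" if "h \<in> Arr R" "Dom R h = a" "Cod R h = b" for h a b
    using \<eta>0[OF that(1)] that(2,3) by simp
  let ?\<theta>d = "\<lambda>e s. inv_arr P (\<alpha> (pY R e) s) \<cdot> (fadd F (Inl (e, s)) \<cdot> (\<alpha> (pZ R e) s \<boxplus> \<alpha> (pX R e) s))"
  have "mmor A (pull (msum B (d (pZ R e)) (d (pX R e))) J) (pull (d (pY R e)) J) (?\<theta>d e)" if e: "e \<in> Tr R" for e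
  proof -
    have o: "pX R e \<in> Obj R" "pY R e \<in> Obj R" "pZ R e \<in> Obj R"
      using e by auto
    have "mmor A (msum A (pull (d (pZ R e)) J) (pull (d (pX R e)) J)) (pull (d (pY R e)) J) (?\<theta>d e)"
      by (rule mmor_Cmp[OF mmor_Cmp[OF mmor_msum[OF model_data[OF pd] model_data[OF pd] model_data[OF rF] model_data[OF rF] E(1) \<alpha> \<alpha>]
          mmor_row_tri[OF assms(2) E(1) assms(3) e] E(1)] mmor_inv[OF \<alpha> E(1)] E(1)]) (use o in auto)
    \<comment> \<open>Fullness requires the source in the form of a pullback;
      \<open>pull_msum\<close> turns the sum of pullbacks into the pullback of the sum.\<close>
    from mmor_agree[OF this agree_sym[OF pull_msum[OF model_data[OF d[OF o(3)]] model_data[OF d[OF o(1)]] E(3,1,2)]] agree_refl]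
    show ?thesis .
  qed
  from E(6)[OF model_msum[OF d d E(2)] d this] have "\<exists>\<eta>. mmor B (msum B (d (pZ R e)) (d (pX R e))) (d (pY R e)) \<eta>
      \<and> (\<forall>s\<in>Obj A. \<eta> (onObj J s) = ?\<theta>d e s)" if "e \<in> Tr R" for e
    using that by auto
  then obtain \<zeta> where \<zeta>0: "\<And>e. e \<in> Tr R \<Longrightarrow> mmor B (msum B (d (pZ R e)) (d (pX R e))) (d (pY R e)) (\<zeta> e)"
    and \<zeta>J: "\<And>e s. \<lbrakk>e \<in> Tr R; s \<in> Obj A\<rbrakk> \<Longrightarrow> \<zeta> e (onObj J s) = ?\<theta>d e s"
    by metis
  have \<zeta>: "mmor B (msum B (d z) (d x)) (d y) (\<zeta> e)" if "e \<in> Tr R" "pZ R e = z" "pX R e = x" "pY R e = y" for e x y z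
    using \<zeta>0[OF that(1)] that(2-4) by simp
  have \<eta>S: "\<eta> h v \<in> Arr P" "Dom P (\<eta> h v) = onObj (d (Dom R h)) v" "Cod P (\<eta> h v) = onObj (d (Cod R h)) v"
    if "h \<in> Arr R" "v \<in> Obj B" for h v
    using mmorD(1-3)[OF \<eta>0[OF that(1)] that(2)] by auto
  have \<zeta>S: "\<zeta> e v \<in> Arr P" "Dom P (\<zeta> e v) = onObj (d (pZ R e)) v \<oplus> onObj (d (pX R e)) v" "Cod P (\<zeta> e v) = onObj (d (pY R e)) v"
    if "e \<in> Tr R" "v \<in> Obj B" for e v
    using mmorD(1-3)[OF \<zeta>0[OF that(1)] that(2)] by auto
  let ?C = "\<lambda>v. \<lparr>onObj = (\<lambda>r. onObj (d r) v), onArr = (\<lambda>h. \<eta> h v), fadd = (\<lambda>e. \<zeta> e v)\<rparr>"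
  have dC: "is_data R (?C v)" if "v \<in> Obj B" for v
    using that D \<eta>S \<zeta>S by (simp add: is_data_def)
  \<comment> \<open>On the image of \<open>J\<close> the columns are connected by
    \<open>\<alpha>\<close> with columns of \<open>F\<close>, hence are models.\<close>
  have mC: "is_model R (?C (onObj J s))" if s: "s \<in> Obj A" for s
  proof (rule model_transport[OF col_model[OF assms(2) E(1) assms(3) s] dC _ assms(2)])
    show "onObj J s \<in> Obj B" using J s by simp
    show "mmor R (?C (onObj J s)) (col A F s) (\<lambda>r. \<alpha> r s)"
      unfolding mmor_def
      using s aS F J D \<eta>S \<zeta>S by (auto simp: sq_def \<eta>J \<zeta>J)
  qed
  \<comment> \<open>For an arbitrary \<open>v\<close> each relation is read as an equation between
    morphisms of models on \<open>B\<close>, evaluated at \<open>v\<close>. The previous fact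
    verifies it on the image of \<open>J\<close>, and faithfulness does the rest.\<close>
  have mC: "is_model R (?C v)" if v: "v \<in> Obj B" for v
  proof (rule is_modelI[OF dC[OF v] R.category_axioms])
    fix r assume r: "r \<in> Obj R"
    have "\<eta> (Ide R r) v = Ide P (onObj (d r) v)"
      by (rule E(7)[OF d d \<eta> mmor_Ide[OF model_data[OF d] E(2)] _ v])
        (use r model_Ide[OF mC r] in auto)
    then show "onArr (?C v) (Ide R r) = Ide P (onObj (?C v) r)" by simp
  next
    fix f g assume fg: "f \<in> Arr R" "g \<in> Arr R" "Dom R g = Cod R f"
    have "\<eta> (g \<cdot>\<^bsub>R\<^esub> f) v = \<eta> g v \<cdot> \<eta> f v"
      by (rule E(7)[OF d d \<eta> mmor_Cmp[OF \<eta> \<eta> E(2)] _ v, of "Dom R f" "Cod R g"])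
        (use fg model_Cmp[OF mC fg] in auto)
    then show "onArr (?C v) (g \<cdot>\<^bsub>R\<^esub> f) = onArr (?C v) g \<cdot> onArr (?C v) f" by simp
  next
    fix e e' f g h assume n: "NatR R e e' f g h"
    note t = R.NatR_in[OF n]
    have 1: "mmor B (msum B (d (pZ R e)) (d (pX R e))) (d (pY R e')) (\<lambda>v. \<zeta> e' v \<cdot> (\<eta> h v \<boxplus> \<eta> f v))"
      using t by (intro mmor_Cmp[OF mmor_msum \<zeta> E(2)] model_data[OF d] \<eta> E(2)) auto
    have 2: "mmor B (msum B (d (pZ R e)) (d (pX R e))) (d (pY R e')) (\<lambda>v. \<eta> g v \<cdot> \<zeta> e v)"
      using t by (intro mmor_Cmp[OF \<zeta> \<eta> E(2)]) auto
    have "\<zeta> e' v \<cdot> (\<eta> h v \<boxplus> \<eta> f v) = \<eta> g v \<cdot> \<zeta> e v"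
      by (rule E(7)[OF model_msum[OF d d E(2)] d 1 2 _ v])
        (use t model_nat[OF mC n] in auto)
    then show "fadd (?C v) e' \<cdot> (onArr (?C v) h \<boxplus> onArr (?C v) f) = onArr (?C v) g \<cdot> fadd (?C v) e" by simp
  next
    fix e e' g assume c: "ComR R e e' g"
    note t = R.ComR_in[OF c]
    let ?s = "\<lambda>v. symm P (onObj (d (pZ R e')) v) (onObj (d (pX R e')) v)"
    have 1: "mmor B (msum B (d (pZ R e')) (d (pX R e'))) (d (pY R e)) (\<lambda>v. \<eta> g v \<cdot> \<zeta> e' v)"
      using t by (intro mmor_Cmp[OF \<zeta> \<eta> E(2)]) auto
    have 2: "mmor B (msum B (d (pZ R e')) (d (pX R e'))) (d (pY R e)) (\<lambda>v. \<zeta> e v \<cdot> ?s v)"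
      using t by (intro mmor_Cmp[OF mmor_symm \<zeta> E(2)] model_data[OF d] E(2)) auto
    have "\<eta> g v \<cdot> \<zeta> e' v = \<zeta> e v \<cdot> ?s v"
      by (rule E(7)[OF model_msum[OF d d E(2)] d 1 2 _ v])
        (use t model_com[OF mC c] in auto)
    then show "onArr (?C v) g \<cdot> fadd (?C v) e' = fadd (?C v) e \<cdot> symm P (onObj (?C v) (pZ R e')) (onObj (?C v) (pX R e'))" by simp
  next
    fix e1 e2 e3 e4 g assume c: "AssR R e1 e2 e3 e4 g"
    note t = R.AssR_in[OF c]
    let ?s = "\<lambda>v. assoc P (onObj (d (pZ R e3)) v) (onObj (d (pZ R e1)) v) (onObj (d (pX R e1)) v)"
    let ?M = "msum B (msum B (d (pZ R e3)) (d (pZ R e1))) (d (pX R e1))"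
    have o: "pZ R e3 \<in> Obj R" "pZ R e1 \<in> Obj R" "pX R e1 \<in> Obj R" "pY R e3 \<in> Obj R"
      using t by auto
    have 1: "mmor B ?M (d (pY R e3)) (\<lambda>v. \<eta> g v \<cdot> (\<zeta> e2 v \<cdot> (\<zeta> e4 v \<boxplus> Ide P (onObj (d (pX R e1)) v))))"
      by (rule mmor_Cmp[OF mmor_Cmp[OF mmor_msum[OF data_msum[OF dd dd E(2)] dd dd dd E(2) \<zeta> mmor_Ide[OF dd E(2)]] \<zeta> E(2)] \<eta> E(2)])
        (use t o in auto)
    have 2: "mmor B ?M (d (pY R e3)) (\<lambda>v. \<zeta> e3 v \<cdot> ((Ide P (onObj (d (pZ R e3)) v) \<boxplus> \<zeta> e1 v) \<cdot> ?s v))"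
      by (rule mmor_Cmp[OF mmor_Cmp[OF mmor_assoc[OF dd dd dd E(2)]
            mmor_msum[OF dd data_msum[OF dd dd E(2)] dd dd E(2) mmor_Ide[OF dd E(2)] \<zeta>] E(2)] \<zeta> E(2)])
        (use t o in auto)
    have "\<eta> g v \<cdot> (\<zeta> e2 v \<cdot> (\<zeta> e4 v \<boxplus> Ide P (onObj (d (pX R e1)) v)))
      = \<zeta> e3 v \<cdot> ((Ide P (onObj (d (pZ R e3)) v) \<boxplus> \<zeta> e1 v) \<cdot> ?s v)"
      by (rule E(7)[OF model_msum[OF model_msum[OF d d E(2)] d E(2)] d 1 2 _ v])
        (use o model_ass[OF mC c] in auto)
    then show "onArr (?C v) g \<cdot> (fadd (?C v) e2 \<cdot> (fadd (?C v) e4 \<boxplus> Ide P (onObj (?C v) (pX R e1))))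
      = fadd (?C v) e3 \<cdot> ((Ide P (onObj (?C v) (pZ R e3)) \<boxplus> fadd (?C v) e1)
         \<cdot> assoc P (onObj (?C v) (pZ R e3)) (onObj (?C v) (pZ R e1)) (onObj (?C v) (pX R e1)))" by simp
  next
    fix az ax ay bz bx "by" assume c: "TwoR R az ax ay bz bx by"
    note t = R.TwoR_in[OF c]
    let ?s = "\<lambda>v. coas P (onObj (d (pZ R az)) v) (onObj (d (pX R az)) v) (onObj (d (pZ R ax)) v) (onObj (d (pX R ax)) v)"
    let ?M = "msum B (msum B (d (pZ R az)) (d (pX R az))) (msum B (d (pZ R ax)) (d (pX R ax)))"
    have o: "pZ R az \<in> Obj R" "pX R az \<in> Obj R" "pZ R ax \<in> Obj R" "pX R ax \<in> Obj R" "pY R by \<in> Obj R"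
      using t by auto
    have 1: "mmor B ?M (d (pY R by)) (\<lambda>v. \<zeta> by v \<cdot> (\<zeta> az v \<boxplus> \<zeta> ax v))"
      using t o by (intro mmor_Cmp[OF mmor_msum \<zeta> E(2)] data_msum model_data[OF d] \<zeta> E(2)) auto
    have 2: "mmor B ?M (d (pY R by)) (\<lambda>v. \<zeta> ay v \<cdot> ((\<zeta> bz v \<boxplus> \<zeta> bx v) \<cdot> ?s v))"
      using t o by (intro mmor_Cmp[OF mmor_Cmp[OF mmor_coas mmor_msum E(2)] \<zeta> E(2)] data_msum model_data[OF d] \<zeta> E(2)) auto
    have "\<zeta> by v \<cdot> (\<zeta> az v \<boxplus> \<zeta> ax v) = \<zeta> ay v \<cdot> ((\<zeta> bz v \<boxplus> \<zeta> bx v) \<cdot> ?s v)"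
      by (rule E(7)[OF model_msum[OF model_msum[OF d d E(2)] model_msum[OF d d E(2)] E(2)] d 1 2 _ v])
        (use o model_two[OF mC c] in auto)
    then show "fadd (?C v) by \<cdot> (fadd (?C v) az \<boxplus> fadd (?C v) ax)
      = fadd (?C v) ay \<cdot> ((fadd (?C v) bz \<boxplus> fadd (?C v) bx)
         \<cdot> coas P (onObj (?C v) (pZ R az)) (onObj (?C v) (pX R az)) (onObj (?C v) (pZ R ax)) (onObj (?C v) (pX R ax)))" by simp
  qed
  \<comment> \<open>An arrow moving both variables must be assigned in one of two orders; the order
    chosen is that of the splitting hypothesis of \<open>tsk_modelI\<close>.\<close>
  define G where "G = \<lparr>onObj = (\<lambda>(r, v). onObj (d r) v), onArr = (\<lambda>(h, g). \<eta> h (Cod B g) \<cdot> onArr (d (Dom R h)) g),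
    fadd = case_sum (\<lambda>(e, v). \<zeta> e v) (\<lambda>(r, e). fadd (d r) e)\<rparr>"
  have Gs: "onObj G (r, v) = onObj (d r) v" "onArr G (h, g) = \<eta> h (Cod B g) \<cdot> onArr (d (Dom R h)) g"
    "fadd G (Inl (e, v)) = \<zeta> e v" "fadd G (Inr (r, u)) = fadd (d r) u" for r v h g e u
    by (simp_all add: G_def)
  have \<eta>I: "\<eta> (Ide R r) v = Ide P (onObj (d r) v)" if "r \<in> Obj R" "v \<in> Obj B" for r v
    using model_Ide[OF mC[OF that(2)] that(1)] by simp
  have dI: "onArr (d r) (Ide B v) = Ide P (onObj (d r) v)" if "r \<in> Obj R" "v \<in> Obj B" for r v
    by (rule model_Ide[OF d[OF that(1)] that(2)])
  have GI: "onArr G (h, Ide B v) = \<eta> h v" if "h \<in> Arr R" "v \<in> Obj B" for h v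
    using that \<eta>S by (simp add: Gs dI)
  have agr: "agree B (d r) (row R G r)" if "r \<in> Obj R" for r
    using that D by (simp add: agree_def Gs \<eta>I)
  have agc: "agree R (?C v) (col B G v)" if "v \<in> Obj B" for v
    using that \<eta>S by (simp add: agree_def Gs dI)
  have mG: "is_model (tsk R B) G"
  proof (rule tsk_modelI[OF assms(2) E(2)])
    show "is_data (tsk R B) G"
      using D \<eta>S \<zeta>S by (auto simp: is_data_def Gs elim!: tsk_TrE)
    show "onArr G (f, g) = onArr G (f, Ide B (Cod B g)) \<cdot> onArr G (Ide R (Dom R f), g)" if "f \<in> Arr R" "g \<in> Arr B" for f g
      using that D \<eta>S by (simp add: Gs dI \<eta>I)
    show "is_model B (row R G r)" if "r \<in> Obj R" for r
      by (rule model_agree[OF d[OF that] agr[OF that] E(2)])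
    show "is_model R (col B G v)" if "v \<in> Obj B" for v
      by (rule model_agree[OF mC[OF that] agc[OF that] assms(2)])
    show "mmor B (row R G (Dom R h)) (row R G (Cod R h)) (\<lambda>s. onArr G (h, Ide B s))" if h: "h \<in> Arr R" for h
      by (rule mmor_cong[OF mmor_agree[OF \<eta>0[OF h] agr agr] _ E(2)]) (use h GI in auto)
    show "mmor B (msum B (row R G (pZ R e)) (row R G (pX R e))) (row R G (pY R e)) (\<lambda>s. fadd G (Inl (e, s)))" if e: "e \<in> Tr R" for e
      by (rule mmor_cong[OF mmor_agree[OF \<zeta>0[OF e] agree_msum[OF agr agr E(2)] agr] _ E(2)]) (use e in \<open>auto simp: Gs\<close>)
  qed
  have "mmor (tsk R A) (pull G (right_map R B J)) F (\<lambda>(r, s). \<alpha> r s)"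
  proof (rule tsk_mmorI[OF assms(2) E(1) right_pull_model[OF assms(1,2) mG] assms(3)])
    show "mmor A (row R (pull G (right_map R B J)) r) (row R F r) (\<lambda>s. (\<lambda>(r, s). \<alpha> r s) (r, s))" if "r \<in> Obj R" for r
      using mmor_agree[OF \<alpha>[OF that] agree_pull[OF agr[OF that] E(3)] agree_refl] by simp
    show "(\<lambda>(r, s). \<alpha> r s) (Cod R h, s) \<cdot> onArr (pull G (right_map R B J)) (h, Ide A s)
      = onArr F (h, Ide A s) \<cdot> (\<lambda>(r, s). \<alpha> r s) (Dom R h, s)" if "h \<in> Arr R" "s \<in> Obj A" for h s
      using that J aS F by (simp add: GI \<eta>J)
    show "(\<lambda>(r, s). \<alpha> r s) (pY R e, s) \<cdot> fadd (pull G (right_map R B J)) (Inl (e, s))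
      = fadd F (Inl (e, s)) \<cdot> ((\<lambda>(r, s). \<alpha> r s) (pZ R e, s) \<boxplus> (\<lambda>(r, s). \<alpha> r s) (pX R e, s))" if "e \<in> Tr R" "s \<in> Obj A" for e s
      using that J aS F by (simp add: GI \<eta>I \<zeta>J Gs(3))
  qed
  with mG show ?thesis by blast
qed

lemma requiv_right:
  assumes "requiv A B J" "sketch R"
  shows "requiv (tsk R A) (tsk R B) (right_map R B J)"
proof -
  note E = requivD[OF assms(1)]
  show ?thesis
    by (rule requivI[OF sketch_tsk[OF assms(2) E(1)] sketch_tsk[OF assms(2) E(2)] is_smap_right[OF assms(2) E(1-3)]])
      (fact right_pull_model[OF assms] right_ess_surj[OF assms] right_full[OF assms] | rule right_unique[OF assms], assumption+)+
qed

end

section \<open>Exchange of the factors and equivalences in both variables\<close>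

definition swap_map :: "('a, 'b, 't) sketch \<Rightarrow> ('c, 'd, 'u) sketch
    \<Rightarrow> ('a \<times> 'c, 'b \<times> 'd, 'c \<times> 'a, 'd \<times> 'b, 't \<times> 'c + 'a \<times> 'u, 'u \<times> 'a + 'c \<times> 't) smap" where
  "swap_map R S = \<lparr>onObj = prod.swap, onArr = prod.swap,
     jT = case_sum (\<lambda>(d, s). Inr (s, d)) (\<lambda>(r, e). Inl (e, r)),
     jA = (\<lambda>d. Ide (tsk S R) (prod.swap (pY (tsk R S) d)))\<rparr>"

lemma swap_map_sel [simp]:
  "onObj (swap_map R S) (r, s) = (s, r)" "onArr (swap_map R S) (f, g) = (g, f)"
  "jT (swap_map R S) (Inl (d, s)) = Inr (s, d)" "jT (swap_map R S) (Inr (r, e)) = Inl (e, r)"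
  "jA (swap_map R S) (Inl (d, s)) = (Ide S s, Ide R (pY R d))" "jA (swap_map R S) (Inr (r, e)) = (Ide S (pY S e), Ide R r)"
  by (simp_all add: swap_map_def)

lemma strict_swap_map:
  assumes "sketch R" "sketch S"
  shows "strict_smap (tsk R S) (tsk S R) (swap_map R S)"
proof -
  interpret R: sketch R by fact
  interpret S: sketch S by fact
  have "is_smap (tsk R S) (tsk S R) (swap_map R S)"
    unfolding is_smap_def is_functor_def by (auto elim!: tsk_TrE)
  then show ?thesis
    by (auto simp: strict_smap_def elim!: tsk_TrE tnat.cases tcom.cases tass.cases ttwo.cases
        intro!: tnat.intros tcom.intros tass.intros intro: ttwo.intros)
qed

text \<open>With the next lemma: if one factor is strict, one of the two arrows composed in
  \<open>jA\<close> is an identity, so the comparison arrow comes from the other factor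
  alone.\<close>

lemma comp_strict_left:
  assumes "strict_smap B C K" "is_smap A B J" "sketch B" "sketch C" "d \<in> Tr A"
  shows "jA (comp_smap C K J) d = onArr K (jA J d)"
proof -
  interpret B: sketch B by fact
  interpret C: sketch C by fact
  have K: "is_smap B C K" "jA K (jT J d) = Ide C (onObj K (pY B (jT J d)))"
    using assms(1) smap_simps(7)[OF assms(2,5)] by (auto simp: strict_smap_def)
  show ?thesis
    using smap_simps[OF K(1)] smap_simps[OF assms(2)] assms(5) by (simp add: comp_smap_def K(2))
qed

lemma comp_strict_right:
  assumes "is_smap B C K" "strict_smap A B J" "sketch A" "sketch B" "sketch C" "d \<in> Tr A"
  shows "jA (comp_smap C K J) d = jA K (jT J d)"
proof -
  interpret A: sketch A by fact
  interpret B: sketch B by fact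
  interpret C: sketch C by fact
  have J: "is_smap A B J" "jA J d = Ide B (onObj J (pY A d))" "pY B (jT J d) = onObj J (pY A d)"
    using assms(2,6) by (auto simp: strict_smap_def)
  show ?thesis
    using smap_simps[OF J(1)] smap_simps[OF assms(1)] assms(6) J(3) by (simp add: comp_smap_def J(2))
qed

definition both_map :: "('e, 'f, 'v) sketch \<Rightarrow> ('g, 'h, 'w) sketch \<Rightarrow> ('a, 'b, 'e, 'f, 't, 'v) smap \<Rightarrow> ('c, 'd, 'g, 'h, 'u, 'w) smap
    \<Rightarrow> ('a \<times> 'c, 'b \<times> 'd, 'e \<times> 'g, 'f \<times> 'h, 't \<times> 'c + 'a \<times> 'u, 'v \<times> 'g + 'e \<times> 'w) smap" where
  "both_map B D J K = \<lparr>onObj = map_prod (onObj J) (onObj K), onArr = map_prod (onArr J) (onArr K),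
     jT = map_sum (map_prod (jT J) (onObj K)) (map_prod (onObj J) (jT K)),
     jA = case_sum (\<lambda>(d, s). (jA J d, Ide D (onObj K s))) (\<lambda>(r, e). (Ide B (onObj J r), jA K e))\<rparr>"

lemma both_map_sel [simp]:
  "onObj (both_map B D J K) (r, s) = (onObj J r, onObj K s)" "onArr (both_map B D J K) (f, g) = (onArr J f, onArr K g)"
  "jT (both_map B D J K) (Inl (d, s)) = Inl (jT J d, onObj K s)" "jT (both_map B D J K) (Inr (r, e)) = Inr (onObj J r, jT K e)"
  "jA (both_map B D J K) (Inl (d, s)) = (jA J d, Ide D (onObj K s))" "jA (both_map B D J K) (Inr (r, e)) = (Ide B (onObj J r), jA K e)"
  by (simp_all add: both_map_def)

lemma comp_smap_sel [simp]:
  "onObj (comp_smap C K J) a = onObj K (onObj J a)" "onArr (comp_smap C K J) f = onArr K (onArr J f)"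
  "jT (comp_smap C K J) d = jT K (jT J d)"
  by (simp_all add: comp_smap_def)

context picard_groupoid
begin

lemma requiv_swap:
  assumes "sketch R" "sketch S"
  shows "requiv (tsk R S) (tsk S R) (swap_map R S)"
  by (rule requiv_iso[OF sketch_tsk[OF assms] sketch_tsk[OF assms(2,1)] strict_swap_map[OF assms] strict_swap_map[OF assms(2,1)]])
    (auto elim!: tsk_TrE)

lemma requiv_both:
  assumes "requiv A B J" "requiv C D K"
  shows "requiv (tsk A C) (tsk B D) (both_map B D J K)"
proof -
  note E = requivD[OF assms(1)] and F = requivD[OF assms(2)]
  interpret A: sketch A by (rule E(1))
  interpret B: sketch B by (rule E(2))
  interpret C: sketch C by (rule F(1))
  interpret D: sketch D by (rule F(2))
  note J = smap_simps[OF E(3)] and K = smap_simps[OF F(3)]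
  \<comment> \<open>Only the second variable can be replaced directly, so the first is brought there
    and back by exchanges of the factors.\<close>
  let ?L1 = "comp_smap (tsk C B) (right_map C B J) (swap_map A C)"
  let ?L2 = "comp_smap (tsk B C) (swap_map C B) ?L1"
  let ?L3 = "comp_smap (tsk B D) (right_map B D K) ?L2"
  have L1: "requiv (tsk A C) (tsk C B) ?L1"
    by (rule requiv_trans[OF requiv_swap[OF E(1) F(1)] requiv_right[OF assms(1) F(1)]])
  have L2: "requiv (tsk A C) (tsk B C) ?L2"
    by (rule requiv_trans[OF L1 requiv_swap[OF F(1) E(2)]])
  have L3: "requiv (tsk A C) (tsk B D) ?L3"
    by (rule requiv_trans[OF L2 requiv_right[OF assms(2) E(2)]])
  have a1: "jA ?L1 d = jA (right_map C B J) (jT (swap_map A C) d)" if "d \<in> Tr (tsk A C)" for d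
    by (rule comp_strict_right[OF is_smap_right[OF F(1) E(1-3)] strict_swap_map[OF E(1) F(1)]
        sketch_tsk[OF E(1) F(1)] sketch_tsk[OF F(1) E(1)] sketch_tsk[OF F(1) E(2)] that])
  have a2: "jA ?L2 d = onArr (swap_map C B) (jA ?L1 d)" if "d \<in> Tr (tsk A C)" for d
    by (rule comp_strict_left[OF strict_swap_map[OF F(1) E(2)] requivD(3)[OF L1] sketch_tsk[OF F(1) E(2)] sketch_tsk[OF E(2) F(1)] that])
  have a3: "jA ?L3 d = onArr (right_map B D K) (jA ?L2 d) \<cdot>\<^bsub>tsk B D\<^esub> jA (right_map B D K) (jT ?L2 d)" for d
    by (simp add: comp_smap_def)
  show ?thesis
  proof (rule requiv_cong[OF L3])
    show "smap_agree (tsk A C) ?L3 (both_map B D J K)"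
      unfolding smap_agree_def
    proof (intro conjI ballI)
      show "onObj ?L3 a = onObj (both_map B D J K) a" if "a \<in> Obj (tsk A C)" for a
        by (cases a) simp
      show "onArr ?L3 a = onArr (both_map B D J K) a" if "a \<in> Arr (tsk A C)" for a
        by (cases a) simp
      show "jT ?L3 d = jT (both_map B D J K) d" if "d \<in> Tr (tsk A C)" for d
        using that by (auto elim!: tsk_TrE)
      show "jA ?L3 d = jA (both_map B D J K) d" if "d \<in> Tr (tsk A C)" for d
        using that by (cases rule: tsk_TrE) (use that in \<open>simp_all add: a3 a2 a1 J K\<close>)
    qed
  qed
qed

end

section \<open>Families of sketches\<close>

lemma prod_cat_sel [simp]:
  "Obj (prod_cat I S) = (\<Pi>\<^sub>E i\<in>I. Obj (S i))" "Arr (prod_cat I S) = (\<Pi>\<^sub>E i\<in>I. Arr (S i))"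
  "Dom (prod_cat I S) f = (\<lambda>i\<in>I. Dom (S i) (f i))" "Cod (prod_cat I S) f = (\<lambda>i\<in>I. Cod (S i) (f i))"
  "Ide (prod_cat I S) x = (\<lambda>i\<in>I. Ide (S i) (x i))" "g \<cdot>\<^bsub>prod_cat I S\<^esub> f = (\<lambda>i\<in>I. g i \<cdot>\<^bsub>S i\<^esub> f i)"
  by (simp_all add: prod_cat_def)

text \<open>Extensionality of the tuples is made explicit, so that arrows can be compared coordinate
  by coordinate.\<close>

lemma prod_Hom: "f \<in> Hom (prod_cat I S) a b \<longleftrightarrow> f \<in> extensional I \<and> a \<in> extensional I \<and> b \<in> extensional I
    \<and> (\<forall>i\<in>I. f i \<in> Arr (S i) \<and> Dom (S i) (f i) = a i \<and> Cod (S i) (f i) = b i)"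
proof
  assume "f \<in> Hom (prod_cat I S) a b"
  then have "f \<in> (\<Pi>\<^sub>E i\<in>I. Arr (S i))" "a = (\<lambda>i\<in>I. Dom (S i) (f i))" "b = (\<lambda>i\<in>I. Cod (S i) (f i))"
    by auto
  then show "f \<in> extensional I \<and> a \<in> extensional I \<and> b \<in> extensional I
    \<and> (\<forall>i\<in>I. f i \<in> Arr (S i) \<and> Dom (S i) (f i) = a i \<and> Cod (S i) (f i) = b i)"
    by (simp add: PiE_iff)
next
  assume *: "f \<in> extensional I \<and> a \<in> extensional I \<and> b \<in> extensional I
    \<and> (\<forall>i\<in>I. f i \<in> Arr (S i) \<and> Dom (S i) (f i) = a i \<and> Cod (S i) (f i) = b i)"
  then have "(\<lambda>i\<in>I. Dom (S i) (f i)) = a" "(\<lambda>i\<in>I. Cod (S i) (f i)) = b"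
    by (auto simp: fun_eq_iff extensional_def)
  then show "f \<in> Hom (prod_cat I S) a b"
    using * by (simp add: PiE_iff)
qed

lemma category_prod_cat:
  assumes "\<And>i. i \<in> I \<Longrightarrow> category (S i)"
  shows "category (prod_cat I S)"
proof -
  note c = category.Obj_simps[OF assms] category.Ide_simps[OF assms] category.Cmp_simps[OF assms]
    category.Ide_Cmp[OF assms] category.Cmp_Ide[OF assms] category.Cmp_assoc'[OF assms]
  show ?thesis
  proof
    show "Dom (prod_cat I S) f \<in> Obj (prod_cat I S)" "Cod (prod_cat I S) f \<in> Obj (prod_cat I S)"
      if "f \<in> Arr (prod_cat I S)" for f
      using that by (simp_all add: c PiE_iff)
    show "Ide (prod_cat I S) a \<in> Hom (prod_cat I S) a a" if "a \<in> Obj (prod_cat I S)" for a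
      using that by (auto simp: prod_Hom c PiE_iff simp del: Hom_def)
    show "g \<cdot>\<^bsub>prod_cat I S\<^esub> f \<in> Hom (prod_cat I S) a d" if "f \<in> Hom (prod_cat I S) a b" "g \<in> Hom (prod_cat I S) b d" for f g a b d
      using that by (simp add: prod_Hom c del: Hom_def)
    show "Ide (prod_cat I S) b \<cdot>\<^bsub>prod_cat I S\<^esub> f = f" "f \<cdot>\<^bsub>prod_cat I S\<^esub> Ide (prod_cat I S) a = f"
      if "f \<in> Hom (prod_cat I S) a b" for f a b
      using that by (auto simp: prod_Hom c fun_eq_iff extensional_def simp del: Hom_def)
    show "(h \<cdot>\<^bsub>prod_cat I S\<^esub> g) \<cdot>\<^bsub>prod_cat I S\<^esub> f = h \<cdot>\<^bsub>prod_cat I S\<^esub> (g \<cdot>\<^bsub>prod_cat I S\<^esub> f)"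
      if "f \<in> Hom (prod_cat I S) a b" "g \<in> Hom (prod_cat I S) b d" "h \<in> Hom (prod_cat I S) d e" for f g h a b d e
      using that by (auto simp: prod_Hom c fun_eq_iff simp del: Hom_def)
  qed
qed

text \<open>As for two factors, an arrow \<open>k\<close> is built in; here it moves all remaining
  variables at once.\<close>

inductive pnat for I :: "'i set" and S :: "'i \<Rightarrow> ('a, 'b, 't) sketch" where
  "\<lbrakk>i \<in> I; x \<in> Obj (prod_cat (I - {i}) S); x' \<in> Obj (prod_cat (I - {i}) S); k \<in> Hom (prod_cat (I - {i}) S) x x';
     NatR (S i) d d' f g h\<rbrakk> \<Longrightarrow> pnat I S (i, x, d) (i, x', d') (k(i := f)) (k(i := g)) (k(i := h))"

inductive pcom for I :: "'i set" and S :: "'i \<Rightarrow> ('a, 'b, 't) sketch" where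
  "\<lbrakk>i \<in> I; x \<in> Obj (prod_cat (I - {i}) S); ComR (S i) d d' g\<rbrakk>
     \<Longrightarrow> pcom I S (i, x, d) (i, x, d') ((Ide (prod_cat (I - {i}) S) x)(i := g))"

inductive pass for I :: "'i set" and S :: "'i \<Rightarrow> ('a, 'b, 't) sketch" where
  "\<lbrakk>i \<in> I; x \<in> Obj (prod_cat (I - {i}) S); AssR (S i) d1 d2 d3 d4 g\<rbrakk>
     \<Longrightarrow> pass I S (i, x, d1) (i, x, d2) (i, x, d3) (i, x, d4) ((Ide (prod_cat (I - {i}) S) x)(i := g))"

text \<open>The pairs of variables are ordered, so both orders of the relation are present, in
  agreement with \<open>ttwo\<close>.\<close>

inductive ptwo for I :: "'i set" and S :: "'i \<Rightarrow> ('a, 'b, 't) sketch" where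
  "\<lbrakk>i \<in> I; j \<in> I; i \<noteq> j; x \<in> Obj (prod_cat (I - {i, j}) S); d \<in> Tr (S i); e \<in> Tr (S j)\<rbrakk>
     \<Longrightarrow> ptwo I S (i, x(j := pZ (S j) e), d) (i, x(j := pX (S j) e), d) (i, x(j := pY (S j) e), d)
          (j, x(i := pZ (S i) d), e) (j, x(i := pX (S i) d), e) (j, x(i := pY (S i) d), e)"

text \<open>The relations \<open>TwoR\<close> of the factors are left out: the sketches of a single variable have none.\<close>

definition psk :: "'i set \<Rightarrow> ('i \<Rightarrow> ('a, 'b, 't) sketch) \<Rightarrow> ('i \<Rightarrow> 'a, 'i \<Rightarrow> 'b, 'i \<times> ('i \<Rightarrow> 'a) \<times> 't) sketch" where
  "psk I S = \<lparr>Obj = Obj (prod_cat I S), Arr = Arr (prod_cat I S), Dom = Dom (prod_cat I S), Cod = Cod (prod_cat I S),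
     Ide = Ide (prod_cat I S), Cmp = Cmp (prod_cat I S),
     Tr = {(i, x, d). i \<in> I \<and> x \<in> Obj (prod_cat (I - {i}) S) \<and> d \<in> Tr (S i)},
     pX = (\<lambda>(i, x, d). x(i := pX (S i) d)), pY = (\<lambda>(i, x, d). x(i := pY (S i) d)), pZ = (\<lambda>(i, x, d). x(i := pZ (S i) d)),
     NatR = pnat I S, ComR = pcom I S, AssR = pass I S, TwoR = ptwo I S\<rparr>"

lemma psk_sel [simp]:
  "Obj (psk I S) = (\<Pi>\<^sub>E i\<in>I. Obj (S i))" "Arr (psk I S) = (\<Pi>\<^sub>E i\<in>I. Arr (S i))"
  "Dom (psk I S) f = (\<lambda>i\<in>I. Dom (S i) (f i))" "Cod (psk I S) f = (\<lambda>i\<in>I. Cod (S i) (f i))"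
  "Ide (psk I S) x = (\<lambda>i\<in>I. Ide (S i) (x i))" "v \<cdot>\<^bsub>psk I S\<^esub> u = (\<lambda>i\<in>I. v i \<cdot>\<^bsub>S i\<^esub> u i)"
  "(i, x, d) \<in> Tr (psk I S) \<longleftrightarrow> i \<in> I \<and> x \<in> (\<Pi>\<^sub>E j\<in>I - {i}. Obj (S j)) \<and> d \<in> Tr (S i)"
  "pX (psk I S) (i, x, d) = x(i := pX (S i) d)" "pY (psk I S) (i, x, d) = x(i := pY (S i) d)"
  "pZ (psk I S) (i, x, d) = x(i := pZ (S i) d)"
  "NatR (psk I S) = pnat I S" "ComR (psk I S) = pcom I S" "AssR (psk I S) = pass I S" "TwoR (psk I S) = ptwo I S"
  by (simp_all add: psk_def)

lemma category_psk:
  assumes "\<And>i. i \<in> I \<Longrightarrow> sketch (S i)"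
  shows "category (psk I S)"
proof -
  have "category (prod_cat I S)"
    using category_prod_cat[of I S] assms sketch.axioms(1) by blast
  then show ?thesis
    by (simp add: category_def Hom_def psk_def del: prod_cat_sel)
qed

lemma psk_Hom: "Hom (psk I S) a b = Hom (prod_cat I S) a b"
  by simp

lemma fun_upd_ext [simp]: "\<lbrakk>x \<in> extensional (I - {i}); i \<in> I\<rbrakk> \<Longrightarrow> x(i := a) \<in> extensional I"
  by (auto simp: extensional_def)

lemma fun_upd_Hom:
  assumes "k \<in> Hom (prod_cat (I - {i}) S) x x'" "i \<in> I" "f \<in> Arr (S i)" "Dom (S i) f = a" "Cod (S i) f = b"
  shows "k(i := f) \<in> Hom (prod_cat I S) (x(i := a)) (x'(i := b))"
  using assms by (auto simp: prod_Hom simp del: Hom_def)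

lemma fun_upd_PiE [simp]: "\<lbrakk>x \<in> PiE (I - {i}) X; a \<in> X i; i \<in> I\<rbrakk> \<Longrightarrow> x(i := a) \<in> PiE I X"
  by (auto simp: PiE_iff extensional_def)

lemma sketch_psk:
  assumes "\<And>i. i \<in> I \<Longrightarrow> sketch (S i)"
  shows "sketch (psk I S)"
proof -
  interpret T: category "psk I S" by (rule category_psk[OF assms])
  note c = sketch.axioms(1)[OF assms]
  note s = sketch.Tr_Obj[OF assms] category.Ide_simps[OF c] category.Obj_simps[OF c]
  have twist: "x \<in> PiE (I - {i, j}) X \<Longrightarrow> a \<in> X j \<Longrightarrow> j \<in> I \<Longrightarrow> i \<noteq> j \<Longrightarrow> x(j := a) \<in> PiE (I - {i}) X" for x :: "'a \<Rightarrow> 'b" and i j X a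
    by (auto simp: PiE_iff extensional_def)
  show ?thesis
  proof unfold_locales
    show "pX (psk I S) d \<in> Obj (psk I S)" "pY (psk I S) d \<in> Obj (psk I S)" "pZ (psk I S) d \<in> Obj (psk I S)"
      if "d \<in> Tr (psk I S)" for d
      using that by (cases d; auto intro!: fun_upd_PiE simp: s simp del: fun_upd_apply)+
    show "d \<in> Tr (psk I S) \<and> d' \<in> Tr (psk I S) \<and> f \<in> Hom (psk I S) (pX (psk I S) d) (pX (psk I S) d')
      \<and> g \<in> Hom (psk I S) (pY (psk I S) d) (pY (psk I S) d') \<and> h \<in> Hom (psk I S) (pZ (psk I S) d) (pZ (psk I S) d')"
      if "NatR (psk I S) d d' f g h" for d d' f g h
      using that unfolding psk_sel
    proof cases
      case (1 i x x' k e e' f' g' h')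
      note n = sketch.NatR_in[OF assms[OF 1(6)] 1(10), unfolded Hom_def mem_Collect_eq]
      show ?thesis
        using n 1 fun_upd_Hom[OF 1(9,6)] by (auto simp: psk_Hom simp del: fun_upd_apply Hom_def prod_cat_sel(2-))
    qed
    show "NatR (psk I S) d d (Ide (psk I S) (pX (psk I S) d)) (Ide (psk I S) (pY (psk I S) d)) (Ide (psk I S) (pZ (psk I S) d))"
      if td: "d \<in> Tr (psk I S)" for d
    proof -
      obtain i x e where d: "d = (i, x, e)" "i \<in> I" "x \<in> Obj (prod_cat (I - {i}) S)" "e \<in> Tr (S i)"
        using td by (cases d) auto
      interpret Q: category "prod_cat (I - {i}) S"
        by (rule category_prod_cat) (use c in auto)
      have "pnat I S (i, x, e) (i, x, e) ((Ide (prod_cat (I - {i}) S) x)(i := Ide (S i) (pX (S i) e)))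
          ((Ide (prod_cat (I - {i}) S) x)(i := Ide (S i) (pY (S i) e))) ((Ide (prod_cat (I - {i}) S) x)(i := Ide (S i) (pZ (S i) e)))"
        using d Q.Ide_in[OF d(3)] by (intro pnat.intros sketch.NatR_Ide[OF assms]) auto
      moreover have "(\<lambda>j\<in>I. Ide (S j) ((x(i := a)) j)) = (Ide (prod_cat (I - {i}) S) x)(i := Ide (S i) a)" for a
        using d(2) by (auto simp: fun_eq_iff)
      ultimately show ?thesis
        by (simp only: psk_sel d(1))
    qed
    show "d \<in> Tr (psk I S) \<and> d' \<in> Tr (psk I S) \<and> pZ (psk I S) d' = pX (psk I S) d \<and> pX (psk I S) d' = pZ (psk I S) d
      \<and> g \<in> Hom (psk I S) (pY (psk I S) d') (pY (psk I S) d)" if "ComR (psk I S) d d' g" for d d' g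
      using that unfolding psk_sel
    proof cases
      case (1 i x e e' g')
      interpret Q: category "prod_cat (I - {i}) S"
        by (rule category_prod_cat) (use c in auto)
      note n = sketch.ComR_in[OF assms[OF 1(4)] 1(6), unfolded Hom_def mem_Collect_eq]
      show ?thesis
        using n 1 fun_upd_Hom[OF Q.Ide_in[OF 1(5)] 1(4)] by (auto simp: psk_Hom simp del: fun_upd_apply Hom_def prod_cat_sel(2-))
    qed
    show "{d1, d2, d3, d4} \<subseteq> Tr (psk I S) \<and> pX (psk I S) d2 = pX (psk I S) d1 \<and> pX (psk I S) d3 = pY (psk I S) d1
      \<and> pX (psk I S) d4 = pZ (psk I S) d1 \<and> pY (psk I S) d4 = pZ (psk I S) d2 \<and> pZ (psk I S) d4 = pZ (psk I S) d3
      \<and> g \<in> Hom (psk I S) (pY (psk I S) d2) (pY (psk I S) d3)" if "AssR (psk I S) d1 d2 d3 d4 g" for d1 d2 d3 d4 g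
      using that unfolding psk_sel
    proof cases
      case (1 i x e1 e2 e3 e4 g')
      interpret Q: category "prod_cat (I - {i}) S"
        by (rule category_prod_cat) (use c in auto)
      note n = sketch.AssR_in[OF assms[OF 1(6)] 1(8), unfolded Hom_def mem_Collect_eq]
      show ?thesis
        using n 1 fun_upd_Hom[OF Q.Ide_in[OF 1(7)] 1(6)] by (auto simp: psk_Hom simp del: fun_upd_apply Hom_def prod_cat_sel(2-))
    qed
    show "{az, ax, ay, bz, bx, by} \<subseteq> Tr (psk I S)
      \<and> pY (psk I S) az = pZ (psk I S) by \<and> pY (psk I S) ax = pX (psk I S) by \<and> pY (psk I S) bz = pZ (psk I S) ay \<and> pY (psk I S) bx = pX (psk I S) ay
      \<and> pZ (psk I S) bz = pZ (psk I S) az \<and> pX (psk I S) bz = pZ (psk I S) ax \<and> pZ (psk I S) bx = pX (psk I S) az \<and> pX (psk I S) bx = pX (psk I S) ax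
      \<and> pY (psk I S) ay = pY (psk I S) by" if "TwoR (psk I S) az ax ay bz bx by" for az ax ay bz bx "by"
      using that unfolding psk_sel
    proof cases
      case (1 i j x d e)
      then show ?thesis
        using twist[of x i j] twist[of x j i] s
        by (simp add: fun_upd_twist insert_commute del: fun_upd_apply)
    qed
  qed
qed

section \<open>Splitting one variable off a family\<close>

definition join_map :: "'i set \<Rightarrow> 'i \<Rightarrow> ('i \<Rightarrow> ('a, 'b, 't) sketch)
    \<Rightarrow> (('i \<Rightarrow> 'a) \<times> 'a, ('i \<Rightarrow> 'b) \<times> 'b, 'i \<Rightarrow> 'a, 'i \<Rightarrow> 'b, ('i \<times> ('i \<Rightarrow> 'a) \<times> 't) \<times> 'a + ('i \<Rightarrow> 'a) \<times> 't, 'i \<times> ('i \<Rightarrow> 'a) \<times> 't) smap" where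
  "join_map I k S = \<lparr>onObj = (\<lambda>(y, a). y(k := a)), onArr = (\<lambda>(f, g). f(k := g)),
     jT = case_sum (\<lambda>((i, x, d), a). (i, x(k := a), d)) (\<lambda>(y, d). (k, y, d)),
     jA = (\<lambda>d. Ide (psk (insert k I) S) ((\<lambda>(y, a). y(k := a)) (pY (tsk (psk I S) (S k)) d)))\<rparr>"

text \<open>Inverse to \<open>join_map\<close>: a triangle in the variable \<open>k\<close> becomes
  a triangle of the right factor, every other one a triangle of the left factor with the coordinate
  \<open>k\<close> as parameter.\<close>

definition split_map :: "'i set \<Rightarrow> 'i \<Rightarrow> ('i \<Rightarrow> ('a, 'b, 't) sketch)
    \<Rightarrow> ('i \<Rightarrow> 'a, 'i \<Rightarrow> 'b, ('i \<Rightarrow> 'a) \<times> 'a, ('i \<Rightarrow> 'b) \<times> 'b, 'i \<times> ('i \<Rightarrow> 'a) \<times> 't, ('i \<times> ('i \<Rightarrow> 'a) \<times> 't) \<times> 'a + ('i \<Rightarrow> 'a) \<times> 't) smap" where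
  "split_map I k S = \<lparr>onObj = (\<lambda>x. (restrict x I, x k)), onArr = (\<lambda>f. (restrict f I, f k)),
     jT = (\<lambda>(i, x, d). if i = k then Inr (x, d) else Inl ((i, restrict x (I - {i}), d), x k)),
     jA = (\<lambda>d. Ide (tsk (psk I S) (S k)) (restrict (pY (psk (insert k I) S) d) I, pY (psk (insert k I) S) d k))\<rparr>"

lemma join_split_sel [simp]:
  "onObj (join_map I k S) (y, a) = y(k := a)" "onArr (join_map I k S) (f, g) = f(k := g)"
  "jT (join_map I k S) (Inl ((i, x, d), a)) = (i, x(k := a), d)" "jT (join_map I k S) (Inr (y, d)) = (k, y, d)"
  "onObj (split_map I k S) x = (restrict x I, x k)" "onArr (split_map I k S) f = (restrict f I, f k)"
  "jT (split_map I k S) (i, x, d) = (if i = k then Inr (x, d) else Inl ((i, restrict x (I - {i}), d), x k))"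
  by (simp_all add: join_map_def split_map_def)

context
  fixes I :: "'i set" and k :: 'i and S :: "'i \<Rightarrow> ('a, 'b, 't) sketch"
  assumes k: "k \<notin> I" and S: "\<And>i. i \<in> insert k I \<Longrightarrow> sketch (S i)"
    and noTwo: "\<And>az ax ay bz bx by. \<not> TwoR (S k) az ax ay bz bx by"
begin

lemma sets_k: "insert k I - {k} = I" "i \<in> I \<Longrightarrow> insert k I - {i} = insert k (I - {i})" "i \<in> I \<Longrightarrow> i \<noteq> k"
  using k by auto

lemma upd_Obj: "\<lbrakk>x \<in> (\<Pi>\<^sub>E j\<in>I. Obj (S j)); a \<in> Obj (S k)\<rbrakk> \<Longrightarrow> x(k := a) \<in> (\<Pi>\<^sub>E j\<in>insert k I. Obj (S j))"
  by (auto simp: PiE_iff extensional_def)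

lemma upd_Obj': "\<lbrakk>x \<in> (\<Pi>\<^sub>E j\<in>I - {i}. Obj (S j)); a \<in> Obj (S k); i \<in> I\<rbrakk> \<Longrightarrow> x(k := a) \<in> (\<Pi>\<^sub>E j\<in>insert k I - {i}. Obj (S j))"
  using k by (auto simp: PiE_iff extensional_def)

lemma upd_Obj'': "\<lbrakk>x \<in> Obj (prod_cat (I - {i}) S); a \<in> Obj (S k); i \<in> I\<rbrakk> \<Longrightarrow> x(k := a) \<in> Obj (prod_cat (insert k I - {i}) S)"
  unfolding prod_cat_sel by (rule upd_Obj')

lemma upd_Hom: "\<lbrakk>f \<in> Hom (prod_cat I S) x y; g \<in> Arr (S k); Dom (S k) g = a; Cod (S k) g = b\<rbrakk>
    \<Longrightarrow> f(k := g) \<in> Hom (prod_cat (insert k I) S) (x(k := a)) (y(k := b))"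
  using k by (auto simp: prod_Hom extensional_def simp del: Hom_def)

lemma upd_Hom': "\<lbrakk>f \<in> Hom (prod_cat (I - {i}) S) x y; g \<in> Arr (S k); Dom (S k) g = a; Cod (S k) g = b; i \<in> I\<rbrakk>
    \<Longrightarrow> f(k := g) \<in> Hom (prod_cat (insert k I - {i}) S) (x(k := a)) (y(k := b))"
  using k by (auto simp: prod_Hom extensional_def simp del: Hom_def)

lemma upd_Ide: "Ide (prod_cat (insert k J) S) (x(k := a)) = (Ide (prod_cat J S) x)(k := Ide (S k) a)"
  by (auto simp: fun_eq_iff)

lemma restrict_Hom: "\<lbrakk>f \<in> Hom (prod_cat J S) x y; I' \<subseteq> J\<rbrakk> \<Longrightarrow> restrict f I' \<in> Hom (prod_cat I' S) (restrict x I') (restrict y I')"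
  by (auto simp: prod_Hom simp del: Hom_def)

lemma sk: "sketch (psk I S)" "sketch (S k)" "sketch (tsk (psk I S) (S k))" "sketch (psk (insert k I) S)"
  using S by (auto intro!: sketch_psk sketch_tsk)

lemma upd_twist: "i \<in> I \<Longrightarrow> x(i := b, k := a) = x(k := a, i := b)"
  using k by (auto simp: fun_eq_iff)

lemma join_nat:
  assumes "NatR (tsk (psk I S) (S k)) d d' f g h"
  shows "NatR (psk (insert k I) S) (jT (join_map I k S) d) (jT (join_map I k S) d') (onArr (join_map I k S) f) (onArr (join_map I k S) g) (onArr (join_map I k S) h)"
proof -
  have "tnat (psk I S) (S k) d d' f g h" using assms by (simp only: tsk_sel)
  then show ?thesis
  proof cases
    case (tnatL e e' f' g' h' u s s')
    have "pnat I S e e' f' g' h'"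
      using tnatL(6) by (simp only: psk_sel)
    then show ?thesis
    proof cases
      case (1 i x x' v c c' f'' g'' h'')
      have "pnat (insert k I) S (i, x(k := s), c) (i, x'(k := s'), c') ((v(k := u))(i := f'')) ((v(k := u))(i := g'')) ((v(k := u))(i := h''))"
        by (rule pnat.intros[OF _ upd_Obj'' upd_Obj'' upd_Hom']) (use 1 tnatL(7-9)[unfolded Hom_def] in \<open>simp_all del: Hom_def\<close>)
      then show ?thesis
        using tnatL 1 by (simp add: upd_twist del: fun_upd_apply)
    qed
  next
    case (tnatR e e' f' g' h' u r r')
    have "pnat (insert k I) S (k, r, e) (k, r', e') (u(k := f')) (u(k := g')) (u(k := h'))"
      using tnatR by (intro pnat.intros) (auto simp: sets_k psk_Hom simp del: Hom_def)
    then show ?thesis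
      using tnatR by (simp del: fun_upd_apply)
  qed
qed

lemma join_com:
  assumes "ComR (tsk (psk I S) (S k)) d d' g"
  shows "ComR (psk (insert k I) S) (jT (join_map I k S) d) (jT (join_map I k S) d') (onArr (join_map I k S) g)"
proof -
  have "tcom (psk I S) (S k) d d' g" using assms by (simp only: tsk_sel)
  then show ?thesis
  proof cases
    case (tcomL e e' g' s)
    have "pcom I S e e' g'"
      using tcomL(4) by (simp only: psk_sel)
    then show ?thesis
    proof cases
      case (1 i x c c' g'')
      have "pcom (insert k I) S (i, x(k := s), c) (i, x(k := s), c') ((Ide (prod_cat (insert k I - {i}) S) (x(k := s)))(i := g''))"
        by (rule pcom.intros[OF _ upd_Obj'']) (use 1 tcomL in auto)
      then show ?thesis
        using tcomL 1 by (simp add: upd_twist sets_k upd_Ide del: fun_upd_apply prod_cat_sel(5))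
    qed
  next
    case (tcomR e e' g' r)
    have "pcom (insert k I) S (k, r, e) (k, r, e') ((Ide (prod_cat (insert k I - {k}) S) r)(k := g'))"
      using tcomR by (intro pcom.intros) (auto simp: sets_k)
    then show ?thesis
      using tcomR by (simp add: sets_k del: fun_upd_apply)
  qed
qed

lemma join_ass:
  assumes "AssR (tsk (psk I S) (S k)) d1 d2 d3 d4 g"
  shows "AssR (psk (insert k I) S) (jT (join_map I k S) d1) (jT (join_map I k S) d2) (jT (join_map I k S) d3) (jT (join_map I k S) d4) (onArr (join_map I k S) g)"
proof -
  have "tass (psk I S) (S k) d1 d2 d3 d4 g" using assms by (simp only: tsk_sel)
  then show ?thesis
  proof cases
    case (tassL e1 e2 e3 e4 g' s)
    have "pass I S e1 e2 e3 e4 g'"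
      using tassL(6) by (simp only: psk_sel)
    then show ?thesis
    proof cases
      case (1 i x c1 c2 c3 c4 g'')
      have "pass (insert k I) S (i, x(k := s), c1) (i, x(k := s), c2) (i, x(k := s), c3) (i, x(k := s), c4)
          ((Ide (prod_cat (insert k I - {i}) S) (x(k := s)))(i := g''))"
        by (rule pass.intros[OF _ upd_Obj'']) (use 1 tassL in auto)
      then show ?thesis
        using tassL 1 by (simp add: upd_twist sets_k upd_Ide del: fun_upd_apply prod_cat_sel(5))
    qed
  next
    case (tassR e1 e2 e3 e4 g' r)
    have "pass (insert k I) S (k, r, e1) (k, r, e2) (k, r, e3) (k, r, e4) ((Ide (prod_cat (insert k I - {k}) S) r)(k := g'))"
      using tassR by (intro pass.intros) (auto simp: sets_k)
    then show ?thesis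
      using tassR by (simp add: sets_k del: fun_upd_apply)
  qed
qed

lemma join_two:
  assumes "TwoR (tsk (psk I S) (S k)) az ax ay bz bx by"
  shows "TwoR (psk (insert k I) S) (jT (join_map I k S) az) (jT (join_map I k S) ax) (jT (join_map I k S) ay) (jT (join_map I k S) bz) (jT (join_map I k S) bx) (jT (join_map I k S) by)"
proof -
  have "ttwo (psk I S) (S k) az ax ay bz bx by" using assms by (simp only: tsk_sel)
  then show ?thesis
  proof cases
    case (ttwoL az' ax' ay' bz' bx' by' s)
    have "ptwo I S az' ax' ay' bz' bx' by'"
      using ttwoL(7) by (simp only: psk_sel)
    then show ?thesis
    proof cases
      case (1 i j x d e)
      have o: "x(k := s) \<in> (\<Pi>\<^sub>E j\<in>insert k I - {i, j}. Obj (S j))"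
        using 1 ttwoL(8) k by (auto simp: PiE_iff extensional_def)
      show ?thesis
        using ptwo.intros[of i "insert k I" j "x(k := s)" S d e] o 1 ttwoL by (simp add: upd_twist del: fun_upd_apply)
    qed
  next
    case (ttwoR az' ax' ay' bz' bx' by' r)
    \<comment> \<open>\<open>psk\<close> has no relation inside a single variable to which this one
      could be sent.\<close>
    then show ?thesis using noTwo by simp
  next
    case (ttwoLR d e)
    obtain i x d' where d: "d = (i, x, d')" by (cases d)
    \<comment> \<open>Removing \<open>i\<close> and \<open>k\<close> from the enlarged index set
      leaves the index set of \<open>x\<close>, so the parameter is unchanged.\<close>
    have o: "i \<in> I" "i \<noteq> k" "insert k I - {i, k} = I - {i}"
      using ttwoLR(7) d k by auto
    show ?thesis
      using ptwo.intros[of i "insert k I" k x S d' e] o ttwoLR d by (simp del: fun_upd_apply)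
  next
    case (ttwoRL d e)
    obtain i x d' where d: "d = (i, x, d')" by (cases d)
    have o: "i \<in> I" "k \<noteq> i" "insert k I - {k, i} = I - {i}"
      using ttwoRL(7) d k by auto
    show ?thesis
      using ptwo.intros[of k "insert k I" i x S e d'] o ttwoRL d by (simp del: fun_upd_apply)
  qed
qed

lemma strict_join: "strict_smap (tsk (psk I S) (S k)) (psk (insert k I) S) (join_map I k S)"
proof -
  interpret A: sketch "psk I S" by (rule sk)
  interpret B: sketch "S k" by (rule sk)
  interpret T: sketch "tsk (psk I S) (S k)" by (rule sk)
  interpret C: sketch "psk (insert k I) S" by (rule sk)
  let ?J = "join_map I k S"
  have fn: "is_functor (tsk (psk I S) (S k)) (psk (insert k I) S) ?J"
    unfolding is_functor_def
  proof (intro conjI ballI allI)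
    show "onObj ?J a \<in> Obj (psk (insert k I) S)" if "a \<in> Obj (tsk (psk I S) (S k))" for a
      using that upd_Obj by (cases a) simp
    show "onArr ?J f \<in> Hom (psk (insert k I) S) (onObj ?J a) (onObj ?J b)" if f: "f \<in> Hom (tsk (psk I S) (S k)) a b" for f a b
    proof -
      obtain u v where "f = (u, v)" by (cases f)
      then show ?thesis
        using f upd_Hom[of u "fst a" "fst b" v "snd a" "snd b"] by (auto simp: psk_Hom simp del: fun_upd_apply)
    qed
    show "onArr ?J (Ide (tsk (psk I S) (S k)) a) = Ide (psk (insert k I) S) (onObj ?J a)" if "a \<in> Obj (tsk (psk I S) (S k))" for a
      using upd_Ide[of I "fst a" "snd a"] by (cases a) simp
    show "onArr ?J (g \<cdot>\<^bsub>tsk (psk I S) (S k)\<^esub> f) = onArr ?J g \<cdot>\<^bsub>psk (insert k I) S\<^esub> onArr ?J f" for g f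
      using k by (cases f, cases g) (auto simp: fun_eq_iff)
  qed
  have Y: "pY (psk (insert k I) S) (jT ?J d) = onObj ?J (pY (tsk (psk I S) (S k)) d) \<and>
      pX (psk (insert k I) S) (jT ?J d) = onObj ?J (pX (tsk (psk I S) (S k)) d) \<and>
      pZ (psk (insert k I) S) (jT ?J d) = onObj ?J (pZ (tsk (psk I S) (S k)) d) \<and> jT ?J d \<in> Tr (psk (insert k I) S)"
    if "d \<in> Tr (tsk (psk I S) (S k))" for d
    using that
  proof (cases rule: tsk_TrE)
    case (1 e s)
    obtain i x e' where e: "e = (i, x, e')" by (cases e)
    show ?thesis
      using 1 e upd_Obj'[of x i s] by (simp add: upd_twist del: fun_upd_apply)
  next
    case (2 r e)
    then show ?thesis by (simp add: sets_k del: fun_upd_apply)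
  qed
  have jA: "jA ?J d = Ide (psk (insert k I) S) (onObj ?J (pY (tsk (psk I S) (S k)) d))" for d
    by (simp add: join_map_def)
  have sm: "is_smap (tsk (psk I S) (S k)) (psk (insert k I) S) ?J"
    unfolding is_smap_def
  proof (intro conjI ballI fn)
    fix d assume d: "d \<in> Tr (tsk (psk I S) (S k))"
    show "jT ?J d \<in> Tr (psk (insert k I) S)" "pX (psk (insert k I) S) (jT ?J d) = onObj ?J (pX (tsk (psk I S) (S k)) d)"
      "pZ (psk (insert k I) S) (jT ?J d) = onObj ?J (pZ (tsk (psk I S) (S k)) d)"
      using Y[OF d] by auto
    have "onObj ?J (pY (tsk (psk I S) (S k)) d) \<in> Obj (psk (insert k I) S)"
      using C.Tr_Obj(2)[of "jT ?J d"] Y[OF d] by simp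
    then show "jA ?J d \<in> Hom (psk (insert k I) S) (pY (psk (insert k I) S) (jT ?J d)) (onObj ?J (pY (tsk (psk I S) (S k)) d))"
      unfolding jA using C.Ide_in Y[OF d] by (simp del: Hom_def psk_sel)
  qed
  show ?thesis
    unfolding strict_smap_def
    using sm Y jA join_nat join_com join_ass join_two by simp
qed

lemma restrict_fun_upd_in: "i \<in> J \<Longrightarrow> restrict (x(i := a)) J = (restrict x (J - {i}))(i := a)"
  by (auto simp: fun_eq_iff restrict_def)

lemma restrict_fun_upd_notin: "x \<in> extensional J \<Longrightarrow> i \<notin> J \<Longrightarrow> restrict (x(i := a)) J = x"
  by (auto simp: fun_eq_iff restrict_def extensional_def)

lemma restrict_PiE: "\<lbrakk>x \<in> PiE J X; J' \<subseteq> J\<rbrakk> \<Longrightarrow> restrict x J' \<in> PiE J' X"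
  by (auto simp: PiE_iff)

lemma split_nat:
  assumes "NatR (psk (insert k I) S) d d' f g h"
  shows "NatR (tsk (psk I S) (S k)) (jT (split_map I k S) d) (jT (split_map I k S) d')
    (onArr (split_map I k S) f) (onArr (split_map I k S) g) (onArr (split_map I k S) h)"
proof -
  have "pnat (insert k I) S d d' f g h"
    using assms by (simp only: psk_sel)
  then show ?thesis
  proof cases
    case (1 i x x' u c c' f' g' h')
    show ?thesis
    proof (cases "i = k")
      case True
      have u: "u \<in> Hom (prod_cat I S) x x'" and x: "x \<in> Obj (prod_cat I S)" "x' \<in> Obj (prod_cat I S)"
        using 1(7-9) sets_k(1) True by auto
      have e: "u \<in> extensional I"
        using u[unfolded prod_Hom] by simp
      have "tnat (psk I S) (S k) (Inr (x, c)) (Inr (x', c')) (u, f') (u, g') (u, h')"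
        by (rule tnatR) (use 1(10) u x True in \<open>simp_all add: psk_Hom del: Hom_def\<close>)
      then show ?thesis
        using 1 True k e by (simp add: restrict_fun_upd_notin del: fun_upd_apply restrict_fupd) simp
    next
      case False
      then have i: "i \<in> I" "i \<noteq> k" using 1 by auto
      have kk: "k \<in> insert k I - {i}" using i by auto
      have sub: "I - {i} \<subseteq> insert k I - {i}" by auto
      have uk: "u k \<in> Hom (S k) (x k) (x' k)"
        using 1(9)[unfolded prod_Hom] kk by simp
      have xk: "x k \<in> Obj (S k)" "x' k \<in> Obj (S k)"
        using 1(7,8) kk by (auto dest: PiE_mem)
      have xr: "restrict x (I - {i}) \<in> Obj (prod_cat (I - {i}) S)" "restrict x' (I - {i}) \<in> Obj (prod_cat (I - {i}) S)"
        using 1(7,8) restrict_PiE[OF _ sub] by (simp_all only: prod_cat_sel)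
      have "pnat I S (i, restrict x (I - {i}), c) (i, restrict x' (I - {i}), c')
         ((restrict u (I - {i}))(i := f')) ((restrict u (I - {i}))(i := g')) ((restrict u (I - {i}))(i := h'))"
        by (rule pnat.intros[OF i(1) xr restrict_Hom[OF 1(9) sub] 1(10)])
      then have "tnat (psk I S) (S k) (Inl ((i, restrict x (I - {i}), c), x k)) (Inl ((i, restrict x' (I - {i}), c'), x' k))
         ((restrict u (I - {i}))(i := f'), u k) ((restrict u (I - {i}))(i := g'), u k) ((restrict u (I - {i}))(i := h'), u k)"
        using uk xk by (intro tnatL) (simp_all only: psk_sel)
      then show ?thesis
        using 1 i by (simp add: restrict_fun_upd_in del: fun_upd_apply restrict_fupd restrict_upd) simp
    qed
  qed
qed

lemma split_com:
  assumes "ComR (psk (insert k I) S) d d' g"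
  shows "ComR (tsk (psk I S) (S k)) (jT (split_map I k S) d) (jT (split_map I k S) d') (onArr (split_map I k S) g)"
proof -
  have "pcom (insert k I) S d d' g"
    using assms by (simp only: psk_sel)
  then show ?thesis
  proof cases
    case (1 i x c c' g')
    show ?thesis
    proof (cases "i = k")
      case True
      have x: "x \<in> Obj (psk I S)"
        using 1(5) sets_k(1) True by auto
      have "tcom (psk I S) (S k) (Inr (x, c)) (Inr (x, c')) (Ide (psk I S) x, g')"
        by (rule tcomR) (use 1(6) x True in simp_all)
      then show ?thesis
        using 1 True k sets_k(1) by (simp add: restrict_fun_upd_notin del: fun_upd_apply restrict_fupd) simp
    next
      case False
      then have i: "i \<in> I" "i \<noteq> k" using 1 by auto
      have kk: "k \<in> insert k I - {i}" using i by auto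
      have sub: "I - {i} \<subseteq> insert k I - {i}" by auto
      have xk: "x k \<in> Obj (S k)"
        using 1(5) kk by (auto dest: PiE_mem)
      have xr: "restrict x (I - {i}) \<in> Obj (prod_cat (I - {i}) S)"
        using 1(5) restrict_PiE[OF _ sub] by (simp only: prod_cat_sel)
      have "pcom I S (i, restrict x (I - {i}), c) (i, restrict x (I - {i}), c') ((Ide (prod_cat (I - {i}) S) (restrict x (I - {i})))(i := g'))"
        by (rule pcom.intros[OF i(1) xr 1(6)])
      then have "tcom (psk I S) (S k) (Inl ((i, restrict x (I - {i}), c), x k)) (Inl ((i, restrict x (I - {i}), c'), x k))
         ((Ide (prod_cat (I - {i}) S) (restrict x (I - {i})))(i := g'), Ide (S k) (x k))"
        using xk by (intro tcomL) (simp_all only: psk_sel)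
      moreover have "onArr (split_map I k S) g = ((Ide (prod_cat (I - {i}) S) (restrict x (I - {i})))(i := g'), Ide (S k) (x k))"
        using 1 i kk by (auto simp: fun_eq_iff)
      ultimately show ?thesis
        using 1 i by simp
    qed
  qed
qed

lemma split_ass:
  assumes "AssR (psk (insert k I) S) d1 d2 d3 d4 g"
  shows "AssR (tsk (psk I S) (S k)) (jT (split_map I k S) d1) (jT (split_map I k S) d2) (jT (split_map I k S) d3)
    (jT (split_map I k S) d4) (onArr (split_map I k S) g)"
proof -
  have "pass (insert k I) S d1 d2 d3 d4 g"
    using assms by (simp only: psk_sel)
  then show ?thesis
  proof cases
    case (1 i x c1 c2 c3 c4 g')
    show ?thesis
    proof (cases "i = k")
      case True
      have x: "x \<in> Obj (psk I S)"
        using 1(7) sets_k(1) True by auto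
      have "tass (psk I S) (S k) (Inr (x, c1)) (Inr (x, c2)) (Inr (x, c3)) (Inr (x, c4)) (Ide (psk I S) x, g')"
        by (rule tassR) (use 1(8) x True in simp_all)
      then show ?thesis
        using 1 True k sets_k(1) by (simp add: restrict_fun_upd_notin del: fun_upd_apply restrict_fupd) simp
    next
      case False
      then have i: "i \<in> I" "i \<noteq> k" using 1 by auto
      have kk: "k \<in> insert k I - {i}" using i by auto
      have sub: "I - {i} \<subseteq> insert k I - {i}" by auto
      have xk: "x k \<in> Obj (S k)"
        using 1(7) kk by (auto dest: PiE_mem)
      have xr: "restrict x (I - {i}) \<in> Obj (prod_cat (I - {i}) S)"
        using 1(7) restrict_PiE[OF _ sub] by (simp only: prod_cat_sel)
      let ?r = "restrict x (I - {i})"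
      have "pass I S (i, ?r, c1) (i, ?r, c2) (i, ?r, c3) (i, ?r, c4) ((Ide (prod_cat (I - {i}) S) ?r)(i := g'))"
        by (rule pass.intros[OF i(1) xr 1(8)])
      then have "tass (psk I S) (S k) (Inl ((i, ?r, c1), x k)) (Inl ((i, ?r, c2), x k)) (Inl ((i, ?r, c3), x k)) (Inl ((i, ?r, c4), x k))
         ((Ide (prod_cat (I - {i}) S) ?r)(i := g'), Ide (S k) (x k))"
        using xk by (intro tassL) (simp_all only: psk_sel)
      moreover have "onArr (split_map I k S) g = ((Ide (prod_cat (I - {i}) S) ?r)(i := g'), Ide (S k) (x k))"
        using 1 i kk by (auto simp: fun_eq_iff)
      ultimately show ?thesis
        using 1 i by simp
    qed
  qed
qed

lemma split_two:
  assumes "TwoR (psk (insert k I) S) az ax ay bz bx by"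
  shows "TwoR (tsk (psk I S) (S k)) (jT (split_map I k S) az) (jT (split_map I k S) ax) (jT (split_map I k S) ay)
    (jT (split_map I k S) bz) (jT (split_map I k S) bx) (jT (split_map I k S) by)"
proof -
  have "ptwo (insert k I) S az ax ay bz bx by"
    using assms by (simp only: psk_sel)
  then show ?thesis
  proof cases
    case (1 i j x d e)
    \<comment> \<open>Relations involving \<open>k\<close> come from the mixed relations of the
      tensor product, the others from those of the left factor with the coordinate \<open>k\<close>
      as parameter.\<close>
    consider "i = k" "j \<in> I" "j \<noteq> k" | "j = k" "i \<in> I" "i \<noteq> k" | "i \<in> I" "j \<in> I" "i \<noteq> k" "j \<noteq> k"
      using 1(7-9) by blast
    then show ?thesis
    proof cases
      case c: 1
      have D: "insert k I - {k, j} = I - {j}" using c k by auto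
      have x: "x \<in> PiE (I - {j}) (\<lambda>l. Obj (S l))" using 1(10) D c by simp
      have xe: "x \<in> extensional (I - {j})" using x by (simp add: PiE_iff)
      have "ttwo (psk I S) (S k) (Inr (pZ (psk I S) (j, x, e), d)) (Inr (pX (psk I S) (j, x, e), d)) (Inr (pY (psk I S) (j, x, e), d))
         (Inl ((j, x, e), pZ (S k) d)) (Inl ((j, x, e), pX (S k) d)) (Inl ((j, x, e), pY (S k) d))"
        by (rule ttwoRL) (use 1 c x in simp_all)
      then show ?thesis
        using 1 c k xe by (simp add: restrict_fun_upd_notin del: restrict_fupd)
    next
      case c: 2
      have D: "insert k I - {i, k} = I - {i}" using c k by auto
      have x: "x \<in> PiE (I - {i}) (\<lambda>l. Obj (S l))" using 1(10) D c by simp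
      have xe: "x \<in> extensional (I - {i})" using x by (simp add: PiE_iff)
      have "ttwo (psk I S) (S k) (Inl ((i, x, d), pZ (S k) e)) (Inl ((i, x, d), pX (S k) e)) (Inl ((i, x, d), pY (S k) e))
         (Inr (pZ (psk I S) (i, x, d), e)) (Inr (pX (psk I S) (i, x, d), e)) (Inr (pY (psk I S) (i, x, d), e))"
        by (rule ttwoLR) (use 1 c x in simp_all)
      then show ?thesis
        using 1 c k xe by (simp add: restrict_fun_upd_notin del: restrict_fupd)
    next
      case c: 3
      have kk: "k \<in> insert k I - {i, j}" using c by auto
      have sub: "I - {i, j} \<subseteq> insert k I - {i, j}" by auto
      have xk: "x k \<in> Obj (S k)"
        using 1(10) kk by (auto dest: PiE_mem)
      let ?r = "restrict x (I - {i, j})"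
      have xr: "?r \<in> Obj (prod_cat (I - {i, j}) S)"
        using 1(10) restrict_PiE[OF _ sub] by (simp only: prod_cat_sel)
      have r: "restrict (x(j := a)) (I - {i}) = ?r(j := a)" "restrict (x(i := b)) (I - {j}) = ?r(i := b)" for a b
        using c(1,2) 1(9) by (auto simp: fun_eq_iff restrict_def)
      have "ptwo I S (i, ?r(j := pZ (S j) e), d) (i, ?r(j := pX (S j) e), d) (i, ?r(j := pY (S j) e), d)
          (j, ?r(i := pZ (S i) d), e) (j, ?r(i := pX (S i) d), e) (j, ?r(i := pY (S i) d), e)"
        by (rule ptwo.intros[OF c(1,2) 1(9) xr 1(11,12)])
      then have "ttwo (psk I S) (S k) (Inl ((i, ?r(j := pZ (S j) e), d), x k)) (Inl ((i, ?r(j := pX (S j) e), d), x k)) (Inl ((i, ?r(j := pY (S j) e), d), x k))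
          (Inl ((j, ?r(i := pZ (S i) d), e), x k)) (Inl ((j, ?r(i := pX (S i) d), e), x k)) (Inl ((j, ?r(i := pY (S i) d), e), x k))"
        using xk by (intro ttwoL) (simp_all only: psk_sel)
      then show ?thesis
        using 1(1-6) c r by (simp only: join_split_sel tsk_sel if_False fun_upd_apply if_True refl) simp
    qed
  qed
qed

lemma strict_split: "strict_smap (psk (insert k I) S) (tsk (psk I S) (S k)) (split_map I k S)"
proof -
  interpret A: sketch "psk I S" by (rule sk)
  interpret B: sketch "S k" by (rule sk)
  interpret T: sketch "tsk (psk I S) (S k)" by (rule sk)
  interpret C: sketch "psk (insert k I) S" by (rule sk)
  let ?J = "split_map I k S" and ?A = "psk (insert k I) S" and ?B = "tsk (psk I S) (S k)"
  have fn: "is_functor ?A ?B ?J"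
    unfolding is_functor_def
  proof (intro conjI ballI allI)
    show "onObj ?J a \<in> Obj ?B" if "a \<in> Obj ?A" for a
      using that by (auto simp: PiE_iff)
    show "onArr ?J f \<in> Hom ?B (onObj ?J a) (onObj ?J b)" if f: "f \<in> Hom ?A a b" for f a b
    proof -
      have "restrict f I \<in> Hom (psk I S) (restrict a I) (restrict b I)"
        using restrict_Hom[OF f[unfolded psk_Hom], of I] unfolding psk_Hom by auto
      moreover have "f k \<in> Hom (S k) (a k) (b k)"
        using f[unfolded psk_Hom prod_Hom] by simp
      ultimately show ?thesis by simp
    qed
    show "onArr ?J (Ide ?A a) = Ide ?B (onObj ?J a)" for a
      by (auto simp: fun_eq_iff)
    show "onArr ?J (g \<cdot>\<^bsub>?A\<^esub> f) = onArr ?J g \<cdot>\<^bsub>?B\<^esub> onArr ?J f" for g f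
      by (auto simp: fun_eq_iff)
  qed
  have Y: "pY ?B (jT ?J d) = onObj ?J (pY ?A d) \<and> pX ?B (jT ?J d) = onObj ?J (pX ?A d) \<and>
      pZ ?B (jT ?J d) = onObj ?J (pZ ?A d) \<and> jT ?J d \<in> Tr ?B" if td: "d \<in> Tr ?A" for d
  proof -
    obtain i x e where d: "d = (i, x, e)" by (cases d)
    show ?thesis
    proof (cases "i = k")
      case True
      then have x: "x \<in> PiE I (\<lambda>j. Obj (S j))" using td d sets_k(1) by simp
      then have "x \<in> extensional I" by (simp add: PiE_iff)
      then show ?thesis
        using True d td x k by (simp add: restrict_fun_upd_notin del: restrict_fupd)
    next
      case False
      then have i: "i \<in> I" "i \<noteq> k" using td d by auto
      have "x k \<in> Obj (S k)" "restrict x (I - {i}) \<in> PiE (I - {i}) (\<lambda>j. Obj (S j))"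
        using td d i by (auto simp: PiE_iff)
      then show ?thesis
        using i d td by (simp add: restrict_fun_upd_in del: restrict_fupd restrict_upd)
    qed
  qed
  have jA: "jA ?J d = Ide ?B (onObj ?J (pY ?A d))" for d
    by (simp add: split_map_def)
  have sm: "is_smap ?A ?B ?J"
    unfolding is_smap_def
  proof (intro conjI ballI fn)
    fix d assume d: "d \<in> Tr ?A"
    show "jT ?J d \<in> Tr ?B" "pX ?B (jT ?J d) = onObj ?J (pX ?A d)" "pZ ?B (jT ?J d) = onObj ?J (pZ ?A d)"
      using Y[OF d] by auto
    have "onObj ?J (pY ?A d) \<in> Obj ?B"
      using T.Tr_Obj(2)[of "jT ?J d"] Y[OF d] by simp
    then show "jA ?J d \<in> Hom ?B (pY ?B (jT ?J d)) (onObj ?J (pY ?A d))"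
      unfolding jA using T.Ide_in Y[OF d] by (simp del: Hom_def psk_sel tsk_sel)
  qed
  show ?thesis
    unfolding strict_smap_def
    using sm Y jA split_nat split_com split_ass split_two by (simp del: tsk_sel psk_sel join_split_sel)
qed

lemma restrict_fun_upd_id: "x \<in> extensional (insert j J) \<Longrightarrow> (restrict x J)(j := x j) = x"
  by (auto simp: fun_eq_iff extensional_def)

lemma join_split:
  "b \<in> Obj (psk (insert k I) S) \<Longrightarrow> onObj (join_map I k S) (onObj (split_map I k S) b) = b"
  "f \<in> Arr (psk (insert k I) S) \<Longrightarrow> onArr (join_map I k S) (onArr (split_map I k S) f) = f"
  "d \<in> Tr (psk (insert k I) S) \<Longrightarrow> jT (join_map I k S) (jT (split_map I k S) d) = d"
proof -
  show "onObj (join_map I k S) (onObj (split_map I k S) b) = b" if "b \<in> Obj (psk (insert k I) S)"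
    using that by (simp add: PiE_iff restrict_fun_upd_id del: fun_upd_apply restrict_upd)
  show "onArr (join_map I k S) (onArr (split_map I k S) f) = f" if "f \<in> Arr (psk (insert k I) S)"
    using that by (simp add: PiE_iff restrict_fun_upd_id del: fun_upd_apply restrict_upd)
  show "jT (join_map I k S) (jT (split_map I k S) d) = d" if td: "d \<in> Tr (psk (insert k I) S)"
  proof -
    obtain i x e where d: "d = (i, x, e)" by (cases d)
    show ?thesis
      using td d restrict_fun_upd_id[of x k "I - {i}"] sets_k by (auto simp: PiE_iff simp del: fun_upd_apply restrict_upd)
  qed
qed

lemma split_join:
  "b \<in> Obj (tsk (psk I S) (S k)) \<Longrightarrow> onObj (split_map I k S) (onObj (join_map I k S) b) = b"
  "f \<in> Arr (tsk (psk I S) (S k)) \<Longrightarrow> onArr (split_map I k S) (onArr (join_map I k S) f) = f"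
  "d \<in> Tr (tsk (psk I S) (S k)) \<Longrightarrow> jT (split_map I k S) (jT (join_map I k S) d) = d"
proof -
  show "onObj (split_map I k S) (onObj (join_map I k S) b) = b" if "b \<in> Obj (tsk (psk I S) (S k))"
    using that k by (cases b) (simp add: PiE_iff restrict_fun_upd_notin del: restrict_fupd)
  show "onArr (split_map I k S) (onArr (join_map I k S) f) = f" if "f \<in> Arr (tsk (psk I S) (S k))"
    using that k by (cases f) (simp add: PiE_iff restrict_fun_upd_notin del: restrict_fupd)
  show "jT (split_map I k S) (jT (join_map I k S) d) = d" if "d \<in> Tr (tsk (psk I S) (S k))"
    using that
  proof (cases rule: tsk_TrE)
    case (1 e s)
    obtain i x e' where e: "e = (i, x, e')" by (cases e)
    show ?thesis
      using 1 e k sets_k(3) by (auto simp add: PiE_iff restrict_fun_upd_notin simp del: restrict_fupd)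
  next
    case (2 r e)
    then show ?thesis by simp
  qed
qed

end

section \<open>Induction on the number of variables\<close>

definition pmap :: "'i set \<Rightarrow> ('i \<Rightarrow> ('c, 'd, 'u) sketch) \<Rightarrow> ('i \<Rightarrow> ('a, 'b, 'c, 'd, 't, 'u) smap)
    \<Rightarrow> ('i \<Rightarrow> 'a, 'i \<Rightarrow> 'b, 'i \<Rightarrow> 'c, 'i \<Rightarrow> 'd, 'i \<times> ('i \<Rightarrow> 'a) \<times> 't, 'i \<times> ('i \<Rightarrow> 'c) \<times> 'u) smap" where
  "pmap I V J = \<lparr>onObj = (\<lambda>x. \<lambda>i\<in>I. onObj (J i) (x i)), onArr = (\<lambda>f. \<lambda>i\<in>I. onArr (J i) (f i)),
     jT = (\<lambda>(i, x, d). (i, \<lambda>j\<in>I - {i}. onObj (J j) (x j), jT (J i) d)),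
     jA = (\<lambda>(i, x, d). (Ide (prod_cat (I - {i}) V) (\<lambda>j\<in>I - {i}. onObj (J j) (x j)))(i := jA (J i) d))\<rparr>"

lemma pmap_sel [simp]:
  "onObj (pmap I V J) x = (\<lambda>i\<in>I. onObj (J i) (x i))" "onArr (pmap I V J) f = (\<lambda>i\<in>I. onArr (J i) (f i))"
  "jT (pmap I V J) (i, x, d) = (i, \<lambda>j\<in>I - {i}. onObj (J j) (x j), jT (J i) d)"
  "jA (pmap I V J) (i, x, d) = (Ide (prod_cat (I - {i}) V) (\<lambda>j\<in>I - {i}. onObj (J j) (x j)))(i := jA (J i) d)"
  by (simp_all add: pmap_def)

lemma empty_psk:
  "Obj (psk {} S) = {\<lambda>_. undefined}" "Arr (psk {} S) = {\<lambda>_. undefined}" "Tr (psk {} S) = {}"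
  by (auto simp: psk_def)

text \<open>The empty family has one object, one arrow and no triangles, whatever the
  factors.\<close>

lemma strict_pmap_empty: "strict_smap (psk {} T) (psk {} V) (pmap {} V J)"
  by (auto simp: strict_smap_def is_smap_def is_functor_def empty_psk simp del: psk_sel(1,2)
      elim: pnat.cases pcom.cases pass.cases ptwo.cases)

context picard_groupoid
begin

text \<open>Split off the variable \<open>k\<close>, replace both factors, and join again. The two
  outer maps are strict, so the comparison arrow of the composite is that of the middle map carried
  along by \<open>join_map\<close>.\<close>

lemma requiv_pmap:
  fixes T :: "'i \<Rightarrow> ('a, 'b, 't) sketch" and V :: "'i \<Rightarrow> ('c, 'd, 'u) sketch"
    and J :: "'i \<Rightarrow> ('a, 'b, 'c, 'd, 't, 'u) smap"
  assumes "finite I" "\<And>i. i \<in> I \<Longrightarrow> requiv (T i) (V i) (J i)"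
    "\<And>i az ax ay bz bx by. i \<in> I \<Longrightarrow> \<not> TwoR (T i) az ax ay bz bx by"
    "\<And>i az ax ay bz bx by. i \<in> I \<Longrightarrow> \<not> TwoR (V i) az ax ay bz bx by"
  shows "requiv (psk I T) (psk I V) (pmap I V J)"
  using assms
proof (induction I rule: finite_induct)
  case empty
  \<comment> \<open>The inverse map is again one between empty families, with an arbitrary value in
    the role of \<open>J\<close>.\<close>
  show ?case
    by (rule requiv_iso[OF sketch_psk sketch_psk strict_pmap_empty strict_pmap_empty[where J = "undefined"]])
      (simp_all add: empty_psk fun_eq_iff del: psk_sel(1,2))
next
  case (insert k I)
  have IH: "requiv (psk I T) (psk I V) (pmap I V J)"
    using insert by auto
  have k: "requiv (T k) (V k) (J k)"
    using insert by auto
  have sT: "\<And>i. i \<in> insert k I \<Longrightarrow> sketch (T i)" and sV: "\<And>i. i \<in> insert k I \<Longrightarrow> sketch (V i)"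
    using requivD(1,2) insert.prems(1) by blast+
  have nT: "\<not> TwoR (T k) az ax ay bz bx by" for az ax ay bz bx "by"
    using insert.prems(2) by auto
  have nV: "\<not> TwoR (V k) az ax ay bz bx by" for az ax ay bz bx "by"
    using insert.prems(3) by auto
  note cT = insert.hyps(2) sT nT and cV = insert.hyps(2) sV nV
  note skT = sk[of k I T, OF cT] and skV = sk[of k I V, OF cV]
    and isoT = strict_split[of k I T, OF cT] strict_join[of k I T, OF cT]
    and isoV = strict_split[of k I V, OF cV] strict_join[of k I V, OF cV]
    and invT = join_split[of k I T, OF cT] split_join[of k I T, OF cT]
    and invV = split_join[of k I V, OF cV] join_split[of k I V, OF cV]
  let ?M1 = "split_map I k T" and ?M2 = "both_map (psk I V) (V k) (pmap I V J) (J k)" and ?M3 = "join_map I k V"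
  let ?C1 = "comp_smap (tsk (psk I V) (V k)) ?M2 ?M1" and ?C2 = "\<lambda>C. comp_smap (psk (insert k I) V) ?M3 C"
  have 1: "requiv (psk (insert k I) T) (tsk (psk I T) (T k)) ?M1"
    by (rule requiv_iso[OF skT(4,3) isoT invT])
  have 2: "requiv (tsk (psk I T) (T k)) (tsk (psk I V) (V k)) ?M2"
    by (rule requiv_both[OF IH k])
  have 3: "requiv (tsk (psk I V) (V k)) (psk (insert k I) V) ?M3"
    by (rule requiv_iso[OF skV(3,4) isoV(2,1) invV])
  have C1: "requiv (psk (insert k I) T) (tsk (psk I V) (V k)) ?C1"
    by (rule requiv_trans[OF 1 2])
  have C2: "requiv (psk (insert k I) T) (psk (insert k I) V) (?C2 ?C1)"
    by (rule requiv_trans[OF C1 3])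
  have a1: "jA ?C1 d = jA ?M2 (jT ?M1 d)" if "d \<in> Tr (psk (insert k I) T)" for d
    by (rule comp_strict_right[OF requivD(3)[OF 2] isoT(1) skT(4) skT(3) skV(3) that])
  have a2: "jA (?C2 ?C1) d = onArr ?M3 (jA ?C1 d)" if "d \<in> Tr (psk (insert k I) T)" for d
    by (rule comp_strict_left[OF isoV(2) requivD(3)[OF C1] skV(3) skV(4) that])
  have kI: "k \<notin> I" by (rule insert.hyps(2))
  have "smap_agree (psk (insert k I) T) (?C2 ?C1) (pmap (insert k I) V J)"
    unfolding smap_agree_def
  proof (intro conjI ballI)
    show "onObj (?C2 ?C1) a = onObj (pmap (insert k I) V J) a" for a
      using kI by (auto simp: fun_eq_iff)
    show "onArr (?C2 ?C1) a = onArr (pmap (insert k I) V J) a" for a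
      using kI by (auto simp: fun_eq_iff)
  next
    fix d assume td: "d \<in> Tr (psk (insert k I) T)"
    obtain i x e where d: "d = (i, x, e)" by (cases d)
    have i: "i \<in> insert k I" using td d by simp
    show "jT (?C2 ?C1) d = jT (pmap (insert k I) V J) d"
      using kI i by (auto simp: fun_eq_iff d)
    show "jA (?C2 ?C1) d = jA (pmap (insert k I) V J) d"
      using kI i unfolding a2[OF td] a1[OF td] by (auto simp: fun_eq_iff d)
  qed
  from requiv_cong[OF C2 this] show ?case .
qed

end

section \<open>Triangulated categories as sketches\<close>

context category
begin

lemma iso_arr_Arr: "iso_arr C f \<Longrightarrow> f \<in> Arr C"
  by (auto simp: iso_arr_def inverse_arrows_def)

lemma iso_arr_Ide [simp]: "a \<in> Obj C \<Longrightarrow> iso_arr C (Ide C a)"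
  by (rule iso_arrI[of _ "Ide C a"]) auto

lemma iso_arr_Cmp:
  assumes "iso_arr C f" "iso_arr C g" "Dom C g = Cod C f"
  shows "iso_arr C (g \<cdot> f)"
proof -
  obtain f' g' where f: "inverse_arrows C f f'" and g: "inverse_arrows C g g'"
    using assms by (auto simp: iso_arr_def)
  have t: "f \<in> Arr C" "f' \<in> Arr C" "Dom C f' = Cod C f" "Cod C f' = Dom C f"
    "g \<in> Arr C" "g' \<in> Arr C" "Dom C g' = Cod C g" "Cod C g' = Dom C g"
    using f g by (auto simp: inverse_arrows_def)
  have e: "f' \<cdot> f = Ide C (Dom C f)" "f \<cdot> f' = Ide C (Cod C f)" "g' \<cdot> g = Ide C (Dom C g)" "g \<cdot> g' = Ide C (Cod C g)"
    using f g by (auto simp: inverse_arrows_def)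
  have "g' \<cdot> (g \<cdot> f) = f" "f \<cdot> (f' \<cdot> g') = g'"
    using t e assms(3) Cmp_assoc'[of f g g', symmetric] Cmp_assoc'[of g' f' f, symmetric] by simp_all
  then show ?thesis
    using t e assms(3) by (intro iso_arrI[of _ "f' \<cdot> g'"]) simp_all
qed

lemma isom_sel [simp]:
  "Obj (isom C) = Obj C" "f \<in> Arr (isom C) \<longleftrightarrow> iso_arr C f" "Dom (isom C) = Dom C" "Cod (isom C) = Cod C"
  "Ide (isom C) = Ide C" "g \<cdot>\<^bsub>isom C\<^esub> f = g \<cdot> f"
  by (simp_all add: isom_def)

lemma category_isom: "category (isom C)"
  by unfold_locales (auto simp: iso_arr_Arr intro: iso_arr_Cmp)

end

section \<open>Zero arrows and split triangles\<close>

context triangulated_category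
begin

lemma zero_in [simp]:
  assumes "a \<in> Obj T" "b \<in> Obj T"
  shows "zeroA T a b \<in> Arr T" "Dom T (zeroA T a b) = a" "Cod T (zeroA T a b) = b"
  using comm_group.axioms(2)[OF Hom_comm_group[OF assms], THEN group.is_monoid, THEN monoid.one_closed]
  by (auto simp: Hom_group_def)

lemma add_in [simp]:
  assumes "f \<in> Arr T" "g \<in> Arr T" "Dom T f = a" "Dom T g = a" "Cod T f = b" "Cod T g = b"
  shows "addA T f g \<in> Arr T" "Dom T (addA T f g) = a" "Cod T (addA T f g) = b"
proof -
  have ob: "a \<in> Obj T" "b \<in> Obj T" using assms by auto
  show "addA T f g \<in> Arr T" "Dom T (addA T f g) = a" "Cod T (addA T f g) = b"
    using comm_group.axioms(2)[OF Hom_comm_group[OF ob], THEN group.is_monoid, THEN monoid.m_closed, of f g] assms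
    by (auto simp: Hom_group_def)
qed

lemma add_zero:
  assumes "f \<in> Arr T" "Dom T f = a" "Cod T f = b"
  shows "addA T f (zeroA T a b) = f" "addA T (zeroA T a b) f = f"
proof -
  have ob: "a \<in> Obj T" "b \<in> Obj T" using assms by auto
  interpret G: comm_group "Hom_group T a b" by (rule Hom_comm_group[OF ob])
  show "addA T f (zeroA T a b) = f" "addA T (zeroA T a b) f = f"
    using G.r_one[of f] G.l_one[of f] assms by (auto simp: Hom_group_def)
qed

lemma add_commute:
  assumes "f \<in> Arr T" "g \<in> Arr T" "Dom T f = a" "Dom T g = a" "Cod T f = b" "Cod T g = b"
  shows "addA T f g = addA T g f"
proof -
  have ob: "a \<in> Obj T" "b \<in> Obj T" using assms by auto
  interpret G: comm_group "Hom_group T a b" by (rule Hom_comm_group[OF ob])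
  show ?thesis
    using G.m_comm[of f g] assms by (auto simp: Hom_group_def)
qed

text \<open>Lets composites with zero arrows be recognised as zero: by bilinearity such a composite
  equals its own double.\<close>

lemma idem_zero:
  assumes "f \<in> Arr T" "Dom T f = a" "Cod T f = b" "addA T f f = f"
  shows "f = zeroA T a b"
proof -
  have ob: "a \<in> Obj T" "b \<in> Obj T" using assms by auto
  interpret G: comm_group "Hom_group T a b" by (rule Hom_comm_group[OF ob])
  show ?thesis
    using G.r_cancel_one[of f f] assms by (auto simp: Hom_group_def)
qed

lemma zero_Cmp [simp]:
  assumes "f \<in> Arr T" "Cod T f = b" "c \<in> Obj T"
  shows "zeroA T b c \<cdot> f = zeroA T (Dom T f) c"
proof (rule idem_zero)
  have b: "b \<in> Obj T" using assms by auto
  show "zeroA T b c \<cdot> f \<in> Arr T" "Dom T (zeroA T b c \<cdot> f) = Dom T f" "Cod T (zeroA T b c \<cdot> f) = c"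
    using assms b by simp_all
  show "addA T (zeroA T b c \<cdot> f) (zeroA T b c \<cdot> f) = zeroA T b c \<cdot> f"
    using assms b Cmp_add_left[of f "Dom T f" b "zeroA T b c" c "zeroA T b c"] by (simp add: add_zero)
qed

lemma Cmp_zero [simp]:
  assumes "f \<in> Arr T" "Dom T f = b" "a \<in> Obj T"
  shows "f \<cdot> zeroA T a b = zeroA T a (Cod T f)"
proof (rule idem_zero)
  have b: "b \<in> Obj T" using assms by auto
  show "f \<cdot> zeroA T a b \<in> Arr T" "Dom T (f \<cdot> zeroA T a b) = a" "Cod T (f \<cdot> zeroA T a b) = Cod T f"
    using assms b by simp_all
  show "addA T (f \<cdot> zeroA T a b) (f \<cdot> zeroA T a b) = f \<cdot> zeroA T a b"
    using assms b Cmp_add_right[of "zeroA T a b" a b "zeroA T a b" f "Cod T f"] by (simp add: add_zero)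
qed

lemma shift_simps [simp]:
  "a \<in> Obj T \<Longrightarrow> shiftO T a \<in> Obj T" "f \<in> Arr T \<Longrightarrow> shiftA T f \<in> Arr T"
  "f \<in> Arr T \<Longrightarrow> Dom T (shiftA T f) = shiftO T (Dom T f)" "f \<in> Arr T \<Longrightarrow> Cod T (shiftA T f) = shiftO T (Cod T f)"
  "a \<in> Obj T \<Longrightarrow> shiftA T (Ide T a) = Ide T (shiftO T a)"
  using shift_equivalence by (auto simp: equivalence_functor_def is_functor_def shift_def)

lemma shift_zero [simp]:
  assumes "a \<in> Obj T" "b \<in> Obj T"
  shows "shiftA T (zeroA T a b) = zeroA T (shiftO T a) (shiftO T b)"
proof (rule idem_zero)
  show "addA T (shiftA T (zeroA T a b)) (shiftA T (zeroA T a b)) = shiftA T (zeroA T a b)"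
    using assms shift_additive[of "zeroA T a b" a b "zeroA T a b"] by (simp add: add_zero)
qed (use assms in simp_all)

lemma zero_object_Ide: "zero_object T z \<Longrightarrow> Ide T z = zeroA T z z"
  using zero_in[of z z] Ide_in[of z] unfolding zero_object_def by fastforce

text \<open>The shift of a zero object has a vanishing identity, which forces every arrow into or
  out of it to be zero.\<close>

lemma zero_object_shift:
  assumes "zero_object T z"
  shows "zero_object T (shiftO T z)"
proof -
  have z: "z \<in> Obj T" using assms by (simp add: zero_object_def)
  have I: "Ide T (shiftO T z) = zeroA T (shiftO T z) (shiftO T z)"
    using z zero_object_Ide[OF assms] shift_simps(5)[OF z] by simp
  have 1: "f = zeroA T a (shiftO T z)" if "f \<in> Hom T a (shiftO T z)" for f a
    using that z I Ide_Cmp[of f "shiftO T z"] zero_Cmp[of f "shiftO T z" "shiftO T z"] by simp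
  have 2: "f = zeroA T (shiftO T z) a" if "f \<in> Hom T (shiftO T z) a" for f a
    using that z I Cmp_Ide[of f "shiftO T z"] Cmp_zero[of f "shiftO T z" "shiftO T z"] by simp
  have "\<exists>!f. f \<in> Hom T a (shiftO T z)" if "a \<in> Obj T" for a
    by (rule ex1I[of _ "zeroA T a (shiftO T z)"], use that z in simp, rule 1)
  moreover have "\<exists>!f. f \<in> Hom T (shiftO T z) a" if "a \<in> Obj T" for a
    by (rule ex1I[of _ "zeroA T (shiftO T z) a"], use that z in simp, rule 2)
  ultimately show ?thesis
    using z by (simp add: zero_object_def del: Hom_def)
qed

lemma neg_zero [simp]:
  assumes "a \<in> Obj T" "b \<in> Obj T"
  shows "negA T (zeroA T a b) = zeroA T a b"
proof -
  interpret G: comm_group "Hom_group T a b" by (rule Hom_comm_group[OF assms])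
  have one: "\<one>\<^bsub>Hom_group T a b\<^esub> = zeroA T a b"
    by (simp add: Hom_group_def)
  show ?thesis
    using G.inv_one assms unfolding one by (simp add: negA_def)
qed

text \<open>One rotation carries this triangle to the identity triangle of \<open>c\<close> with
  third vertex the zero object \<open>shiftO T z\<close>; the sign falls on a zero arrow.\<close>

lemma Dist_zero_left:
  assumes "zero_object T z" "c \<in> Obj T"
  shows "Tri (zeroA T z c) (Ide T c) (zeroA T c (shiftO T z)) \<in> Dist T"
proof -
  have z: "z \<in> Obj T" using assms by (simp add: zero_object_def)
  have t: "is_triangle T (Tri (zeroA T z c) (Ide T c) (zeroA T c (shiftO T z)))"
    using z assms(2) by (simp add: is_triangle_def tX_def tY_def tZ_def)
  show ?thesis
    using Dist_identity[OF assms(2) zero_object_shift[OF assms(1)]] z assms(2) by (simp add: Dist_rotate[OF t])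
qed

lemma biproduct_swap:
  assumes "biproduct T x y s i\<^sub>1 i\<^sub>2 p\<^sub>1 p\<^sub>2"
  shows "biproduct T y x s i\<^sub>2 i\<^sub>1 p\<^sub>2 p\<^sub>1"
  using assms add_commute[of "i\<^sub>1 \<cdot> p\<^sub>1" "i\<^sub>2 \<cdot> p\<^sub>2" s s] by (simp add: biproduct_def)

text \<open>
  Complete \<open>i\<^sub>1\<close> to a triangle \<open>x \<rightarrow> s \<rightarrow> c \<rightarrow> \<Sigma>x\<close>.  As \<open>i\<^sub>1\<close> splits, the last map vanishes, so
  \<open>s \<rightarrow> c\<close> is an epimorphism with the same weak universal property as \<open>p\<^sub>2\<close>.
\<close>

lemma split_triangle_Dist:
  assumes "biproduct T x y s i\<^sub>1 i\<^sub>2 p\<^sub>1 p\<^sub>2"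
  shows "Tri i\<^sub>1 p\<^sub>2 (zeroA T y (shiftO T x)) \<in> Dist T"
proof -
  have ob: "x \<in> Obj T" "y \<in> Obj T" "s \<in> Obj T"
    and A: "i\<^sub>1 \<in> Arr T" "Dom T i\<^sub>1 = x" "Cod T i\<^sub>1 = s" "i\<^sub>2 \<in> Arr T" "Dom T i\<^sub>2 = y" "Cod T i\<^sub>2 = s"
      "p\<^sub>1 \<in> Arr T" "Dom T p\<^sub>1 = s" "Cod T p\<^sub>1 = x" "p\<^sub>2 \<in> Arr T" "Dom T p\<^sub>2 = s" "Cod T p\<^sub>2 = y"
    and e: "p\<^sub>1 \<cdot> i\<^sub>1 = Ide T x" "p\<^sub>2 \<cdot> i\<^sub>2 = Ide T y" "p\<^sub>2 \<cdot> i\<^sub>1 = zeroA T x y"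
      "addA T (i\<^sub>1 \<cdot> p\<^sub>1) (i\<^sub>2 \<cdot> p\<^sub>2) = Ide T s"
    using assms by (auto simp: biproduct_def)
  obtain z where z: "zero_object T z" using has_zero_object by blast
  then have zO: "z \<in> Obj T" by (simp add: zero_object_def)
  obtain v w where vw: "Tri i\<^sub>1 v w \<in> Dist T" using Dist_complete[OF A(1)] by blast
  define c where "c = Cod T v"
  have t: "is_triangle T (Tri i\<^sub>1 v w)" by (rule Dist_triangle[OF vw])
  then have V: "v \<in> Arr T" "Dom T v = s" "Cod T v = c" "w \<in> Arr T" "Dom T w = c" "Cod T w = shiftO T x"
    using A by (auto simp: is_triangle_def tX_def tY_def tZ_def c_def)
  have c: "c \<in> Obj T" using V by auto
  have idT: "Tri (Ide T x) (zeroA T x z) (zeroA T z (shiftO T x)) \<in> Dist T"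
    by (rule Dist_identity[OF ob(1) z])
  \<comment> \<open>The retraction \<open>p\<^sub>1\<close> of \<open>i\<^sub>1\<close> gives a
    morphism to the identity triangle of \<open>x\<close>, so \<open>w\<close> factors through the
    zero object.\<close>
  have "\<exists>h. triangle_morphism T (Tri i\<^sub>1 v w) (Tri (Ide T x) (zeroA T x z) (zeroA T z (shiftO T x))) (Ide T x) p\<^sub>1 h"
    by (rule Dist_morphism[OF vw idT]) (use A ob zO e(1) in \<open>simp_all add: tX_def tY_def\<close>)
  then obtain h where "triangle_morphism T (Tri i\<^sub>1 v w) (Tri (Ide T x) (zeroA T x z) (zeroA T z (shiftO T x))) (Ide T x) p\<^sub>1 h" by blast
  then have h: "h \<in> Arr T" "Dom T h = c" "Cod T h = z" "w = zeroA T z (shiftO T x) \<cdot> h"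
    using A V ob zO by (simp_all add: triangle_morphism_def tX_def tY_def tZ_def)
  have w0: "w = zeroA T c (shiftO T x)"
    unfolding h(4) using h(1-3) ob zO by simp
  \<comment> \<open>In the other direction, \<open>v \<cdot> i\<^sub>1\<close> factors through the
    zero object.\<close>
  have "\<exists>h'. triangle_morphism T (Tri (Ide T x) (zeroA T x z) (zeroA T z (shiftO T x))) (Tri i\<^sub>1 v w) (Ide T x) i\<^sub>1 h'"
    by (rule Dist_morphism[OF idT vw]) (use A ob zO in \<open>simp_all add: tX_def tY_def\<close>)
  then obtain h' where "triangle_morphism T (Tri (Ide T x) (zeroA T x z) (zeroA T z (shiftO T x))) (Tri i\<^sub>1 v w) (Ide T x) i\<^sub>1 h'" by blast
  then have h': "h' \<in> Arr T" "Dom T h' = z" "Cod T h' = c" "v \<cdot> i\<^sub>1 = h' \<cdot> zeroA T x z"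
    using A V ob zO by (simp_all add: triangle_morphism_def tX_def tY_def tZ_def)
  have vi: "v \<cdot> i\<^sub>1 = zeroA T x c"
    unfolding h'(4) using h'(1-3) ob zO by simp
  \<comment> \<open>\<open>p\<^sub>2\<close> vanishes on \<open>i\<^sub>1\<close>, so it factors
    through \<open>v\<close>; a triangle starting in a zero object expresses this as a morphism of
    triangles.\<close>
  have "\<exists>q. triangle_morphism T (Tri i\<^sub>1 v w) (Tri (zeroA T z y) (Ide T y) (zeroA T y (shiftO T z))) (zeroA T x z) p\<^sub>2 q"
    by (rule Dist_morphism[OF vw Dist_zero_left[OF z ob(2)]]) (use A ob zO e(3) in \<open>simp_all add: tX_def tY_def\<close>)
  then obtain q where "triangle_morphism T (Tri i\<^sub>1 v w) (Tri (zeroA T z y) (Ide T y) (zeroA T y (shiftO T z))) (zeroA T x z) p\<^sub>2 q" by blast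
  then have q: "q \<in> Arr T" "Dom T q = c" "Cod T q = y" "q \<cdot> v = p\<^sub>2"
    using A V ob zO by (simp_all add: triangle_morphism_def tX_def tY_def tZ_def)
  have rot: "Tri v w (negA T (shiftA T i\<^sub>1)) \<in> Dist T"
    using Dist_rotate[OF t] vw by simp
  \<comment> \<open>In the rotated triangle an arrow out of \<open>c\<close> that kills
    \<open>v\<close> factors through \<open>w\<close>, which is zero.\<close>
  have epi: "g = zeroA T c d" if g: "g \<in> Arr T" "Dom T g = c" "Cod T g = d" "g \<cdot> v = zeroA T s d" for g d
  proof -
    have d: "d \<in> Obj T" using g by auto
    have "\<exists>h. triangle_morphism T (Tri v w (negA T (shiftA T i\<^sub>1))) (Tri (zeroA T z d) (Ide T d) (zeroA T d (shiftO T z))) (zeroA T s z) g h"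
      by (rule Dist_morphism[OF rot Dist_zero_left[OF z d]]) (use V ob zO d g in \<open>simp_all add: tX_def tY_def\<close>)
    then obtain h where "triangle_morphism T (Tri v w (negA T (shiftA T i\<^sub>1))) (Tri (zeroA T z d) (Ide T d) (zeroA T d (shiftO T z))) (zeroA T s z) g h" by blast
    then have h: "h \<in> Arr T" "Dom T h = shiftO T x" "Cod T h = d" "g = h \<cdot> w"
      using V ob zO d g c by (simp_all add: triangle_morphism_def tX_def tY_def tZ_def)
    show ?thesis
      unfolding h(4) w0 using h(1-3) ob c by simp
  qed
  define r where "r = v \<cdot> i\<^sub>2"
  have r: "r \<in> Arr T" "Dom T r = y" "Cod T r = c"
    using A V by (simp_all add: r_def)
  have qr: "q \<cdot> r = Ide T y"
    using q A V e(2) Cmp_assoc'[of i\<^sub>2 v q, symmetric] by (simp add: r_def)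
  have "v \<cdot> (i\<^sub>2 \<cdot> p\<^sub>2) = v"
  proof -
    have "v = v \<cdot> addA T (i\<^sub>1 \<cdot> p\<^sub>1) (i\<^sub>2 \<cdot> p\<^sub>2)"
      using e(4) V by simp
    also have "\<dots> = addA T (v \<cdot> (i\<^sub>1 \<cdot> p\<^sub>1)) (v \<cdot> (i\<^sub>2 \<cdot> p\<^sub>2))"
      using A V by (intro Cmp_add_right[of _ s s]) auto
    also have "v \<cdot> (i\<^sub>1 \<cdot> p\<^sub>1) = zeroA T s c"
      using A V vi c Cmp_assoc'[of p\<^sub>1 i\<^sub>1 v, symmetric] by simp
    also have "addA T (zeroA T s c) (v \<cdot> (i\<^sub>2 \<cdot> p\<^sub>2)) = v \<cdot> (i\<^sub>2 \<cdot> p\<^sub>2)"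
      using A V by (intro add_zero) auto
    finally show ?thesis ..
  qed
  then have rqv: "(r \<cdot> q) \<cdot> v = v"
    using A V q by (simp add: r_def)
  \<comment> \<open>\<open>epi\<close> cancels \<open>v\<close> only against zero. So the identity
    is subtracted, with \<open>n\<close> its negative, and \<open>epi\<close> is applied to the
    difference.\<close>
  have rq: "r \<cdot> q = Ide T c"
  proof -
    interpret G: comm_group "Hom_group T c c" by (rule Hom_comm_group[OF c c])
    have cr: "r \<cdot> q \<in> carrier (Hom_group T c c)" "Ide T c \<in> carrier (Hom_group T c c)"
      using r q c by (auto simp: Hom_group_def)
    define n where "n = inv\<^bsub>Hom_group T c c\<^esub> Ide T c"
    have n: "n \<in> Arr T" "Dom T n = c" "Cod T n = c" "addA T (Ide T c) n = zeroA T c c"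
      using G.inv_closed[OF cr(2)] G.r_inv[OF cr(2)] by (auto simp: n_def[symmetric]) (auto simp: Hom_group_def)
    have "addA T (r \<cdot> q) n \<cdot> v = addA T ((r \<cdot> q) \<cdot> v) (n \<cdot> v)"
      using r q n V by (intro Cmp_add_left[of _ s c _ c]) auto
    also have "\<dots> = addA T (Ide T c \<cdot> v) (n \<cdot> v)"
      using rqv V by simp
    also have "\<dots> = addA T (Ide T c) n \<cdot> v"
      using n V c by (intro Cmp_add_left[of _ s c _ c, symmetric]) auto
    also have "\<dots> = zeroA T s c"
      using n V c by simp
    finally have "addA T (r \<cdot> q) n = zeroA T c c"
      using r q n by (intro epi) auto
    then have "(r \<cdot> q) \<otimes>\<^bsub>Hom_group T c c\<^esub> n = Ide T c \<otimes>\<^bsub>Hom_group T c c\<^esub> n"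
      using n(4) by (simp add: Hom_group_def)
    then show ?thesis
      using G.right_cancel[OF G.inv_closed[OF cr(2)] cr] by (simp add: n_def[symmetric])
  qed
  have iq: "iso_arr T q"
    by (rule iso_arrI[of q r]) (use q r qr rq in auto)
  have t': "is_triangle T (Tri i\<^sub>1 p\<^sub>2 (zeroA T y (shiftO T x)))"
    using A ob by (simp add: is_triangle_def tX_def tY_def tZ_def)
  have "triangle_iso T (Tri i\<^sub>1 v w) (Tri i\<^sub>1 p\<^sub>2 (zeroA T y (shiftO T x))) (Ide T x) (Ide T s) q"
    using A V ob q iq c by (auto simp: triangle_iso_def triangle_morphism_def tX_def tY_def tZ_def w0)
  from Dist_iso[OF vw t' this] show ?thesis .
qed

end

text \<open>The arrows are the isomorphisms only, while triangles are made of arbitrary arrows of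
  \<open>T\<close>; so a triangle is not a diagram in the underlying category but a separate datum.
  The comparison arrows in \<open>ComR\<close> and \<open>AssR\<close> are identities.\<close>

definition Tsk :: "('o, 'm, 'x) tri_cat_scheme \<Rightarrow> ('o, 'm, 'm triangle) sketch" where
  "Tsk T = \<lparr>Obj = Obj T, Arr = {f. iso_arr T f}, Dom = Dom T, Cod = Cod T, Ide = Ide T, Cmp = Cmp T,
     Tr = Dist T, pX = tX T, pY = tY T, pZ = tZ T,
     NatR = (\<lambda>d d' f g h. d \<in> Dist T \<and> d' \<in> Dist T \<and> triangle_iso T d d' f g h),
     ComR = (\<lambda>d d' g. \<exists>x y s i\<^sub>1 i\<^sub>2 p\<^sub>1 p\<^sub>2. biproduct T x y s i\<^sub>1 i\<^sub>2 p\<^sub>1 p\<^sub>2 \<and> g = Ide T s \<and>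
        d = Tri i\<^sub>1 p\<^sub>2 (zeroA T y (shiftO T x)) \<and> d' = Tri i\<^sub>2 p\<^sub>1 (zeroA T x (shiftO T y))),
     AssR = (\<lambda>d1 d2 d3 d4 g. octahedron T d1 d2 d3 d4 \<and> g = Ide T (tY T d2)),
     TwoR = (\<lambda>_ _ _ _ _ _. False)\<rparr>"

lemma Tsk_sel [simp]:
  "Obj (Tsk T) = Obj T" "f \<in> Arr (Tsk T) \<longleftrightarrow> iso_arr T f" "Dom (Tsk T) = Dom T" "Cod (Tsk T) = Cod T" "Ide (Tsk T) = Ide T"
  "g \<cdot>\<^bsub>Tsk T\<^esub> f' = g \<cdot>\<^bsub>T\<^esub> f'" "Tr (Tsk T) = Dist T" "pX (Tsk T) = tX T" "pY (Tsk T) = tY T" "pZ (Tsk T) = tZ T"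
  "NatR (Tsk T) d d' f g h \<longleftrightarrow> d \<in> Dist T \<and> d' \<in> Dist T \<and> triangle_iso T d d' f g h"
  "ComR (Tsk T) d d' g \<longleftrightarrow> (\<exists>x y s i\<^sub>1 i\<^sub>2 p\<^sub>1 p\<^sub>2. biproduct T x y s i\<^sub>1 i\<^sub>2 p\<^sub>1 p\<^sub>2 \<and> g = Ide T s \<and>
        d = Tri i\<^sub>1 p\<^sub>2 (zeroA T y (shiftO T x)) \<and> d' = Tri i\<^sub>2 p\<^sub>1 (zeroA T x (shiftO T y)))"
  "AssR (Tsk T) d1 d2 d3 d4 g \<longleftrightarrow> octahedron T d1 d2 d3 d4 \<and> g = Ide T (tY T d2)"
  "TwoR (Tsk T) az ax ay bz bx by \<longleftrightarrow> False"
  by (simp_all add: Tsk_def)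

lemma (in triangulated_category) Dist_Obj:
  assumes "d \<in> Dist T"
  shows "tX T d \<in> Obj T" "tY T d \<in> Obj T" "tZ T d \<in> Obj T" "tU d \<in> Arr T" "tV d \<in> Arr T" "tW d \<in> Arr T"
    "Dom T (tU d) = tX T d" "Cod T (tU d) = tY T d" "Dom T (tV d) = tY T d" "Cod T (tV d) = tZ T d"
    "Dom T (tW d) = tZ T d" "Cod T (tW d) = shiftO T (tX T d)"
  using Dist_triangle[OF assms] by (auto simp: is_triangle_def tX_def tY_def tZ_def)

lemma (in triangulated_category) sketch_Tsk: "sketch (Tsk T)"
proof -
  have c: "category (Tsk T)"
    using category_isom by (simp add: category_def Hom_def isom_def Tsk_def)
  interpret S: category "Tsk T" by (rule c)
  show ?thesis
  proof unfold_locales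
    show "pX (Tsk T) d \<in> Obj (Tsk T)" "pY (Tsk T) d \<in> Obj (Tsk T)" "pZ (Tsk T) d \<in> Obj (Tsk T)" if "d \<in> Tr (Tsk T)" for d
      using that Dist_Obj by auto
    show "d \<in> Tr (Tsk T) \<and> d' \<in> Tr (Tsk T) \<and> f \<in> Hom (Tsk T) (pX (Tsk T) d) (pX (Tsk T) d') \<and>
      g \<in> Hom (Tsk T) (pY (Tsk T) d) (pY (Tsk T) d') \<and> h \<in> Hom (Tsk T) (pZ (Tsk T) d) (pZ (Tsk T) d')"
      if "NatR (Tsk T) d d' f g h" for d d' f g h
      using that by (auto simp: triangle_iso_def triangle_morphism_def)
    show "NatR (Tsk T) d d (Ide (Tsk T) (pX (Tsk T) d)) (Ide (Tsk T) (pY (Tsk T) d)) (Ide (Tsk T) (pZ (Tsk T) d))" if "d \<in> Tr (Tsk T)" for d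
      using that Dist_Obj[of d] by (auto simp: triangle_iso_def triangle_morphism_def)
    show "d \<in> Tr (Tsk T) \<and> d' \<in> Tr (Tsk T) \<and> pZ (Tsk T) d' = pX (Tsk T) d \<and> pX (Tsk T) d' = pZ (Tsk T) d \<and>
      g \<in> Hom (Tsk T) (pY (Tsk T) d') (pY (Tsk T) d)" if cr: "ComR (Tsk T) d d' g" for d d' g
    proof -
      \<comment> \<open>The commutativity axiom mentions split triangles without assuming them
        distinguished; \<open>split_triangle_Dist\<close> makes them triangles of the
        sketch.\<close>
      obtain x y s i\<^sub>1 i\<^sub>2 p\<^sub>1 p\<^sub>2 where b: "biproduct T x y s i\<^sub>1 i\<^sub>2 p\<^sub>1 p\<^sub>2" and g: "g = Ide T s" and
        d: "d = Tri i\<^sub>1 p\<^sub>2 (zeroA T y (shiftO T x))" "d' = Tri i\<^sub>2 p\<^sub>1 (zeroA T x (shiftO T y))"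
        using cr by auto
      show ?thesis
        using split_triangle_Dist[OF b] split_triangle_Dist[OF biproduct_swap[OF b]] b
        by (auto simp: g d tX_def tY_def tZ_def biproduct_def)
    qed
    show "{d1, d2, d3, d4} \<subseteq> Tr (Tsk T) \<and> pX (Tsk T) d2 = pX (Tsk T) d1 \<and> pX (Tsk T) d3 = pY (Tsk T) d1 \<and>
      pX (Tsk T) d4 = pZ (Tsk T) d1 \<and> pY (Tsk T) d4 = pZ (Tsk T) d2 \<and> pZ (Tsk T) d4 = pZ (Tsk T) d3 \<and>
      g \<in> Hom (Tsk T) (pY (Tsk T) d2) (pY (Tsk T) d3)" if "AssR (Tsk T) d1 d2 d3 d4 g" for d1 d2 d3 d4 g
    proof -
      have o: "octahedron T d1 d2 d3 d4" and g: "g = Ide T (tY T d2)" using that by auto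
      have D: "d1 \<in> Dist T" "d2 \<in> Dist T" "d3 \<in> Dist T" "d4 \<in> Dist T"
        and u: "tY T d1 = tX T d3" "tU d2 = tU d3 \<cdot> tU d1"
        using o by (auto simp: octahedron_def)
      have "tX T d2 = tX T d1" "tY T d2 = tY T d3"
        using u Dist_Obj[OF D(1)] Dist_Obj[OF D(3)] Dist_Obj[OF D(2)]
        by (auto simp: tX_def[of T d2] tY_def[of T d2])
      then show ?thesis
        using o g D Dist_Obj(2)[OF D(2)] by (auto simp: octahedron_def)
    qed
  qed (simp_all)
qed

section \<open>Picard groupoids as sketches\<close>

text \<open>The pair \<open>(a, b)\<close> plays the triangle
  \<open>b \<rightarrow> a \<oplus> b \<rightarrow> a\<close>, in the order of the additivity map
  from \<open>[z] + [x]\<close> to \<open>[y]\<close>. All data of a symmetric monoidal functor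
  except the unit constraint are then those of a model.\<close>

definition Vsk :: "('v, 'w, 'y) mon_cat_scheme \<Rightarrow> ('v, 'w, 'v \<times> 'v) sketch" where
  "Vsk V = \<lparr>Obj = Obj V, Arr = Arr V, Dom = Dom V, Cod = Cod V, Ide = Ide V, Cmp = Cmp V,
     Tr = Obj V \<times> Obj V, pX = snd, pY = (\<lambda>(a, b). a \<oplus>\<^bsub>V\<^esub> b), pZ = fst,
     NatR = (\<lambda>d d' f g h. {d, d'} \<subseteq> Obj V \<times> Obj V \<and> f \<in> Hom V (snd d) (snd d') \<and> h \<in> Hom V (fst d) (fst d') \<and> g = h \<boxplus>\<^bsub>V\<^esub> f),
     ComR = (\<lambda>d d' g. d' \<in> Obj V \<times> Obj V \<and> d = (snd d', fst d') \<and> g = symm V (fst d') (snd d')),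
     AssR = (\<lambda>d1 d2 d3 d4 g. \<exists>a\<in>Obj V. \<exists>b\<in>Obj V. \<exists>c\<in>Obj V. d1 = (b, c) \<and> d2 = (a \<oplus>\<^bsub>V\<^esub> b, c) \<and> d3 = (a, b \<oplus>\<^bsub>V\<^esub> c)
        \<and> d4 = (a, b) \<and> g = assoc V a b c),
     TwoR = (\<lambda>_ _ _ _ _ _. False)\<rparr>"

lemma Vsk_sel [simp]:
  "Obj (Vsk V) = Obj V" "Arr (Vsk V) = Arr V" "Dom (Vsk V) = Dom V" "Cod (Vsk V) = Cod V" "Ide (Vsk V) = Ide V"
  "g \<cdot>\<^bsub>Vsk V\<^esub> f = g \<cdot>\<^bsub>V\<^esub> f" "Tr (Vsk V) = Obj V \<times> Obj V" "pX (Vsk V) (a, b) = b" "pZ (Vsk V) (a, b) = a" "pY (Vsk V) (a, b) = a \<oplus>\<^bsub>V\<^esub> b"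
  "NatR (Vsk V) (a, b) (a', b') u v w \<longleftrightarrow> a \<in> Obj V \<and> b \<in> Obj V \<and> a' \<in> Obj V \<and> b' \<in> Obj V
      \<and> u \<in> Hom V b b' \<and> w \<in> Hom V a a' \<and> v = w \<boxplus>\<^bsub>V\<^esub> u"
  "ComR (Vsk V) d d' g \<longleftrightarrow> d' \<in> Obj V \<times> Obj V \<and> d = (snd d', fst d') \<and> g = symm V (fst d') (snd d')"
  "AssR (Vsk V) d1 d2 d3 d4 g \<longleftrightarrow> (\<exists>a\<in>Obj V. \<exists>b\<in>Obj V. \<exists>c\<in>Obj V. d1 = (b, c) \<and> d2 = (a \<oplus>\<^bsub>V\<^esub> b, c) \<and> d3 = (a, b \<oplus>\<^bsub>V\<^esub> c)
        \<and> d4 = (a, b) \<and> g = assoc V a b c)"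
  "TwoR (Vsk V) az ax ay bz bx by \<longleftrightarrow> False"
  by (auto simp: Vsk_def)

lemma (in picard_groupoid) sketch_Vsk: "sketch (Vsk P)"
proof -
  have "category (Vsk P)"
    using category_axioms by (simp add: category_def Hom_def Vsk_def)
  then interpret S: category "Vsk P" .
  show ?thesis
  proof unfold_locales
    show "d \<in> Tr (Vsk P) \<and> d' \<in> Tr (Vsk P) \<and> f \<in> Hom (Vsk P) (pX (Vsk P) d) (pX (Vsk P) d') \<and>
      g \<in> Hom (Vsk P) (pY (Vsk P) d) (pY (Vsk P) d') \<and> h \<in> Hom (Vsk P) (pZ (Vsk P) d) (pZ (Vsk P) d')"
      if "NatR (Vsk P) d d' f g h" for d d' f g h
      using that by (cases d, cases d') auto
  qed auto
qed

definition vmod :: "('v, 'w, 'p, 'q, 'z) mon_funct_scheme \<Rightarrow> ('v, 'w, 'v \<times> 'v, 'p, 'q) model" where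
  "vmod F = \<lparr>onObj = onObj F, onArr = onArr F, fadd = (\<lambda>(a, b). tensC F a b)\<rparr>"

lemma vmod_sel [simp]: "onObj (vmod F) = onObj F" "onArr (vmod F) = onArr F" "fadd (vmod F) (a, b) = tensC F a b"
  by (simp_all add: vmod_def)

definition vfun :: "('v, 'w, 'v \<times> 'v, 'p, 'q) model \<Rightarrow> 'q \<Rightarrow> ('v, 'w, 'p, 'q) mon_funct" where
  "vfun G u = \<lparr>onObj = onObj G, onArr = onArr G, tensC = (\<lambda>a b. fadd G (a, b)), unitC = u\<rparr>"

lemma vfun_sel [simp]: "onObj (vfun G u) = onObj G" "onArr (vfun G u) = onArr G" "tensC (vfun G u) a b = fadd G (a, b)" "unitC (vfun G u) = u"
  by (simp_all add: vfun_def)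

lemma vmod_vfun [simp]: "vmod (vfun G u) = G"
  by (cases G) (simp add: vmod_def vfun_def)

section \<open>Unit constraints recovered from the binary ones\<close>

context picard_groupoid
begin

lemma vmod_model:
  assumes "picard_groupoid V" "symmetric_monoidal_functor V P F"
  shows "is_model (Vsk V) (vmod F)"
proof -
  interpret V: picard_groupoid V by fact
  interpret S: sketch "Vsk V" by (rule V.sketch_Vsk)
  note F = assms(2)[unfolded symmetric_monoidal_functor_def]
  have d: "is_data (Vsk V) (vmod F)"
    using F by (auto simp: is_data_def is_functor_def)
  show ?thesis
  proof (rule is_modelI[OF d S.category_axioms])
    show "onArr (vmod F) (Ide (Vsk V) a) = Ide P (onObj (vmod F) a)" if "a \<in> Obj (Vsk V)" for a
      using F that by (simp add: is_functor_def)
    show "onArr (vmod F) (g \<cdot>\<^bsub>Vsk V\<^esub> f) = onArr (vmod F) g \<cdot> onArr (vmod F) f"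
      if "f \<in> Arr (Vsk V)" "g \<in> Arr (Vsk V)" "Dom (Vsk V) g = Cod (Vsk V) f" for f g
      using F that by (simp add: is_functor_def)
    show "fadd (vmod F) d' \<cdot> (onArr (vmod F) h \<boxplus> onArr (vmod F) f) = onArr (vmod F) g \<cdot> fadd (vmod F) d"
      if "NatR (Vsk V) d d' f g h" for d d' f g h
      using F that by (cases d, cases d') simp
    show "onArr (vmod F) g \<cdot> fadd (vmod F) d' = fadd (vmod F) d \<cdot> symm P (onObj (vmod F) (pZ (Vsk V) d')) (onObj (vmod F) (pX (Vsk V) d'))"
      if "ComR (Vsk V) d d' g" for d d' g
      using F that by (cases d') simp
    show "onArr (vmod F) g \<cdot> (fadd (vmod F) d2 \<cdot> (fadd (vmod F) d4 \<boxplus> Ide P (onObj (vmod F) (pX (Vsk V) d1))))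
      = fadd (vmod F) d3 \<cdot> ((Ide P (onObj (vmod F) (pZ (Vsk V) d3)) \<boxplus> fadd (vmod F) d1)
         \<cdot> assoc P (onObj (vmod F) (pZ (Vsk V) d3)) (onObj (vmod F) (pZ (Vsk V) d1)) (onObj (vmod F) (pX (Vsk V) d1)))"
      if "AssR (Vsk V) d1 d2 d3 d4 g" for d1 d2 d3 d4 g
      using F that by auto
  qed simp
qed

text \<open>A unit constraint is an arrow \<open>u\<close> for which
  \<open>lam V G b \<cdot> (u \<boxplus> Ide P (onObj G b))\<close> is the left unit isomorphism of
  \<open>P\<close>; \<open>rho\<close> plays the same role on the right.\<close>

definition lam :: "('v, 'w, 'y) mon_cat_scheme \<Rightarrow> ('v, 'w, 'v \<times> 'v, 'o, 'm) model \<Rightarrow> 'v \<Rightarrow> 'm" where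
  "lam V G b = onArr G (lunit V b) \<cdot> fadd G (unitO V, b)"

definition rho :: "('v, 'w, 'y) mon_cat_scheme \<Rightarrow> ('v, 'w, 'v \<times> 'v, 'o, 'm) model \<Rightarrow> 'v \<Rightarrow> 'm" where
  "rho V G a = onArr G (runit V a) \<cdot> fadd G (a, unitO V)"

context
  fixes V :: "('v, 'w, 'y) mon_cat_scheme" and G :: "('v, 'w, 'v \<times> 'v, 'o, 'm) model"
  assumes V: "picard_groupoid V" and G: "is_model (Vsk V) G"
begin

interpretation V: picard_groupoid V by (rule V)

lemma Gs:
  "a \<in> Obj V \<Longrightarrow> onObj G a \<in> Obj P" "f \<in> Arr V \<Longrightarrow> onArr G f \<in> Arr P"
  "f \<in> Arr V \<Longrightarrow> Dom P (onArr G f) = onObj G (Dom V f)" "f \<in> Arr V \<Longrightarrow> Cod P (onArr G f) = onObj G (Cod V f)"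
  "\<lbrakk>a \<in> Obj V; b \<in> Obj V\<rbrakk> \<Longrightarrow> fadd G (a, b) \<in> Arr P"
  "\<lbrakk>a \<in> Obj V; b \<in> Obj V\<rbrakk> \<Longrightarrow> Dom P (fadd G (a, b)) = onObj G a \<oplus> onObj G b"
  "\<lbrakk>a \<in> Obj V; b \<in> Obj V\<rbrakk> \<Longrightarrow> Cod P (fadd G (a, b)) = onObj G (a \<oplus>\<^bsub>V\<^esub> b)"
  using model_simps[OF G] by auto

lemma G_nat: "\<lbrakk>f \<in> Arr V; h \<in> Arr V; Dom V f = b; Cod V f = b'; Dom V h = a; Cod V h = a'\<rbrakk>
    \<Longrightarrow> fadd G (a', b') \<cdot> (onArr G h \<boxplus> onArr G f) = onArr G (h \<boxplus>\<^bsub>V\<^esub> f) \<cdot> fadd G (a, b)"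
  using model_nat[OF G, of "(a, b)" "(a', b')" f "h \<boxplus>\<^bsub>V\<^esub> f" h] by auto

lemma G_ass: "\<lbrakk>a \<in> Obj V; b \<in> Obj V; c \<in> Obj V\<rbrakk> \<Longrightarrow>
   onArr G (assoc V a b c) \<cdot> (fadd G (a \<oplus>\<^bsub>V\<^esub> b, c) \<cdot> (fadd G (a, b) \<boxplus> Ide P (onObj G c)))
   = fadd G (a, b \<oplus>\<^bsub>V\<^esub> c) \<cdot> ((Ide P (onObj G a) \<boxplus> fadd G (b, c)) \<cdot> assoc P (onObj G a) (onObj G b) (onObj G c))"
  using model_ass[OF G, of "(b, c)" "(a \<oplus>\<^bsub>V\<^esub> b, c)" "(a, b \<oplus>\<^bsub>V\<^esub> c)" "(a, b)" "assoc V a b c"] by auto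

lemma lam_simps [simp]:
  assumes "b \<in> Obj V"
  shows "lam V G b \<in> Arr P" "Dom P (lam V G b) = onObj G (unitO V) \<oplus> onObj G b" "Cod P (lam V G b) = onObj G b"
  using assms Gs by (simp_all add: lam_def)

lemma rho_simps [simp]:
  assumes "b \<in> Obj V"
  shows "rho V G b \<in> Arr P" "Dom P (rho V G b) = onObj G b \<oplus> onObj G (unitO V)" "Cod P (rho V G b) = onObj G b"
  using assms Gs by (simp_all add: rho_def)

text \<open>The triangle identity of \<open>V\<close>, carried to \<open>P\<close> by the
  associativity and naturality of \<open>G\<close>. It links the left and the right unit
  equation.\<close>

lemma rho_lam:
  assumes "a \<in> Obj V" "b \<in> Obj V"
  shows "rho V G a \<boxplus> Ide P (onObj G b)
    = (Ide P (onObj G a) \<boxplus> lam V G b) \<cdot> assoc P (onObj G a) (onObj G (unitO V)) (onObj G b)"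
proof -
  let ?o = "unitO V" and ?I = "\<lambda>x. Ide P (onObj G x)"
  note I = model_Ide[OF G, simplified, symmetric]
  have "fadd G (a, b) \<cdot> (rho V G a \<boxplus> ?I b)
    = (fadd G (a, b) \<cdot> (onArr G (runit V a) \<boxplus> onArr G (Ide V b))) \<cdot> (fadd G (a, ?o) \<boxplus> ?I b)"
    using assms Gs by (simp add: rho_def interchange I[symmetric])
  also have "\<dots> = onArr G (runit V a \<boxplus>\<^bsub>V\<^esub> Ide V b) \<cdot> (fadd G (a \<oplus>\<^bsub>V\<^esub> ?o, b) \<cdot> (fadd G (a, ?o) \<boxplus> ?I b))"
    using assms Gs by (simp add: G_nat)
  also have "runit V a \<boxplus>\<^bsub>V\<^esub> Ide V b = (Ide V a \<boxplus>\<^bsub>V\<^esub> lunit V b) \<cdot>\<^bsub>V\<^esub> assoc V a ?o b"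
    using assms by (simp add: V.triangle_unit)
  also have "onArr G \<dots> = onArr G (Ide V a \<boxplus>\<^bsub>V\<^esub> lunit V b) \<cdot> onArr G (assoc V a ?o b)"
    using assms model_Cmp[OF G] by simp
  also have "(onArr G (Ide V a \<boxplus>\<^bsub>V\<^esub> lunit V b) \<cdot> onArr G (assoc V a ?o b)) \<cdot> (fadd G (a \<oplus>\<^bsub>V\<^esub> ?o, b) \<cdot> (fadd G (a, ?o) \<boxplus> ?I b))
     = onArr G (Ide V a \<boxplus>\<^bsub>V\<^esub> lunit V b) \<cdot> (fadd G (a, ?o \<oplus>\<^bsub>V\<^esub> b) \<cdot> ((?I a \<boxplus> fadd G (?o, b)) \<cdot> assoc P (onObj G a) (onObj G ?o) (onObj G b)))"
    using assms Gs by (simp add: G_ass)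
  also have "\<dots> = (fadd G (a, b) \<cdot> (onArr G (Ide V a) \<boxplus> onArr G (lunit V b))) \<cdot> ((?I a \<boxplus> fadd G (?o, b)) \<cdot> assoc P (onObj G a) (onObj G ?o) (onObj G b))"
    using assms Gs by (simp add: G_nat)
  also have "\<dots> = fadd G (a, b) \<cdot> ((?I a \<boxplus> lam V G b) \<cdot> assoc P (onObj G a) (onObj G ?o) (onObj G b))"
    using assms Gs by (simp add: lam_def interchange' I[symmetric])
  finally show ?thesis
    by (rule Cmp_cancel_left) (use assms Gs in simp_all)
qed

text \<open>By \<open>rho_lam\<close> and the triangle identity of \<open>P\<close> the two sides
  agree after translation by \<open>onObj G b\<close>, which is faithful. So the left equation at a
  single \<open>b\<close> gives the right equation at every \<open>a\<close>.\<close>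

lemma rho_unit:
  assumes "a \<in> Obj V" "b \<in> Obj V" "u \<in> Hom P (unitO P) (onObj G (unitO V))"
    "lam V G b \<cdot> (u \<boxplus> Ide P (onObj G b)) = lunit P (onObj G b)"
  shows "rho V G a \<cdot> (Ide P (onObj G a) \<boxplus> u) = runit P (onObj G a)"
proof -
  let ?I = "\<lambda>x. Ide P (onObj G x)" and ?a = "onObj G a" and ?b = "onObj G b" and ?o = "onObj G (unitO V)"
  have "(rho V G a \<cdot> (?I a \<boxplus> u)) \<boxplus> ?I b = (rho V G a \<boxplus> ?I b) \<cdot> ((?I a \<boxplus> u) \<boxplus> ?I b)"
    using assms(1-3) Gs by (simp add: interchange)
  also have "\<dots> = (?I a \<boxplus> lam V G b) \<cdot> (assoc P ?a ?o ?b \<cdot> ((?I a \<boxplus> u) \<boxplus> ?I b))"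
    using assms(1-3) Gs by (simp add: rho_lam)
  also have "assoc P ?a ?o ?b \<cdot> ((?I a \<boxplus> u) \<boxplus> ?I b) = (?I a \<boxplus> (u \<boxplus> ?I b)) \<cdot> assoc P ?a (unitO P) ?b"
    using assms(1-3) Gs by (intro assoc_natural) simp_all
  also have "(?I a \<boxplus> lam V G b) \<cdot> ((?I a \<boxplus> (u \<boxplus> ?I b)) \<cdot> assoc P ?a (unitO P) ?b)
      = (?I a \<boxplus> (lam V G b \<cdot> (u \<boxplus> ?I b))) \<cdot> assoc P ?a (unitO P) ?b"
    using assms(1-3) Gs by (simp add: interchange')
  also have "\<dots> = runit P ?a \<boxplus> ?I b"
    unfolding assms(4) using assms(1,2) Gs by (simp add: triangle_unit)
  finally show ?thesis
    by (rule tensA_Ide_right_faithful) (use assms(1-3) Gs in simp_all)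
qed

text \<open>Fullness of translation solves the left equation at each \<open>b\<close> separately.
  Any two solutions satisfy the same right equation at the unit, so they coincide.\<close>

lemma unit_exists:
  "\<exists>u\<in>Hom P (unitO P) (onObj G (unitO V)). \<forall>b\<in>Obj V.
     lam V G b \<cdot> (u \<boxplus> Ide P (onObj G b)) = lunit P (onObj G b) \<and> rho V G b \<cdot> (Ide P (onObj G b) \<boxplus> u) = runit P (onObj G b)"
proof -
  let ?o = "unitO V"
  have ex: "\<exists>u\<in>Hom P (unitO P) (onObj G ?o). lam V G b \<cdot> (u \<boxplus> Ide P (onObj G b)) = lunit P (onObj G b)" if b: "b \<in> Obj V" for b
  proof -
    have h: "inv_arr P (lam V G b) \<cdot> lunit P (onObj G b) \<in> Hom P (unitO P \<oplus> onObj G b) (onObj G ?o \<oplus> onObj G b)"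
      using b Gs by simp
    obtain u where u: "u \<in> Hom P (unitO P) (onObj G ?o)" "u \<boxplus> Ide P (onObj G b) = inv_arr P (lam V G b) \<cdot> lunit P (onObj G b)"
      using tensA_Ide_right_full[OF _ _ _ h] b Gs by auto
    then have "lam V G b \<cdot> (u \<boxplus> Ide P (onObj G b)) = lunit P (onObj G b)"
      unfolding u(2) using b Gs by simp
    with u(1) show ?thesis by blast
  qed
  obtain u where u: "u \<in> Hom P (unitO P) (onObj G ?o)" "lam V G ?o \<cdot> (u \<boxplus> Ide P (onObj G ?o)) = lunit P (onObj G ?o)"
    using ex[of ?o] V.unitO_Obj by blast
  have "lam V G b \<cdot> (u \<boxplus> Ide P (onObj G b)) = lunit P (onObj G b)" if b: "b \<in> Obj V" for b
  proof -
    obtain w where w: "w \<in> Hom P (unitO P) (onObj G ?o)" "lam V G b \<cdot> (w \<boxplus> Ide P (onObj G b)) = lunit P (onObj G b)"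
      using ex[OF b] by blast
    have "rho V G ?o \<cdot> (Ide P (onObj G ?o) \<boxplus> u) = rho V G ?o \<cdot> (Ide P (onObj G ?o) \<boxplus> w)"
      using rho_unit[OF V.unitO_Obj V.unitO_Obj u] rho_unit[OF V.unitO_Obj b w] by simp
    then have "Ide P (onObj G ?o) \<boxplus> u = Ide P (onObj G ?o) \<boxplus> w"
      by (rule Cmp_cancel_left) (use u(1) w(1) Gs in simp_all)
    then have "u = w"
      by (rule tensA_Ide_left_faithful) (use u(1) w(1) Gs in simp_all)
    then show ?thesis using w(2) by simp
  qed
  then show ?thesis
    using u(1) rho_unit[OF _ V.unitO_Obj u] by blast
qed

lemma vfun_functor:
  assumes "u \<in> Hom P (unitO P) (onObj G (unitO V))"
    "\<And>b. b \<in> Obj V \<Longrightarrow> lam V G b \<cdot> (u \<boxplus> Ide P (onObj G b)) = lunit P (onObj G b)"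
    "\<And>b. b \<in> Obj V \<Longrightarrow> rho V G b \<cdot> (Ide P (onObj G b) \<boxplus> u) = runit P (onObj G b)"
  shows "symmetric_monoidal_functor V P (vfun G u)"
proof -
  have f: "is_functor V P (vfun G u)"
    using G by (auto simp: is_model_def is_functor_def)
  have l: "onArr G (lunit V a) \<cdot> (fadd G (unitO V, a) \<cdot> (u \<boxplus> Ide P (onObj G a))) = lunit P (onObj G a)" if "a \<in> Obj V" for a
    using assms(2)[OF that] assms(1) Gs that by (simp add: lam_def)
  have r: "onArr G (runit V a) \<cdot> (fadd G (a, unitO V) \<cdot> (Ide P (onObj G a) \<boxplus> u)) = runit P (onObj G a)" if "a \<in> Obj V" for a
    using assms(3)[OF that] assms(1) Gs that by (simp add: rho_def)
  have s: "onArr G (symm V a b) \<cdot> fadd G (a, b) = fadd G (b, a) \<cdot> symm P (onObj G a) (onObj G b)" if "a \<in> Obj V" "b \<in> Obj V" for a b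
    using model_com[OF G, of "(b, a)" "(a, b)" "symm V a b"] that by auto
  show ?thesis
    unfolding symmetric_monoidal_functor_def
    using f l r s G_nat G_ass assms(1) Gs by (simp add: Gs(1))
qed

end

text \<open>\<open>\<tau> (unitO V) \<cdot> u\<close> solves the equation that characterises
  \<open>w\<close>, so morphisms of models respect unit constraints.\<close>

lemma mmor_unit:
  assumes "picard_groupoid V" "is_model (Vsk V) F" "is_model (Vsk V) G" "mmor (Vsk V) F G \<tau>"
    "u \<in> Hom P (unitO P) (onObj F (unitO V))" "w \<in> Hom P (unitO P) (onObj G (unitO V))"
    "lam V F (unitO V) \<cdot> (u \<boxplus> Ide P (onObj F (unitO V))) = lunit P (onObj F (unitO V))"
    "lam V G (unitO V) \<cdot> (w \<boxplus> Ide P (onObj G (unitO V))) = lunit P (onObj G (unitO V))"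
  shows "\<tau> (unitO V) \<cdot> u = w"
proof -
  interpret V: picard_groupoid V by fact
  let ?o = "unitO V"
  let ?F = "onObj F ?o" and ?G = "onObj G ?o" and ?t = "\<tau> ?o"
  note Fs = Gs[OF assms(1,2)] and Gs = Gs[OF assms(1,3)]
  note lF = lam_simps[OF assms(1,2) V.unitO_Obj] and lG = lam_simps[OF assms(1,3) V.unitO_Obj]
  note t = mmorD[OF assms(4)]
  have t0: "?t \<in> Arr P" "Dom P ?t = ?F" "Cod P ?t = ?G"
    using t(1-3)[of ?o] by simp_all
  have "sq (?t \<boxplus> ?t) (lam V F ?o) (lam V G ?o) ?t"
  proof -
    have "sq (?t \<boxplus> ?t) (fadd F (?o, ?o)) (fadd G (?o, ?o)) (\<tau> (?o \<oplus>\<^bsub>V\<^esub> ?o))"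
      using t(5)[of "(?o, ?o)"] by simp
    moreover have "sq (\<tau> (?o \<oplus>\<^bsub>V\<^esub> ?o)) (onArr F (lunit V ?o)) (onArr G (lunit V ?o)) ?t"
      using t(4)[of "lunit V ?o"] by simp
    ultimately show ?thesis
      unfolding lam_def by (rule sq_Cmp)
  qed
  then have n: "?t \<cdot> lam V F ?o = lam V G ?o \<cdot> (?t \<boxplus> ?t)"
    by (simp add: sq_def)
  have "lam V G ?o \<cdot> ((?t \<cdot> u) \<boxplus> ?t) = (lam V G ?o \<cdot> (?t \<boxplus> ?t)) \<cdot> (u \<boxplus> Ide P ?F)"
    using t0 assms(5) Fs lG by (simp add: interchange)
  also have "\<dots> = ?t \<cdot> (lam V F ?o \<cdot> (u \<boxplus> Ide P ?F))"
    unfolding n[symmetric] using t0 assms(5) Fs lF by simp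
  also have "\<dots> = lunit P ?G \<cdot> (Ide P (unitO P) \<boxplus> ?t)"
    unfolding assms(7) using lunit_nat[of ?t ?F ?G] t0 by simp
  also have "\<dots> = lam V G ?o \<cdot> ((w \<boxplus> Ide P ?G) \<cdot> (Ide P (unitO P) \<boxplus> ?t))"
    unfolding assms(8)[symmetric] using t0 assms(6) Gs lG by simp
  also have "\<dots> = lam V G ?o \<cdot> (w \<boxplus> ?t)"
    using t0 assms(6) Gs by (simp add: interchange)
  finally have e: "(?t \<cdot> u) \<boxplus> ?t = w \<boxplus> ?t"
    by (rule Cmp_cancel_left) (use t0 assms(5,6) Fs Gs lG in simp_all)
  \<comment> \<open>Faithfulness of translation needs an identity in the second place, so
    \<open>?t\<close> is cancelled by its inverse.\<close>
  have "(?t \<cdot> u) \<boxplus> Ide P ?G = ((?t \<cdot> u) \<boxplus> ?t) \<cdot> (Ide P (unitO P) \<boxplus> inv_arr P ?t)"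
    using t0 assms(5) Fs by (simp add: interchange)
  also have "\<dots> = w \<boxplus> Ide P ?G"
    unfolding e using t0 assms(6) Gs by (simp add: interchange)
  finally show ?thesis
    by (rule tensA_Ide_right_faithful) (use t0 assms(5,6) Gs in simp_all)
qed

lemma smf_unit:
  assumes "picard_groupoid V" "symmetric_monoidal_functor V P F" "b \<in> Obj V"
  shows "unitC F \<in> Hom P (unitO P) (onObj F (unitO V))"
    "lam V (vmod F) b \<cdot> (unitC F \<boxplus> Ide P (onObj F b)) = lunit P (onObj F b)"
proof -
  interpret V: picard_groupoid V by fact
  note F = assms(2)[unfolded symmetric_monoidal_functor_def]
  show 1: "unitC F \<in> Hom P (unitO P) (onObj F (unitO V))"
    using F by simp
  show "lam V (vmod F) b \<cdot> (unitC F \<boxplus> Ide P (onObj F b)) = lunit P (onObj F b)"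
    using F assms(3) 1 Gs[OF assms(1) vmod_model[OF assms(1,2)]] by (simp add: lam_def)
qed

text \<open>The unit clause is supplied by \<open>mmor_unit\<close>.\<close>

lemma monoidal_nat_trans_iff:
  assumes "picard_groupoid V" "symmetric_monoidal_functor V P F" "symmetric_monoidal_functor V P G"
  shows "monoidal_nat_trans V P F G \<tau> \<longleftrightarrow> \<tau> \<in> extensional (Obj V) \<and> mmor (Vsk V) (vmod F) (vmod G) \<tau>"
proof -
  interpret V: picard_groupoid V by fact
  note mF = vmod_model[OF assms(1,2)] and mG = vmod_model[OF assms(1,3)]
  note Fs = Gs[OF assms(1) mF, simplified] and Gs = Gs[OF assms(1) mG, simplified]
  show ?thesis
  proof
    assume "monoidal_nat_trans V P F G \<tau>"
    then show "\<tau> \<in> extensional (Obj V) \<and> mmor (Vsk V) (vmod F) (vmod G) \<tau>"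
      using Fs Gs by (auto simp: monoidal_nat_trans_def nat_trans_def mmor_def sq_def)
  next
    assume a: "\<tau> \<in> extensional (Obj V) \<and> mmor (Vsk V) (vmod F) (vmod G) \<tau>"
    then have m: "mmor (Vsk V) (vmod F) (vmod G) \<tau>" by simp
    have "\<tau> (unitO V) \<cdot> unitC F = unitC G"
      by (rule mmor_unit[OF assms(1) mF mG m]) (use smf_unit[OF assms(1,2) V.unitO_Obj] smf_unit[OF assms(1,3) V.unitO_Obj] in simp_all)
    then show "monoidal_nat_trans V P F G \<tau>"
      using a by (auto simp: monoidal_nat_trans_def nat_trans_def mmor_def sq_def)
  qed
qed

end

section \<open>Universal determinant functors\<close>

text \<open>A triangle goes to the formal triangle on the images of its ends, and the additivity
  morphism of \<open>det\<close> is the comparison with the image of its middle vertex.\<close>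

definition det_map :: "('o, 'm, 'x) tri_cat_scheme \<Rightarrow> ('o, 'm, 'v, 'w, 'z) det_funct_scheme
    \<Rightarrow> ('o, 'm, 'v, 'w, 'm triangle, 'v \<times> 'v) smap" where
  "det_map T det = \<lparr>onObj = onObj det, onArr = onArr det, jT = (\<lambda>d. (onObj det (tZ T d), onObj det (tX T d))), jA = addD det\<rparr>"

lemma det_map_sel [simp]:
  "onObj (det_map T det) = onObj det" "onArr (det_map T det) = onArr det"
  "jT (det_map T det) d = (onObj det (tZ T d), onObj det (tX T d))" "jA (det_map T det) d = addD det d"
  by (simp_all add: det_map_def)

definition dmod :: "('o, 'm, 'p, 'q, 'z) det_funct_scheme \<Rightarrow> ('o, 'm, 'm triangle, 'p, 'q) model" where
  "dmod D = \<lparr>onObj = onObj D, onArr = onArr D, fadd = addD D\<rparr>"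

definition dfun :: "('o, 'm, 'm triangle, 'p, 'q) model \<Rightarrow> ('o, 'm, 'p, 'q) det_funct" where
  "dfun F = \<lparr>onObj = onObj F, onArr = onArr F, addD = fadd F\<rparr>"

lemma dmod_sel [simp]:
  "onObj (dmod D) = onObj D" "onArr (dmod D) = onArr D" "fadd (dmod D) = addD D"
  "onObj (dfun F) = onObj F" "onArr (dfun F) = onArr F" "addD (dfun F) = fadd F" "dmod (dfun F) = F"
  by (simp_all add: dmod_def dfun_def)

lemma is_functor_isom: "is_functor (isom T) P D \<longleftrightarrow> is_functor (Tsk T) P D"
  by (simp add: is_functor_def isom_def)

context picard_groupoid
begin

text \<open>The two notions differ by identity arrows composed on the left in the commutativity and
  associativity relations. Absorbing them requires the typing of the additivity data, hence the
  typed equivalences \<open>com\<close> and \<open>ass\<close>.\<close>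

lemma determinant_iff:
  assumes "triangulated_category T"
  shows "determinant_functor T P D \<longleftrightarrow> is_model (Tsk T) (dmod D)"
proof -
  interpret T: triangulated_category T by fact
  interpret S: sketch "Tsk T" by (rule T.sketch_Tsk)
  have com: "(\<forall>x y s i\<^sub>1 i\<^sub>2 p\<^sub>1 p\<^sub>2. biproduct T x y s i\<^sub>1 i\<^sub>2 p\<^sub>1 p\<^sub>2 \<longrightarrow>
        addD D (Tri i\<^sub>2 p\<^sub>1 (zeroA T x (shiftO T y)))
        = addD D (Tri i\<^sub>1 p\<^sub>2 (zeroA T y (shiftO T x))) \<cdot> symm P (onObj D x) (onObj D y)) \<longleftrightarrow>
     (\<forall>d d' g. ComR (Tsk T) d d' g \<longrightarrow> onArr D g \<cdot> addD D d' = addD D d \<cdot> symm P (onObj D (tZ T d')) (onObj D (tX T d')))"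
    if F: "is_functor (Tsk T) P D" and t: "\<forall>d\<in>Dist T. addD D d \<in> Hom P (onObj D (tZ T d) \<oplus> onObj D (tX T d)) (onObj D (tY T d))"
  proof -
    have "onArr D (Ide T s) \<cdot> addD D (Tri i\<^sub>2 p\<^sub>1 (zeroA T x (shiftO T y))) = addD D (Tri i\<^sub>2 p\<^sub>1 (zeroA T x (shiftO T y)))
       \<and> tZ T (Tri i\<^sub>2 p\<^sub>1 (zeroA T x (shiftO T y))) = x \<and> tX T (Tri i\<^sub>2 p\<^sub>1 (zeroA T x (shiftO T y))) = y"
      if b: "biproduct T x y s i\<^sub>1 i\<^sub>2 p\<^sub>1 p\<^sub>2" for x y s i\<^sub>1 i\<^sub>2 p\<^sub>1 p\<^sub>2
    proof -
      have "s \<in> Obj T" "tY T (Tri i\<^sub>2 p\<^sub>1 (zeroA T x (shiftO T y))) = s"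
        "tZ T (Tri i\<^sub>2 p\<^sub>1 (zeroA T x (shiftO T y))) = x" "tX T (Tri i\<^sub>2 p\<^sub>1 (zeroA T x (shiftO T y))) = y"
        using b by (auto simp: biproduct_def tX_def tY_def tZ_def)
      then show ?thesis
        using F t T.split_triangle_Dist[OF T.biproduct_swap[OF b]] by (auto simp: is_functor_def)
    qed
    note e = this
    show ?thesis
    proof (intro iffI allI impI)
      fix d d' g
      assume L: "\<forall>x y s i\<^sub>1 i\<^sub>2 p\<^sub>1 p\<^sub>2. biproduct T x y s i\<^sub>1 i\<^sub>2 p\<^sub>1 p\<^sub>2 \<longrightarrow>
        addD D (Tri i\<^sub>2 p\<^sub>1 (zeroA T x (shiftO T y)))
        = addD D (Tri i\<^sub>1 p\<^sub>2 (zeroA T y (shiftO T x))) \<cdot> symm P (onObj D x) (onObj D y)" and "ComR (Tsk T) d d' g"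
      then obtain x y s i\<^sub>1 i\<^sub>2 p\<^sub>1 p\<^sub>2 where b: "biproduct T x y s i\<^sub>1 i\<^sub>2 p\<^sub>1 p\<^sub>2" and g: "g = Ide T s" and
        d: "d = Tri i\<^sub>1 p\<^sub>2 (zeroA T y (shiftO T x))" "d' = Tri i\<^sub>2 p\<^sub>1 (zeroA T x (shiftO T y))"
        by auto
      show "onArr D g \<cdot> addD D d' = addD D d \<cdot> symm P (onObj D (tZ T d')) (onObj D (tX T d'))"
        using L[rule_format, OF b] e[OF b] by (simp only: g d)
    next
      fix x y s i\<^sub>1 i\<^sub>2 p\<^sub>1 p\<^sub>2
      assume R: "\<forall>d d' g. ComR (Tsk T) d d' g \<longrightarrow> onArr D g \<cdot> addD D d' = addD D d \<cdot> symm P (onObj D (tZ T d')) (onObj D (tX T d'))"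
        and b: "biproduct T x y s i\<^sub>1 i\<^sub>2 p\<^sub>1 p\<^sub>2"
      have "ComR (Tsk T) (Tri i\<^sub>1 p\<^sub>2 (zeroA T y (shiftO T x))) (Tri i\<^sub>2 p\<^sub>1 (zeroA T x (shiftO T y))) (Ide T s)"
        using b by auto
      from R[rule_format, OF this] show "addD D (Tri i\<^sub>2 p\<^sub>1 (zeroA T x (shiftO T y)))
        = addD D (Tri i\<^sub>1 p\<^sub>2 (zeroA T y (shiftO T x))) \<cdot> symm P (onObj D x) (onObj D y)"
        using e[OF b] by (simp only:)
    qed
  qed
  have ass: "(\<forall>\<Delta>\<^sub>1 \<Delta>\<^sub>2 \<Delta>\<^sub>3 \<Delta>\<^sub>4. octahedron T \<Delta>\<^sub>1 \<Delta>\<^sub>2 \<Delta>\<^sub>3 \<Delta>\<^sub>4 \<longrightarrow>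
        addD D \<Delta>\<^sub>2 \<cdot> (addD D \<Delta>\<^sub>4 \<boxplus> Ide P (onObj D (tX T \<Delta>\<^sub>1)))
        = addD D \<Delta>\<^sub>3 \<cdot> ((Ide P (onObj D (tZ T \<Delta>\<^sub>3)) \<boxplus> addD D \<Delta>\<^sub>1) \<cdot>
            assoc P (onObj D (tZ T \<Delta>\<^sub>3)) (onObj D (tZ T \<Delta>\<^sub>1)) (onObj D (tX T \<Delta>\<^sub>1)))) \<longleftrightarrow>
     (\<forall>\<Delta>\<^sub>1 \<Delta>\<^sub>2 \<Delta>\<^sub>3 \<Delta>\<^sub>4 g. AssR (Tsk T) \<Delta>\<^sub>1 \<Delta>\<^sub>2 \<Delta>\<^sub>3 \<Delta>\<^sub>4 g \<longrightarrow>
        onArr D g \<cdot> (addD D \<Delta>\<^sub>2 \<cdot> (addD D \<Delta>\<^sub>4 \<boxplus> Ide P (onObj D (tX T \<Delta>\<^sub>1))))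
        = addD D \<Delta>\<^sub>3 \<cdot> ((Ide P (onObj D (tZ T \<Delta>\<^sub>3)) \<boxplus> addD D \<Delta>\<^sub>1) \<cdot>
            assoc P (onObj D (tZ T \<Delta>\<^sub>3)) (onObj D (tZ T \<Delta>\<^sub>1)) (onObj D (tX T \<Delta>\<^sub>1))))"
    if F: "is_functor (Tsk T) P D" and t: "\<forall>d\<in>Dist T. addD D d \<in> Hom P (onObj D (tZ T d) \<oplus> onObj D (tX T d)) (onObj D (tY T d))"
  proof -
    have "onArr D (Ide T (tY T d2)) \<cdot> (addD D d2 \<cdot> (addD D d4 \<boxplus> Ide P (onObj D (tX T d1)))) = addD D d2 \<cdot> (addD D d4 \<boxplus> Ide P (onObj D (tX T d1)))"
      if o: "octahedron T d1 d2 d3 d4" for d1 d2 d3 d4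
    proof -
      have a: "AssR (Tsk T) d1 d2 d3 d4 (Ide T (tY T d2))" using o by simp
      note n = S.AssR_in[OF a]
      show ?thesis
        using n t F T.Dist_Obj[of d1] T.Dist_Obj[of d2] T.Dist_Obj[of d4] by (auto simp: is_functor_def)
    qed
    then show ?thesis by simp
  qed
  have f: "is_functor (Tsk T) P (dmod D) \<longleftrightarrow> is_functor (Tsk T) P D"
    by (simp add: is_functor_def)
  show ?thesis
  proof
    assume *: "determinant_functor T P D"
    note d = *[unfolded determinant_functor_def is_functor_isom]
    have F: "is_functor (Tsk T) P D" and t: "\<forall>d\<in>Dist T. addD D d \<in> Hom P (onObj D (tZ T d) \<oplus> onObj D (tX T d)) (onObj D (tY T d))"
      using d by blast+
    show "is_model (Tsk T) (dmod D)"
      unfolding is_model_def f dmod_sel Tsk_sel(7-11,14)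
      by (intro conjI F t iffD1[OF com[OF F t] conjunct1[OF conjunct2[OF conjunct2[OF conjunct2[OF d]]]]] iffD1[OF ass[OF F t] conjunct2[OF conjunct2[OF conjunct2[OF conjunct2[OF d]]]]])
        (use conjunct1[OF conjunct2[OF conjunct2[OF d]]] in blast)+
  next
    assume *: "is_model (Tsk T) (dmod D)"
    note d = *[unfolded is_model_def f dmod_sel Tsk_sel(7-11)]
    have F: "is_functor (Tsk T) P D" and t: "\<forall>d\<in>Dist T. addD D d \<in> Hom P (onObj D (tZ T d) \<oplus> onObj D (tX T d)) (onObj D (tY T d))"
      using d by blast+
    show "determinant_functor T P D"
      unfolding determinant_functor_def is_functor_isom
      by (intro conjI F t iffD2[OF com[OF F t] conjunct1[OF conjunct2[OF conjunct2[OF conjunct2[OF d]]]]] iffD2[OF ass[OF F t] conjunct1[OF conjunct2[OF conjunct2[OF conjunct2[OF conjunct2[OF d]]]]]])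
        (use conjunct1[OF conjunct2[OF conjunct2[OF d]]] in blast)+
  qed
qed

lemma is_smap_det:
  assumes "triangulated_category T" "picard_groupoid V" "determinant_functor T V det"
  shows "is_smap (Tsk T) (Vsk V) (det_map T det)"
proof -
  interpret T: triangulated_category T by fact
  interpret V: picard_groupoid V by fact
  have F: "is_functor (Tsk T) V det" and t: "\<And>d. d \<in> Dist T \<Longrightarrow> addD det d \<in> Hom V (onObj det (tZ T d) \<oplus>\<^bsub>V\<^esub> onObj det (tX T d)) (onObj det (tY T d))"
    using assms(3) unfolding determinant_functor_def is_functor_isom by blast+
  have O: "onObj det a \<in> Obj V" if "a \<in> Obj T" for a
    using F that by (auto simp: is_functor_def)
  have "is_functor (Tsk T) (Vsk V) (det_map T det)"
    using F by (simp add: is_functor_def)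
  then show ?thesis
    using t T.Dist_Obj O by (simp add: is_smap_def)
qed

text \<open>As \<open>det\<close> does not preserve relations strictly, each one is pasted from two:
  the relation of \<open>det\<close> inside \<open>V\<close>, pushed forward by \<open>G\<close>,
  and the matching relation of \<open>G\<close> on sums in \<open>V\<close>.\<close>

lemma det_pull_model:
  assumes "triangulated_category T" "picard_groupoid V" "determinant_functor T V det" "is_model (Vsk V) G"
  shows "is_model (Tsk T) (pull G (det_map T det))"
proof -
  interpret T: triangulated_category T by fact
  interpret V: picard_groupoid V by fact
  interpret S: sketch "Tsk T" by (rule T.sketch_Tsk)
  interpret W: sketch "Vsk V" by (rule V.sketch_Vsk)
  have mD: "V.is_model (Tsk T) (dmod det)"
    by (rule iffD1[OF V.determinant_iff[OF assms(1)] assms(3)])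
  note D = V.model_simps[OF mD, simplified] and g = Gs[OF assms(2,4)]
  note nat = V.model_nat[OF mD, simplified] and com = V.model_com[OF mD, unfolded dmod_sel] and ass = V.model_ass[OF mD, unfolded dmod_sel]
  note Gn = G_nat[OF assms(2,4)] and Ga = G_ass[OF assms(2,4)] and GC = model_Cmp[OF assms(4), simplified]
  have Gi: "onArr G (Ide V a) = Ide P (onObj G a)" if "a \<in> Obj V" for a
    using model_Ide[OF assms(4)] that by simp
  let ?F = "pull G (det_map T det)" and ?D = "onObj det"
  show ?thesis
  proof (rule is_modelI[OF data_pull[OF model_data[OF assms(4)] is_smap_det[OF assms(1-3)] T.sketch_Tsk V.sketch_Vsk] S.category_axioms])
    show "onArr ?F (Ide (Tsk T) a) = Ide P (onObj ?F a)" if "a \<in> Obj (Tsk T)" for a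
      using that V.model_Ide[OF mD, of a] D by (simp add: Gi)
    show "onArr ?F (v \<cdot>\<^bsub>Tsk T\<^esub> u) = onArr ?F v \<cdot> onArr ?F u" if "u \<in> Arr (Tsk T)" "v \<in> Arr (Tsk T)" "Dom (Tsk T) v = Cod (Tsk T) u" for u v
      using that V.model_Cmp[OF mD, of u v] D by (simp add: GC)
  next
    fix d d' u v w assume n: "NatR (Tsk T) d d' u v w"
    note t = S.NatR_in[OF n]
    have ob: "tX T d \<in> Obj T" "tZ T d \<in> Obj T" "tX T d' \<in> Obj T" "tZ T d' \<in> Obj T"
      using t T.Dist_Obj[of d] T.Dist_Obj[of d'] by auto
    let ?c = "fadd G (?D (tZ T d), ?D (tX T d))" and ?c' = "fadd G (?D (tZ T d'), ?D (tX T d'))"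
    have "fadd ?F d' \<cdot> (onArr ?F w \<boxplus> onArr ?F u) = onArr G (addD det d') \<cdot> (?c' \<cdot> (onArr G (onArr det w) \<boxplus> onArr G (onArr det u)))"
      using t D g ob by simp
    also have "\<dots> = onArr G (addD det d' \<cdot>\<^bsub>V\<^esub> (onArr det w \<boxplus>\<^bsub>V\<^esub> onArr det u)) \<cdot> ?c"
      using t D g ob by (simp add: Gn GC)
    also have "addD det d' \<cdot>\<^bsub>V\<^esub> (onArr det w \<boxplus>\<^bsub>V\<^esub> onArr det u) = onArr det v \<cdot>\<^bsub>V\<^esub> addD det d"
      using V.model_nat[OF mD n] by simp
    also have "onArr G \<dots> \<cdot> ?c = onArr ?F v \<cdot> fadd ?F d"
      using t D g ob by (simp add: GC)
    finally show "fadd ?F d' \<cdot> (onArr ?F w \<boxplus> onArr ?F u) = onArr ?F v \<cdot> fadd ?F d" .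
  next
    fix d d' u assume n: "ComR (Tsk T) d d' u"
    note t = S.ComR_in[OF n]
    have ob: "tX T d \<in> Obj T" "tZ T d \<in> Obj T" "tX T d' \<in> Obj T" "tZ T d' \<in> Obj T"
      using t T.Dist_Obj[of d] T.Dist_Obj[of d'] by auto
    have e: "tZ T d' = tX T d" "tX T d' = tZ T d" using t by auto
    let ?x = "?D (tX T d)" and ?z = "?D (tZ T d)"
    have "onArr ?F u \<cdot> fadd ?F d' = onArr G (onArr det u \<cdot>\<^bsub>V\<^esub> addD det d') \<cdot> fadd G (?x, ?z)"
      using t D g ob by (simp add: GC e)
    also have "onArr det u \<cdot>\<^bsub>V\<^esub> addD det d' = addD det d \<cdot>\<^bsub>V\<^esub> symm V ?x ?z"
      using com[OF n] by (simp only: e Tsk_sel)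
    also have "onArr G \<dots> \<cdot> fadd G (?x, ?z) = onArr G (addD det d) \<cdot> (onArr G (symm V ?x ?z) \<cdot> fadd G (?x, ?z))"
      using t D g ob by (simp add: GC)
    also have "onArr G (symm V ?x ?z) \<cdot> fadd G (?x, ?z) = fadd G (?z, ?x) \<cdot> symm P (onObj G ?x) (onObj G ?z)"
      using model_com[OF assms(4), of "(?z, ?x)" "(?x, ?z)" "symm V ?x ?z"] D ob by simp
    finally show "onArr ?F u \<cdot> fadd ?F d' = fadd ?F d \<cdot> symm P (onObj ?F (pZ (Tsk T) d')) (onObj ?F (pX (Tsk T) d'))"
      using t D g ob by (simp add: e)
  next
    fix d1 d2 d3 d4 u assume n: "AssR (Tsk T) d1 d2 d3 d4 u"
    note t = S.AssR_in[OF n]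
    have tr: "d1 \<in> Dist T" "d2 \<in> Dist T" "d3 \<in> Dist T" "d4 \<in> Dist T" using t by auto
    define x y z where "x = ?D (tX T d1)" and "y = ?D (tZ T d1)" and "z = ?D (tZ T d3)"
    have ob: "x \<in> Obj V" "y \<in> Obj V" "z \<in> Obj V"
      using D T.Dist_Obj[OF tr(1)] T.Dist_Obj[OF tr(3)] by (auto simp: x_def y_def z_def)
    have e: "tX T d2 = tX T d1" "tX T d3 = tY T d1" "tX T d4 = tZ T d1" "tY T d4 = tZ T d2" "tZ T d4 = tZ T d3" "tY T d2 = tY T d3"
      using t n T.Dist_Obj(2)[OF tr(2)] by auto
    have u: "u = Ide T (tY T d2)" using n by simp
    have ad: "addD det d1 \<in> Arr V" "Dom V (addD det d1) = y \<oplus>\<^bsub>V\<^esub> x" "Cod V (addD det d1) = ?D (tY T d1)"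
      "addD det d2 \<in> Arr V" "Dom V (addD det d2) = ?D (tZ T d2) \<oplus>\<^bsub>V\<^esub> x" "Cod V (addD det d2) = ?D (tY T d3)"
      "addD det d3 \<in> Arr V" "Dom V (addD det d3) = z \<oplus>\<^bsub>V\<^esub> ?D (tY T d1)" "Cod V (addD det d3) = ?D (tY T d3)"
      "addD det d4 \<in> Arr V" "Dom V (addD det d4) = z \<oplus>\<^bsub>V\<^esub> y" "Cod V (addD det d4) = ?D (tZ T d2)"
      using D tr by (simp_all add: x_def y_def z_def e)
    have ob': "?D (tZ T d2) \<in> Obj V" "?D (tY T d1) \<in> Obj V" "?D (tY T d3) \<in> Obj V"
      using D(1) T.Dist_Obj(2,3)[OF tr(1)] T.Dist_Obj(2,3)[OF tr(2)] T.Dist_Obj(2,3)[OF tr(3)] by simp_all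
    have U: "onArr G (onArr det u) = Ide P (onObj G (?D (tY T d3)))"
      using V.model_Ide[OF mD, of "tY T d2"] T.Dist_Obj(2)[OF tr(2)] D by (simp add: u Gi e)
    have l: "onArr ?F u \<cdot> (fadd ?F d2 \<cdot> (fadd ?F d4 \<boxplus> Ide P (onObj ?F (pX (Tsk T) d1))))
      = onArr G (addD det d2) \<cdot> ((fadd G (?D (tZ T d2), x) \<cdot> (onArr G (addD det d4) \<boxplus> onArr G (Ide V x))) \<cdot> (fadd G (z, y) \<boxplus> Ide P (onObj G x)))"
      using ad ob ob' g by (simp add: e U Gi interchange x_def[symmetric] y_def[symmetric] z_def[symmetric])
    \<comment> \<open>The associativity of \<open>det\<close>, freed from the identity arrow
      \<open>onArr det u\<close>.\<close>
    have k: "addD det d2 \<cdot>\<^bsub>V\<^esub> (addD det d4 \<boxplus>\<^bsub>V\<^esub> Ide V x) = addD det d3 \<cdot>\<^bsub>V\<^esub> ((Ide V z \<boxplus>\<^bsub>V\<^esub> addD det d1) \<cdot>\<^bsub>V\<^esub> assoc V z y x)"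
    proof -
      have "onArr det u = Ide V (?D (tY T d3))"
        using V.model_Ide[OF mD, of "tY T d2"] T.Dist_Obj(2)[OF tr(2)] by (simp add: u e)
      then show ?thesis
        using ass[OF n] ad ob ob' by (simp add: x_def[symmetric] y_def[symmetric] z_def[symmetric])
    qed
    have "onArr G (addD det d2) \<cdot> ((fadd G (?D (tZ T d2), x) \<cdot> (onArr G (addD det d4) \<boxplus> onArr G (Ide V x))) \<cdot> (fadd G (z, y) \<boxplus> Ide P (onObj G x)))
      = onArr G (addD det d2 \<cdot>\<^bsub>V\<^esub> (addD det d4 \<boxplus>\<^bsub>V\<^esub> Ide V x)) \<cdot> (fadd G (z \<oplus>\<^bsub>V\<^esub> y, x) \<cdot> (fadd G (z, y) \<boxplus> Ide P (onObj G x)))"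
      using ad ob ob' g by (simp add: Gn GC)
    also have "\<dots> = onArr G (addD det d3) \<cdot> (onArr G (Ide V z \<boxplus>\<^bsub>V\<^esub> addD det d1) \<cdot>
        (onArr G (assoc V z y x) \<cdot> (fadd G (z \<oplus>\<^bsub>V\<^esub> y, x) \<cdot> (fadd G (z, y) \<boxplus> Ide P (onObj G x)))))"
      unfolding k using ad ob ob' g by (simp add: GC)
    also have "\<dots> = onArr G (addD det d3) \<cdot> ((onArr G (Ide V z \<boxplus>\<^bsub>V\<^esub> addD det d1) \<cdot> fadd G (z, y \<oplus>\<^bsub>V\<^esub> x)) \<cdot>
        ((Ide P (onObj G z) \<boxplus> fadd G (y, x)) \<cdot> assoc P (onObj G z) (onObj G y) (onObj G x)))"
      using ad ob ob' g by (simp add: Ga)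
    also have "onArr G (Ide V z \<boxplus>\<^bsub>V\<^esub> addD det d1) \<cdot> fadd G (z, y \<oplus>\<^bsub>V\<^esub> x) = fadd G (z, ?D (tY T d1)) \<cdot> (onArr G (Ide V z) \<boxplus> onArr G (addD det d1))"
      using ad ob ob' by (intro Gn[symmetric]) simp_all
    also have "onArr G (addD det d3) \<cdot> ((fadd G (z, ?D (tY T d1)) \<cdot> (onArr G (Ide V z) \<boxplus> onArr G (addD det d1))) \<cdot>
        ((Ide P (onObj G z) \<boxplus> fadd G (y, x)) \<cdot> assoc P (onObj G z) (onObj G y) (onObj G x)))
      = fadd ?F d3 \<cdot> ((Ide P (onObj ?F (pZ (Tsk T) d3)) \<boxplus> fadd ?F d1)
         \<cdot> assoc P (onObj ?F (pZ (Tsk T) d3)) (onObj ?F (pZ (Tsk T) d1)) (onObj ?F (pX (Tsk T) d1)))"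
      using ad ob ob' g by (simp add: e Gi interchange' x_def[symmetric] y_def[symmetric] z_def[symmetric])
    finally show "onArr ?F u \<cdot> (fadd ?F d2 \<cdot> (fadd ?F d4 \<boxplus> Ide P (onObj ?F (pX (Tsk T) d1))))
      = fadd ?F d3 \<cdot> ((Ide P (onObj ?F (pZ (Tsk T) d3)) \<boxplus> fadd ?F d1)
         \<cdot> assoc P (onObj ?F (pZ (Tsk T) d3)) (onObj ?F (pZ (Tsk T) d1)) (onObj ?F (pX (Tsk T) d1)))"
      unfolding l .
  qed simp
qed

text \<open>The additivity square of a factorisation is the square of a morphism from the pullback
  along \<open>det_map\<close>, because the correction there is the image of the additivity morphism
  of \<open>det\<close> under \<open>f\<close>.\<close>

lemma det_factorization_iff:
  assumes "triangulated_category T" "picard_groupoid V" "determinant_functor T V det" "determinant_functor T P D"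
    "symmetric_monoidal_functor V P f"
  shows "det_factorization T V P det D f \<alpha> \<longleftrightarrow> \<alpha> \<in> extensional (Obj T) \<and> mmor (Tsk T) (pull (vmod f) (det_map T det)) (dmod D) \<alpha>"
proof -
  interpret T: triangulated_category T by fact
  interpret V: picard_groupoid V by fact
  have m: "is_model (Tsk T) (pull (vmod f) (det_map T det))"
    by (rule det_pull_model[OF assms(1-3) vmod_model[OF assms(2,5)]])
  have mD: "is_model (Tsk T) (dmod D)"
    by (rule iffD1[OF determinant_iff[OF assms(1)] assms(4)])
  note s = model_simps[OF m, simplified] and d = model_simps[OF mD, simplified]
  have A: "iso_arr T u \<Longrightarrow> u \<in> Arr T" for u by (rule T.iso_arr_Arr)
  have 1: "nat_trans (isom T) P (comp_functor f det) D \<alpha> \<longleftrightarrow> \<alpha> \<in> extensional (Obj T) \<and>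
     (\<forall>a\<in>Obj T. \<alpha> a \<in> Hom P (onObj f (onObj det a)) (onObj D a)) \<and>
     (\<forall>u. iso_arr T u \<longrightarrow> \<alpha> (Cod T u) \<cdot> onArr f (onArr det u) = onArr D u \<cdot> \<alpha> (Dom T u))"
    by (auto simp: nat_trans_def comp_functor_def)
  have 2: "sq (\<alpha> (Dom T u)) (onArr f (onArr det u)) (onArr D u) (\<alpha> (Cod T u)) \<longleftrightarrow>
      \<alpha> (Cod T u) \<cdot> onArr f (onArr det u) = onArr D u \<cdot> \<alpha> (Dom T u)"
    if "\<forall>a\<in>Obj T. \<alpha> a \<in> Hom P (onObj f (onObj det a)) (onObj D a)" "iso_arr T u" for u
    using that A[OF that(2)] s d by (simp add: sq_def)
  have 3: "sq (\<alpha> (tZ T e) \<boxplus> \<alpha> (tX T e)) (onArr f (addD det e) \<cdot> tensC f (onObj det (tZ T e)) (onObj det (tX T e))) (addD D e) (\<alpha> (tY T e)) \<longleftrightarrow>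
      \<alpha> (tY T e) \<cdot> (onArr f (addD det e) \<cdot> tensC f (onObj det (tZ T e)) (onObj det (tX T e))) = addD D e \<cdot> (\<alpha> (tZ T e) \<boxplus> \<alpha> (tX T e))"
    if "\<forall>a\<in>Obj T. \<alpha> a \<in> Hom P (onObj f (onObj det a)) (onObj D a)" "e \<in> Dist T" for e
    using that T.Dist_Obj[OF that(2)] s(5-7)[OF that(2)] d(5-7)[OF that(2)] by (simp add: sq_def)
  show ?thesis
    unfolding det_factorization_def mmor_def 1 using assms(5) 2 3 by auto
qed

end

text \<open>Universality in terms of models. Two mismatches are repaired: models carry no unit
  constraint, and their morphisms are not normalised outside the objects.\<close>

lemma universal_model:
  fixes P :: "('p, 'q) mon_cat" and T :: "('c, 'd) tri_cat" and V :: "('a, 'b) mon_cat" and det :: "('c, 'd, 'a, 'b) det_funct"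
  assumes "triangulated_category T" "universal_determinant_functor TYPE(('p, 'q) mon_cat) T V det" "picard_groupoid P"
    "picard_groupoid.is_model P (Tsk T) F"
  shows "\<exists>G \<alpha>. picard_groupoid.is_model P (Vsk V) G \<and> picard_groupoid.mmor P (Tsk T) (picard_groupoid.pull P G (det_map T det)) F \<alpha> \<and>
    (\<forall>H \<alpha>'. picard_groupoid.is_model P (Vsk V) H \<longrightarrow> picard_groupoid.mmor P (Tsk T) (picard_groupoid.pull P H (det_map T det)) F \<alpha>' \<longrightarrow>
      (\<exists>\<beta>. picard_groupoid.mmor P (Vsk V) G H \<beta> \<and> (\<forall>x\<in>Obj T. \<alpha>' x \<cdot>\<^bsub>P\<^esub> \<beta> (onObj det x) = \<alpha> x) \<and>
        (\<forall>\<beta>'. picard_groupoid.mmor P (Vsk V) G H \<beta>' \<longrightarrow> (\<forall>x\<in>Obj T. \<alpha>' x \<cdot>\<^bsub>P\<^esub> \<beta>' (onObj det x) = \<alpha> x) \<longrightarrow> (\<forall>v\<in>Obj V. \<beta>' v = \<beta> v))))"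
proof -
  interpret P: picard_groupoid P by fact
  interpret T: triangulated_category T by fact
  have V: "picard_groupoid V" and det: "determinant_functor T V det"
    using assms(2) by (auto simp: universal_determinant_functor_def)
  interpret V: picard_groupoid V by (rule V)
  have detO: "onObj det x \<in> Obj V" if "x \<in> Obj T" for x
    using det that by (auto simp: determinant_functor_def is_functor_def T.isom_sel)
  have D: "determinant_functor T P (dfun F)"
    by (rule iffD2[OF P.determinant_iff[OF assms(1)]]) (simp add: assms(4))
  have U: "\<forall>D. determinant_functor T P D \<longrightarrow>
        (\<exists>(f :: ('a, 'b, 'p, 'q) mon_funct) \<alpha>. det_factorization T V P det (D :: ('c, 'd, 'p, 'q) det_funct) f \<alpha> \<and>
           (\<forall>(f' :: ('a, 'b, 'p, 'q) mon_funct) \<alpha>'. det_factorization T V P det D f' \<alpha>' \<longrightarrow>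
              (\<exists>!\<beta>. monoidal_nat_trans V P f f' \<beta> \<and> (\<forall>x\<in>Obj T. \<alpha>' x \<cdot>\<^bsub>P\<^esub> \<beta> (onObj det x) = \<alpha> x))))"
    using assms(2,3) unfolding universal_determinant_functor_def by blast
  obtain f :: "('a, 'b, 'p, 'q) mon_funct" and \<alpha> where f: "det_factorization T V P det (dfun F) f \<alpha>"
    and u: "\<And>(f' :: ('a, 'b, 'p, 'q) mon_funct) \<alpha>'. det_factorization T V P det (dfun F) f' \<alpha>' \<Longrightarrow>
              (\<exists>!\<beta>. monoidal_nat_trans V P f f' \<beta> \<and> (\<forall>x\<in>Obj T. \<alpha>' x \<cdot>\<^bsub>P\<^esub> \<beta> (onObj det x) = \<alpha> x))"
    using U[rule_format, OF D] by blast
  have sf: "symmetric_monoidal_functor V P f"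
    using f by (simp add: det_factorization_def)
  note fac = P.det_factorization_iff[OF assms(1) V det D]
  have mf: "P.is_model (Vsk V) (vmod f)"
    by (rule P.vmod_model[OF V sf])
  have ma: "P.mmor (Tsk T) (P.pull (vmod f) (det_map T det)) F \<alpha>"
    using fac[OF sf] f by simp
  have "\<exists>\<beta>. P.mmor (Vsk V) (vmod f) H \<beta> \<and> (\<forall>x\<in>Obj T. \<alpha>' x \<cdot>\<^bsub>P\<^esub> \<beta> (onObj det x) = \<alpha> x) \<and>
        (\<forall>\<beta>'. P.mmor (Vsk V) (vmod f) H \<beta>' \<longrightarrow> (\<forall>x\<in>Obj T. \<alpha>' x \<cdot>\<^bsub>P\<^esub> \<beta>' (onObj det x) = \<alpha> x) \<longrightarrow> (\<forall>v\<in>Obj V. \<beta>' v = \<beta> v))"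
    if H: "P.is_model (Vsk V) H" and a: "P.mmor (Tsk T) (P.pull H (det_map T det)) F \<alpha>'" for H \<alpha>'
  proof -
    \<comment> \<open>A unit constraint completes the model \<open>H\<close> to a symmetric monoidal
      functor.\<close>
    obtain w where w: "w \<in> Hom P (unitO P) (onObj H (unitO V))" "\<And>b. b \<in> Obj V \<Longrightarrow> P.lam V H b \<cdot>\<^bsub>P\<^esub> (w \<boxplus>\<^bsub>P\<^esub> Ide P (onObj H b)) = lunit P (onObj H b)"
      "\<And>b. b \<in> Obj V \<Longrightarrow> P.rho V H b \<cdot>\<^bsub>P\<^esub> (Ide P (onObj H b) \<boxplus>\<^bsub>P\<^esub> w) = runit P (onObj H b)"
      using P.unit_exists[OF V H] by blast
    have sh: "symmetric_monoidal_functor V P (vfun H w)"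
      by (rule P.vfun_functor[OF V H w])
    \<comment> \<open>Factorisations have extensional components, so \<open>\<alpha>'\<close> is cut
      down to the objects of \<open>T\<close>.\<close>
    have r: "P.mmor (Tsk T) (P.pull (vmod (vfun H w)) (det_map T det)) (dmod (dfun F)) (restrict \<alpha>' (Obj T))"
      using P.mmor_cong[OF a _ T.sketch_Tsk, of "restrict \<alpha>' (Obj T)"] by simp
    have d: "det_factorization T V P det (dfun F) (vfun H w) (restrict \<alpha>' (Obj T))"
      using fac[OF sh] r by simp
    from u[OF d] obtain \<beta> where \<beta>: "monoidal_nat_trans V P f (vfun H w) \<beta>" "\<forall>x\<in>Obj T. restrict \<alpha>' (Obj T) x \<cdot>\<^bsub>P\<^esub> \<beta> (onObj det x) = \<alpha> x"
      and un: "\<And>\<beta>'. monoidal_nat_trans V P f (vfun H w) \<beta>' \<and> (\<forall>x\<in>Obj T. restrict \<alpha>' (Obj T) x \<cdot>\<^bsub>P\<^esub> \<beta>' (onObj det x) = \<alpha> x) \<Longrightarrow> \<beta>' = \<beta>"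
      by (metis (no_types, lifting))
    have "\<beta>' v = \<beta> v" if b: "P.mmor (Vsk V) (vmod f) H \<beta>'" "\<forall>x\<in>Obj T. \<alpha>' x \<cdot>\<^bsub>P\<^esub> \<beta>' (onObj det x) = \<alpha> x" and v: "v \<in> Obj V" for \<beta>' v
    proof -
      have "P.mmor (Vsk V) (vmod f) H (restrict \<beta>' (Obj V))"
        by (rule P.mmor_cong[OF b(1) _ V.sketch_Vsk]) simp
      then have "monoidal_nat_trans V P f (vfun H w) (restrict \<beta>' (Obj V))"
        using P.monoidal_nat_trans_iff[OF V sf sh] by simp
      then have "restrict \<beta>' (Obj V) = \<beta>"
        using un b(2) detO by simp
      then show ?thesis using v by (metis restrict_apply')
    qed
    then show ?thesis
      using \<beta> P.monoidal_nat_trans_iff[OF V sf sh] by (intro exI[of _ \<beta>]) auto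
  qed
  with mf ma show ?thesis by blast
qed

text \<open>Universality speaks of factorisations of one determinant functor. For fullness and
  faithfulness it is applied to the one obtained from \<open>G\<close>, of which \<open>G\<close>
  and \<open>H\<close> provide competing factorisations.\<close>

lemma requiv_det:
  fixes P :: "('p, 'q) mon_cat" and T :: "('c, 'd) tri_cat" and V :: "('a, 'b) mon_cat" and det :: "('c, 'd, 'a, 'b) det_funct"
  assumes "triangulated_category T" "universal_determinant_functor TYPE(('p, 'q) mon_cat) T V det" "picard_groupoid P"
  shows "picard_groupoid.requiv P (Tsk T) (Vsk V) (det_map T det)"
proof -
  interpret P: picard_groupoid P by fact
  interpret T: triangulated_category T by fact
  have V: "picard_groupoid V" and det: "determinant_functor T V det"
    using assms(2) by (auto simp: universal_determinant_functor_def)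
  interpret V: picard_groupoid V by (rule V)
  note sT = T.sketch_Tsk and sV = V.sketch_Vsk and sm = P.is_smap_det[OF assms(1) V det]
  let ?J = "det_map T det"
  have pm: "P.is_model (Tsk T) (P.pull G ?J)" if "P.is_model (Vsk V) G" for G
    by (rule P.det_pull_model[OF assms(1) V det that])
  have detO: "onObj det x \<in> Obj V" if "x \<in> Obj T" for x
    using smap_simps(1)[OF sm] that by simp
  show ?thesis
  proof (rule P.requivI[OF sT sV sm pm])
    show "\<exists>G \<alpha>. P.is_model (Vsk V) G \<and> P.mmor (Tsk T) (P.pull G ?J) F \<alpha>" if "P.is_model (Tsk T) F" for F
      using universal_model[OF assms that] by blast
  next
    fix G H \<theta>
    assume G: "P.is_model (Vsk V) G" and H: "P.is_model (Vsk V) H" and \<theta>: "P.mmor (Tsk T) (P.pull G ?J) (P.pull H ?J) \<theta>"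
    obtain K \<alpha> where K: "P.is_model (Vsk V) K" "P.mmor (Tsk T) (P.pull K ?J) (P.pull G ?J) \<alpha>"
      and U: "\<And>L \<alpha>'. \<lbrakk>P.is_model (Vsk V) L; P.mmor (Tsk T) (P.pull L ?J) (P.pull G ?J) \<alpha>'\<rbrakk> \<Longrightarrow>
        \<exists>\<beta>. P.mmor (Vsk V) K L \<beta> \<and> (\<forall>x\<in>Obj T. \<alpha>' x \<cdot>\<^bsub>P\<^esub> \<beta> (onObj det x) = \<alpha> x)"
      using universal_model[OF assms pm[OF G]] by blast
    \<comment> \<open>\<open>G\<close> factors its own pullback through the identity.\<close>
    obtain \<beta> where \<beta>: "P.mmor (Vsk V) K G \<beta>" "\<forall>x\<in>Obj T. Ide P (onObj G (onObj det x)) \<cdot>\<^bsub>P\<^esub> \<beta> (onObj det x) = \<alpha> x"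
      using U[OF G P.mmor_Ide[OF P.model_data[OF pm[OF G]] sT]] by auto
    \<comment> \<open>\<open>H\<close> factors the same pullback through the inverse of
      \<open>\<theta>\<close>; the extension of \<open>\<theta>\<close> is the quotient of the two
      comparisons with \<open>K\<close>.\<close>
    obtain \<beta>' where \<beta>': "P.mmor (Vsk V) K H \<beta>'" "\<forall>x\<in>Obj T. inv_arr P (\<theta> x) \<cdot>\<^bsub>P\<^esub> \<beta>' (onObj det x) = \<alpha> x"
      using U[OF H P.mmor_inv[OF \<theta> sT]] by auto
    have m: "P.mmor (Vsk V) G H (\<lambda>v. \<beta>' v \<cdot>\<^bsub>P\<^esub> inv_arr P (\<beta> v))"
      by (rule P.mmor_Cmp[OF P.mmor_inv[OF \<beta>(1) sV] \<beta>'(1) sV])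
    have "\<beta>' (onObj det x) \<cdot>\<^bsub>P\<^esub> inv_arr P (\<beta> (onObj det x)) = \<theta> x" if x: "x \<in> Obj T" for x
    proof -
      have t: "\<theta> x \<in> Arr P" "Dom P (\<theta> x) = onObj G (onObj det x)" "Cod P (\<theta> x) = onObj H (onObj det x)"
        using P.mmorD(1-3)[OF \<theta>] x by simp_all
      note b = P.mmorD(1-3)[OF \<beta>(1), simplified, OF detO[OF x]] and b' = P.mmorD(1-3)[OF \<beta>'(1), simplified, OF detO[OF x]]
      have "\<beta>' (onObj det x) = \<theta> x \<cdot>\<^bsub>P\<^esub> (inv_arr P (\<theta> x) \<cdot>\<^bsub>P\<^esub> \<beta>' (onObj det x))"
        using t b' by simp
      also have "inv_arr P (\<theta> x) \<cdot>\<^bsub>P\<^esub> \<beta>' (onObj det x) = \<beta> (onObj det x)"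
        using bspec[OF \<beta>(2) x] bspec[OF \<beta>'(2) x] b by simp
      finally have e: "\<beta>' (onObj det x) = \<theta> x \<cdot>\<^bsub>P\<^esub> \<beta> (onObj det x)" .
      show ?thesis
        unfolding e using t b by simp
    qed
    then show "\<exists>\<eta>. P.mmor (Vsk V) G H \<eta> \<and> (\<forall>a\<in>Obj (Tsk T). \<eta> (onObj ?J a) = \<theta> a)"
      using m by (intro exI[of _ "\<lambda>v. \<beta>' v \<cdot>\<^bsub>P\<^esub> inv_arr P (\<beta> v)"]) simp
  next
    fix G H \<eta> \<eta>' v
    assume G: "P.is_model (Vsk V) G" and H: "P.is_model (Vsk V) H" and \<eta>: "P.mmor (Vsk V) G H \<eta>" and \<eta>': "P.mmor (Vsk V) G H \<eta>'"
      and eq: "\<And>a. a \<in> Obj (Tsk T) \<Longrightarrow> \<eta> (onObj ?J a) = \<eta>' (onObj ?J a)" and v: "v \<in> Obj (Vsk V)"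
    obtain K \<alpha> where K: "P.is_model (Vsk V) K"
      and U: "\<And>L \<alpha>'. \<lbrakk>P.is_model (Vsk V) L; P.mmor (Tsk T) (P.pull L ?J) (P.pull G ?J) \<alpha>'\<rbrakk> \<Longrightarrow>
        \<exists>\<beta>. P.mmor (Vsk V) K L \<beta> \<and> (\<forall>x\<in>Obj T. \<alpha>' x \<cdot>\<^bsub>P\<^esub> \<beta> (onObj det x) = \<alpha> x) \<and>
          (\<forall>\<beta>'. P.mmor (Vsk V) K L \<beta>' \<longrightarrow> (\<forall>x\<in>Obj T. \<alpha>' x \<cdot>\<^bsub>P\<^esub> \<beta>' (onObj det x) = \<alpha> x) \<longrightarrow> (\<forall>v\<in>Obj V. \<beta>' v = \<beta> v))"
      using universal_model[OF assms pm[OF G]] by blast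
    obtain \<beta> where \<beta>: "P.mmor (Vsk V) K G \<beta>" "\<forall>x\<in>Obj T. Ide P (onObj G (onObj det x)) \<cdot>\<^bsub>P\<^esub> \<beta> (onObj det x) = \<alpha> x"
      using U[OF G P.mmor_Ide[OF P.model_data[OF pm[OF G]] sT]] by auto
    have p: "P.mmor (Tsk T) (P.pull H ?J) (P.pull G ?J) (\<lambda>x. inv_arr P (\<eta> (onObj ?J x)))"
      by (rule P.mmor_inv[OF P.mmor_pull[OF \<eta> P.model_data[OF G] P.model_data[OF H] sm sT sV] sT])
    note b = P.mmorD(1-3)[OF \<beta>(1), simplified] and e = P.mmorD(1-3)[OF \<eta>, simplified] and e' = P.mmorD(1-3)[OF \<eta>', simplified]
    have 1: "inv_arr P (\<eta> (onObj det x)) \<cdot>\<^bsub>P\<^esub> (\<eta> (onObj det x) \<cdot>\<^bsub>P\<^esub> \<beta> (onObj det x)) = \<alpha> x" if "x \<in> Obj T" for x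
      using bspec[OF \<beta>(2) that] b[OF detO[OF that]] e[OF detO[OF that]] by simp
    have 2: "inv_arr P (\<eta> (onObj det x)) \<cdot>\<^bsub>P\<^esub> (\<eta>' (onObj det x) \<cdot>\<^bsub>P\<^esub> \<beta> (onObj det x)) = \<alpha> x" if "x \<in> Obj T" for x
      using 1[OF that] eq[of x] that by simp
    from U[OF H p] obtain \<beta>' where un: "\<forall>\<beta>''. P.mmor (Vsk V) K H \<beta>'' \<longrightarrow> (\<forall>x\<in>Obj T. inv_arr P (\<eta> (onObj ?J x)) \<cdot>\<^bsub>P\<^esub> \<beta>'' (onObj det x) = \<alpha> x) \<longrightarrow> (\<forall>v\<in>Obj V. \<beta>'' v = \<beta>' v)"
      by blast
    \<comment> \<open>Both composites compare \<open>K\<close> with \<open>H\<close> over the same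
      factorisation, so they equal the unique comparison, and \<open>\<beta>\<close>
      cancels.\<close>
    have "\<eta> v \<cdot>\<^bsub>P\<^esub> \<beta> v = \<beta>' v"
      using un[rule_format, OF P.mmor_Cmp[OF \<beta>(1) \<eta> sV]] 1 v by simp
    moreover have "\<eta>' v \<cdot>\<^bsub>P\<^esub> \<beta> v = \<beta>' v"
      using un[rule_format, OF P.mmor_Cmp[OF \<beta>(1) \<eta>' sV]] 2 v by simp
    ultimately have "\<eta> v \<cdot>\<^bsub>P\<^esub> \<beta> v = \<eta>' v \<cdot>\<^bsub>P\<^esub> \<beta> v" by simp
    then show "\<eta> v = \<eta>' v"
      by (rule P.Cmp_cancel_right) (use v b e e' in simp_all)
  qed
qed

section \<open>Functors of several variables as models\<close>

text \<open>An arrow of a finite product is a composite of arrows that move one coordinate. The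
  triangle-function axiom concerns one other variable at a time, whereas the sketch of a family asks
  for naturality along arrows of all other variables at once.\<close>

lemma prod_arrow_induct:
  assumes "finite J" "\<And>j. j \<in> J \<Longrightarrow> category (C j)" "k \<in> Hom (prod_cat J C) x x'"
    and id: "\<And>y. y \<in> Obj (prod_cat J C) \<Longrightarrow> Q (Ide (prod_cat J C) y)"
    and single: "\<And>j y f. \<lbrakk>j \<in> J; y \<in> Obj (prod_cat (J - {j}) C); f \<in> Arr (C j)\<rbrakk> \<Longrightarrow> Q ((Ide (prod_cat (J - {j}) C) y)(j := f))"
    and comp: "\<And>f g. \<lbrakk>f \<in> Arr (prod_cat J C); g \<in> Arr (prod_cat J C); Dom (prod_cat J C) g = Cod (prod_cat J C) f; Q f; Q g\<rbrakk>
      \<Longrightarrow> Q (g \<cdot>\<^bsub>prod_cat J C\<^esub> f)"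
  shows "Q k"
proof -
  note c = category.Ide_simps[OF assms(2)] category.Obj_simps[OF assms(2)] category.Ide_Cmp[OF assms(2)] category.Cmp_Ide[OF assms(2)]
  note k = assms(3)[unfolded prod_Hom]
  have ob: "x j \<in> Obj (C j)" "x' j \<in> Obj (C j)" if "j \<in> J" for j
    using k c(4)[OF that, of "k j"] c(5)[OF that, of "k j"] that by simp_all
  \<comment> \<open>The arrow that has moved the coordinates in \<open>S\<close> and still rests at
    \<open>x\<close> in the others.\<close>
  let ?k = "\<lambda>S. \<lambda>j\<in>J. if j \<in> S then k j else Ide (C j) (x j)"
  have "Q (?k S)" if "finite S" "S \<subseteq> J" for S
    using that
  proof (induction S rule: finite_induct)
    case empty
    have "?k {} = Ide (prod_cat J C) x"
      by (auto simp: fun_eq_iff)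
    moreover have "x \<in> Obj (prod_cat J C)"
      using k ob by (simp add: PiE_iff)
    ultimately show ?case
      by (metis (no_types, lifting) id)
  next
    case (insert s S)
    \<comment> \<open>The next factor moves the coordinate \<open>s\<close>, with those in
      \<open>S\<close> already at their targets.\<close>
    let ?y = "\<lambda>j\<in>J - {s}. if j \<in> S then x' j else x j"
    let ?g = "(Ide (prod_cat (J - {s}) C) ?y)(s := k s)"
    have s: "s \<in> J" "s \<notin> S" using insert by auto
    have g: "Q ?g"
      using single[OF s(1), of ?y "k s"] k s ob by (auto simp: PiE_iff)
    have "Q (?g \<cdot>\<^bsub>prod_cat J C\<^esub> ?k S)"
    proof (rule comp)
      show "?k S \<in> Arr (prod_cat J C)" "?g \<in> Arr (prod_cat J C)"
        using k s ob c by (auto simp: PiE_iff extensional_def)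
      show "Dom (prod_cat J C) ?g = Cod (prod_cat J C) (?k S)"
        using k s ob c by (auto simp: fun_eq_iff)
      show "Q (?k S)" by (rule insert.IH) (use insert.prems in blast)
    qed (rule g)
    also have "?g \<cdot>\<^bsub>prod_cat J C\<^esub> ?k S = ?k (insert s S)"
      using k s ob c by (auto simp: fun_eq_iff)
    finally show ?case .
  qed
  from this[OF assms(1) order_refl] have "Q (?k J)" .
  moreover have "?k J = k"
    using k by (auto simp: fun_eq_iff extensional_def)
  ultimately show ?thesis by simp
qed

section \<open>Slices of a model on a family\<close>

context picard_groupoid
begin

definition pslice :: "'i set \<Rightarrow> ('i \<Rightarrow> ('a, 'b, 't) sketch) \<Rightarrow> ('i \<Rightarrow> 'a, 'i \<Rightarrow> 'b, 'i \<times> ('i \<Rightarrow> 'a) \<times> 't, 'o, 'm) model \<Rightarrow> 'i \<Rightarrow> ('i \<Rightarrow> 'a)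
    \<Rightarrow> ('a, 'b, 't, 'o, 'm) model" where
  "pslice I S F i x = \<lparr>onObj = (\<lambda>a. onObj F (x(i := a))), onArr = (\<lambda>f. onArr F ((Ide (prod_cat (I - {i}) S) x)(i := f))),
     fadd = (\<lambda>d. fadd F (i, x, d))\<rparr>"

lemma pslice_sel:
  "onObj (pslice I S F i x) a = onObj F (x(i := a))" "onArr (pslice I S F i x) f = onArr F ((Ide (prod_cat (I - {i}) S) x)(i := f))"
  "fadd (pslice I S F i x) d = fadd F (i, x, d)"
  by (simp_all add: pslice_def)

context
  fixes I :: "'i set" and S :: "'i \<Rightarrow> ('a, 'b, 't) sketch"
  assumes S: "\<And>i. i \<in> I \<Longrightarrow> sketch (S i)"
    and noTwo: "\<And>i az ax ay bz bx by. i \<in> I \<Longrightarrow> \<not> TwoR (S i) az ax ay bz bx by"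
begin

lemmas Sc = sketch.axioms(1)[OF S]

lemma prod_I: "category (prod_cat (I - J) S)"
  using category_prod_cat[of "I - J" S] Sc by simp

lemma upd_Hom_I:
  assumes "k \<in> Hom (prod_cat (I - {i}) S) x x'" "i \<in> I" "f \<in> Arr (S i)"
  shows "k(i := f) \<in> Arr (psk I S)" "Dom (psk I S) (k(i := f)) = x(i := Dom (S i) f)" "Cod (psk I S) (k(i := f)) = x'(i := Cod (S i) f)"
  using fun_upd_Hom[OF assms refl refl, folded psk_Hom] unfolding Hom_def by auto

lemma upd_Cmp:
  assumes "i \<in> I"
  shows "(k(i := g)) \<cdot>\<^bsub>psk I S\<^esub> (l(i := f)) = (k \<cdot>\<^bsub>prod_cat (I - {i}) S\<^esub> l)(i := g \<cdot>\<^bsub>S i\<^esub> f)"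
  using assms by (auto simp: fun_eq_iff)

lemma upd_Ide_I: "i \<in> I \<Longrightarrow> (Ide (prod_cat (I - {i}) S) x)(i := Ide (S i) a) = Ide (psk I S) (x(i := a))"
  by (auto simp: fun_eq_iff)

lemma upd_PiE: "\<lbrakk>x \<in> Obj (prod_cat (I - {i}) S); a \<in> Obj (S i); i \<in> I\<rbrakk> \<Longrightarrow> x(i := a) \<in> Obj (psk I S)"
  by simp

lemma psk_Tr: "\<lbrakk>i \<in> I; x \<in> Obj (prod_cat (I - {i}) S); d \<in> Tr (S i)\<rbrakk> \<Longrightarrow> (i, x, d) \<in> Tr (psk I S)"
  by simp

lemma pslice_data:
  assumes "is_data (psk I S) F" "i \<in> I" "x \<in> Obj (prod_cat (I - {i}) S)"
  shows "is_data (S i) (pslice I S F i x)"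
proof -
  interpret Q: category "prod_cat (I - {i}) S" by (rule prod_I)
  interpret Si: sketch "S i" by (rule S[OF assms(2)])
  note F = data_simps[OF assms(1)]
  note a = upd_Hom_I[OF Q.Ide_in[OF assms(3)] assms(2)]
  show ?thesis
    unfolding is_data_def
  proof (intro conjI ballI)
    show "onObj (pslice I S F i x) a \<in> Obj P" if "a \<in> Obj (S i)" for a
      unfolding pslice_sel by (rule F(1)[OF upd_PiE[OF assms(3) that assms(2)]])
    show "onArr (pslice I S F i x) f \<in> Hom P (onObj (pslice I S F i x) (Dom (S i) f)) (onObj (pslice I S F i x) (Cod (S i) f))" if "f \<in> Arr (S i)" for f
      unfolding pslice_sel Hom_def using F(2-4)[OF a(1)[OF that]] a[OF that] by simp
    show "fadd (pslice I S F i x) d \<in> Hom P (onObj (pslice I S F i x) (pZ (S i) d) \<oplus> onObj (pslice I S F i x) (pX (S i) d)) (onObj (pslice I S F i x) (pY (S i) d))"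
      if "d \<in> Tr (S i)" for d
      unfolding pslice_sel Hom_def using F(5-7)[OF psk_Tr[OF assms(2,3) that]] by simp
  qed
qed

lemma pslice_model:
  assumes F: "is_model (psk I S) F" and i: "i \<in> I" and x: "x \<in> Obj (prod_cat (I - {i}) S)"
  shows "is_model (S i) (pslice I S F i x)"
proof -
  interpret Q: category "prod_cat (I - {i}) S" by (rule prod_I)
  interpret Si: sketch "S i" by (rule S[OF i])
  let ?I = "Ide (prod_cat (I - {i}) S) x"
  show ?thesis
  proof (rule is_modelI[OF pslice_data[OF model_data[OF F] i x] Si.category_axioms])
    show "onArr (pslice I S F i x) (Ide (S i) a) = Ide P (onObj (pslice I S F i x) a)" if "a \<in> Obj (S i)" for a
      unfolding pslice_sel upd_Ide_I[OF i] by (rule model_Ide[OF F upd_PiE[OF x that i]])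
    show "onArr (pslice I S F i x) (g \<cdot>\<^bsub>S i\<^esub> f) = onArr (pslice I S F i x) g \<cdot> onArr (pslice I S F i x) f"
      if fg: "f \<in> Arr (S i)" "g \<in> Arr (S i)" "Dom (S i) g = Cod (S i) f" for f g
    proof -
      have "?I(i := g \<cdot>\<^bsub>S i\<^esub> f) = (?I(i := g)) \<cdot>\<^bsub>psk I S\<^esub> (?I(i := f))"
        unfolding upd_Cmp[OF i] using Q.Ide_Cmp[of ?I x] Q.Ide_simps[OF x] by metis
      then show ?thesis
        unfolding pslice_sel
        using model_Cmp[OF F upd_Hom_I(1)[OF Q.Ide_in[OF x] i fg(1)] upd_Hom_I(1)[OF Q.Ide_in[OF x] i fg(2)]]
          upd_Hom_I(2,3)[OF Q.Ide_in[OF x] i] fg by simp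
    qed
    show "fadd (pslice I S F i x) d' \<cdot> (onArr (pslice I S F i x) h \<boxplus> onArr (pslice I S F i x) f) = onArr (pslice I S F i x) g \<cdot> fadd (pslice I S F i x) d"
      if n: "NatR (S i) d d' f g h" for d d' f g h
      unfolding pslice_sel
      by (rule model_nat[OF F, unfolded psk_sel(11), OF pnat.intros[OF i x x Q.Ide_in[OF x] n]])
    show "onArr (pslice I S F i x) g \<cdot> fadd (pslice I S F i x) d'
       = fadd (pslice I S F i x) d \<cdot> symm P (onObj (pslice I S F i x) (pZ (S i) d')) (onObj (pslice I S F i x) (pX (S i) d'))"
      if n: "ComR (S i) d d' g" for d d' g
      unfolding pslice_sel
      using model_com[OF F, unfolded psk_sel(12), OF pcom.intros[OF i x n]] unfolding psk_sel(8-10) .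
    show "onArr (pslice I S F i x) g \<cdot> (fadd (pslice I S F i x) d2 \<cdot> (fadd (pslice I S F i x) d4 \<boxplus> Ide P (onObj (pslice I S F i x) (pX (S i) d1))))
      = fadd (pslice I S F i x) d3 \<cdot> ((Ide P (onObj (pslice I S F i x) (pZ (S i) d3)) \<boxplus> fadd (pslice I S F i x) d1)
         \<cdot> assoc P (onObj (pslice I S F i x) (pZ (S i) d3)) (onObj (pslice I S F i x) (pZ (S i) d1)) (onObj (pslice I S F i x) (pX (S i) d1)))"
      if n: "AssR (S i) d1 d2 d3 d4 g" for d1 d2 d3 d4 g
      unfolding pslice_sel
      using model_ass[OF F, unfolded psk_sel(13), OF pass.intros[OF i x n]] unfolding psk_sel(8-10) .
  qed (use noTwo[OF i] in blast)
qed

text \<open>Relations inside a variable are checked on slices. Beyond these and functoriality, only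
  naturality of each triangle along arrows of the other variables and the two-triangle relation
  remain.\<close>

lemma psk_modelI:
  assumes d: "is_data (psk I S) F"
    and Id: "\<And>a. a \<in> Obj (psk I S) \<Longrightarrow> onArr F (Ide (psk I S) a) = Ide P (onObj F a)"
    and Cm: "\<And>f g. \<lbrakk>f \<in> Arr (psk I S); g \<in> Arr (psk I S); Dom (psk I S) g = Cod (psk I S) f\<rbrakk>
        \<Longrightarrow> onArr F (g \<cdot>\<^bsub>psk I S\<^esub> f) = onArr F g \<cdot> onArr F f"
    and sl: "\<And>i x. \<lbrakk>i \<in> I; x \<in> Obj (prod_cat (I - {i}) S)\<rbrakk> \<Longrightarrow> is_model (S i) (pslice I S F i x)"
    and cross: "\<And>i x x' k d. \<lbrakk>i \<in> I; k \<in> Hom (prod_cat (I - {i}) S) x x'; d \<in> Tr (S i)\<rbrakk> \<Longrightarrow>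
        fadd F (i, x', d) \<cdot> (onArr F (k(i := Ide (S i) (pZ (S i) d))) \<boxplus> onArr F (k(i := Ide (S i) (pX (S i) d))))
        = onArr F (k(i := Ide (S i) (pY (S i) d))) \<cdot> fadd F (i, x, d)"
    and two: "\<And>az ax ay bz bx by. ptwo I S az ax ay bz bx by \<Longrightarrow>
        fadd F by \<cdot> (fadd F az \<boxplus> fadd F ax)
        = fadd F ay \<cdot> ((fadd F bz \<boxplus> fadd F bx)
           \<cdot> coas P (onObj F (pZ (psk I S) az)) (onObj F (pX (psk I S) az)) (onObj F (pZ (psk I S) ax)) (onObj F (pX (psk I S) ax)))"
  shows "is_model (psk I S) F"
proof -
  interpret A: sketch "psk I S" by (rule sketch_psk[OF S])
  note F = data_simps[OF d]
  show ?thesis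
  proof (rule is_modelI[OF d A.category_axioms Id Cm])
    fix d d' f g h assume "NatR (psk I S) d d' f g h"
    then have "pnat I S d d' f g h" by (simp only: psk_sel)
    then show "fadd F d' \<cdot> (onArr F h \<boxplus> onArr F f) = onArr F g \<cdot> fadd F d"
    proof cases
      case (1 i x x' k e e' f' g' h')
      interpret Q: category "prod_cat (I - {i}) S" by (rule prod_I)
      interpret Si: sketch "S i" by (rule S[OF 1(6)])
      note n = Si.NatR_in[OF 1(10), unfolded Hom_def mem_Collect_eq]
      let ?I = "Ide (prod_cat (I - {i}) S) x"
      have kc: "k \<cdot>\<^bsub>prod_cat (I - {i}) S\<^esub> ?I = k"
        using 1(9) unfolding Hom_def by (intro Q.Cmp_Ide) blast+
      \<comment> \<open>An arrow moving the variable \<open>i\<close> by \<open>u\<close> and the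
        others by \<open>k\<close> is made to move \<open>i\<close> first; the two factors fall
        under the slice and under \<open>cross\<close>.\<close>
      have dec: "onArr F (k(i := u)) = onArr F (k(i := Ide (S i) (Cod (S i) u))) \<cdot> onArr F (?I(i := u))"
        and tk: "onArr F (k(i := Ide (S i) (Cod (S i) u))) \<in> Arr P" "Dom P (onArr F (k(i := Ide (S i) (Cod (S i) u)))) = onObj F (x(i := Cod (S i) u))"
           "Cod P (onArr F (k(i := Ide (S i) (Cod (S i) u)))) = onObj F (x'(i := Cod (S i) u))"
        and tI: "onArr F (?I(i := u)) \<in> Arr P" "Dom P (onArr F (?I(i := u))) = onObj F (x(i := Dom (S i) u))" "Cod P (onArr F (?I(i := u))) = onObj F (x(i := Cod (S i) u))"
        if u: "u \<in> Arr (S i)" for u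
      proof -
        have o: "Ide (S i) (Cod (S i) u) \<in> Arr (S i)" using u by simp
        note a = upd_Hom_I[OF 1(9) 1(6) o] and b = upd_Hom_I[OF Q.Ide_in[OF 1(7)] 1(6) u]
        have "k(i := u) = (k(i := Ide (S i) (Cod (S i) u))) \<cdot>\<^bsub>psk I S\<^esub> (?I(i := u))"
          unfolding upd_Cmp[OF 1(6)] kc using u by simp
        then show "onArr F (k(i := u)) = onArr F (k(i := Ide (S i) (Cod (S i) u))) \<cdot> onArr F (?I(i := u))"
          using Cm[OF b(1) a(1)] a(2) b(3) u by simp
        show "onArr F (k(i := Ide (S i) (Cod (S i) u))) \<in> Arr P" "Dom P (onArr F (k(i := Ide (S i) (Cod (S i) u)))) = onObj F (x(i := Cod (S i) u))"
           "Cod P (onArr F (k(i := Ide (S i) (Cod (S i) u)))) = onObj F (x'(i := Cod (S i) u))"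
          using F(2-4)[OF a(1)] a(2,3) u by simp_all
        show "onArr F (?I(i := u)) \<in> Arr P" "Dom P (onArr F (?I(i := u))) = onObj F (x(i := Dom (S i) u))" "Cod P (onArr F (?I(i := u))) = onObj F (x(i := Cod (S i) u))"
          using F(2-4)[OF b(1)] b(2,3) by simp_all
      qed
      have f: "f' \<in> Arr (S i)" "g' \<in> Arr (S i)" "h' \<in> Arr (S i)" "Cod (S i) f' = pX (S i) e'" "Cod (S i) g' = pY (S i) e'" "Cod (S i) h' = pZ (S i) e'"
        "Dom (S i) f' = pX (S i) e" "Dom (S i) g' = pY (S i) e" "Dom (S i) h' = pZ (S i) e"
        using n by auto
      note ad = F(5-7)[OF psk_Tr[OF 1(6,8)], of e', unfolded psk_sel] and ad' = F(5-7)[OF psk_Tr[OF 1(6,7)], of e', unfolded psk_sel]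
        and ad0 = F(5-7)[OF psk_Tr[OF 1(6,7)], of e, unfolded psk_sel]
      have slc: "fadd F (i, x, e') \<cdot> (onArr F (?I(i := h')) \<boxplus> onArr F (?I(i := f'))) = onArr F (?I(i := g')) \<cdot> fadd F (i, x, e)"
        using model_nat[OF sl[OF 1(6,7)] 1(10)] unfolding pslice_sel .
      have cr: "fadd F (i, x', e') \<cdot> (onArr F (k(i := Ide (S i) (pZ (S i) e'))) \<boxplus> onArr F (k(i := Ide (S i) (pX (S i) e'))))
        = onArr F (k(i := Ide (S i) (pY (S i) e'))) \<cdot> fadd F (i, x, e')"
        using cross[OF 1(6,9), of e'] n by blast
      let ?kz = "onArr F (k(i := Ide (S i) (pZ (S i) e')))" and ?kx = "onArr F (k(i := Ide (S i) (pX (S i) e')))"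
        and ?ky = "onArr F (k(i := Ide (S i) (pY (S i) e')))"
      note tks = tk[OF f(1), unfolded f] tk[OF f(2), unfolded f] tk[OF f(3), unfolded f]
      note tIs = tI[OF f(1), unfolded f] tI[OF f(2), unfolded f] tI[OF f(3), unfolded f]
      have "fadd F (i, x', e') \<cdot> (onArr F (k(i := h')) \<boxplus> onArr F (k(i := f')))
         = (fadd F (i, x', e') \<cdot> (?kz \<boxplus> ?kx)) \<cdot> (onArr F (?I(i := h')) \<boxplus> onArr F (?I(i := f')))"
        unfolding dec[OF f(1)] dec[OF f(3)] f(4,6) using tks tIs ad n by (simp add: interchange del: fun_upd_apply prod_cat_sel(5))
      also have "\<dots> = ?ky \<cdot> (fadd F (i, x, e') \<cdot> (onArr F (?I(i := h')) \<boxplus> onArr F (?I(i := f'))))"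
        unfolding cr using tks tIs ad' n by (simp del: fun_upd_apply prod_cat_sel(5))
      also have "\<dots> = onArr F (k(i := g')) \<cdot> fadd F (i, x, e)"
        unfolding slc dec[OF f(2)] f(5) using tks tIs ad0 n by (simp del: fun_upd_apply prod_cat_sel(5))
      finally show ?thesis
        using 1 by (simp only:)
    qed
  next
    fix d d' g assume "ComR (psk I S) d d' g"
    then have "pcom I S d d' g" by (simp only: psk_sel)
    then show "onArr F g \<cdot> fadd F d' = fadd F d \<cdot> symm P (onObj F (pZ (psk I S) d')) (onObj F (pX (psk I S) d'))"
    proof cases
      case (1 i x e e' g')
      show ?thesis
        using model_com[OF sl[OF 1(4,5)] 1(6)] unfolding 1(1-3) pslice_sel psk_sel(8-10) .
    qed
  next
    fix d1 d2 d3 d4 g assume "AssR (psk I S) d1 d2 d3 d4 g"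
    then have "pass I S d1 d2 d3 d4 g" by (simp only: psk_sel)
    then show "onArr F g \<cdot> (fadd F d2 \<cdot> (fadd F d4 \<boxplus> Ide P (onObj F (pX (psk I S) d1))))
      = fadd F d3 \<cdot> ((Ide P (onObj F (pZ (psk I S) d3)) \<boxplus> fadd F d1)
         \<cdot> assoc P (onObj F (pZ (psk I S) d3)) (onObj F (pZ (psk I S) d1)) (onObj F (pX (psk I S) d1)))"
    proof cases
      case (1 i x e1 e2 e3 e4 g')
      show ?thesis
        using model_ass[OF sl[OF 1(6,7)] 1(8)] unfolding 1(1-5) pslice_sel psk_sel(8-10) .
    qed
  next
    fix az ax ay bz bx "by" assume "TwoR (psk I S) az ax ay bz bx by"
    then show "fadd F by \<cdot> (fadd F az \<boxplus> fadd F ax)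
        = fadd F ay \<cdot> ((fadd F bz \<boxplus> fadd F bx)
           \<cdot> coas P (onObj F (pZ (psk I S) az)) (onObj F (pX (psk I S) az)) (onObj F (pZ (psk I S) ax)) (onObj F (pX (psk I S) ax)))"
      by (intro two) (simp only: psk_sel)
  qed
qed

end

end

lemma prod_cat_Tsk: "prod_cat I (\<lambda>i. Tsk (T i)) = prod_cat I (\<lambda>i. isom (T i))"
  by (simp add: prod_cat_def Tsk_def isom_def)

lemma prod_cat_Vsk: "prod_cat I (\<lambda>i. Vsk (V i)) = prod_cat I V"
  by (simp add: prod_cat_def Vsk_def)

lemma prod_cat_Tsk_Obj: "Obj (prod_cat I (\<lambda>i. Tsk (T i))) = Obj (prod_cat I T)"
  "Ide (prod_cat I (\<lambda>i. Tsk (T i))) = Ide (prod_cat I T)"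
  by (simp_all add: fun_eq_iff)

lemma is_functor_psk: "is_functor (psk I S) P F \<longleftrightarrow> is_functor (prod_cat I S) P F"
  by (simp add: is_functor_def)

definition mdmod :: "('o, 'm, 'p, 'q, 'z) mdet_funct_scheme \<Rightarrow> (nat \<Rightarrow> 'o, nat \<Rightarrow> 'm, nat \<times> (nat \<Rightarrow> 'o) \<times> 'm triangle, 'p, 'q) model" where
  "mdmod D = \<lparr>onObj = onObj D, onArr = onArr D, fadd = (\<lambda>(i, x, d). maddD D i x d)\<rparr>"

definition mvmod :: "('v, 'w, 'p, 'q, 'z) mexact_funct_scheme \<Rightarrow> (nat \<Rightarrow> 'v, nat \<Rightarrow> 'w, nat \<times> (nat \<Rightarrow> 'v) \<times> 'v \<times> 'v, 'p, 'q) model" where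
  "mvmod g = \<lparr>onObj = onObj g, onArr = onArr g, fadd = (\<lambda>(i, x, a, b). mtensC g i x a b)\<rparr>"

lemma mdmod_sel [simp]:
  "onObj (mdmod D) = onObj D" "onArr (mdmod D) = onArr D" "fadd (mdmod D) (i, x, d) = maddD D i x d"
  "onObj (mvmod g) = onObj g" "onArr (mvmod g) = onArr g" "fadd (mvmod g) (i, x, a, b) = mtensC g i x a b"
  by (simp_all add: mdmod_def mvmod_def)

section \<open>Multi-determinant functors as models\<close>

context picard_groupoid
begin

lemma inv_comp: "\<lbrakk>f \<in> Arr P; g \<in> Arr P; Dom P g = Cod P f\<rbrakk> \<Longrightarrow> inv_arr P (g \<cdot> f) = inv_arr P f \<cdot> inv_arr P g"
  by (rule inv_unique) simp_all

lemma inv_coas: "\<lbrakk>a \<in> Obj P; b \<in> Obj P; c \<in> Obj P; d \<in> Obj P\<rbrakk> \<Longrightarrow> inv_arr P (coas P a b c d) = coas P a c b d"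
  using coas_coas[of a c b d] by (intro inv_unique) simp_all

text \<open>Multiexactness is written with the splitting maps
  \<open>F (a + b) \<rightarrow> F a + F b\<close>, models with their inverses. Inverting both sides
  passes from one form to the other and exchanges the middle arguments of
  \<open>coas\<close>.\<close>

lemma two_inverse:
  assumes "ac \<in> Obj P" "ad \<in> Obj P" "bc \<in> Obj P" "bd \<in> Obj P"
    "A \<in> Arr P" "Dom P A = ac \<oplus> ad" "B \<in> Arr P" "Dom P B = bc \<oplus> bd" "C \<in> Arr P" "Dom P C = Cod P A \<oplus> Cod P B"
    "D \<in> Arr P" "Dom P D = ac \<oplus> bc" "E \<in> Arr P" "Dom P E = ad \<oplus> bd" "G \<in> Arr P" "Dom P G = Cod P D \<oplus> Cod P E" "Cod P G = Cod P C"
  shows "coas P ac ad bc bd \<cdot> ((inv_arr P A \<boxplus> inv_arr P B) \<cdot> inv_arr P C) = (inv_arr P D \<boxplus> inv_arr P E) \<cdot> inv_arr P G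
    \<longleftrightarrow> G \<cdot> (D \<boxplus> E) = C \<cdot> ((A \<boxplus> B) \<cdot> coas P ac bc ad bd)" (is "?l = ?r \<longleftrightarrow> ?l' = ?r'")
proof -
  have l: "inv_arr P ?l' = ?r" "?l' \<in> Arr P" and r: "inv_arr P ?r' = ?l" "?r' \<in> Arr P"
    using assms by (simp_all add: inv_comp inv_coas)
  show ?thesis
    using l r inv_inv by metis
qed

text \<open>The axioms state the relation for \<open>i < j\<close> only; composing with the inverse
  \<open>coas\<close> provides the other order.\<close>

lemma two_swap:
  assumes "ac \<in> Obj P" "ad \<in> Obj P" "bc \<in> Obj P" "bd \<in> Obj P"
    "A \<in> Arr P" "Dom P A = ac \<oplus> ad" "B \<in> Arr P" "Dom P B = bc \<oplus> bd" "C \<in> Arr P" "Dom P C = Cod P A \<oplus> Cod P B"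
    and eq: "G \<cdot> (D \<boxplus> E) = C \<cdot> ((A \<boxplus> B) \<cdot> coas P ac bc ad bd)"
    and "D \<in> Arr P" "Dom P D = ac \<oplus> bc" "E \<in> Arr P" "Dom P E = ad \<oplus> bd" "G \<in> Arr P" "Dom P G = Cod P D \<oplus> Cod P E"
  shows "C \<cdot> (A \<boxplus> B) = G \<cdot> ((D \<boxplus> E) \<cdot> coas P ac ad bc bd)"
proof -
  have "G \<cdot> ((D \<boxplus> E) \<cdot> coas P ac ad bc bd) = (G \<cdot> (D \<boxplus> E)) \<cdot> coas P ac ad bc bd"
    using assms(1-4,12-) by simp
  also have "\<dots> = C \<cdot> (A \<boxplus> B)"
    unfolding eq using assms(1-10) by simp
  finally show ?thesis ..
qed

lemma mmor_iff:
  assumes "sketch S" "is_data S F" "is_data S G"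
  shows "mmor S F G \<theta> \<longleftrightarrow> (\<forall>a\<in>Obj S. \<theta> a \<in> Hom P (onObj F a) (onObj G a)) \<and>
     (\<forall>f\<in>Arr S. \<theta> (Cod S f) \<cdot> onArr F f = onArr G f \<cdot> \<theta> (Dom S f)) \<and>
     (\<forall>d\<in>Tr S. \<theta> (pY S d) \<cdot> fadd F d = fadd G d \<cdot> (\<theta> (pZ S d) \<boxplus> \<theta> (pX S d)))"
proof -
  interpret A: sketch S by fact
  note F = data_simps[OF assms(2)] and G = data_simps[OF assms(3)]
  let ?O = "\<forall>a\<in>Obj S. \<theta> a \<in> Hom P (onObj F a) (onObj G a)"
  have 2: "sq (\<theta> (Dom S f)) (onArr F f) (onArr G f) (\<theta> (Cod S f)) \<longleftrightarrow>
      \<theta> (Cod S f) \<cdot> onArr F f = onArr G f \<cdot> \<theta> (Dom S f)" if O: ?O and f: "f \<in> Arr S" for f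
    using bspec[OF O A.Obj_simps(1)[OF f]] bspec[OF O A.Obj_simps(2)[OF f]] F(2-4)[OF f] G(2-4)[OF f]
    by (simp add: sq_def)
  have 3: "sq (\<theta> (pZ S d) \<boxplus> \<theta> (pX S d)) (fadd F d) (fadd G d) (\<theta> (pY S d)) \<longleftrightarrow>
      \<theta> (pY S d) \<cdot> fadd F d = fadd G d \<cdot> (\<theta> (pZ S d) \<boxplus> \<theta> (pX S d))" if O: ?O and d: "d \<in> Tr S" for d
    using bspec[OF O A.Tr_Obj(1)[OF d]] bspec[OF O A.Tr_Obj(2)[OF d]] bspec[OF O A.Tr_Obj(3)[OF d]] F(5-7)[OF d] G(5-7)[OF d]
    by (simp add: sq_def)
  show ?thesis
    unfolding mmor_def using 2 3 by blast
qed

lemma nat_trans_iff: "nat_trans C P F G \<theta> \<longleftrightarrow> \<theta> \<in> extensional (Obj C) \<and>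
    (\<forall>a\<in>Obj C. \<theta> a \<in> Hom P (onObj F a) (onObj G a)) \<and>
    (\<forall>f\<in>Arr C. \<theta> (Cod C f) \<cdot> onArr F f = onArr G f \<cdot> \<theta> (Dom C f))"
  by (auto simp: nat_trans_def)

text \<open>The additivity maps of the family are those of its slices, so their typing is inherited
  from there.\<close>

lemma psk_dataI:
  assumes "is_functor (psk I S) P F"
    "\<And>i x. \<lbrakk>i \<in> I; x \<in> Obj (prod_cat (I - {i}) S)\<rbrakk> \<Longrightarrow> is_data (S i) (pslice I S F i x)"
  shows "is_data (psk I S) F"
  unfolding is_data_def
proof (intro conjI ballI)
  show "onObj F a \<in> Obj P" if "a \<in> Obj (psk I S)" for a
    using assms(1) that by (simp add: is_functor_def)
  show "onArr F f \<in> Hom P (onObj F (Dom (psk I S) f)) (onObj F (Cod (psk I S) f))" if "f \<in> Arr (psk I S)" for f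
    using assms(1) that by (simp add: is_functor_def)
  fix d assume td: "d \<in> Tr (psk I S)"
  obtain i x e where d: "d = (i, x, e)" by (cases d)
  have i: "i \<in> I" "x \<in> Obj (prod_cat (I - {i}) S)" "e \<in> Tr (S i)"
    using td by (simp_all add: d)
  show "fadd F d \<in> Hom P (onObj F (pZ (psk I S) d) \<oplus> onObj F (pX (psk I S) d)) (onObj F (pY (psk I S) d))"
    using data_simps(5-7)[OF assms(2)[OF i(1,2)] i(3)] by (simp add: d pslice_sel)
qed

context
  fixes n :: nat and T :: "nat \<Rightarrow> ('a, 'b) tri_cat"
  assumes T: "\<And>i. i \<le> n \<Longrightarrow> triangulated_category (T i)"
begin

abbreviation "Ts \<equiv> \<lambda>i. Tsk (T i)"

lemma sT: "i \<in> {..n} \<Longrightarrow> sketch (Ts i)" and nT: "i \<in> {..n} \<Longrightarrow> \<not> TwoR (Ts i) az ax ay bz bx by"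
  using T by (auto intro: triangulated_category.sketch_Tsk)

lemma pslice_mdmod: "pslice {..n} Ts (mdmod D) i x = dmod (mdet_slice n T D i x)"
  by (simp add: pslice_def dmod_def mdet_slice_def arr_at_def)

text \<open>The triangle-function axiom is the case in which \<open>k\<close> moves a single
  coordinate; the general case follows by pasting squares along
  \<open>prod_arrow_induct\<close>.\<close>

lemma mdet_cross:
  assumes D: "multi_determinant_functor n T P D" and d: "is_data (psk {..n} Ts) (mdmod D)"
    and i: "i \<in> {..n}" and k: "k \<in> Hom (prod_cat ({..n} - {i}) Ts) x x'" and e: "e \<in> Dist (T i)"
  shows "maddD D i x' e \<cdot> (onArr D (k(i := Ide (T i) (tZ (T i) e))) \<boxplus> onArr D (k(i := Ide (T i) (tX (T i) e))))
    = onArr D (k(i := Ide (T i) (tY (T i) e))) \<cdot> maddD D i x e"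
proof -
  interpret Q: category "prod_cat ({..n} - {i}) Ts"
    by (rule category_prod_cat) (use sT sketch.axioms(1) in blast)
  interpret Ti: triangulated_category "T i" by (rule T) (use i in simp)
  interpret Si: sketch "Ts i" by (rule sT[OF i])
  note F = data_simps[OF d, unfolded mdmod_sel]
  have fu: "is_functor (psk {..n} Ts) P D"
    using D unfolding multi_determinant_functor_def is_functor_psk prod_cat_Tsk by blast
  have Cm: "onArr D (g \<cdot>\<^bsub>psk {..n} Ts\<^esub> f) = onArr D g \<cdot> onArr D f"
    if "f \<in> Arr (psk {..n} Ts)" "g \<in> Arr (psk {..n} Ts)" "Dom (psk {..n} Ts) g = Cod (psk {..n} Ts) f" for f g
    using fu that unfolding is_functor_def Hom_def by blast
  have Id: "onArr D (Ide (psk {..n} Ts) a) = Ide P (onObj D a)" if "a \<in> Obj (psk {..n} Ts)" for a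
    using fu that unfolding is_functor_def by blast
  note ob = Ti.Dist_Obj(1-3)[OF e]
  \<comment> \<open>Stated as a square, the property carries the typing that the pasting of
    composites needs.\<close>
  let ?Q = "\<lambda>k. sq (onArr D (k(i := Ide (T i) (tZ (T i) e))) \<boxplus> onArr D (k(i := Ide (T i) (tX (T i) e))))
      (maddD D i (Dom (prod_cat ({..n} - {i}) Ts) k) e) (maddD D i (Cod (prod_cat ({..n} - {i}) Ts) k) e) (onArr D (k(i := Ide (T i) (tY (T i) e))))"
  have Hm: "k \<in> Hom (prod_cat ({..n} - {i}) Ts) (Dom (prod_cat ({..n} - {i}) Ts) k) (Cod (prod_cat ({..n} - {i}) Ts) k)"
    if "k \<in> Arr (prod_cat ({..n} - {i}) Ts)" for k
    using that unfolding Hom_def by blast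
  have A: "k(i := Ide (T i) a) \<in> Arr (psk {..n} Ts)" "Dom (psk {..n} Ts) (k(i := Ide (T i) a)) = (Dom (prod_cat ({..n} - {i}) Ts) k)(i := a)"
    "Cod (psk {..n} Ts) (k(i := Ide (T i) a)) = (Cod (prod_cat ({..n} - {i}) Ts) k)(i := a)"
    if "k \<in> Arr (prod_cat ({..n} - {i}) Ts)" "a \<in> Obj (T i)" for k a
    using upd_Hom_I[OF sT nT Hm[OF that(1)] i, of "Ide (T i) a"] Ti.Ide_simps[OF that(2)] Si.Ide_simps(1)[of a] that(2) by (simp_all del: psk_sel fun_upd_apply prod_cat_sel Hom_def)
  have tr: "(i, y, e) \<in> Tr (psk {..n} Ts)" if "y \<in> Obj (prod_cat ({..n} - {i}) Ts)" for y
    using that i e by simp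
  have mt: "maddD D i y e \<in> Arr P" "Dom P (maddD D i y e) = onObj D (y(i := tZ (T i) e)) \<oplus> onObj D (y(i := tX (T i) e))"
    "Cod P (maddD D i y e) = onObj D (y(i := tY (T i) e))" if "y \<in> Obj (prod_cat ({..n} - {i}) Ts)" for y
    using F(5-7)[OF tr[OF that]] by simp_all
  have "?Q k"
  proof (rule prod_arrow_induct[OF _ _ k, where Q = ?Q])
    show "finite ({..n} - {i})" by simp
    show "category (Ts j)" if "j \<in> {..n} - {i}" for j
      using sT[of j] that sketch.axioms(1) by blast
    show "?Q (Ide (prod_cat ({..n} - {i}) Ts) y)" if y: "y \<in> Obj (prod_cat ({..n} - {i}) Ts)" for y
    proof -
      have I: "onArr D ((Ide (prod_cat ({..n} - {i}) Ts) y)(i := Ide (T i) a)) = Ide P (onObj D (y(i := a)))"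
        and o: "onObj D (y(i := a)) \<in> Obj P" if a: "a \<in> Obj (T i)" for a
      proof -
        have ya: "y(i := a) \<in> Obj (psk {..n} Ts)"
          using y a i by simp
        have "(Ide (prod_cat ({..n} - {i}) Ts) y)(i := Ide (T i) a) = Ide (psk {..n} Ts) (y(i := a))"
          using i by (auto simp: fun_eq_iff)
        then show "onArr D ((Ide (prod_cat ({..n} - {i}) Ts) y)(i := Ide (T i) a)) = Ide P (onObj D (y(i := a)))"
          using Id[OF ya] by simp
        show "onObj D (y(i := a)) \<in> Obj P"
          by (rule F(1)[OF ya])
      qed
      show ?thesis
        unfolding Q.Ide_simps[OF y] I[OF ob(1)] I[OF ob(2)] I[OF ob(3)] sq_def
        using mt[OF y] o[OF ob(1)] o[OF ob(2)] o[OF ob(3)] by simp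
    qed
    show "?Q (g \<cdot>\<^bsub>prod_cat ({..n} - {i}) Ts\<^esub> f)"
      if fg: "f \<in> Arr (prod_cat ({..n} - {i}) Ts)" "g \<in> Arr (prod_cat ({..n} - {i}) Ts)"
        "Dom (prod_cat ({..n} - {i}) Ts) g = Cod (prod_cat ({..n} - {i}) Ts) f" and q: "?Q f" "?Q g" for f g
    proof -
      have c: "onArr D ((g \<cdot>\<^bsub>prod_cat ({..n} - {i}) Ts\<^esub> f)(i := Ide (T i) a)) = onArr D (g(i := Ide (T i) a)) \<cdot> onArr D (f(i := Ide (T i) a))"
        and t: "onArr D (g(i := Ide (T i) a)) \<in> Arr P" "onArr D (f(i := Ide (T i) a)) \<in> Arr P"
          "Dom P (onArr D (g(i := Ide (T i) a))) = Cod P (onArr D (f(i := Ide (T i) a)))"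
        if a: "a \<in> Obj (T i)" for a
      proof -
        have "(g \<cdot>\<^bsub>prod_cat ({..n} - {i}) Ts\<^esub> f)(i := Ide (T i) a) = (g(i := Ide (T i) a)) \<cdot>\<^bsub>psk {..n} Ts\<^esub> (f(i := Ide (T i) a))"
          using i a by (auto simp: fun_eq_iff)
        then show "onArr D ((g \<cdot>\<^bsub>prod_cat ({..n} - {i}) Ts\<^esub> f)(i := Ide (T i) a)) = onArr D (g(i := Ide (T i) a)) \<cdot> onArr D (f(i := Ide (T i) a))"
          using Cm[OF A(1)[OF fg(1) a] A(1)[OF fg(2) a]] A(2)[OF fg(2) a] A(3)[OF fg(1) a] fg(3) by (simp del: psk_sel prod_cat_sel fun_upd_apply)
        show "onArr D (g(i := Ide (T i) a)) \<in> Arr P" "onArr D (f(i := Ide (T i) a)) \<in> Arr P"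
          "Dom P (onArr D (g(i := Ide (T i) a))) = Cod P (onArr D (f(i := Ide (T i) a)))"
          using F(2-4)[OF A(1)[OF fg(1) a]] F(2-4)[OF A(1)[OF fg(2) a]] A(2)[OF fg(2) a] A(3)[OF fg(1) a] fg(3) by (simp_all del: psk_sel prod_cat_sel fun_upd_apply)
      qed
      show ?thesis
        using sq_vert[OF q(1) q(2)[unfolded fg(3)]] interchange[OF t(2,1,2,1,3,3), OF ob(3) ob(3) ob(1) ob(1) ob(3) ob(1)]
        unfolding c[OF ob(1)] c[OF ob(2)] c[OF ob(3)] Q.Cmp_simps[OF fg] by simp
    qed
    fix j y f assume j: "j \<in> {..n} - {i}" and y: "y \<in> Obj (prod_cat ({..n} - {i} - {j}) Ts)" and f: "f \<in> Arr (Ts j)"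
    interpret Sj: sketch "Ts j" by (rule sT) (use j in simp)
    interpret Tj: triangulated_category "T j" by (rule T) (use j in simp)
    let ?k = "(Ide (prod_cat ({..n} - {i} - {j}) Ts) y)(j := f)"
    have f': "iso_arr (T j) f" "f \<in> Arr (T j)" using f Tj.iso_arr_Arr by auto
    have eq: "{..n} - {i} - {j} = {..n} - {j, i}" by auto
    have idi: "iso_arr (T l) (Ide (T l) b)" "Dom (T l) (Ide (T l) b) = b" "Cod (T l) (Ide (T l) b) = b" if "l \<le> n" "b \<in> Obj (T l)" for l b
      using category.Ide_simps[OF sketch.axioms(1)[OF sT], of l b] that by simp_all
    have ka: "?k \<in> Arr (prod_cat ({..n} - {i}) Ts)"
      using j y f idi by (auto simp: PiE_iff extensional_def)
    have kd: "Dom (prod_cat ({..n} - {i}) Ts) ?k = y(j := Dom (T j) f)" "Cod (prod_cat ({..n} - {i}) Ts) ?k = y(j := Cod (T j) f)"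
      using j y f idi by (auto simp: fun_eq_iff PiE_iff extensional_def)
    have ar: "arr_at n T j (y(i := t)) f = ?k(i := Ide (T i) t)" for t
      using i j by (auto simp: arr_at_def fun_eq_iff)
    have "\<forall>i j. i \<noteq> j \<and> i \<le> n \<and> j \<le> n \<longrightarrow>
        (\<forall>x\<in>Obj (prod_cat ({..n} - {i, j}) T). \<forall>a b. \<forall>f\<in>Hom (isom (T i)) a b. \<forall>\<Delta>\<in>Dist (T j).
           (let Df = (\<lambda>t. onArr D (arr_at n T i (x(j := t)) f))
            in Df (tY (T j) \<Delta>) \<cdot> maddD D j (x(i := a)) \<Delta>
               = maddD D j (x(i := b)) \<Delta> \<cdot> (Df (tZ (T j) \<Delta>) \<boxplus> Df (tX (T j) \<Delta>))))"
      by (rule conjunct2[OF conjunct2[OF conjunct2[OF D[unfolded multi_determinant_functor_def]]]])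
    note tf = this[THEN spec, of j, THEN spec, of i, THEN mp]
    have "y \<in> Obj (prod_cat ({..n} - {j, i}) T)"
      using y unfolding eq prod_cat_Tsk_Obj .
    moreover have "f \<in> Hom (isom (T j)) (Dom (T j) f) (Cod (T j) f)"
      using f' by (simp add: isom_def)
    ultimately have *: "onArr D (?k(i := Ide (T i) (tY (T i) e))) \<cdot> maddD D i (y(j := Dom (T j) f)) e
      = maddD D i (y(j := Cod (T j) f)) e \<cdot> (onArr D (?k(i := Ide (T i) (tZ (T i) e))) \<boxplus> onArr D (?k(i := Ide (T i) (tX (T i) e))))"
      using tf[THEN bspec, THEN spec, THEN spec, THEN bspec, THEN bspec, of y f _ _ e] i j e unfolding Let_def ar by blast
    have dm: "y(j := Dom (T j) f) \<in> Obj (prod_cat ({..n} - {i}) Ts)" "y(j := Cod (T j) f) \<in> Obj (prod_cat ({..n} - {i}) Ts)"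
      using Q.Obj_simps[OF ka] unfolding kd by blast+
    show "?Q ?k"
      unfolding sq_def kd using * mt[OF dm(1)] mt[OF dm(2)] F(2-4)[OF A(1)[OF ka ob(1)]] F(2-4)[OF A(1)[OF ka ob(2)]] F(2-4)[OF A(1)[OF ka ob(3)]]
        A(2,3)[OF ka ob(1), unfolded kd] A(2,3)[OF ka ob(2), unfolded kd] A(2,3)[OF ka ob(3), unfolded kd]
      by (simp del: fun_upd_apply psk_sel prod_cat_sel)
  qed
  moreover have "Dom (prod_cat ({..n} - {i}) Ts) k = x" "Cod (prod_cat ({..n} - {i}) Ts) k = x'"
    using k unfolding Hom_def by blast+
  ultimately show ?thesis
    by (simp add: sq_def del: prod_cat_sel)
qed

lemma mdet_model:
  assumes D: "multi_determinant_functor n T P D"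
  shows "is_model (psk {..n} Ts) (mdmod D)"
proof -
  have fu: "is_functor (psk {..n} Ts) P D"
    using D unfolding multi_determinant_functor_def is_functor_psk prod_cat_Tsk by blast
  have sl: "is_model (Ts i) (pslice {..n} Ts (mdmod D) i x)" if "i \<in> {..n}" "x \<in> Obj (prod_cat ({..n} - {i}) Ts)" for i x
  proof -
    have "determinant_functor (T i) P (mdet_slice n T D i x)"
      using D that unfolding multi_determinant_functor_def prod_cat_Tsk_Obj by auto
    then show ?thesis
      unfolding pslice_mdmod using determinant_iff[OF T[of i]] that(1) by blast
  qed
  have d: "is_data (psk {..n} Ts) (mdmod D)"
    by (rule psk_dataI[OF _ model_data[OF sl]]) (use fu in \<open>simp_all add: is_functor_def\<close>)
  note F = data_simps[OF d]
  have two: "\<forall>i j. i < j \<and> j \<le> n \<longrightarrow>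
        (\<forall>x\<in>Obj (prod_cat ({..n} - {i, j}) T). \<forall>\<Delta>\<^sub>i\<in>Dist (T i). \<forall>\<Delta>\<^sub>j\<in>Dist (T j).
           (let x\<^sub>i = tX (T i) \<Delta>\<^sub>i; y\<^sub>i = tY (T i) \<Delta>\<^sub>i; z\<^sub>i = tZ (T i) \<Delta>\<^sub>i;
                x\<^sub>j = tX (T j) \<Delta>\<^sub>j; y\<^sub>j = tY (T j) \<Delta>\<^sub>j; z\<^sub>j = tZ (T j) \<Delta>\<^sub>j;
                Do = (\<lambda>s t. onObj D (x(i := s, j := t)));
                D\<^sub>i = (\<lambda>t. maddD D i (x(j := t)) \<Delta>\<^sub>i);
                D\<^sub>j = (\<lambda>s. maddD D j (x(i := s)) \<Delta>\<^sub>j)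
            in D\<^sub>j y\<^sub>i \<cdot> (D\<^sub>i z\<^sub>j \<boxplus> D\<^sub>i x\<^sub>j)
               = D\<^sub>i y\<^sub>j \<cdot> ((D\<^sub>j z\<^sub>i \<boxplus> D\<^sub>j x\<^sub>i) \<cdot> coas P (Do z\<^sub>i z\<^sub>j) (Do x\<^sub>i z\<^sub>j) (Do z\<^sub>i x\<^sub>j) (Do x\<^sub>i x\<^sub>j))))"
    using D unfolding multi_determinant_functor_def by blast
  interpret A: sketch "psk {..n} Ts" by (rule sketch_psk[OF sT])
  show ?thesis
  proof (rule psk_modelI[OF sT nT d])
    show "onArr (mdmod D) (Ide (psk {..n} Ts) a) = Ide P (onObj (mdmod D) a)" if "a \<in> Obj (psk {..n} Ts)" for a
      using fu that unfolding is_functor_def mdmod_sel by blast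
    show "onArr (mdmod D) (g \<cdot>\<^bsub>psk {..n} Ts\<^esub> f) = onArr (mdmod D) g \<cdot> onArr (mdmod D) f"
      if "f \<in> Arr (psk {..n} Ts)" "g \<in> Arr (psk {..n} Ts)" "Dom (psk {..n} Ts) g = Cod (psk {..n} Ts) f" for f g
      using fu that unfolding is_functor_def Hom_def mdmod_sel by blast
    show "is_model (Ts i) (pslice {..n} Ts (mdmod D) i x)" if "i \<in> {..n}" "x \<in> Obj (prod_cat ({..n} - {i}) Ts)" for i x
      by (rule sl[OF that])
    show "fadd (mdmod D) (i, x', e) \<cdot> (onArr (mdmod D) (k(i := Ide (Ts i) (pZ (Ts i) e))) \<boxplus> onArr (mdmod D) (k(i := Ide (Ts i) (pX (Ts i) e))))
        = onArr (mdmod D) (k(i := Ide (Ts i) (pY (Ts i) e))) \<cdot> fadd (mdmod D) (i, x, e)"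
      if "i \<in> {..n}" "k \<in> Hom (prod_cat ({..n} - {i}) Ts) x x'" "e \<in> Tr (Ts i)" for i x x' k e
      using mdet_cross[OF D d that(1,2)] that(3) unfolding mdmod_sel Tsk_sel .
  next
    fix az ax ay bz bx "by" assume p: "ptwo {..n} Ts az ax ay bz bx by"
    have t: "TwoR (psk {..n} Ts) az ax ay bz bx by" using p by (simp only: psk_sel)
    note t = A.TwoR_in[OF t]
    show "fadd (mdmod D) by \<cdot> (fadd (mdmod D) az \<boxplus> fadd (mdmod D) ax)
        = fadd (mdmod D) ay \<cdot> ((fadd (mdmod D) bz \<boxplus> fadd (mdmod D) bx)
           \<cdot> coas P (onObj (mdmod D) (pZ (psk {..n} Ts) az)) (onObj (mdmod D) (pX (psk {..n} Ts) az)) (onObj (mdmod D) (pZ (psk {..n} Ts) ax)) (onObj (mdmod D) (pX (psk {..n} Ts) ax)))"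
      using p
    proof cases
      case (1 i j x u v)
      show ?thesis
      proof (cases "i < j")
        case True
        have x: "x \<in> Obj (prod_cat ({..n} - {i, j}) T)"
          using 1(10) unfolding prod_cat_Tsk_Obj .
        show ?thesis
          using two[rule_format, OF _ x, of u v] True 1 unfolding Let_def
          by (simp add: fun_upd_twist[of j i] del: fun_upd_apply)
      next
        case False
        \<comment> \<open>The axiom is available for the pair in increasing order;
          \<open>two_swap\<close> reverses the resulting equation.\<close>
        then have ji: "j < i" using 1 by simp
        have x: "x \<in> Obj (prod_cat ({..n} - {j, i}) T)"
          using 1(10) unfolding prod_cat_Tsk_Obj by (simp add: insert_commute)
        have tr: "az \<in> Tr (psk {..n} Ts)" "ax \<in> Tr (psk {..n} Ts)" "ay \<in> Tr (psk {..n} Ts)" "bz \<in> Tr (psk {..n} Ts)" "bx \<in> Tr (psk {..n} Ts)" "by \<in> Tr (psk {..n} Ts)"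
          using t by simp_all
        have eq: "fadd (mdmod D) ay \<cdot> (fadd (mdmod D) bz \<boxplus> fadd (mdmod D) bx) = fadd (mdmod D) by \<cdot> ((fadd (mdmod D) az \<boxplus> fadd (mdmod D) ax)
           \<cdot> coas P (onObj (mdmod D) (pZ (psk {..n} Ts) az)) (onObj (mdmod D) (pZ (psk {..n} Ts) ax)) (onObj (mdmod D) (pX (psk {..n} Ts) az)) (onObj (mdmod D) (pX (psk {..n} Ts) ax)))"
          using two[rule_format, OF _ x, of v u] ji 1 unfolding Let_def
          by (simp add: fun_upd_twist[of i j] del: fun_upd_apply)
        show ?thesis
          by (rule two_swap[OF _ _ _ _ _ _ _ _ _ _ eq]) (use t tr F A.Tr_Obj in \<open>simp_all del: psk_sel mdmod_sel\<close>)
      qed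
    qed
  qed
qed

lemma mdet_morphism_iff:
  assumes "is_data (psk {..n} Ts) (mdmod D1)" "is_data (psk {..n} Ts) (mdmod D2)"
  shows "mdet_morphism n T P D1 D2 \<theta> \<longleftrightarrow> \<theta> \<in> extensional (Obj (prod_cat {..n} T)) \<and> mmor (psk {..n} Ts) (mdmod D1) (mdmod D2) \<theta>"
proof -
  have 1: "nat_trans (prod_cat {..n} (\<lambda>i. isom (T i))) P D1 D2 \<theta> \<longleftrightarrow> \<theta> \<in> extensional (Obj (prod_cat {..n} T)) \<and>
     (\<forall>a\<in>Obj (psk {..n} Ts). \<theta> a \<in> Hom P (onObj D1 a) (onObj D2 a)) \<and>
     (\<forall>f\<in>Arr (psk {..n} Ts). \<theta> (Cod (psk {..n} Ts) f) \<cdot> onArr D1 f = onArr D2 f \<cdot> \<theta> (Dom (psk {..n} Ts) f))"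
    unfolding prod_cat_Tsk[symmetric] nat_trans_iff prod_cat_Tsk_Obj(1)[symmetric] by simp
  have 2: "(\<forall>i\<le>n. \<forall>x\<in>Obj (prod_cat ({..n} - {i}) T). \<forall>\<Delta>\<in>Dist (T i).
        \<theta> (x(i := tY (T i) \<Delta>)) \<cdot> maddD D1 i x \<Delta> = maddD D2 i x \<Delta> \<cdot> (\<theta> (x(i := tZ (T i) \<Delta>)) \<boxplus> \<theta> (x(i := tX (T i) \<Delta>)))) \<longleftrightarrow>
     (\<forall>d\<in>Tr (psk {..n} Ts). \<theta> (pY (psk {..n} Ts) d) \<cdot> fadd (mdmod D1) d = fadd (mdmod D2) d \<cdot> (\<theta> (pZ (psk {..n} Ts) d) \<boxplus> \<theta> (pX (psk {..n} Ts) d)))"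
    by (auto simp: psk_def)
  have S: "sketch (psk {..n} Ts)" by (rule sketch_psk[OF sT])
  show ?thesis
    unfolding mdet_morphism_def 1 2 mmor_iff[OF S assms] mdmod_sel by blast
qed

end

end

lemma prod_cat_Vsk_Obj: "Obj (prod_cat I (\<lambda>i. Vsk (V i))) = Obj (prod_cat I V)"
  by (simp add: prod_cat_Vsk)

section \<open>Multiexact functors as models\<close>

context picard_groupoid
begin

lemma is_functor_model:
  assumes "is_model S F"
  shows "is_functor S P F"
  using assms by (auto simp: is_model_def)

definition unit_for :: "('v, 'w) mon_cat \<Rightarrow> ('v, 'w, 'v \<times> 'v, 'o, 'm) model \<Rightarrow> 'm \<Rightarrow> bool" where
  "unit_for W F u \<longleftrightarrow> u \<in> Hom P (unitO P) (onObj F (unitO W)) \<and> (\<forall>b\<in>Obj W.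
     lam W F b \<cdot> (u \<boxplus> Ide P (onObj F b)) = lunit P (onObj F b) \<and> rho W F b \<cdot> (Ide P (onObj F b) \<boxplus> u) = runit P (onObj F b))"

context
  fixes n :: nat and V :: "nat \<Rightarrow> ('v, 'w) mon_cat"
  assumes V: "\<And>i. i \<le> n \<Longrightarrow> picard_groupoid (V i)"
begin

abbreviation "Vs \<equiv> \<lambda>i. Vsk (V i)"

lemma sV: "i \<in> {..n} \<Longrightarrow> sketch (Vs i)" and nV: "i \<in> {..n} \<Longrightarrow> \<not> TwoR (Vs i) az ax ay bz bx by"
  using V by (auto intro: picard_groupoid.sketch_Vsk)

lemma upd_Hom_V:
  assumes "k \<in> Hom (prod_cat ({..n} - {i}) Vs) x x'" "i \<in> {..n}" "f \<in> Arr (Vs i)"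
  shows "k(i := f) \<in> Arr (psk {..n} Vs)" "Dom (psk {..n} Vs) (k(i := f)) = x(i := Dom (Vs i) f)" "Cod (psk {..n} Vs) (k(i := f)) = x'(i := Cod (Vs i) f)"
  by (rule upd_Hom_I[OF sV nV assms]; assumption)+

lemma pslice_mvmod: "pslice {..n} Vs (mvmod g) i x = vmod (mexact_slice n V g i x)"
  by (auto simp: pslice_def vmod_def mexact_slice_def arr_at_def prod_cat_Vsk fun_eq_iff)

lemma mexact_two_iff:
  assumes d: "is_data (psk {..n} Vs) F"
    and ij: "i \<noteq> j" "i \<le> n" "j \<le> n" and x: "x \<in> Obj (prod_cat ({..n} - {i, j}) Vs)"
    and ab: "a \<in> Obj (V i)" "b \<in> Obj (V i)" and cd: "c \<in> Obj (V j)" "e \<in> Obj (V j)"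
  shows "coas P (onObj F (x(i := a, j := c))) (onObj F (x(i := a, j := e))) (onObj F (x(i := b, j := c))) (onObj F (x(i := b, j := e)))
      \<cdot> ((inv_arr P (fadd F (j, x(i := a), c, e)) \<boxplus> inv_arr P (fadd F (j, x(i := b), c, e))) \<cdot> inv_arr P (fadd F (i, x(j := c \<oplus>\<^bsub>V j\<^esub> e), a, b)))
     = (inv_arr P (fadd F (i, x(j := c), a, b)) \<boxplus> inv_arr P (fadd F (i, x(j := e), a, b))) \<cdot> inv_arr P (fadd F (j, x(i := a \<oplus>\<^bsub>V i\<^esub> b), c, e))
   \<longleftrightarrow> fadd F (j, x(i := a \<oplus>\<^bsub>V i\<^esub> b), c, e) \<cdot> (fadd F (i, x(j := c), a, b) \<boxplus> fadd F (i, x(j := e), a, b))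
     = fadd F (i, x(j := c \<oplus>\<^bsub>V j\<^esub> e), a, b) \<cdot> ((fadd F (j, x(i := a), c, e) \<boxplus> fadd F (j, x(i := b), c, e))
       \<cdot> coas P (onObj F (x(i := a, j := c))) (onObj F (x(i := b, j := c))) (onObj F (x(i := a, j := e))) (onObj F (x(i := b, j := e))))"
proof -
  interpret A: sketch "psk {..n} Vs" by (rule sketch_psk[OF sV])
  note F = data_simps[OF d]
  \<comment> \<open>The relation supplies the vertices of the six triangles involved.\<close>
  have t: "TwoR (psk {..n} Vs) (i, x(j := c), a, b) (i, x(j := e), a, b) (i, x(j := c \<oplus>\<^bsub>V j\<^esub> e), a, b)
      (j, x(i := a), c, e) (j, x(i := b), c, e) (j, x(i := a \<oplus>\<^bsub>V i\<^esub> b), c, e)"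
    using ptwo.intros[of i "{..n}" j x Vs "(a, b)" "(c, e)"] ij x ab cd by (simp del: fun_upd_apply prod_cat_sel)
  note t = A.TwoR_in[OF t]
  have tr: "(i, x(j := c), a, b) \<in> Tr (psk {..n} Vs)" "(i, x(j := e), a, b) \<in> Tr (psk {..n} Vs)"
    "(i, x(j := c \<oplus>\<^bsub>V j\<^esub> e), a, b) \<in> Tr (psk {..n} Vs)" "(j, x(i := a), c, e) \<in> Tr (psk {..n} Vs)"
    "(j, x(i := b), c, e) \<in> Tr (psk {..n} Vs)" "(j, x(i := a \<oplus>\<^bsub>V i\<^esub> b), c, e) \<in> Tr (psk {..n} Vs)"
    using t by simp_all
  have tw: "x(j := q, i := p) = x(i := p, j := q)" for p q
    using ij(1) by (simp add: fun_upd_twist)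
  note Ft = F(5-7)[OF tr(1)] F(5-7)[OF tr(2)] F(5-7)[OF tr(3)] F(5-7)[OF tr(4)] F(5-7)[OF tr(5)] F(5-7)[OF tr(6)]
  note Fo = F(1)[OF A.Tr_Obj(1)[OF tr(4)]] F(1)[OF A.Tr_Obj(3)[OF tr(4)]] F(1)[OF A.Tr_Obj(1)[OF tr(5)]] F(1)[OF A.Tr_Obj(3)[OF tr(5)]]
  note all = Ft[unfolded psk_sel(8-10) Vsk_sel tw] Fo[unfolded psk_sel(8-10) Vsk_sel tw]
  show ?thesis
    by (rule two_inverse) (use all in \<open>simp_all del: fun_upd_apply\<close>)
qed

lemma multiexact_model:
  assumes g: "multiexact n V P g"
  shows "is_model (psk {..n} Vs) (mvmod g)"
proof -
  have fu: "is_functor (psk {..n} Vs) P g"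
    using g unfolding multiexact_def is_functor_psk prod_cat_Vsk by blast
  have sl: "is_model (Vs i) (pslice {..n} Vs (mvmod g) i x)" if "i \<in> {..n}" "x \<in> Obj (prod_cat ({..n} - {i}) Vs)" for i x
  proof -
    have "symmetric_monoidal_functor (V i) P (mexact_slice n V g i x)"
      using g that unfolding multiexact_def prod_cat_Vsk_Obj by auto
    then show ?thesis
      unfolding pslice_mvmod using vmod_model V[of i] that(1) by blast
  qed
  have d: "is_data (psk {..n} Vs) (mvmod g)"
    by (rule psk_dataI[OF _ model_data[OF sl]]) (use fu in \<open>simp_all add: is_functor_def\<close>)
  note F = data_simps[OF d]
  interpret A: sketch "psk {..n} Vs" by (rule sketch_psk[OF sV])
  have two: "fadd (mvmod g) (j, x(i := a \<oplus>\<^bsub>V i\<^esub> b), c, e) \<cdot> (fadd (mvmod g) (i, x(j := c), a, b) \<boxplus> fadd (mvmod g) (i, x(j := e), a, b))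
     = fadd (mvmod g) (i, x(j := c \<oplus>\<^bsub>V j\<^esub> e), a, b) \<cdot> ((fadd (mvmod g) (j, x(i := a), c, e) \<boxplus> fadd (mvmod g) (j, x(i := b), c, e))
       \<cdot> coas P (onObj (mvmod g) (x(i := a, j := c))) (onObj (mvmod g) (x(i := b, j := c))) (onObj (mvmod g) (x(i := a, j := e))) (onObj (mvmod g) (x(i := b, j := e))))"
    if ij: "i < j" "j \<le> n" and x: "x \<in> Obj (prod_cat ({..n} - {i, j}) Vs)"
      and ab: "a \<in> Obj (V i)" "b \<in> Obj (V i)" "c \<in> Obj (V j)" "e \<in> Obj (V j)" for i j x a b c e
  proof -
    note l = conjunct2[OF conjunct2[OF conjunct2[OF conjunct2[OF g[unfolded multiexact_def]]]], THEN spec, THEN spec, THEN mp, OF conjI[OF ij],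
      folded prod_cat_Vsk_Obj, THEN bspec, OF x, THEN bspec, OF ab(1), THEN bspec, OF ab(2), THEN bspec, OF ab(3), THEN bspec, OF ab(4), unfolded Let_def]
    have "i \<noteq> j" "i \<le> n" using ij by simp_all
    from mexact_two_iff[OF d this ij(2) x ab, THEN iffD1, unfolded mdmod_sel, OF l] show ?thesis
      unfolding mdmod_sel .
  qed
  show ?thesis
  proof (rule psk_modelI[OF sV nV d])
    show "onArr (mvmod g) (Ide (psk {..n} Vs) a) = Ide P (onObj (mvmod g) a)" if "a \<in> Obj (psk {..n} Vs)" for a
      using fu that unfolding is_functor_def mdmod_sel by blast
    show "onArr (mvmod g) (k \<cdot>\<^bsub>psk {..n} Vs\<^esub> f) = onArr (mvmod g) k \<cdot> onArr (mvmod g) f"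
      if "f \<in> Arr (psk {..n} Vs)" "k \<in> Arr (psk {..n} Vs)" "Dom (psk {..n} Vs) k = Cod (psk {..n} Vs) f" for f k
      using fu that unfolding is_functor_def Hom_def mdmod_sel by blast
    show "is_model (Vs i) (pslice {..n} Vs (mvmod g) i x)" if "i \<in> {..n}" "x \<in> Obj (prod_cat ({..n} - {i}) Vs)" for i x
      by (rule sl[OF that])
    show "fadd (mvmod g) (i, x', u) \<cdot> (onArr (mvmod g) (k(i := Ide (Vs i) (pZ (Vs i) u))) \<boxplus> onArr (mvmod g) (k(i := Ide (Vs i) (pX (Vs i) u))))
        = onArr (mvmod g) (k(i := Ide (Vs i) (pY (Vs i) u))) \<cdot> fadd (mvmod g) (i, x, u)"
      if i: "i \<in> {..n}" and k: "k \<in> Hom (prod_cat ({..n} - {i}) Vs) x x'" and u: "u \<in> Tr (Vs i)" for i x x' k u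
    proof -
      obtain a b where ab: "u = (a, b)" "a \<in> Obj (V i)" "b \<in> Obj (V i)" using u by (cases u) auto
      have i': "i \<le> n" using i by simp
      show ?thesis
        unfolding ab(1) mdmod_sel Vsk_sel
        by (rule conjunct1[OF conjunct2[OF conjunct2[OF g[unfolded multiexact_def]]], THEN spec, THEN mp, OF i', THEN spec, THEN spec,
            THEN bspec, OF k[unfolded prod_cat_Vsk], THEN bspec, OF ab(2), THEN bspec, OF ab(3)])
    qed
  next
    fix az ax ay bz bx "by" assume p: "ptwo {..n} Vs az ax ay bz bx by"
    have t: "TwoR (psk {..n} Vs) az ax ay bz bx by" using p by (simp only: psk_sel)
    note t = A.TwoR_in[OF t]
    show "fadd (mvmod g) by \<cdot> (fadd (mvmod g) az \<boxplus> fadd (mvmod g) ax)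
        = fadd (mvmod g) ay \<cdot> ((fadd (mvmod g) bz \<boxplus> fadd (mvmod g) bx)
           \<cdot> coas P (onObj (mvmod g) (pZ (psk {..n} Vs) az)) (onObj (mvmod g) (pX (psk {..n} Vs) az)) (onObj (mvmod g) (pZ (psk {..n} Vs) ax)) (onObj (mvmod g) (pX (psk {..n} Vs) ax)))"
      using p
    proof cases
      case (1 i j x u v)
      obtain a b c e where uv: "u = (a, b)" "v = (c, e)" by (cases u, cases v) auto
      have ab: "a \<in> Obj (V i)" "b \<in> Obj (V i)" "c \<in> Obj (V j)" "e \<in> Obj (V j)"
        using 1(11,12) by (simp_all add: uv)
      have tw: "x(j := q, i := p) = x(i := p, j := q)" for p q
        using 1(9) by (simp add: fun_upd_twist)
      show ?thesis
      proof (cases "i < j")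
        case True
        have "j \<le> n" using 1(8) by simp
        from two[OF True this 1(10) ab] show ?thesis
          unfolding 1(1-6) uv psk_sel(8-10) Vsk_sel tw .
      next
        case False
        then have ji: "j < i" "i \<le> n" using 1 by simp_all
        have x: "x \<in> Obj (prod_cat ({..n} - {j, i}) Vs)"
          using 1(10) by (simp only: insert_commute)
        have tr: "az \<in> Tr (psk {..n} Vs)" "ax \<in> Tr (psk {..n} Vs)" "ay \<in> Tr (psk {..n} Vs)" "bz \<in> Tr (psk {..n} Vs)" "bx \<in> Tr (psk {..n} Vs)" "by \<in> Tr (psk {..n} Vs)"
          using t by simp_all
        have eq: "fadd (mvmod g) ay \<cdot> (fadd (mvmod g) bz \<boxplus> fadd (mvmod g) bx) = fadd (mvmod g) by \<cdot> ((fadd (mvmod g) az \<boxplus> fadd (mvmod g) ax)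
           \<cdot> coas P (onObj (mvmod g) (pZ (psk {..n} Vs) az)) (onObj (mvmod g) (pZ (psk {..n} Vs) ax)) (onObj (mvmod g) (pX (psk {..n} Vs) az)) (onObj (mvmod g) (pX (psk {..n} Vs) ax)))"
          using two[OF ji x ab(3,4,1,2)] unfolding 1(1-6) uv psk_sel(8-10) Vsk_sel tw .
        show ?thesis
          by (rule two_swap[OF _ _ _ _ _ _ _ _ _ _ eq]) (use t tr F A.Tr_Obj in \<open>simp_all del: psk_sel mdmod_sel\<close>)
      qed
    qed
  qed
qed

text \<open>Unit constraints are chosen independently for each variable and each value of the
  others. They exist by \<open>unit_exists\<close> and are unique, so the choices fit
  together.\<close>

definition mexact_of :: "(nat \<Rightarrow> 'v, nat \<Rightarrow> 'w, nat \<times> (nat \<Rightarrow> 'v) \<times> 'v \<times> 'v, 'o, 'm) model \<Rightarrow> ('v, 'w, 'o, 'm) mexact_funct" where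
  "mexact_of G = \<lparr>onObj = onObj G, onArr = onArr G, mtensC = (\<lambda>i x a b. fadd G (i, x, a, b)),
     munitC = (\<lambda>i x. SOME u. unit_for (V i) (pslice {..n} Vs G i x) u)\<rparr>"

lemma mvmod_mexact_of [simp]: "mvmod (mexact_of G) = G"
  by (cases G) (simp add: mvmod_def mexact_of_def)

lemma mexact_of_multiexact:
  assumes G: "is_model (psk {..n} Vs) G"
  shows "multiexact n V P (mexact_of G)"
proof -
  interpret A: sketch "psk {..n} Vs" by (rule sketch_psk[OF sV])
  let ?g = "mexact_of G"
  have s: "onObj ?g = onObj G" "onArr ?g = onArr G" "mtensC ?g i x a b = fadd G (i, x, a, b)" for i x a b
    by (simp_all add: mexact_of_def)
  have slm: "is_model (Vs i) (pslice {..n} Vs G i x)" if "i \<le> n" "x \<in> Obj (prod_cat ({..n} - {i}) Vs)" for i x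
    by (rule pslice_model[OF sV nV G]) (use that in simp_all)
  have u: "munitC ?g i x \<in> Hom P (unitO P) (onObj G (x(i := unitO (V i))))" 
      "b \<in> Obj (V i) \<Longrightarrow> lam (V i) (pslice {..n} Vs G i x) b \<cdot> (munitC ?g i x \<boxplus> Ide P (onObj (pslice {..n} Vs G i x) b)) = lunit P (onObj (pslice {..n} Vs G i x) b)"
      "b \<in> Obj (V i) \<Longrightarrow> rho (V i) (pslice {..n} Vs G i x) b \<cdot> (Ide P (onObj (pslice {..n} Vs G i x) b) \<boxplus> munitC ?g i x) = runit P (onObj (pslice {..n} Vs G i x) b)"
    if i: "i \<le> n" "x \<in> Obj (prod_cat ({..n} - {i}) Vs)" for i x b
  proof -
    have "\<exists>u. unit_for (V i) (pslice {..n} Vs G i x) u"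
      using unit_exists[OF V slm, OF i(1) i] unfolding unit_for_def by blast
    then have "unit_for (V i) (pslice {..n} Vs G i x) (SOME u. unit_for (V i) (pslice {..n} Vs G i x) u)" by (rule someI_ex)
    moreover have "munitC ?g i x = (SOME u. unit_for (V i) (pslice {..n} Vs G i x) u)" by (simp add: mexact_of_def)
    ultimately have q: "unit_for (V i) (pslice {..n} Vs G i x) (munitC ?g i x)" by simp
    show "munitC ?g i x \<in> Hom P (unitO P) (onObj G (x(i := unitO (V i))))"
      using q unfolding unit_for_def pslice_sel by blast
    show "b \<in> Obj (V i) \<Longrightarrow> lam (V i) (pslice {..n} Vs G i x) b \<cdot> (munitC ?g i x \<boxplus> Ide P (onObj (pslice {..n} Vs G i x) b)) = lunit P (onObj (pslice {..n} Vs G i x) b)"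
      "b \<in> Obj (V i) \<Longrightarrow> rho (V i) (pslice {..n} Vs G i x) b \<cdot> (Ide P (onObj (pslice {..n} Vs G i x) b) \<boxplus> munitC ?g i x) = runit P (onObj (pslice {..n} Vs G i x) b)"
      using q unfolding unit_for_def by blast+
  qed
  have ten: "fadd G (i, x', a, b) \<cdot> (onArr G (h(i := Ide (V i) a)) \<boxplus> onArr G (h(i := Ide (V i) b)))
        = onArr G (h(i := Ide (V i) (a \<oplus>\<^bsub>V i\<^esub> b))) \<cdot> fadd G (i, x, a, b)"
    if i: "i \<le> n" and h: "h \<in> Hom (prod_cat ({..n} - {i}) Vs) x x'" and ab: "a \<in> Obj (V i)" "b \<in> Obj (V i)" for i x x' h a b
  proof -
    interpret Vi: picard_groupoid "V i" by (rule V[OF i])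
    interpret Q: category "prod_cat ({..n} - {i}) Vs"
      by (rule category_prod_cat) (use sV sketch.axioms(1) in blast)
    have x: "x \<in> Obj (prod_cat ({..n} - {i}) Vs)" "x' \<in> Obj (prod_cat ({..n} - {i}) Vs)"
      using h Q.Obj_simps unfolding Hom_def by blast+
    have i': "i \<in> {..n}" using i by simp
    have "NatR (Vs i) (a, b) (a, b) (Ide (V i) b) (Ide (V i) (a \<oplus>\<^bsub>V i\<^esub> b)) (Ide (V i) a)"
      using ab by (simp add: Vi.tensA_Ide)
    from model_nat[OF G, unfolded psk_sel(11), OF pnat.intros[OF i' x h this]] show ?thesis .
  qed
  \<comment> \<open>The arrow \<open>h\<close> induces a morphism between two slices; by
    \<open>mmor_unit\<close> it carries the chosen unit constraint of one to that of the
    other.\<close>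
  have unt: "munitC ?g i x' = onArr G (h(i := Ide (V i) (unitO (V i)))) \<cdot> munitC ?g i x"
    if i: "i \<le> n" and h: "h \<in> Hom (prod_cat ({..n} - {i}) Vs) x x'" for i x x' h
  proof -
    interpret Vi: picard_groupoid "V i" by (rule V[OF i])
    interpret Si: sketch "Vs i" by (rule Vi.sketch_Vsk)
    interpret Q: category "prod_cat ({..n} - {i}) Vs"
      by (rule category_prod_cat) (use sV sketch.axioms(1) in blast)
    have i': "i \<in> {..n}" using i by simp
    have x: "x \<in> Obj (prod_cat ({..n} - {i}) Vs)" "x' \<in> Obj (prod_cat ({..n} - {i}) Vs)"
      using h Q.Obj_simps unfolding Hom_def by blast+
    note sx = slm[OF i x(1)] and sx' = slm[OF i x(2)]
    have hc: "h \<cdot>\<^bsub>prod_cat ({..n} - {i}) Vs\<^esub> Ide (prod_cat ({..n} - {i}) Vs) x = h"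
      "Ide (prod_cat ({..n} - {i}) Vs) x' \<cdot>\<^bsub>prod_cat ({..n} - {i}) Vs\<^esub> h = h"
      using Q.Ide_left[OF h] Q.Ide_right[OF h] by blast+
    note up = upd_Hom_V[OF _ i']
    have cmp: "onArr G ((k \<cdot>\<^bsub>prod_cat ({..n} - {i}) Vs\<^esub> l)(i := p \<cdot>\<^bsub>V i\<^esub> q)) = onArr G (k(i := p)) \<cdot> onArr G (l(i := q))"
      if "k \<in> Hom (prod_cat ({..n} - {i}) Vs) y z" "l \<in> Hom (prod_cat ({..n} - {i}) Vs) w y" "p \<in> Arr (V i)" "q \<in> Arr (V i)" "Dom (V i) p = Cod (V i) q"
      for k l p q y z w
    proof -
      have pq: "p \<in> Arr (Vs i)" "q \<in> Arr (Vs i)" using that by simp_all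
      have "(k(i := p)) \<cdot>\<^bsub>psk {..n} Vs\<^esub> (l(i := q)) = (k \<cdot>\<^bsub>prod_cat ({..n} - {i}) Vs\<^esub> l)(i := p \<cdot>\<^bsub>Vs i\<^esub> q)"
        by (rule upd_Cmp[OF sV nV i'])
      then show ?thesis
        using model_Cmp[OF G up(1)[OF that(2) pq(2)] up(1)[OF that(1) pq(1)]] up(2)[OF that(1) pq(1)] up(3)[OF that(2) pq(2)] that(5)
        by (simp del: psk_sel fun_upd_apply prod_cat_sel Hom_def)
    qed
    have "mmor (Vs i) (pslice {..n} Vs G i x) (pslice {..n} Vs G i x') (\<lambda>a. onArr G (h(i := Ide (V i) a)))"
      unfolding mmor_iff[OF Si.sketch_axioms model_data[OF sx] model_data[OF sx']] pslice_sel
    proof (intro conjI ballI)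
      show "onArr G (h(i := Ide (V i) a)) \<in> Hom P (onObj G (x(i := a))) (onObj G (x'(i := a)))" if "a \<in> Obj (Vs i)" for a
        using model_simps(2-4)[OF G up(1)[OF h, of "Ide (V i) a"]] up(2,3)[OF h, of "Ide (V i) a"] that
        by (simp del: psk_sel fun_upd_apply prod_cat_sel)
      show "onArr G (h(i := Ide (V i) (Cod (Vs i) f))) \<cdot> onArr G ((Ide (prod_cat ({..n} - {i}) Vs) x)(i := f))
        = onArr G ((Ide (prod_cat ({..n} - {i}) Vs) x')(i := f)) \<cdot> onArr G (h(i := Ide (V i) (Dom (Vs i) f)))" if "f \<in> Arr (Vs i)" for f
        using cmp[OF h Q.Ide_in[OF x(1)], of "Ide (V i) (Cod (V i) f)" f] cmp[OF Q.Ide_in[OF x(2)] h, of f "Ide (V i) (Dom (V i) f)"] that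
        unfolding hc by simp
      show "onArr G (h(i := Ide (V i) (pY (Vs i) d))) \<cdot> fadd G (i, x, d)
        = fadd G (i, x', d) \<cdot> (onArr G (h(i := Ide (V i) (pZ (Vs i) d))) \<boxplus> onArr G (h(i := Ide (V i) (pX (Vs i) d))))" if "d \<in> Tr (Vs i)" for d
      proof -
        obtain a b where d: "d = (a, b)" "a \<in> Obj (V i)" "b \<in> Obj (V i)" using \<open>d \<in> Tr (Vs i)\<close> by (cases d) auto
        show ?thesis
          unfolding d(1) Vsk_sel by (rule ten[OF i h d(2,3), symmetric])
      qed
    qed
    from mmor_unit[OF Vi.picard_groupoid_axioms sx sx' this] u(1,2)[OF i x(1)] u(1,2)[OF i x(2)]
    show ?thesis unfolding pslice_sel by simp
  qed
  show ?thesis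
    unfolding multiexact_def s
  proof (intro conjI allI impI ballI)
    show "is_functor (prod_cat {..n} V) P ?g"
      using is_functor_model[OF G] unfolding is_functor_psk prod_cat_Vsk by (simp add: is_functor_def s)
    show "symmetric_monoidal_functor (V i) P (mexact_slice n V ?g i x)" if i: "i \<le> n" and x: "x \<in> Obj (prod_cat ({..n} - {i}) V)" for i x
    proof -
      note x' = x[folded prod_cat_Vsk_Obj]
      have "mexact_slice n V ?g i x = vfun (pslice {..n} Vs G i x) (munitC ?g i x)"
        by (simp add: mexact_slice_def vfun_def pslice_def arr_at_def prod_cat_Vsk s fun_eq_iff)
      moreover have "symmetric_monoidal_functor (V i) P (vfun (pslice {..n} Vs G i x) (munitC ?g i x))"
        by (rule vfun_functor[OF V[OF i] slm[OF i x']]) (use u[OF i x'] in \<open>simp_all only: pslice_sel\<close>)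
      ultimately show ?thesis by simp
    qed
    show "fadd G (i, x', a, b) \<cdot> (onArr G (h(i := Ide (V i) a)) \<boxplus> onArr G (h(i := Ide (V i) b)))
        = onArr G (h(i := Ide (V i) (a \<oplus>\<^bsub>V i\<^esub> b))) \<cdot> fadd G (i, x, a, b)"
      if "i \<le> n" "h \<in> Hom (prod_cat ({..n} - {i}) V) x x'" "a \<in> Obj (V i)" "b \<in> Obj (V i)" for i x x' h a b
      by (rule ten) (use that in \<open>simp_all only: prod_cat_Vsk\<close>)
    show "munitC ?g i x' = onArr G (h(i := Ide (V i) (unitO (V i)))) \<cdot> munitC ?g i x"
      if "i \<le> n" "h \<in> Hom (prod_cat ({..n} - {i}) V) x x'" for i x x' h
      by (rule unt) (use that in \<open>simp_all only: prod_cat_Vsk\<close>)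
    fix i j x a b c e
    assume ij: "i < j \<and> j \<le> n" and x: "x \<in> Obj (prod_cat ({..n} - {i, j}) V)"
      and ab: "a \<in> Obj (V i)" "b \<in> Obj (V i)" "c \<in> Obj (V j)" "e \<in> Obj (V j)"
    note x' = x[folded prod_cat_Vsk_Obj]
    have ij': "i \<noteq> j" "i \<le> n" "j \<le> n" using ij by auto
    have "ptwo {..n} Vs (i, x(j := pZ (Vs j) (c, e)), a, b) (i, x(j := pX (Vs j) (c, e)), a, b) (i, x(j := pY (Vs j) (c, e)), a, b)
        (j, x(i := pZ (Vs i) (a, b)), c, e) (j, x(i := pX (Vs i) (a, b)), c, e) (j, x(i := pY (Vs i) (a, b)), c, e)"
      by (rule ptwo.intros) (use ij' x' ab in \<open>simp_all del: prod_cat_sel\<close>)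
    then have t: "TwoR (psk {..n} Vs) (i, x(j := c), a, b) (i, x(j := e), a, b) (i, x(j := c \<oplus>\<^bsub>V j\<^esub> e), a, b)
      (j, x(i := a), c, e) (j, x(i := b), c, e) (j, x(i := a \<oplus>\<^bsub>V i\<^esub> b), c, e)"
      unfolding psk_sel(14) Vsk_sel .
    have tw: "x(j := q, i := p) = x(i := p, j := q)" for p q
      using ij'(1) by (simp add: fun_upd_twist)
    show "let Fo = \<lambda>s t. onObj G (x(i := s, j := t)); split_i = \<lambda>t. inv_arr P (fadd G (i, x(j := t), a, b));
             split_j = \<lambda>s. inv_arr P (fadd G (j, x(i := s), c, e))
         in coas P (Fo a c) (Fo a e) (Fo b c) (Fo b e) \<cdot> ((split_j a \<boxplus> split_j b) \<cdot> split_i (c \<oplus>\<^bsub>V j\<^esub> e))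
          = (split_i c \<boxplus> split_i e) \<cdot> split_j (a \<oplus>\<^bsub>V i\<^esub> b)"
      unfolding Let_def
      by (rule mexact_two_iff[OF model_data[OF G] ij' x' ab, THEN iffD2]) (use model_two[OF G t] in \<open>simp only: psk_sel(8-10) Vsk_sel tw\<close>)
  qed
qed

text \<open>On each slice \<open>monoidal_nat_trans_iff\<close> reduces the monoidal condition to
  additivity squares, and together these are the squares of a morphism of models on the
  family.\<close>

lemma multiexact_nat_trans_iff:
  assumes d: "multiexact n V P d" and g: "multiexact n V P g"
  shows "multiexact_nat_trans n V P d g \<gamma> \<longleftrightarrow> \<gamma> \<in> extensional (Obj (prod_cat {..n} V)) \<and> mmor (psk {..n} Vs) (mvmod d) (mvmod g) \<gamma>"
proof -
  note md = multiexact_model[OF d] and mg = multiexact_model[OF g]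
  have 1: "nat_trans (prod_cat {..n} V) P d g \<gamma> \<longleftrightarrow> \<gamma> \<in> extensional (Obj (prod_cat {..n} V)) \<and>
     (\<forall>a\<in>Obj (psk {..n} Vs). \<gamma> a \<in> Hom P (onObj d a) (onObj g a)) \<and>
     (\<forall>f\<in>Arr (psk {..n} Vs). \<gamma> (Cod (psk {..n} Vs) f) \<cdot> onArr d f = onArr g f \<cdot> \<gamma> (Dom (psk {..n} Vs) f))"
    unfolding nat_trans_iff by simp
  have 2: "(\<forall>i\<le>n. \<forall>x\<in>Obj (prod_cat ({..n} - {i}) V).
        monoidal_nat_trans (V i) P (mexact_slice n V d i x) (mexact_slice n V g i x) (\<lambda>a\<in>Obj (V i). \<gamma> (x(i := a)))) \<longleftrightarrow>
     (\<forall>u\<in>Tr (psk {..n} Vs). \<gamma> (pY (psk {..n} Vs) u) \<cdot> fadd (mvmod d) u = fadd (mvmod g) u \<cdot> (\<gamma> (pZ (psk {..n} Vs) u) \<boxplus> \<gamma> (pX (psk {..n} Vs) u)))"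
    if nt: "nat_trans (prod_cat {..n} V) P d g \<gamma>"
  proof -
    have sl: "monoidal_nat_trans (V i) P (mexact_slice n V d i x) (mexact_slice n V g i x) (\<lambda>a\<in>Obj (V i). \<gamma> (x(i := a))) \<longleftrightarrow>
       (\<forall>a\<in>Obj (V i). \<forall>b\<in>Obj (V i). \<gamma> (x(i := a \<oplus>\<^bsub>V i\<^esub> b)) \<cdot> mtensC d i x a b = mtensC g i x a b \<cdot> (\<gamma> (x(i := a)) \<boxplus> \<gamma> (x(i := b))))"
      if i: "i \<le> n" and x: "x \<in> Obj (prod_cat ({..n} - {i}) V)" for i x
    proof -
      interpret Vi: picard_groupoid "V i" by (rule V[OF i])
      interpret Si: sketch "Vs i" by (rule Vi.sketch_Vsk)
      interpret Q: category "prod_cat ({..n} - {i}) Vs"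
        by (rule category_prod_cat) (use sV sketch.axioms(1) in blast)
      have i': "i \<in> {..n}" using i by simp
      note x' = x[folded prod_cat_Vsk_Obj]
      have s: "symmetric_monoidal_functor (V i) P (mexact_slice n V d i x)" "symmetric_monoidal_functor (V i) P (mexact_slice n V g i x)"
        by (rule conjunct1[OF conjunct2[OF d[unfolded multiexact_def]], THEN spec, THEN mp, OF i, THEN bspec, OF x]
            conjunct1[OF conjunct2[OF g[unfolded multiexact_def]], THEN spec, THEN mp, OF i, THEN bspec, OF x])+
      note m = vmod_model[OF V[OF i] s(1)] vmod_model[OF V[OF i] s(2)]
      note up = upd_Hom_V[OF Q.Ide_in[OF x'] i']
      have o: "\<gamma> (x(i := a)) \<in> Hom P (onObj d (x(i := a))) (onObj g (x(i := a)))" if "a \<in> Obj (V i)" for a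
      proof -
        have "x(i := a) \<in> Obj (psk {..n} Vs)"
          using upd_PiE[OF sV nV x' _ i'] that by (simp del: psk_sel prod_cat_sel fun_upd_apply)
        then show ?thesis using nt[unfolded 1] by blast
      qed
      have nat: "\<gamma> (x(i := Cod (V i) f)) \<cdot> onArr d (arr_at n V i x f) = onArr g (arr_at n V i x f) \<cdot> \<gamma> (x(i := Dom (V i) f))" if "f \<in> Arr (V i)" for f
      proof -
        have f: "f \<in> Arr (Vs i)" using that by simp
        have "arr_at n V i x f = (Ide (prod_cat ({..n} - {i}) Vs) x)(i := f)"
          by (simp add: arr_at_def prod_cat_Vsk)
        then show ?thesis
          using conjunct2[OF conjunct2[OF nt[unfolded 1]], THEN bspec, OF up(1)[OF f]] unfolding up(2,3)[OF f] by simp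
      qed
      show ?thesis
        unfolding monoidal_nat_trans_iff[OF V[OF i] s] mmor_iff[OF Si.sketch_axioms model_data[OF m(1)] model_data[OF m(2)]]
        using o nat by (auto simp: mexact_slice_def simp del: Hom_def fun_upd_apply)
    qed
    show ?thesis
      using sl by (auto simp: psk_def prod_cat_Vsk_Obj simp del: prod_cat_sel)
  qed
  have S: "sketch (psk {..n} Vs)" by (rule sketch_psk[OF sV])
  show ?thesis
    unfolding multiexact_nat_trans_def mmor_iff[OF S model_data[OF md] model_data[OF mg]]
    using 1 2 unfolding mdmod_sel by blast
qed

end

text \<open>An equality of records, not just agreement on the carriers: the additivity data of
  \<open>g \<circ> det\<close> are by definition corrected by \<open>addD (det i)\<close> in the
  variable of the triangle.\<close>

lemma pull_mvmod:
  "pull (mvmod g) (pmap {..n} (\<lambda>i. Vsk (V i)) (\<lambda>i. det_map (T i) (det i))) = mdmod (mexact_comp_det n T V P g det)"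
proof (rule model.equality)
  show "fadd (pull (mvmod g) (pmap {..n} (\<lambda>i. Vsk (V i)) (\<lambda>i. det_map (T i) (det i)))) = fadd (mdmod (mexact_comp_det n T V P g det))"
  proof (rule ext)
    show "fadd (pull (mvmod g) (pmap {..n} (\<lambda>i. Vsk (V i)) (\<lambda>i. det_map (T i) (det i)))) d = fadd (mdmod (mexact_comp_det n T V P g det)) d" for d
      by (cases d) (simp add: mexact_comp_det_def prod_functor_def arr_at_def prod_cat_Vsk Let_def del: prod_cat_sel)
  qed
qed (simp_all add: pull_def pmap_def mdmod_def mvmod_def det_map_def mexact_comp_det_def comp_functor_def prod_functor_def)

end

theorem theorem4p1:
  fixes n :: nat
    and T :: "nat \<Rightarrow> ('o, 'm) tri_cat"
    and V :: "nat \<Rightarrow> ('v, 'w) mon_cat"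
    and det :: "nat \<Rightarrow> ('o, 'm, 'v, 'w) det_funct"
    and P :: "('p, 'q) mon_cat"
    and D :: "('o, 'm, 'p, 'q) mdet_funct"
  assumes "\<And>i. i \<le> n \<Longrightarrow> triangulated_category (T i)"
    and "\<And>i. i \<le> n \<Longrightarrow>
           universal_determinant_functor TYPE(('p, 'q) mon_cat) (T i) (V i) (det i)"
    and "picard_groupoid P"
    and "multi_determinant_functor n T P D"
  shows "\<exists>(d :: ('v, 'w, 'p, 'q) mexact_funct) a.
           mdet_factorization n T V P det D d a \<and>
           (\<forall>(g :: ('v, 'w, 'p, 'q) mexact_funct) \<beta>.
              mdet_factorization n T V P det D g \<beta> \<longrightarrow>
              (\<exists>!\<gamma>. multiexact_nat_trans n V P d g \<gamma> \<and>
                 (\<forall>x\<in>Obj (prod_cat {..n} T).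
                    a x = \<beta> x \<cdot>\<^bsub>P\<^esub> \<gamma> (onObj (prod_functor {..n} det) x))))"
proof -
  interpret picard_groupoid P by fact
  have V: "picard_groupoid (V i)" if "i \<le> n" for i
    using assms(2)[OF that] by (simp add: universal_determinant_functor_def)
  let ?T = "psk {..n} (\<lambda>i. Tsk (T i))" and ?V = "psk {..n} (\<lambda>i. Vsk (V i))"
    and ?J = "pmap {..n} (\<lambda>i. Vsk (V i)) (\<lambda>i. det_map (T i) (det i))"
  \<comment> \<open>Each variable is covered by \<open>requiv_det\<close>, and the relation
    \<open>TwoR\<close> is empty for the sketches of single variables, as the induction
    requires.\<close>
  have R: "requiv ?T ?V ?J"
    by (rule requiv_pmap) (use requiv_det[OF assms(1,2,3)] in auto)
  note sk = requivD(1,2)[OF R]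
  interpret A: sketch ?T by (rule sk)
  interpret B: sketch ?V by (rule sk)
  have ob: "Obj (prod_cat {..n} T) = Obj ?T" "Obj (prod_cat {..n} V) = Obj ?V"
    by simp_all
  have J: "onObj (prod_functor {..n} det) x = onObj ?J x" for x
    by (simp add: prod_functor_def)
  have Jo: "onObj ?J x \<in> Obj ?V" if "x \<in> Obj ?T" for x
    by (rule smap_simps(1)[OF requivD(3)[OF R] that])
  note mD = mdet_model[OF assms(1,4)]
  \<comment> \<open>Existence is essential surjectivity; \<open>mexact_of\<close> adds the unit
    constraints to \<open>G\<close>.\<close>
  obtain G \<alpha> where G: "is_model ?V G" and \<alpha>: "mmor ?T (pull G ?J) (mdmod D) \<alpha>"
    using requivD(5)[OF R mD] by blast
  define d where "d = mexact_of n V G"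
  \<comment> \<open>Natural transformations have extensional components.\<close>
  define a where "a = restrict \<alpha> (Obj ?T)"
  have md: "mvmod d = G"
    unfolding d_def by (rule mvmod_mexact_of[OF V])
  have ed: "multiexact n V P d"
    unfolding d_def by (rule mexact_of_multiexact[OF V G])
  have fact: "mdet_factorization n T V P det D g \<beta> \<longleftrightarrow> multiexact n V P g \<and> \<beta> \<in> extensional (Obj ?T)
      \<and> mmor ?T (pull (mvmod g) ?J) (mdmod D) \<beta>" for g :: "('v, 'w, 'p, 'q) mexact_funct" and \<beta>
  proof -
    have "is_data ?T (mdmod (mexact_comp_det n T V P g det))" if "multiexact n V P g"
      unfolding pull_mvmod[symmetric] by (rule model_data[OF requivD(4)[OF R multiexact_model[OF V that]]])
    then show ?thesis
      unfolding mdet_factorization_def pull_mvmod ob[symmetric] using mdet_morphism_iff[OF assms(1) _ model_data[OF mD]] by blast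
  qed
  have a: "mmor ?T (pull (mvmod d) ?J) (mdmod D) a"
    unfolding md by (rule mmor_cong[OF \<alpha> _ sk(1)]) (simp only: a_def restrict_apply if_True)
  have "mdet_factorization n T V P det D d a"
    unfolding fact using ed a by (simp add: a_def del: psk_sel)
  moreover have "\<exists>!\<gamma>. multiexact_nat_trans n V P d g \<gamma> \<and> (\<forall>x\<in>Obj (prod_cat {..n} T). a x = \<beta> x \<cdot>\<^bsub>P\<^esub> \<gamma> (onObj (prod_functor {..n} det) x))"
    if g: "mdet_factorization n T V P det D g \<beta>" for g :: "('v, 'w, 'p, 'q) mexact_funct" and \<beta>
  proof -
    have eg: "multiexact n V P g" and \<beta>: "mmor ?T (pull (mvmod g) ?J) (mdmod D) \<beta>"
      using g unfolding fact by blast+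
    note mg = multiexact_model[OF V eg] and md = multiexact_model[OF V ed]
    have nt: "multiexact_nat_trans n V P d g \<gamma> \<longleftrightarrow> \<gamma> \<in> extensional (Obj ?V) \<and> mmor ?V (mvmod d) (mvmod g) \<gamma>" for \<gamma>
      unfolding ob(2)[symmetric] by (rule multiexact_nat_trans_iff[OF V ed eg])
    note as = mmorD(1-3)[OF a] and bs = mmorD(1-3)[OF \<beta>]
    \<comment> \<open>Uniqueness is full faithfulness, applied to the morphism
      \<open>inv_arr P (\<beta> x) \<cdot> a x\<close> between the two pullbacks.\<close>
    obtain \<eta> where \<eta>: "mmor ?V (mvmod d) (mvmod g) \<eta>" "\<And>x. x \<in> Obj ?T \<Longrightarrow> \<eta> (onObj ?J x) = inv_arr P (\<beta> x) \<cdot>\<^bsub>P\<^esub> a x"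
      using requivD(6)[OF R md mg mmor_Cmp[OF a mmor_inv[OF \<beta> sk(1)] sk(1)]] by blast
    have "\<exists>!\<gamma>. (\<gamma> \<in> extensional (Obj ?V) \<and> mmor ?V (mvmod d) (mvmod g) \<gamma>) \<and> (\<forall>x\<in>Obj ?T. a x = \<beta> x \<cdot>\<^bsub>P\<^esub> \<gamma> (onObj ?J x))"
    proof (rule ex1I)
      show "(restrict \<eta> (Obj ?V) \<in> extensional (Obj ?V) \<and> mmor ?V (mvmod d) (mvmod g) (restrict \<eta> (Obj ?V))) \<and>
          (\<forall>x\<in>Obj ?T. a x = \<beta> x \<cdot>\<^bsub>P\<^esub> restrict \<eta> (Obj ?V) (onObj ?J x))"
      proof (intro conjI ballI)
        show "restrict \<eta> (Obj ?V) \<in> extensional (Obj ?V)" by (rule restrict_extensional)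
        show "mmor ?V (mvmod d) (mvmod g) (restrict \<eta> (Obj ?V))"
          by (rule mmor_cong[OF \<eta>(1) _ sk(2)]) (simp only: restrict_apply if_True)
        show "a x = \<beta> x \<cdot>\<^bsub>P\<^esub> restrict \<eta> (Obj ?V) (onObj ?J x)" if "x \<in> Obj ?T" for x
          unfolding restrict_apply using Jo[OF that] \<eta>(2)[OF that] as[OF that] bs[OF that]
          by (simp del: psk_sel pmap_sel)
      qed
    next
      fix \<gamma> assume \<gamma>: "(\<gamma> \<in> extensional (Obj ?V) \<and> mmor ?V (mvmod d) (mvmod g) \<gamma>) \<and> (\<forall>x\<in>Obj ?T. a x = \<beta> x \<cdot>\<^bsub>P\<^esub> \<gamma> (onObj ?J x))"
      have m: "mmor ?V (mvmod d) (mvmod g) \<gamma>" using \<gamma> by blast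
      \<comment> \<open>\<open>\<beta> x\<close> is invertible, so the factorisation equation
        determines \<open>\<gamma>\<close> on the image of the product of the
        \<open>det i\<close>.\<close>
      have eq: "\<gamma> (onObj ?J x) = \<eta> (onObj ?J x)" if x: "x \<in> Obj ?T" for x
        using \<gamma>[THEN conjunct2, THEN bspec, OF x] \<eta>(2)[OF x] bs[OF x] mmorD(1-3)[OF m Jo[OF x]]
        by (simp del: psk_sel pmap_sel)
      have "\<gamma> b = \<eta> b" if "b \<in> Obj ?V" for b
        by (rule requivD(7)[OF R md mg m \<eta>(1) eq that])
      then show "\<gamma> = restrict \<eta> (Obj ?V)"
        using \<gamma> by (intro extensionalityI[of _ "Obj ?V"]) (simp_all del: psk_sel)
    qed
    then show ?thesis
      unfolding nt ob(1) J .
  qed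
  ultimately show ?thesis by blast
qed

end
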